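(* Let $H$ be the minimal Schr\"odinger operator in $L^2(\mathbb{R}^2)$ associated with distinct points $x_1,\dots,x_m\in\mathbb{R}^2$ and let $\Pi=\{\mathbb{C}^m,\Gamma_0,\Gamma_1\}$ be the boundary triplet for $H^*$ described in the context. Then: (i) the Weyl function $M(\cdot)$ corresponding to the boundary triplet $\Pi$ is $$M(z)=\Bigl(\tfrac1{2\pi}\bigl(\psi(1)-\ln(\tfrac{\sqrt z}{2i})\bigr)\delta_{jk}+\widetilde G_{\sqrt z}(x_j-x_k)\Bigr)_{j,k=1}^m,\qquad z\in\mathbb{C}_+,$$ where $\psi(1)=\frac{\Gamma'(1)}{\Gamma(1)}$, $\widetilde G_{\sqrt z}(x)=\tfrac i4H_0^{(1)}(\sqrt z|x|)$ for $x\ne0$ and $\widetilde G_{\sqrt z}(0)=0$; (ii) the corresponding $\gamma$-field is given, for $\{a_j\}_{j=1}^m\in\mathbb{C}^m$ and $z\in\rho(H_0)=\mathbb{C}\setminus[0,\infty)$, by $$\gamma(z)\{a_j\}_{j=1}^m=\sum_{j=1}^ma_j\tfrac i4H_0^{(1)}(\sqrt z|x-x_j|).$$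
   Context: Let $m\in\mathbb{N}$, $x_1,\dots,x_m\in\mathbb{R}^2$ distinct, $X=\{x_1,\dots,x_m\}$. $H=-\Delta$ in $L^2(\mathbb{R}^2)$ with $\operatorname{dom}(H)=\{f\in W^{2,2}(\mathbb{R}^2):f(x_j)=0,\ j=1,\dots,m\}$; $\operatorname{dom}(H^* )=\{f\in L^2(\mathbb{R}^2)\cap W^{2,2}_{\rm loc}(\mathbb{R}^2\setminus X):\Delta f\in L^2(\mathbb{R}^2)\}$ (with $\Delta f$ computed on $\mathbb{R}^2\setminus X$) and $H^*f=-\Delta f$ on $\mathbb{R}^2\setminus X$. For $f\in\operatorname{dom}(H^* )$ let $\xi_{0j}=\lim_{x\to x_j}\frac{f(x)}{\ln|x-x_j|}$ and $$\Gamma_0f=-2\pi\Bigl\{\lim_{x\to x_j}\tfrac{f(x)}{\ln|x-x_j|}\Bigr\}_{j=1}^m,\qquad\Gamma_1f=\Bigl\{\lim_{x\to x_j}\bigl(f(x)-\xi_{0j}\ln|x-x_j|\bigr)\Bigr\}_{j=1}^m.$$ $\{\mathbb{C}^m,\Gamma_0,\Gamma_1\}$ is a boundary triplet for $H^*$ (the Green identity $(H^*f,g)-(f,H^*g)=(\Gamma_1f,\Gamma_0g)-(\Gamma_0f,\Gamma_1g)$ holds and $(\Gamma_0,\Gamma_1)^\top$ is surjective onto $\mathbb{C}^m\oplus\mathbb{C}^m$), and $H_0:=H^*\upharpoonright\ker(\Gamma_0)$ is the free Hamiltonian $-\Delta$ on $W^{2,2}(\mathbb{R}^2)$. With $\mathfrak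 N_z=\ker(H^*-z)$, the Weyl function is the matrix-valued function on $\rho(H_0)$ defined by $M(z)\Gamma_0f_z=\Gamma_1f_z$ for $f_z\in\mathfrak N_z$, and the $\gamma$-field is $\gamma(z)=(\Gamma_0\upharpoonright\mathfrak N_z)^{-1}:\mathbb{C}^m\to\mathfrak N_z$. $\sqrt{\cdot}$ is the branch of the square root with cut along $[0,\infty)$ with $\sqrt1=1$ (on the upper side of the cut), so $\operatorname{Im}\sqrt z>0$ off $[0,\infty)$; $\ln$ is the principal branch; $H_0^{(1)}$ is the Hankel function of the first kind of order zero; in $\psi(1)$, $\Gamma$ is the Euler Gamma function; $\delta_{jk}$ is the Kronecker symbol; $\mathbb{C}_+$ is the open upper half-plane. *)

theory Defs
  imports "HOL-Analysis.Analysis"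
begin

section \<open>The Hilbert space of square-integrable functions on the plane\<close>

type_synonym plane = "real ^ 2"

text \<open>Elements of $L^2(\mathbb{R}^2)$ are represented by square-integrable Borel functions.  The set
  \<open>L2\<close> consists of these representatives; the vector represented by \<open>f\<close> is the class
  \<open>L2_class f\<close> of all representatives equal to \<open>f\<close> almost everywhere.\<close>

definition L2 :: "(plane \<Rightarrow> complex) set" where
  "L2 = {f \<in> borel_measurable lborel. integrable lborel (\<lambda>y. (norm (f y))\<^sup>2)}"

definition L2_class :: "(plane \<Rightarrow> complex) \<Rightarrow> (plane \<Rightarrow> complex) set" where
  "L2_class f = {g \<in> L2. AE y in lborel. g y = f y}"

definition L2_norm :: "(plane \<Rightarrow> complex) \<Rightarrow> real" where
  "L2_norm f = sqrt (LINT y|lborel. (norm (f y))\<^sup>2)"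


section \<open>Weak derivatives and local Sobolev spaces\<close>

definition partial :: "2 \<Rightarrow> (plane \<Rightarrow> complex) \<Rightarrow> plane \<Rightarrow> complex" where
  "partial i \<phi> y = frechet_derivative \<phi> (at y) (axis i 1)"

text \<open>For \<open>k > 0\<close> the total derivative is required to exist, so \<open>C_k k\<close> is the usual class $C^k$
  and the intersection over all \<open>k\<close> is $C^\infty$.\<close>

primrec C_k :: "nat \<Rightarrow> (plane \<Rightarrow> complex) \<Rightarrow> bool" where
  "C_k 0 \<phi> \<longleftrightarrow> continuous_on UNIV \<phi>"
| "C_k (Suc k) \<phi> \<longleftrightarrow> \<phi> differentiable_on UNIV \<and> (\<forall>i. C_k k (partial i \<phi>))"

definition test_functions :: "plane set \<Rightarrow> (plane \<Rightarrow> complex) set" where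
  "test_functions \<Omega> = {\<phi>. (\<forall>k. C_k k \<phi>) \<and>
     (\<exists>K. compact K \<and> K \<subseteq> \<Omega> \<and> (\<forall>y. y \<notin> K \<longrightarrow> \<phi> y = 0))}"

definition L2_loc :: "plane set \<Rightarrow> (plane \<Rightarrow> complex) set" where
  "L2_loc \<Omega> = {u. \<forall>K. compact K \<and> K \<subseteq> \<Omega> \<longrightarrow>
     set_borel_measurable lborel K u \<and> set_integrable lborel K (\<lambda>y. (norm (u y))\<^sup>2)}"

definition weak_partial ::
    "plane set \<Rightarrow> 2 \<Rightarrow> (plane \<Rightarrow> complex) \<Rightarrow> (plane \<Rightarrow> complex) \<Rightarrow> bool" where
  "weak_partial \<Omega> i u v \<longleftrightarrow> (\<forall>\<phi>\<in>test_functions \<Omega>.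
     (LINT y|lborel. u y * partial i \<phi> y) = - (LINT y|lborel. v y * \<phi> y))"

text \<open>All weak partial derivatives up to order two exist in $L^2_{\rm loc}(\Omega)$.\<close>

definition W22_loc :: "plane set \<Rightarrow> (plane \<Rightarrow> complex) set" where
  "W22_loc \<Omega> = {u \<in> L2_loc \<Omega>. \<forall>i. \<exists>v\<in>L2_loc \<Omega>. weak_partial \<Omega> i u v \<and>
     (\<forall>j. \<exists>w\<in>L2_loc \<Omega>. weak_partial \<Omega> j v w)}"

text \<open>\<open>g\<close> is the (distributional) Laplacian of \<open>u\<close> on \<open>\<Omega>\<close>.\<close>

definition weak_laplacian :: "plane set \<Rightarrow> (plane \<Rightarrow> complex) \<Rightarrow> (plane \<Rightarrow> complex) \<Rightarrow> bool" where
  "weak_laplacian \<Omega> u g \<longleftrightarrow> (\<forall>\<phi>\<in>test_functions \<Omega>.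
     (LINT y|lborel. u y * (\<Sum>i\<in>UNIV. partial i (partial i \<phi>) y)) = (LINT y|lborel. g y * \<phi> y))"


section \<open>Operators, resolvent sets, Weyl functions, gamma-fields\<close>

text \<open>An operator in $L^2(\mathbb{R}^2)$ is given by its graph, a set of pairs of representatives.\<close>

type_synonym op_graph = "((plane \<Rightarrow> complex) \<times> (plane \<Rightarrow> complex)) set"

text \<open>\<open>A - z\<close> is onto $L^2(\mathbb{R}^2)$ and bounded below (hence injective up to null sets), i.e.
  it has an everywhere defined bounded inverse.\<close>

definition resolvent_set :: "op_graph \<Rightarrow> complex set" where
  "resolvent_set A = {z.
     (\<forall>h\<in>L2. \<exists>f. (f, \<lambda>y. h y + z * f y) \<in> A) \<and>
     (\<exists>C. \<forall>(f, g)\<in>A. L2_norm f \<le> C * L2_norm (\<lambda>y. g y - z * f y))}"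

definition defect_space :: "op_graph \<Rightarrow> complex \<Rightarrow> (plane \<Rightarrow> complex) set" where
  "defect_space A z = {f. (f, \<lambda>y. z * f y) \<in> A}"

definition weyl_function ::
    "op_graph \<Rightarrow> ((plane \<Rightarrow> complex) \<Rightarrow> complex ^ 'm) \<Rightarrow> ((plane \<Rightarrow> complex) \<Rightarrow> complex ^ 'm)
      \<Rightarrow> complex \<Rightarrow> complex ^ 'm ^ 'm" where
  "weyl_function A G0 G1 z = (THE M. \<forall>f\<in>defect_space A z. M *v G0 f = G1 f)"

text \<open>The value at \<open>a\<close> of the inverse of \<open>G0\<close> restricted to \<open>defect_space A z\<close>: the set of all
  representatives that \<open>G0\<close> sends to \<open>a\<close>.  The inverse map exists at \<open>a\<close> precisely when this set
  is a single class \<open>L2_class f\<close> with \<open>f \<in> L2\<close>.\<close>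

definition gamma_field ::
    "op_graph \<Rightarrow> ((plane \<Rightarrow> complex) \<Rightarrow> complex ^ 'm) \<Rightarrow> complex \<Rightarrow> complex ^ 'm
      \<Rightarrow> (plane \<Rightarrow> complex) set" where
  "gamma_field A G0 z a = {f \<in> defect_space A z. G0 f = a}"


section \<open>Point interactions\<close>

text \<open>The adjoint $H^*$ of $H = -\Delta$, $\mathrm{dom}(H) = \{f \in W^{2,2}(\mathbb{R}^2) : f = 0
  \mbox{ on } X\}$.\<close>

definition H_star :: "plane set \<Rightarrow> op_graph" where
  "H_star X = {(f, h). f \<in> L2 \<and> f \<in> W22_loc (- X) \<and> h \<in> L2 \<and> weak_laplacian (- X) f (\<lambda>y. - h y)}"

text \<open>Functions in $W^{2,2}_{\rm loc}(\mathbb{R}^2\setminus X)$ have a representative that is continuous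
  off \<open>X\<close> (unique there); pointwise limits of such functions refer to it.\<close>

definition cont_rep :: "plane set \<Rightarrow> (plane \<Rightarrow> complex) \<Rightarrow> plane \<Rightarrow> complex" where
  "cont_rep X f = (SOME g. continuous_on (- X) g \<and> (AE y in lborel. g y = f y))"

definition log_coeff :: "('m::finite \<Rightarrow> plane) \<Rightarrow> (plane \<Rightarrow> complex) \<Rightarrow> 'm \<Rightarrow> complex" where
  "log_coeff x f j =
     Lim (at (x j)) (\<lambda>y. cont_rep (range x) f y / complex_of_real (ln (norm (y - x j))))"

definition Gamma0 :: "('m::finite \<Rightarrow> plane) \<Rightarrow> (plane \<Rightarrow> complex) \<Rightarrow> complex ^ 'm" where
  "Gamma0 x f = (\<chi> j. - 2 * complex_of_real pi * log_coeff x f j)"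

definition Gamma1 :: "('m::finite \<Rightarrow> plane) \<Rightarrow> (plane \<Rightarrow> complex) \<Rightarrow> complex ^ 'm" where
  "Gamma1 x f = (\<chi> j. Lim (at (x j)) (\<lambda>y. cont_rep (range x) f y
     - log_coeff x f j * complex_of_real (ln (norm (y - x j)))))"

definition H_0 :: "('m::finite \<Rightarrow> plane) \<Rightarrow> op_graph" where
  "H_0 x = {(f, h) \<in> H_star (range x). Gamma0 x f = 0}"


section \<open>Special functions\<close>

text \<open>The branch of the square root with cut $[0,\infty)$ and nonnegative imaginary part; the cut
  belongs to its upper side, so that \<open>sqrt_up 1 = 1\<close>.\<close>

definition sqrt_up :: "complex \<Rightarrow> complex" where
  "sqrt_up z = (if Im z \<ge> 0 then csqrt z else - csqrt z)"

definition bessel_J0 :: "complex \<Rightarrow> complex" where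
  "bessel_J0 w = (\<Sum>k. (-1) ^ k * (w\<^sup>2 / 4) ^ k / (fact k)\<^sup>2)"

text \<open>The standard series of the Bessel function of the second kind of order zero (principal
  branch, cut $(-\infty,0]$).\<close>

definition bessel_Y0 :: "complex \<Rightarrow> complex" where
  "bessel_Y0 w = 2 / complex_of_real pi * ((ln (w / 2) + euler_mascheroni) * bessel_J0 w
     - (\<Sum>k. (-1) ^ k * harm k * (w\<^sup>2 / 4) ^ k / (fact k)\<^sup>2))"

definition hankel1_0 :: "complex \<Rightarrow> complex" where
  "hankel1_0 w = bessel_J0 w + \<i> * bessel_Y0 w"

definition psi :: "complex \<Rightarrow> complex" where
  "psi w = deriv Gamma w / Gamma w"

definition G_tilde :: "complex \<Rightarrow> plane \<Rightarrow> complex" where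
  "G_tilde \<kappa> y = (if y = 0 then 0 else \<i> / 4 * hankel1_0 (\<kappa> * complex_of_real (norm y)))"

end

theory Submission
  imports Defs "HOL-Complex_Analysis.Complex_Analysis"
begin

text \<open>With \<open>lam = - \<i> \<surd>z\<close>, \<open>Re lam > 0\<close>, the fundamental solution of \<open>- \<Delta> - z\<close> on the plane is
  \<open>K(lam \<bar>x\<bar>) / (2 \<pi>)\<close> with \<open>K(w) = \<integral> exp (- w cosh t) dt\<close> over \<open>t \<ge> 0\<close>.  The integral gives decay at infinity; the
  logarithmic power series solution of the same equation gives the behaviour at \<open>0\<close> and the Hankel function.
  The two agree because their difference has constant Wronskian with the regular solution and because
  \<open>\<Gamma>'(1)\<close> fixes the constant term of \<open>K\<close> at \<open>0\<close>.

  An element \<open>f\<close> of the defect space is orthogonal to \<open>(- \<Delta> - z) \<phi>\<close> for every test function \<open>\<phi>\<close> whose support avoids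
  the points \<open>x\<^sub>j\<close>, hence, by a cutoff argument, for every \<open>\<phi>\<close> that merely vanishes at them.  The pairing therefore
  depends on the values \<open>\<phi> (x\<^sub>j)\<close> only, and so coincides with that of a combination of the fundamental solutions
  centred at the \<open>x\<^sub>j\<close>; uniqueness in \<open>L\<^sup>2\<close> identifies the two.  Reading off the expansion at \<open>x\<^sub>j\<close>
  yields the Weyl function and the gamma-field.  Convolution with the fundamental solution and
  energy estimates provide the resolvent off \<open>[0, \<infinity>)\<close>, and cut-off plane waves put \<open>[0, \<infinity>)\<close> into the spectrum.\<close>

section \<open>Smooth functions on the plane\<close>

text \<open>The obstacle is that the defect space is described by weak derivatives and
  almost-everywhere classes, while the boundary maps are pointwise limits of a continuous
  representative. So every relevant function is first written, almost everywhere, as a continuous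
  function plus a combination of fundamental solutions; this is why the resolvent lemma also
  delivers a continuous representative. No surface integrals occur: the fundamental solution is
  smoothed by adding \<open>\<epsilon>\<^sup>2\<close> to its squared radius, and the error of the
  smoothed equation is an explicit approximate identity. Removing the points works because a test
  function vanishing at a point, times a cutoff of scale \<epsilon>, has second derivatives of size
  1/\<epsilon> on area of order \<open>\<epsilon>\<^sup>2\<close>, hence stays bounded in L2. No
  Fourier transform is used either: the pairing of the right-hand side with the solution f is T - z
  N, with T and N the squared norms of its gradient and of f, so the distance of z to the half-line
  controls f. The diagonal term psi(1) - ln(sqrt z / (2i)) is what remains of the expansion at a
  pole after the logarithm is removed.\<close>

definition smooth_fun :: "(plane \<Rightarrow> complex) \<Rightarrow> bool" where
  "smooth_fun \<phi> \<longleftrightarrow> (\<forall>k. C_k k \<phi>)"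

definition lap :: "(plane \<Rightarrow> complex) \<Rightarrow> plane \<Rightarrow> complex" where
  "lap \<phi> y = (\<Sum>i\<in>UNIV. partial i (partial i \<phi>) y)"

section \<open>Calculus of partial derivatives and of the classes \<open>C_k\<close>\<close>

lemma partial_eqI: "(f has_derivative D) (at y) \<Longrightarrow> partial i f y = D (axis i 1)"
  unfolding partial_def using frechet_derivative_at by metis

lemma frechet_derivative_worksI:
  "f differentiable (at y) \<Longrightarrow> (f has_derivative frechet_derivative f (at y)) (at y)"
  by (simp add: frechet_derivative_works)

lemma smooth_fun_differentiable: "smooth_fun f \<Longrightarrow> f differentiable (at y)"
  unfolding smooth_fun_def using C_k.simps(2)[of 0 f] by (auto simp: differentiable_on_def)

lemma smooth_fun_has_derivative: "smooth_fun f \<Longrightarrow> (f has_derivative frechet_derivative f (at y)) (at y)"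
  using smooth_fun_differentiable frechet_derivative_works by blast

lemma smooth_fun_partial [simp]: "smooth_fun f \<Longrightarrow> smooth_fun (partial i f)"
  unfolding smooth_fun_def by (metis C_k.simps(2))

lemma smooth_fun_continuous: "smooth_fun f \<Longrightarrow> continuous_on A f"
  unfolding smooth_fun_def by (metis C_k.simps(1) continuous_on_subset subset_UNIV)

lemma smooth_fun_isCont: "smooth_fun f \<Longrightarrow> isCont f y"
  using smooth_fun_continuous[of f UNIV] by (simp add: continuous_on_eq_continuous_at)

lemma smooth_fun_measurable: "smooth_fun f \<Longrightarrow> f \<in> borel_measurable borel"
  by (intro borel_measurable_continuous_onI smooth_fun_continuous)

lemma C_k_Suc_imp: "C_k (Suc k) f \<Longrightarrow> C_k k f"
proof (induction k arbitrary: f)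
  case 0
  then show ?case by (simp add: differentiable_imp_continuous_on)
next
  case (Suc k)
  then show ?case by (metis C_k.simps(2))
qed

text \<open>Reduces smoothness to one differentiability check when the partial derivatives are
  already known to be smooth. The hypothesis gives every order \<open>Suc k\<close> directly;
  \<open>C_k_Suc_imp\<close> then supplies order zero as well.\<close>

lemma smooth_fun_iff:
  "smooth_fun f \<longleftrightarrow> (\<forall>y. f differentiable (at y)) \<and> (\<forall>i. smooth_fun (partial i f))"
proof
  assume "smooth_fun f"
  then show "(\<forall>y. f differentiable (at y)) \<and> (\<forall>i. smooth_fun (partial i f))"
    using smooth_fun_differentiable smooth_fun_partial by blast
next
  assume *: "(\<forall>y. f differentiable (at y)) \<and> (\<forall>i. smooth_fun (partial i f))"
  have "C_k (Suc k) f" for k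
    using * by (auto simp: smooth_fun_def differentiable_on_def)
  then show "smooth_fun f" unfolding smooth_fun_def using C_k_Suc_imp by blast
qed

lemma partial_add:
  assumes "f differentiable (at y)" "g differentiable (at y)"
  shows "partial i (\<lambda>y. f y + g y) y = partial i f y + partial i g y"
  using partial_eqI[OF has_derivative_add[OF assms[THEN frechet_derivative_worksI]]]
  by (simp add: partial_def)

lemma partial_diff:
  assumes "f differentiable (at y)" "g differentiable (at y)"
  shows "partial i (\<lambda>y. f y - g y) y = partial i f y - partial i g y"
  using partial_eqI[OF has_derivative_diff[OF assms[THEN frechet_derivative_worksI]]]
  by (simp add: partial_def)

lemma partial_mult:
  assumes "f differentiable (at y)" "g differentiable (at y)"
  shows "partial i (\<lambda>y. f y * g y) y = f y * partial i g y + partial i f y * g y"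
  using partial_eqI[OF has_derivative_mult[OF assms[THEN frechet_derivative_worksI]]]
  by (simp add: partial_def)

lemma partial_const [simp]: "partial i (\<lambda>y. c) = (\<lambda>y. 0)"
  using partial_eqI[OF has_derivative_const] by auto

lemma partial_cmult:
  assumes "f differentiable (at y)"
  shows "partial i (\<lambda>y. c * f y) y = c * partial i f y"
  using partial_mult[OF differentiable_const assms] by simp

lemma partial_cnj:
  assumes "f differentiable (at y)"
  shows "partial i (\<lambda>y. cnj (f y)) y = cnj (partial i f y)"
  using partial_eqI[OF bounded_linear.has_derivative[OF bounded_linear_cnj frechet_derivative_worksI[OF assms]]]
  by (simp add: partial_def)

lemma partial_affine:
  fixes c :: real
  assumes "f differentiable (at (c *\<^sub>R y + d))"
  shows "((\<lambda>y. f (c *\<^sub>R y + d)) has_derivative (\<lambda>h. c *\<^sub>R frechet_derivative f (at (c *\<^sub>R y + d)) h)) (at y)"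
    and "partial i (\<lambda>y. f (c *\<^sub>R y + d)) y = c *\<^sub>R partial i f (c *\<^sub>R y + d)"
proof -
  have 1: "((\<lambda>y. c *\<^sub>R y + d) has_derivative (\<lambda>h. c *\<^sub>R h)) (at y)"
    by (auto intro!: derivative_eq_intros)
  have lin: "linear (frechet_derivative f (at (c *\<^sub>R y + d)))"
    using frechet_derivative_worksI[OF assms] has_derivative_linear by blast
  have "((\<lambda>y. f (c *\<^sub>R y + d)) has_derivative (\<lambda>h. frechet_derivative f (at (c *\<^sub>R y + d)) (c *\<^sub>R h))) (at y)"
    using has_derivative_compose[OF 1 frechet_derivative_worksI[OF assms]] .
  then show *: "((\<lambda>y. f (c *\<^sub>R y + d)) has_derivative (\<lambda>h. c *\<^sub>R frechet_derivative f (at (c *\<^sub>R y + d)) h)) (at y)"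
    by (simp add: linear_cmul[OF lin])
  show "partial i (\<lambda>y. f (c *\<^sub>R y + d)) y = c *\<^sub>R partial i f (c *\<^sub>R y + d)"
    using partial_eqI[OF *] by (simp add: partial_def)
qed

lemma C_k_differentiable: "C_k (Suc k) f \<Longrightarrow> f differentiable (at y)"
  by (simp add: differentiable_on_def)

lemma C_k_add: "C_k k f \<Longrightarrow> C_k k g \<Longrightarrow> C_k k (\<lambda>y. f y + g y)"
proof (induction k arbitrary: f g)
  case 0
  then show ?case by (simp add: continuous_on_add)
next
  case (Suc k)
  have "partial i (\<lambda>y. f y + g y) = (\<lambda>y. partial i f y + partial i g y)" for i
    using partial_add[OF C_k_differentiable[OF Suc.prems(1)] C_k_differentiable[OF Suc.prems(2)]] by blast
  then show ?case using Suc by (simp add: differentiable_on_add)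
qed

lemma C_k_mult: "C_k k f \<Longrightarrow> C_k k g \<Longrightarrow> C_k k (\<lambda>y. f y * g y)"
proof (induction k arbitrary: f g)
  case 0
  then show ?case by (simp add: continuous_on_mult)
next
  case (Suc k)
  have "partial i (\<lambda>y. f y * g y) = (\<lambda>y. f y * partial i g y + partial i f y * g y)" for i
    using partial_mult[OF C_k_differentiable[OF Suc.prems(1)] C_k_differentiable[OF Suc.prems(2)]] by blast
  moreover have "C_k k (\<lambda>y. f y * partial i g y + partial i f y * g y)" for i
    using Suc.prems C_k_Suc_imp[OF Suc.prems(1)] C_k_Suc_imp[OF Suc.prems(2)]
    by (intro C_k_add Suc.IH) auto
  ultimately show ?case using Suc.prems by (simp add: differentiable_on_mult)
qed

lemma C_k_const: "C_k k (\<lambda>y. c)"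
  by (induction k arbitrary: c) auto

lemma C_k_cnj: "C_k k f \<Longrightarrow> C_k k (\<lambda>y. cnj (f y))"
proof (induction k arbitrary: f)
  case 0
  then show ?case by (auto intro!: continuous_intros)
next
  case (Suc k)
  have "partial i (\<lambda>y. cnj (f y)) = (\<lambda>y. cnj (partial i f y))" for i
    using partial_cnj[OF C_k_differentiable[OF Suc.prems]] by blast
  moreover have "(\<lambda>y. cnj (f y)) differentiable (at y)" for y
    using bounded_linear.has_derivative[OF bounded_linear_cnj frechet_derivative_worksI[OF C_k_differentiable[OF Suc.prems]]]
    unfolding differentiable_def by blast
  ultimately show ?case using Suc by (simp add: differentiable_on_def)
qed

lemma C_k_affine:
  fixes c :: real
  shows "C_k k f \<Longrightarrow> C_k k (\<lambda>y. f (c *\<^sub>R y + d))"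
proof (induction k arbitrary: f)
  case 0
  then show ?case
    by (auto intro!: continuous_intros continuous_on_compose2[of UNIV f])
next
  case (Suc k)
  have 1: "partial i (\<lambda>y. f (c *\<^sub>R y + d)) = (\<lambda>y. of_real c * partial i f (c *\<^sub>R y + d))" for i
    using partial_affine(2)[OF C_k_differentiable[OF Suc.prems]] by (auto simp: scaleR_conv_of_real)
  have "(\<lambda>y. f (c *\<^sub>R y + d)) differentiable (at y)" for y
    using partial_affine(1)[OF C_k_differentiable[OF Suc.prems]]
    unfolding differentiable_def by blast
  then show ?case using Suc 1 by (auto simp: differentiable_on_def intro!: C_k_mult C_k_const)
qed

section \<open>Closure properties of smooth functions\<close>

named_theorems smooth_intros

lemma smooth_fun_const [smooth_intros]: "smooth_fun (\<lambda>y. c)"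
  by (simp add: smooth_fun_def C_k_const)
lemma smooth_fun_add [smooth_intros]: "smooth_fun f \<Longrightarrow> smooth_fun g \<Longrightarrow> smooth_fun (\<lambda>y. f y + g y)"
  by (simp add: smooth_fun_def C_k_add)
lemma smooth_fun_mult [smooth_intros]: "smooth_fun f \<Longrightarrow> smooth_fun g \<Longrightarrow> smooth_fun (\<lambda>y. f y * g y)"
  by (simp add: smooth_fun_def C_k_mult)
lemma smooth_fun_diff [smooth_intros]: "smooth_fun f \<Longrightarrow> smooth_fun g \<Longrightarrow> smooth_fun (\<lambda>y. f y - g y)"
  using smooth_fun_add[OF _ smooth_fun_mult[OF smooth_fun_const[of "-1"]], of f g] by simp
lemma smooth_fun_cnj [smooth_intros]: "smooth_fun f \<Longrightarrow> smooth_fun (\<lambda>y. cnj (f y))"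
  by (simp add: smooth_fun_def C_k_cnj)
lemma smooth_fun_affine:
  fixes c :: real
  shows "smooth_fun f \<Longrightarrow> smooth_fun (\<lambda>y. f (c *\<^sub>R y + d))"
  by (simp add: smooth_fun_def C_k_affine)
lemma smooth_fun_sum [smooth_intros]:
  "(\<And>s. s \<in> S \<Longrightarrow> smooth_fun (f s)) \<Longrightarrow> smooth_fun (\<lambda>y. \<Sum>s\<in>S. f s y)"
  by (induction S rule: infinite_finite_induct) (auto intro!: smooth_intros)
lemma smooth_fun_prod [smooth_intros]:
  "(\<And>s. s \<in> S \<Longrightarrow> smooth_fun (f s)) \<Longrightarrow> smooth_fun (\<lambda>y. \<Prod>s\<in>S. f s y)"
  by (induction S rule: infinite_finite_induct) (auto intro!: smooth_intros)
lemma smooth_fun_power [smooth_intros]: "smooth_fun f \<Longrightarrow> smooth_fun (\<lambda>y. f y ^ n)"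
  by (induction n) (auto intro!: smooth_intros)

lemma smooth_fun_lap [simp]: "smooth_fun f \<Longrightarrow> smooth_fun (lap f)"
  unfolding lap_def[abs_def] by (intro smooth_intros) auto

lemma partial_coord: "partial i (\<lambda>y. complex_of_real (y $ j)) = (\<lambda>y. if i = j then 1 else 0)"
proof
  fix y :: plane
  have "((\<lambda>y::plane. complex_of_real (y $ j)) has_derivative (\<lambda>h. of_real (h $ j))) (at y)"
    by (auto intro!: derivative_eq_intros bounded_linear_imp_has_derivative bounded_linear_compose[OF bounded_linear_of_real] bounded_linear_vec_nth)
  from partial_eqI[OF this] show "partial i (\<lambda>y. complex_of_real (y $ j)) y = (if i = j then 1 else 0)"
    by (simp add: axis_def)
qed

lemma smooth_fun_coord [smooth_intros]: "smooth_fun (\<lambda>y. complex_of_real (y $ j))"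
proof -
  have "(\<lambda>y::plane. complex_of_real (y $ j)) differentiable (at y)" for y
    by (auto intro!: bounded_linear_imp_differentiable bounded_linear_compose[OF bounded_linear_of_real] bounded_linear_vec_nth)
  then show ?thesis
    by (subst smooth_fun_iff) (auto simp: partial_coord intro!: smooth_intros)
qed

text \<open>The inner function is real but carried as a complex-valued one, because
  \<open>partial\<close> and \<open>smooth_fun\<close> are defined only for those; its real
  derivative is recovered as a real part.\<close>

lemma partial_compose:
  assumes q: "(\<lambda>y. complex_of_real (q y)) differentiable (at y)"
    and \<eta>: "(\<eta> has_vector_derivative \<eta>') (at (q y))"
  shows "(\<lambda>y. \<eta> (q y)) differentiable (at y)"
    and "partial i (\<lambda>y. \<eta> (q y)) y = \<eta>' * partial i (\<lambda>y. complex_of_real (q y)) y"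
proof -
  let ?D = "frechet_derivative (\<lambda>y. complex_of_real (q y)) (at y)"
  have "((\<lambda>y. Re (complex_of_real (q y))) has_derivative (\<lambda>h. Re (?D h))) (at y)"
    by (rule has_derivative_Re[OF frechet_derivative_worksI[OF q]])
  then have dq: "(q has_derivative (\<lambda>h. Re (?D h))) (at y)" by simp
  then have dqc: "((\<lambda>y. complex_of_real (q y)) has_derivative (\<lambda>h. of_real (Re (?D h)))) (at y)"
    by (rule has_derivative_of_real)
  have *: "((\<lambda>y. \<eta> (q y)) has_derivative (\<lambda>h. Re (?D h) *\<^sub>R \<eta>')) (at y)"
    using has_derivative_compose[OF dq \<eta>[unfolded has_vector_derivative_def]] .
  then show "(\<lambda>y. \<eta> (q y)) differentiable (at y)" unfolding differentiable_def by blast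
  show "partial i (\<lambda>y. \<eta> (q y)) y = \<eta>' * partial i (\<lambda>y. complex_of_real (q y)) y"
    using partial_eqI[OF *, of i] partial_eqI[OF dqc, of i] by (simp add: scaleR_conv_of_real)
qed

text \<open>The outer function arrives as a sequence of its successive derivatives, so that the
  induction on the order can pass from \<open>\<eta> n\<close> to \<open>\<eta> (Suc n)\<close>.
  These derivatives are demanded only at values of \<open>q\<close>, which admits functions singular
  elsewhere, such as the reciprocal and the logarithmic solution.\<close>

lemma smooth_fun_compose:
  assumes q: "smooth_fun (\<lambda>y. complex_of_real (q y))"
    and \<eta>: "\<And>n y. (\<eta> n has_vector_derivative \<eta> (Suc n) (q y)) (at (q y))"
  shows "smooth_fun (\<lambda>y. \<eta> n (q y))"
proof -
  note dq = smooth_fun_differentiable[OF q]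
  have d: "(\<lambda>y. \<eta> n (q y)) differentiable (at y)" for n y
    by (rule partial_compose(1)[OF dq \<eta>])
  have "C_k k (\<lambda>y. \<eta> n (q y))" for k n
  proof (induction k arbitrary: n)
    case 0
    then show ?case using d by (auto simp: continuous_on_eq_continuous_at intro!: differentiable_imp_continuous_within)
  next
    case (Suc k)
    have "partial i (\<lambda>y. \<eta> n (q y)) = (\<lambda>y. \<eta> (Suc n) (q y) * partial i (\<lambda>y. complex_of_real (q y)) y)" for i
      using partial_compose(2)[OF dq \<eta>] by blast
    moreover have "C_k k (\<lambda>y. \<eta> (Suc n) (q y) * partial i (\<lambda>y. complex_of_real (q y)) y)" for i
      using Suc q smooth_fun_partial[OF q] by (intro C_k_mult) (auto simp: smooth_fun_def)
    ultimately show ?case using d by (simp add: differentiable_on_def)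
  qed
  then show ?thesis by (simp add: smooth_fun_def)
qed

lemma norm_sq_plane: "complex_of_real ((norm (y - c))\<^sup>2) = (\<Sum>i\<in>UNIV. (of_real (y $ i) - of_real (c $ i))\<^sup>2)"
  for y c :: plane
  by (simp add: norm_vec_def L2_set_def real_sqrt_pow2 sum_nonneg)

lemma smooth_fun_norm_sq [smooth_intros]:
  "smooth_fun (\<lambda>y. complex_of_real ((norm (y - c))\<^sup>2))"
  unfolding norm_sq_plane by (intro smooth_intros)

lemma partial_norm_sq:
  "partial i (\<lambda>y. complex_of_real ((norm (y - c))\<^sup>2)) y = of_real (2 * (y $ i - c $ i))"
proof -
  have "((\<lambda>y. (norm (y - c))\<^sup>2) has_derivative (\<lambda>h. 2 * inner (y - c) h)) (at y)"
    unfolding power2_norm_eq_inner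
    by (auto intro!: derivative_eq_intros simp: inner_commute)
  from partial_eqI[OF has_derivative_of_real[OF this]] show ?thesis
    by (simp add: inner_axis)
qed

lemma partial_zero_outside:
  assumes "\<And>y. y \<notin> K \<Longrightarrow> f y = 0" "closed K" "y \<notin> K"
  shows "partial i f y = 0"
proof -
  have "(f has_derivative (\<lambda>h. 0)) (at y)"
    by (rule has_derivative_transform_within_open[of "\<lambda>_. 0" _ _ _ "-K"]) (use assms in auto)
  from partial_eqI[OF this] show ?thesis .
qed

section \<open>Algebra of test functions\<close>

lemma test_functions_iff:
  "\<phi> \<in> test_functions \<Omega> \<longleftrightarrow> smooth_fun \<phi> \<and> (\<exists>K. compact K \<and> K \<subseteq> \<Omega> \<and> (\<forall>y. y \<notin> K \<longrightarrow> \<phi> y = 0))"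
  by (simp add: test_functions_def smooth_fun_def)

lemma test_functions_smooth: "\<phi> \<in> test_functions \<Omega> \<Longrightarrow> smooth_fun \<phi>"
  by (simp add: test_functions_iff)

lemma test_functions_mono: "\<phi> \<in> test_functions \<Omega> \<Longrightarrow> \<Omega> \<subseteq> \<Omega>' \<Longrightarrow> \<phi> \<in> test_functions \<Omega>'"
  unfolding test_functions_iff by blast

lemma test_functions_partial: "\<phi> \<in> test_functions \<Omega> \<Longrightarrow> partial i \<phi> \<in> test_functions \<Omega>"
  unfolding test_functions_iff using partial_zero_outside compact_imp_closed smooth_fun_partial by metis

lemma test_functions_mult: "\<phi> \<in> test_functions \<Omega> \<Longrightarrow> smooth_fun f \<Longrightarrow> (\<lambda>y. f y * \<phi> y) \<in> test_functions \<Omega>"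
  unfolding test_functions_iff by (auto intro!: smooth_intros)

lemma test_functions_mult': "\<phi> \<in> test_functions \<Omega> \<Longrightarrow> smooth_fun f \<Longrightarrow> (\<lambda>y. \<phi> y * f y) \<in> test_functions \<Omega>"
  unfolding test_functions_iff by (auto intro!: smooth_intros)

lemma test_functions_cmult: "\<phi> \<in> test_functions \<Omega> \<Longrightarrow> (\<lambda>y. c * \<phi> y) \<in> test_functions \<Omega>"
  by (rule test_functions_mult) (auto intro: smooth_intros)

lemma test_functions_add:
  assumes "\<phi> \<in> test_functions \<Omega>" "\<psi> \<in> test_functions \<Omega>"
  shows "(\<lambda>y. \<phi> y + \<psi> y) \<in> test_functions \<Omega>"
proof -
  obtain K L where "compact K" "K \<subseteq> \<Omega>" "\<forall>y. y \<notin> K \<longrightarrow> \<phi> y = 0" "compact L" "L \<subseteq> \<Omega>" "\<forall>y. y \<notin> L \<longrightarrow> \<psi> y = 0"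
    using assms unfolding test_functions_iff by blast
  then have "compact (K \<union> L) \<and> K \<union> L \<subseteq> \<Omega> \<and> (\<forall>y. y \<notin> K \<union> L \<longrightarrow> \<phi> y + \<psi> y = 0)"
    by (auto intro: compact_Un)
  then show ?thesis using assms unfolding test_functions_iff by (auto intro!: smooth_intros exI)
qed

lemma test_functions_diff:
  assumes "\<phi> \<in> test_functions \<Omega>" "\<psi> \<in> test_functions \<Omega>"
  shows "(\<lambda>y. \<phi> y - \<psi> y) \<in> test_functions \<Omega>"
  using test_functions_add[OF assms(1) test_functions_cmult[OF assms(2), of "-1"]] by simp

lemma test_functions_zero: "(\<lambda>y. 0) \<in> test_functions \<Omega>"
  unfolding test_functions_iff by (auto intro!: smooth_intros exI[of _ "{}"])

lemma test_functions_sum: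
  "(\<And>s. s \<in> S \<Longrightarrow> \<phi> s \<in> test_functions \<Omega>) \<Longrightarrow> (\<lambda>y. \<Sum>s\<in>S. \<phi> s y) \<in> test_functions \<Omega>"
  by (induction S rule: infinite_finite_induct) (auto intro!: test_functions_add test_functions_zero)

lemma test_functions_lap: "\<phi> \<in> test_functions \<Omega> \<Longrightarrow> lap \<phi> \<in> test_functions \<Omega>"
  unfolding lap_def[abs_def] by (intro test_functions_sum test_functions_partial)

lemma test_functions_affine:
  fixes c :: real
  assumes "\<phi> \<in> test_functions UNIV" "c \<noteq> 0"
  shows "(\<lambda>y. \<phi> (c *\<^sub>R y + d)) \<in> test_functions UNIV"
proof -
  obtain K where K: "compact K" "\<forall>y. y \<notin> K \<longrightarrow> \<phi> y = 0" "smooth_fun \<phi>"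
    using assms unfolding test_functions_iff by blast
  let ?L = "(\<lambda>y. inverse c *\<^sub>R (y - d)) ` K"
  have "compact ?L" by (intro compact_continuous_image continuous_intros K)
  moreover have "\<phi> (c *\<^sub>R y + d) = 0" if "y \<notin> ?L" for y
  proof -
    have "c *\<^sub>R y + d \<notin> K"
    proof
      assume "c *\<^sub>R y + d \<in> K"
      then have "inverse c *\<^sub>R ((c *\<^sub>R y + d) - d) \<in> ?L" by blast
      then show False using that assms(2) by simp
    qed
    then show ?thesis using K by blast
  qed
  ultimately show ?thesis unfolding test_functions_iff using K smooth_fun_affine[of \<phi> c d] by blast
qed

section \<open>The Laplacian of products, linear combinations and rescalings\<close>

lemma lap_mult:
  assumes "smooth_fun f" "smooth_fun g"
  shows "lap (\<lambda>y. f y * g y) y = f y * lap g y + 2 * (\<Sum>i\<in>UNIV. partial i f y * partial i g y) + lap f y * g y"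
proof -
  note d = smooth_fun_differentiable
  have 1: "partial i (\<lambda>y. f y * g y) = (\<lambda>y. f y * partial i g y + partial i f y * g y)" for i
    using partial_mult d assms by blast
  have "partial i (partial i (\<lambda>y. f y * g y)) y
      = f y * partial i (partial i g) y + 2 * (partial i f y * partial i g y) + partial i (partial i f) y * g y" for i
    unfolding 1
    by (subst partial_add) (auto intro!: d smooth_intros assms smooth_fun_partial simp: partial_mult[OF d d] assms)
  then show ?thesis by (simp add: lap_def sum.distrib sum_distrib_left sum_distrib_right)
qed

lemma lap_add:
  assumes "smooth_fun f" "smooth_fun g"
  shows "lap (\<lambda>y. f y + g y) y = lap f y + lap g y"
proof -
  have 1: "partial i (\<lambda>y. f y + g y) = (\<lambda>y. partial i f y + partial i g y)" if "smooth_fun f" "smooth_fun g" for i f g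
    using partial_add smooth_fun_differentiable that by blast
  show ?thesis using assms by (simp add: lap_def 1 sum.distrib)
qed

lemma lap_diff:
  assumes "smooth_fun f" "smooth_fun g"
  shows "lap (\<lambda>y. f y - g y) y = lap f y - lap g y"
proof -
  have 1: "partial i (\<lambda>y. f y - g y) = (\<lambda>y. partial i f y - partial i g y)" if "smooth_fun f" "smooth_fun g" for i f g
    using partial_diff smooth_fun_differentiable that by blast
  show ?thesis using assms by (simp add: lap_def 1 sum_subtractf)
qed

lemma lap_cmult:
  assumes "smooth_fun f"
  shows "lap (\<lambda>y. c * f y) y = c * lap f y"
proof -
  have 1: "partial i (\<lambda>y. c * f y) = (\<lambda>y. c * partial i f y)" if "smooth_fun f" for i f
    using partial_cmult smooth_fun_differentiable that by blast
  show ?thesis using assms by (simp add: lap_def 1 sum_distrib_left)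
qed

lemma lap_sum:
  assumes "finite S" "\<And>s. s \<in> S \<Longrightarrow> smooth_fun (f s)"
  shows "lap (\<lambda>y. \<Sum>s\<in>S. f s y) y = (\<Sum>s\<in>S. lap (f s) y)"
  using assms
proof (induction S rule: finite_induct)
  case empty
  then show ?case by (simp add: lap_def)
next
  case (insert s S)
  then show ?case by (simp add: lap_add smooth_fun_sum)
qed

lemma lap_affine:
  fixes c :: real
  assumes "smooth_fun f"
  shows "lap (\<lambda>y. f (c *\<^sub>R y + d)) y = of_real (c\<^sup>2) * lap f (c *\<^sub>R y + d)"
proof -
  have 1: "partial i (\<lambda>y. f (c *\<^sub>R y + d)) = (\<lambda>y. c *\<^sub>R partial i f (c *\<^sub>R y + d))" if "smooth_fun f" for i f
    using partial_affine(2)[OF smooth_fun_differentiable] that by blast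
  have "partial i (partial i (\<lambda>y. f (c *\<^sub>R y + d))) y = of_real (c\<^sup>2) * partial i (partial i f) (c *\<^sub>R y + d)" for i
  proof -
    have "partial i (partial i (\<lambda>y. f (c *\<^sub>R y + d))) y = partial i (\<lambda>y. of_real c * partial i f (c *\<^sub>R y + d)) y"
      using 1[OF assms] by (simp add: scaleR_conv_of_real)
    also have "\<dots> = of_real c * partial i (\<lambda>y. partial i f (c *\<^sub>R y + d)) y"
      using assms by (intro partial_cmult smooth_fun_differentiable smooth_fun_affine smooth_fun_partial)
    finally show ?thesis
      using 1[OF smooth_fun_partial[OF assms]] by (simp add: scaleR_conv_of_real power2_eq_square)
  qed
  then show ?thesis by (simp add: lap_def sum_distrib_left)
qed

section \<open>Bump functions\<close>

text \<open>For \<open>P = 1\<close> this is the classical flat function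
  \<open>exp (- 1 / t)\<close>; the polynomial factor in \<open>1 / t\<close> makes the family
  closed under differentiation.\<close>

definition bump :: "real poly \<Rightarrow> real \<Rightarrow> real" where
  "bump P t = (if t > 0 then poly P (1 / t) * exp (- (1 / t)) else 0)"

lemma poly_mult_exp_tendsto_0: "((\<lambda>x::real. poly P x * exp (- x)) \<longlongrightarrow> 0) at_top"
proof -
  have "((\<lambda>x. \<Sum>i\<le>degree P. coeff P i * (x ^ i / exp x)) \<longlongrightarrow> (\<Sum>i\<le>degree P. coeff P i * 0)) at_top"
    by (intro tendsto_sum tendsto_mult tendsto_const tendsto_power_div_exp_0)
  moreover have "(\<Sum>i\<le>degree P. coeff P i * (x ^ i / exp x)) = poly P x * exp (- x)" for x
    unfolding poly_altdef sum_distrib_right by (simp add: exp_minus field_simps)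
  ultimately show ?thesis by simp
qed

text \<open>Differentiating \<open>1 / t\<close> produces the factor \<open>1 / t\<^sup>2\<close>,
  hence the polynomial \<open>[:0, 0, 1:]\<close>; the difference \<open>P - pderiv P\<close>
  collects the derivative of the exponential and that of the polynomial. Only the origin needs a
  limit.\<close>

lemma bump_has_derivative:
  "(bump P has_real_derivative bump ([:0, 0, 1:] * (P - pderiv P)) t) (at t)"
proof -
  consider "t > 0" | "t < 0" | "t = 0" by linarith
  then show ?thesis
  proof cases
    case 1
    have "((\<lambda>t. poly P (1 / t) * exp (- (1 / t))) has_real_derivative
        (poly P (1/t) * (exp (- (1/t)) * (1 / t^2)) + poly (pderiv P) (1/t) * (- (1/t^2)) * exp (- (1/t)))) (at t)"
      using 1 by (auto intro!: derivative_eq_intros DERIV_chain2[OF poly_DERIV] simp: power2_eq_square)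
    then have "((\<lambda>t. poly P (1 / t) * exp (- (1 / t))) has_real_derivative bump ([:0, 0, 1:] * (P - pderiv P)) t) (at t)"
      using 1 by (simp add: bump_def field_simps power2_eq_square)
    then show ?thesis
      by (rule has_field_derivative_transform_within_open[of _ _ _ "{0<..}"]) (use 1 in \<open>auto simp: bump_def\<close>)
  next
    case 2
    have "((\<lambda>t. 0) has_real_derivative bump ([:0, 0, 1:] * (P - pderiv P)) t) (at t)"
      using 2 by (simp add: bump_def)
    then show ?thesis
      by (rule has_field_derivative_transform_within_open[of _ _ _ "{..<0}"]) (use 2 in \<open>auto simp: bump_def\<close>)
  next
    case 3
    \<comment> \<open>Dividing by \<open>h\<close> is one more factor \<open>1 / h\<close>, so the
      difference quotient at zero is again of the same kind, with \<open>pCons 0 P\<close> in place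
      of \<open>P\<close>.\<close>
    have "((\<lambda>x. poly (pCons 0 P) x * exp (- x)) \<longlongrightarrow> 0) at_top"
      by (rule poly_mult_exp_tendsto_0)
    then have "((\<lambda>h. poly (pCons 0 P) (inverse h) * exp (- (inverse h))) \<longlongrightarrow> 0) (at_right 0)"
      using filterlim_compose filterlim_inverse_at_top_right by blast
    then have "((\<lambda>h. bump P h / h) \<longlongrightarrow> 0) (at_right 0)"
      by (rule Lim_transform_eventually)
         (auto simp: bump_def eventually_at_filter field_simps)
    moreover have "((\<lambda>h. bump P h / h) \<longlongrightarrow> 0) (at_left 0)"
      by (rule Lim_transform_eventually[OF tendsto_const]) (auto simp: bump_def eventually_at_filter)
    ultimately have "((\<lambda>h. bump P h / h) \<longlongrightarrow> 0) (at 0)"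
      by (simp add: filterlim_split_at)
    then show ?thesis using 3 by (simp add: DERIV_def bump_def)
  qed
qed

lemma smooth_fun_bump:
  assumes "smooth_fun (\<lambda>y. complex_of_real (q y))"
  shows "smooth_fun (\<lambda>y. complex_of_real (bump 1 (q y)))"
proof -
  define P where "P = rec_nat (1::real poly) (\<lambda>_ P. [:0, 0, 1:] * (P - pderiv P))"
  have P: "P 0 = 1" "P (Suc n) = [:0, 0, 1:] * (P n - pderiv (P n))" for n
    by (simp_all add: P_def)
  define \<eta> where "\<eta> n t = complex_of_real (bump (P n) t)" for n t
  have "(\<eta> n has_vector_derivative \<eta> (Suc n) (q y)) (at (q y))" for n y
    unfolding P \<eta>_def by (intro has_vector_derivative_of_real bump_has_derivative)
  from smooth_fun_compose[of q \<eta>, OF assms this, of 0] show ?thesis by (simp add: P \<eta>_def)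
qed

lemma bump_simps [simp]:
  "t \<le> 0 \<Longrightarrow> bump 1 t = 0" "t > 0 \<Longrightarrow> bump 1 t > 0" "bump 1 t \<ge> 0" "bump 1 t \<le> 1"
  by (auto simp: bump_def)

lemma smooth_fun_inverse_real:
  assumes q: "smooth_fun (\<lambda>y. complex_of_real (q y))" "\<And>y. q y > 0"
  shows "smooth_fun (\<lambda>y. complex_of_real (1 / q y))"
proof -
  define \<eta> where "\<eta> n t = complex_of_real ((-1) ^ n * fact n * inverse t ^ Suc n)" for n and t :: real
  have "(\<eta> n has_vector_derivative \<eta> (Suc n) (q y)) (at (q y))" for n y
  proof -
    have "((\<lambda>t. (-1) ^ n * fact n * inverse t ^ Suc n) has_real_derivative
        (-1) ^ n * fact n * ((1 + real n) * (- (inverse (q y) ^ Suc (Suc 0)) * inverse (q y) ^ n))) (at (q y))"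
      using q(2)[of y] by (intro DERIV_cmult DERIV_power_Suc DERIV_inverse) auto
    also have "(-1) ^ n * fact n * ((1 + real n) * (- (inverse (q y) ^ Suc (Suc 0)) * inverse (q y) ^ n))
        = (-1) ^ Suc n * fact (Suc n) * inverse (q y) ^ Suc (Suc n)"
      by (simp add: algebra_simps)
    finally have "((\<lambda>t. (-1) ^ n * fact n * inverse t ^ Suc n) has_real_derivative
        (-1) ^ Suc n * fact (Suc n) * inverse (q y) ^ Suc (Suc n)) (at (q y))" .
    then show ?thesis unfolding \<eta>_def by (rule has_vector_derivative_of_real)
  qed
  from smooth_fun_compose[of q \<eta>, OF q(1) this, of 0] show ?thesis by (simp add: \<eta>_def field_simps)
qed

text \<open>A quotient \<open>a / (a + b)\<close>, with \<open>a\<close> positive exactly where the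
  squared norm is below 2 and \<open>b\<close> exactly where it exceeds 1. The overlap keeps the
  denominator positive, and using the squared norm keeps the function smooth at the origin.\<close>

definition std_cutoff :: "plane \<Rightarrow> real" where
  "std_cutoff y = bump 1 (2 - (norm y)\<^sup>2) * (1 / (bump 1 (2 - (norm y)\<^sup>2) + bump 1 ((norm y)\<^sup>2 - 1)))"

lemma std_cutoff_denom: "bump 1 (2 - q) + bump 1 (q - 1) > 0"
proof (cases "q < 2")
  case True
  then show ?thesis by (intro add_pos_nonneg) auto
next
  case False
  then show ?thesis by (intro add_nonneg_pos) auto
qed

lemma smooth_fun_std_cutoff: "smooth_fun (\<lambda>y. complex_of_real (std_cutoff y))"
proof -
  have n: "smooth_fun (\<lambda>y::plane. complex_of_real ((norm y)\<^sup>2))"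
    using smooth_fun_norm_sq[of 0] by simp
  have 1: "smooth_fun (\<lambda>y::plane. complex_of_real (2 - (norm y)\<^sup>2))"
    using smooth_fun_diff[OF smooth_fun_const[of 2] n] by simp
  have 2: "smooth_fun (\<lambda>y::plane. complex_of_real ((norm y)\<^sup>2 - 1))"
    using smooth_fun_diff[OF n smooth_fun_const[of 1]] by simp
  have 3: "smooth_fun (\<lambda>y::plane. complex_of_real (bump 1 (2 - (norm y)\<^sup>2) + bump 1 ((norm y)\<^sup>2 - 1)))"
    using smooth_fun_add[OF smooth_fun_bump[OF 1] smooth_fun_bump[OF 2]] by simp
  show ?thesis
    using smooth_fun_mult[OF smooth_fun_bump[OF 1] smooth_fun_inverse_real[OF 3 std_cutoff_denom]]
    by (simp add: std_cutoff_def)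
qed

lemma std_cutoff_bounds: "0 \<le> std_cutoff y" "std_cutoff y \<le> 1"
  using std_cutoff_denom[of "(norm y)\<^sup>2"] by (auto simp: std_cutoff_def field_simps)

lemma std_cutoff_eq_1: "norm y \<le> 1 \<Longrightarrow> std_cutoff y = 1"
  using std_cutoff_denom[of "(norm y)\<^sup>2"] by (auto simp: std_cutoff_def abs_square_le_1)

lemma std_cutoff_eq_0:
  assumes "norm y \<ge> 2" shows "std_cutoff y = 0"
proof -
  have "2\<^sup>2 \<le> (norm y)\<^sup>2" using assms by (intro power_mono) auto
  then show ?thesis by (simp add: std_cutoff_def)
qed

text \<open>The argument is \<open>(y - c) / R\<close>, spelled in the form required by the lemmas
  on affine substitutions.\<close>

definition cutoff :: "plane \<Rightarrow> real \<Rightarrow> plane \<Rightarrow> complex" where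
  "cutoff c R y = of_real (std_cutoff ((1 / R) *\<^sub>R y + (- (1 / R)) *\<^sub>R c))"

lemma test_functions_bounded:
  assumes "\<phi> \<in> test_functions \<Omega>"
  obtains C where "C \<ge> 0" "\<And>y. norm (\<phi> y) \<le> C"
proof -
  obtain K where K: "compact K" "\<forall>y. y \<notin> K \<longrightarrow> \<phi> y = 0" "smooth_fun \<phi>"
    using assms unfolding test_functions_iff by blast
  have "bounded (\<phi> ` K)"
    by (intro compact_imp_bounded compact_continuous_image smooth_fun_continuous K)
  then obtain C where "\<And>y. y \<in> K \<Longrightarrow> norm (\<phi> y) \<le> C" unfolding bounded_iff by blast
  then show ?thesis using that[of "max C 0"] K(2) by (metis max.cobounded2 max.coboundedI1 norm_zero)
qed

lemma std_cutoff_test: "(\<lambda>y. complex_of_real (std_cutoff y)) \<in> test_functions UNIV"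
  unfolding test_functions_iff
  by (auto intro!: smooth_fun_std_cutoff exI[of _ "cball 0 2"] std_cutoff_eq_0 simp: not_le)

lemma cutoff_arg: "norm ((1 / R) *\<^sub>R y + (- (1 / R)) *\<^sub>R c) = dist y c / R" if "R > 0"
proof -
  have "(1 / R) *\<^sub>R y + (- (1 / R)) *\<^sub>R c = (1 / R) *\<^sub>R (y - c)" by (simp add: algebra_simps)
  then show ?thesis using that by (simp add: dist_norm)
qed

lemma smooth_fun_cutoff [smooth_intros]: "smooth_fun (cutoff c R)"
  unfolding cutoff_def[abs_def] by (rule smooth_fun_affine[OF smooth_fun_std_cutoff])

lemma cutoff_eq_1: "R > 0 \<Longrightarrow> dist y c \<le> R \<Longrightarrow> cutoff c R y = 1"
  unfolding cutoff_def by (subst std_cutoff_eq_1) (simp_all only: cutoff_arg, simp_all)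

lemma cutoff_eq_0: "R > 0 \<Longrightarrow> dist y c \<ge> 2 * R \<Longrightarrow> cutoff c R y = 0"
  unfolding cutoff_def by (subst std_cutoff_eq_0) (simp_all only: cutoff_arg, simp_all add: field_simps)

lemma norm_cutoff_le: "norm (cutoff c R y) \<le> 1"
  unfolding cutoff_def using std_cutoff_bounds by simp

lemma cutoff_test: "R > 0 \<Longrightarrow> cball c (2 * R) \<subseteq> \<Omega> \<Longrightarrow> cutoff c R \<in> test_functions \<Omega>"
  unfolding test_functions_iff
  by (auto intro!: smooth_fun_cutoff exI[of _ "cball c (2 * R)"] cutoff_eq_0 simp: not_le dist_commute)

lemma cutoff_partial_eq_0: "R > 0 \<Longrightarrow> dist y c > 2 * R \<Longrightarrow> partial i (cutoff c R) y = 0"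
  by (rule partial_zero_outside[of "cball c (2 * R)"]) (auto intro!: cutoff_eq_0 simp: not_le dist_commute)

lemma cutoff_lap_eq_0: "R > 0 \<Longrightarrow> dist y c > 2 * R \<Longrightarrow> lap (cutoff c R) y = 0"
  unfolding lap_def
  by (intro sum.neutral ballI partial_zero_outside[of "cball c (2 * R)"] cutoff_partial_eq_0) (auto simp: not_le dist_commute)

text \<open>Rescaling costs one factor \<open>1 / R\<close> per derivative and the centre does not
  matter, so one constant taken from the unit cutoff serves every radius, shrinking towards a point
  or growing to infinity.\<close>

lemma cutoff_derivative_bounds:
  obtains C where "C \<ge> 0" "\<And>c R i y. R > 0 \<Longrightarrow> norm (partial i (cutoff c R) y) \<le> C / R"
    "\<And>c R y. R > 0 \<Longrightarrow> norm (lap (cutoff c R) y) \<le> C / R\<^sup>2"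
proof -
  let ?s = "\<lambda>y. complex_of_real (std_cutoff y)"
  have "\<exists>C. \<forall>y. norm (partial i ?s y) \<le> C" for i
    using test_functions_bounded[OF test_functions_partial[OF std_cutoff_test]] by metis
  then obtain A where A: "\<And>i y. norm (partial i ?s y) \<le> A i" by metis
  obtain B where B: "B \<ge> 0" "\<And>y. norm (lap ?s y) \<le> B"
    using test_functions_bounded[OF test_functions_lap[OF std_cutoff_test]] by metis
  define C where "C = B + (\<Sum>i\<in>UNIV. \<bar>A i\<bar>)"
  have CA: "norm (partial i ?s y) \<le> C" for i y
    using A[of i y] B(1) member_le_sum[of i UNIV "\<lambda>i. \<bar>A i\<bar>"] by (simp add: C_def)
  have CB: "norm (lap ?s y) \<le> C" for y
    using B(2)[of y] by (simp add: C_def add_increasing2 sum_nonneg)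
  have C0: "C \<ge> 0" using CB norm_ge_zero order_trans by blast
  show ?thesis
  proof (rule that[OF C0])
    fix c :: plane and R :: real and i y assume R: "R > 0"
    have "partial i (cutoff c R) y = (1 / R) *\<^sub>R partial i ?s ((1/R) *\<^sub>R y + (- (1 / R)) *\<^sub>R c)"
      unfolding cutoff_def[abs_def]
      by (rule partial_affine(2)[OF smooth_fun_differentiable[OF smooth_fun_std_cutoff]])
    then have "norm (partial i (cutoff c R) y) = (1 / R) * norm (partial i ?s ((1/R) *\<^sub>R y + (- (1 / R)) *\<^sub>R c))"
      using R by simp
    also have "\<dots> \<le> (1 / R) * C" using R by (intro mult_left_mono CA) auto
    finally show "norm (partial i (cutoff c R) y) \<le> C / R" by simp
  next
    fix c :: plane and R :: real and y assume R: "R > 0"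
    have "lap (cutoff c R) y = of_real ((1 / R)\<^sup>2) * lap ?s ((1/R) *\<^sub>R y + (- (1 / R)) *\<^sub>R c)"
      unfolding cutoff_def[abs_def] by (rule lap_affine[OF smooth_fun_std_cutoff])
    then have "norm (lap (cutoff c R) y) = (1 / R)\<^sup>2 * norm (lap ?s ((1/R) *\<^sub>R y + (- (1 / R)) *\<^sub>R c))"
      by (simp only: norm_mult norm_of_real) simp
    also have "\<dots> \<le> (1 / R)\<^sup>2 * C" using R by (intro mult_left_mono CB) auto
    finally show "norm (lap (cutoff c R) y) \<le> C / R\<^sup>2" by (simp add: power_divide)
  qed
qed

section \<open>Square-integrable functions\<close>

lemma L2I: "f \<in> borel_measurable borel \<Longrightarrow> integrable lborel (\<lambda>y. (norm (f y))\<^sup>2) \<Longrightarrow> f \<in> L2"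
  by (simp add: L2_def)

lemma L2_measurable [measurable_dest]: "f \<in> L2 \<Longrightarrow> f \<in> borel_measurable borel"
  by (simp add: L2_def)

lemma L2_integrable: "f \<in> L2 \<Longrightarrow> integrable lborel (\<lambda>y. (norm (f y))\<^sup>2)"
  by (simp add: L2_def)

lemma L2_norm_ge_0 [simp]: "L2_norm f \<ge> 0"
  by (simp add: L2_norm_def)

lemma L2_norm_sq: "(L2_norm f)\<^sup>2 = (LINT y|lborel. (norm (f y))\<^sup>2)"
  by (simp add: L2_norm_def)

lemma L2_bound:
  assumes "f \<in> borel_measurable borel" "integrable lborel g" "\<And>y. (norm (f y))\<^sup>2 \<le> g y"
  shows "f \<in> L2"
  by (rule L2I[OF assms(1)], rule Bochner_Integration.integrable_bound[OF assms(2)])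
     (use assms in \<open>auto intro!: AE_I2 order_trans[OF assms(3)]\<close>)

lemma L2_mult_integrable:
  assumes "f \<in> L2" "g \<in> L2"
  shows "integrable lborel (\<lambda>y. f y * g y)"
proof (rule Bochner_Integration.integrable_bound)
  show "integrable lborel (\<lambda>y. (norm (f y))\<^sup>2 + (norm (g y))\<^sup>2)"
    using assms by (auto simp: L2_integrable)
  show "(\<lambda>y. f y * g y) \<in> borel_measurable lborel" using assms by (auto dest: L2_measurable)
  show "AE y in lborel. norm (f y * g y) \<le> norm ((norm (f y))\<^sup>2 + (norm (g y))\<^sup>2)"
  proof (rule AE_I2)
    fix y
    have "norm (f y) * norm (g y) \<le> (norm (f y))\<^sup>2 + (norm (g y))\<^sup>2"
      using sum_squares_bound[of "norm (f y)" "norm (g y)"] mult_nonneg_nonneg[OF norm_ge_zero[of "f y"] norm_ge_zero[of "g y"]]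
      by linarith
    then show "norm (f y * g y) \<le> norm ((norm (f y))\<^sup>2 + (norm (g y))\<^sup>2)"
      by (simp add: norm_mult)
  qed
qed

lemma L2_cnj: "f \<in> L2 \<Longrightarrow> (\<lambda>y. cnj (f y)) \<in> L2"
  using measurable_compose[OF _ borel_measurable_continuous_onI[OF continuous_on_cnj[OF continuous_on_id]]]
  by (auto simp: L2_def)

lemma L2_norm_cnj [simp]: "L2_norm (\<lambda>y. cnj (f y)) = L2_norm f"
  by (simp add: L2_norm_def)

lemma L2_add:
  assumes "f \<in> L2" "g \<in> L2" shows "(\<lambda>y. f y + g y) \<in> L2"
proof (rule L2_bound)
  show "(\<lambda>y. f y + g y) \<in> borel_measurable borel" using assms by (auto dest: L2_measurable)
  show "integrable lborel (\<lambda>y. 2 * (norm (f y))\<^sup>2 + 2 * (norm (g y))\<^sup>2)"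
    using assms by (auto simp: L2_integrable)
  fix y
  have "(norm (f y + g y))\<^sup>2 \<le> (norm (f y) + norm (g y))\<^sup>2"
    by (intro power_mono norm_triangle_ineq) auto
  also have "\<dots> \<le> 2 * (norm (f y))\<^sup>2 + 2 * (norm (g y))\<^sup>2"
    using sum_squares_bound[of "norm (f y)" "norm (g y)"] by (simp add: power2_sum)
  finally show "(norm (f y + g y))\<^sup>2 \<le> 2 * (norm (f y))\<^sup>2 + 2 * (norm (g y))\<^sup>2" .
qed

lemma L2_cmult: "f \<in> L2 \<Longrightarrow> (\<lambda>y. c * f y) \<in> L2"
  by (auto simp: L2_def norm_mult power_mult_distrib)

lemma L2_norm_cmult: "L2_norm (\<lambda>y. c * f y) = norm c * L2_norm f"
  by (simp add: L2_norm_def norm_mult power_mult_distrib real_sqrt_mult)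

lemma L2_zero: "(\<lambda>y. 0) \<in> L2"
  by (auto simp: L2_def)

lemma L2_diff: "f \<in> L2 \<Longrightarrow> g \<in> L2 \<Longrightarrow> (\<lambda>y. f y - g y) \<in> L2"
  using L2_add[of f "\<lambda>y. -1 * g y"] L2_cmult[of g "-1"] by simp

text \<open>The optimal weight is \<open>t = sqrt B / sqrt A\<close>. Adding \<open>e\<close> to
  \<open>A\<close> and \<open>B\<close> keeps this quotient defined and positive; letting
  \<open>e\<close> tend to zero removes the slack.\<close>

lemma mult_le_sqrt_sqrtI:
  fixes I A B :: real
  assumes "\<And>t. t > 0 \<Longrightarrow> 2 * I \<le> t * A + B / t" "A \<ge> 0" "B \<ge> 0"
  shows "I \<le> sqrt A * sqrt B"
proof (rule field_le_epsilon)
  have *: "I \<le> sqrt (A + e) * sqrt (B + e)" if "e > 0" for e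
  proof -
    define a b where "a = sqrt (A + e)" and "b = sqrt (B + e)"
    have ab: "a > 0" "b > 0" "A = a\<^sup>2 - e" "B = b\<^sup>2 - e" using that assms by (auto simp: a_def b_def)
    have "2 * I \<le> b / a * A + B / (b / a)" by (rule assms(1)) (use ab in auto)
    also have "\<dots> \<le> b / a * a\<^sup>2 + b\<^sup>2 / (b / a)"
      using ab that by (intro add_mono mult_left_mono divide_right_mono) auto
    also have "\<dots> = 2 * (a * b)" using ab by (simp add: field_simps power2_eq_square)
    finally show ?thesis by (simp add: a_def b_def)
  qed
  fix e :: real assume "e > 0"
  have "((\<lambda>e. sqrt (A + e) * sqrt (B + e)) \<longlongrightarrow> sqrt (A + 0) * sqrt (B + 0)) (at_right 0)"
    by (intro tendsto_intros)
  then have "I \<le> sqrt (A + 0) * sqrt (B + 0)"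
    by (rule tendsto_lowerbound) (auto simp: eventually_at_filter *)
  then show "I \<le> sqrt A * sqrt B + e" using \<open>e > 0\<close> by simp
qed

lemma L2_Cauchy_Schwarz_abs:
  assumes "f \<in> L2" "g \<in> L2"
  shows "(LINT y|lborel. norm (f y) * norm (g y)) \<le> L2_norm f * L2_norm g"
  unfolding L2_norm_def
proof (rule mult_le_sqrt_sqrtI)
  fix t :: real assume t: "t > 0"
  note i = L2_integrable[OF assms(1)] L2_integrable[OF assms(2)]
  have "2 * (LINT y|lborel. norm (f y) * norm (g y)) = (LINT y|lborel. 2 * (norm (f y) * norm (g y)))"
    by simp
  also have "\<dots> \<le> (LINT y|lborel. t * (norm (f y))\<^sup>2 + (norm (g y))\<^sup>2 / t)"
  proof (rule integral_mono)
    show "integrable lborel (\<lambda>y. 2 * (norm (f y) * norm (g y)))"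
      using integrable_norm[OF L2_mult_integrable[OF assms]] by (simp add: norm_mult)
    show "integrable lborel (\<lambda>y. t * (norm (f y))\<^sup>2 + (norm (g y))\<^sup>2 / t)" using i by auto
    fix y
    have "0 \<le> (t * norm (f y) - norm (g y))\<^sup>2 / t" using t by simp
    also have "\<dots> = t * (norm (f y))\<^sup>2 + (norm (g y))\<^sup>2 / t - 2 * (norm (f y) * norm (g y))"
      using t by (simp add: power2_eq_square field_simps)
    finally show "2 * (norm (f y) * norm (g y)) \<le> t * (norm (f y))\<^sup>2 + (norm (g y))\<^sup>2 / t" by simp
  qed
  also have "\<dots> = t * (LINT y|lborel. (norm (f y))\<^sup>2) + (LINT y|lborel. (norm (g y))\<^sup>2) / t"
    using i by simp
  finally show "2 * (LINT y|lborel. norm (f y) * norm (g y)) \<le> t * (LINT y|lborel. (norm (f y))\<^sup>2) + (LINT y|lborel. (norm (g y))\<^sup>2) / t" .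
qed auto

lemma L2_Cauchy_Schwarz:
  assumes "f \<in> L2" "g \<in> L2"
  shows "norm (LINT y|lborel. f y * g y) \<le> L2_norm f * L2_norm g"
  using integral_norm_bound[of lborel "\<lambda>y. f y * g y"] L2_Cauchy_Schwarz_abs[OF assms]
  by (simp add: norm_mult)

lemma L2_norm_triangle:
  assumes "f \<in> L2" "g \<in> L2"
  shows "L2_norm (\<lambda>y. f y + g y) \<le> L2_norm f + L2_norm g"
proof (rule power2_le_imp_le)
  have i: "integrable lborel (\<lambda>y. 2 * (norm (f y) * norm (g y)))"
    using integrable_norm[OF L2_mult_integrable[OF assms]] by (simp add: norm_mult)
  have "(L2_norm (\<lambda>y. f y + g y))\<^sup>2 \<le> (LINT y|lborel. (norm (f y))\<^sup>2 + (norm (g y))\<^sup>2 + 2 * (norm (f y) * norm (g y)))"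
    unfolding L2_norm_sq
  proof (rule integral_mono)
    show "integrable lborel (\<lambda>y. (norm (f y + g y))\<^sup>2)" by (rule L2_integrable[OF L2_add[OF assms]])
    show "integrable lborel (\<lambda>y. (norm (f y))\<^sup>2 + (norm (g y))\<^sup>2 + 2 * (norm (f y) * norm (g y)))"
      by (intro Bochner_Integration.integrable_add L2_integrable assms i)
    fix y
    have "(norm (f y + g y))\<^sup>2 \<le> (norm (f y) + norm (g y))\<^sup>2"
      by (intro power_mono norm_triangle_ineq) auto
    then show "(norm (f y + g y))\<^sup>2 \<le> (norm (f y))\<^sup>2 + (norm (g y))\<^sup>2 + 2 * (norm (f y) * norm (g y))"
      by (simp add: power2_sum)
  qed
  also have "\<dots> = (L2_norm f)\<^sup>2 + (L2_norm g)\<^sup>2 + 2 * (LINT y|lborel. norm (f y) * norm (g y))"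
    using i L2_integrable[OF assms(1)] L2_integrable[OF assms(2)]
    by (simp add: L2_norm_sq)
  also have "\<dots> \<le> (L2_norm f + L2_norm g)\<^sup>2"
    using L2_Cauchy_Schwarz_abs[OF assms] by (simp add: power2_sum)
  finally show "(L2_norm (\<lambda>y. f y + g y))\<^sup>2 \<le> (L2_norm f + L2_norm g)\<^sup>2" .
qed simp

lemma L2_norm_triangle_diff:
  assumes "f \<in> L2" "g \<in> L2"
  shows "L2_norm (\<lambda>y. f y - g y) \<le> L2_norm f + L2_norm g"
  using L2_norm_triangle[OF assms(1) L2_cmult[OF assms(2), of "-1"]] L2_norm_cmult[of "-1" g] by simp

lemma L2_norm_diff_commute: "L2_norm (\<lambda>y. f y - g y) = L2_norm (\<lambda>y. g y - f y)"
  by (simp add: L2_norm_def norm_minus_commute)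

lemma L2_norm_cong_AE:
  assumes "f \<in> borel_measurable borel" "g \<in> borel_measurable borel" "AE y in lborel. f y = g y"
  shows "L2_norm f = L2_norm g"
  unfolding L2_norm_def using assms by (intro arg_cong[where f=sqrt] integral_cong_AE) auto

lemma L2_norm_eq_0_imp_AE:
  assumes "f \<in> L2" "L2_norm f = 0"
  shows "AE y in lborel. f y = 0"
  using integral_nonneg_eq_0_iff_AE[OF L2_integrable[OF assms(1)]] assms(2) by (auto simp: L2_norm_def)

lemma L2_tendsto_integral:
  assumes "\<And>n. f n \<in> L2" "g \<in> L2" "\<phi> \<in> L2" "(\<lambda>n. L2_norm (\<lambda>y. f n y - g y)) \<longlonglongrightarrow> 0"
  shows "(\<lambda>n. LINT y|lborel. f n y * \<phi> y) \<longlonglongrightarrow> (LINT y|lborel. g y * \<phi> y)"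
proof (subst tendsto_dist_iff, rule tendsto_sandwich[OF _ _ tendsto_const])
  show "(\<lambda>n. L2_norm (\<lambda>y. f n y - g y) * L2_norm \<phi>) \<longlonglongrightarrow> 0"
    using tendsto_mult_right[OF assms(4), of "L2_norm \<phi>"] by simp
  have "dist (LINT y|lborel. f n y * \<phi> y) (LINT y|lborel. g y * \<phi> y) \<le> L2_norm (\<lambda>y. f n y - g y) * L2_norm \<phi>" for n
  proof -
    have "(LINT y|lborel. f n y * \<phi> y) - (LINT y|lborel. g y * \<phi> y) = (LINT y|lborel. (f n y - g y) * \<phi> y)"
      using L2_mult_integrable[OF assms(1) assms(3)] L2_mult_integrable[OF assms(2,3)]
      by (simp add: left_diff_distrib)
    then show ?thesis using L2_Cauchy_Schwarz[OF L2_diff[OF assms(1,2)] assms(3)] by (simp add: dist_norm)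
  qed
  then show "\<forall>\<^sub>F n in sequentially. dist (LINT y|lborel. f n y * \<phi> y) (LINT y|lborel. g y * \<phi> y) \<le> L2_norm (\<lambda>y. f n y - g y) * L2_norm \<phi>"
    by simp
qed auto

lemma L2_tendsto_norm:
  assumes "\<And>n. f n \<in> L2" "g \<in> L2" "(\<lambda>n. L2_norm (\<lambda>y. f n y - g y)) \<longlonglongrightarrow> 0"
  shows "(\<lambda>n. L2_norm (f n)) \<longlonglongrightarrow> L2_norm g"
proof (subst tendsto_dist_iff, rule tendsto_sandwich[OF _ _ tendsto_const assms(3)])
  have "dist (L2_norm (f n)) (L2_norm g) \<le> L2_norm (\<lambda>y. f n y - g y)" for n
    using L2_norm_triangle[OF L2_diff[OF assms(1,2)] assms(2), of n]
      L2_norm_triangle[OF L2_diff[OF assms(2,1)] assms(1), of n n] L2_norm_diff_commute[of "f n" g]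
    by (auto simp: dist_real_def)
  then show "\<forall>\<^sub>F n in sequentially. dist (L2_norm (f n)) (L2_norm g) \<le> L2_norm (\<lambda>y. f n y - g y)" by simp
qed auto

lemma continuous_compact_support_integrable:
  fixes f :: "plane \<Rightarrow> 'b::{banach, second_countable_topology}"
  assumes "continuous_on UNIV f" "compact K" "\<And>y. y \<notin> K \<Longrightarrow> f y = 0"
  shows "integrable lborel f"
proof -
  have "integrable lborel (\<lambda>y. indicator K y *\<^sub>R f y)"
    using assms by (intro borel_integrable_compact continuous_on_subset[OF assms(1)]) auto
  moreover have "(\<lambda>y. indicator K y *\<^sub>R f y) = f" using assms(3) by (auto simp: indicator_def)
  ultimately show ?thesis by simp
qed

lemma test_functions_integrable:
  assumes "\<phi> \<in> test_functions \<Omega>"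
  shows "integrable lborel \<phi>"
  using assms unfolding test_functions_iff
  by (auto intro: continuous_compact_support_integrable smooth_fun_continuous)

lemma test_functions_L2:
  assumes "\<phi> \<in> test_functions \<Omega>"
  shows "\<phi> \<in> L2"
proof -
  obtain K where K: "compact K" "\<forall>y. y \<notin> K \<longrightarrow> \<phi> y = 0" "smooth_fun \<phi>"
    using assms unfolding test_functions_iff by blast
  show ?thesis
    by (rule L2I[OF smooth_fun_measurable[OF K(3)]], rule continuous_compact_support_integrable[OF _ K(1)])
       (use K in \<open>auto intro!: continuous_intros smooth_fun_continuous\<close>)
qed

section \<open>Reflection and translation invariance\<close>

lemma lborel_reflect: "distr lborel borel (\<lambda>x. d - x) = (lborel :: 'a::euclidean_space measure)"
  using lborel_affine[of "-1" d] by (simp add: density_1)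

lemma lborel_translate: "distr lborel borel (\<lambda>x. x + d) = (lborel :: 'a::euclidean_space measure)"
  using lborel_distr_plus[of d] by (simp add: add.commute[of _ d])

lemma lborel_integral_reflect:
  fixes f :: "'a::euclidean_space \<Rightarrow> 'b::{banach, second_countable_topology}"
  assumes "f \<in> borel_measurable borel"
  shows "(LINT x|lborel. f (d - x)) = (LINT x|lborel. f x)"
    and "integrable lborel (\<lambda>x. f (d - x)) \<longleftrightarrow> integrable lborel f"
  using integral_distr[of "\<lambda>x. d - x" lborel borel f] integrable_distr_eq[of "\<lambda>x. d - x" lborel borel f] assms
  by (simp_all add: lborel_reflect)

lemma lborel_integral_translate:
  fixes f :: "'a::euclidean_space \<Rightarrow> 'b::{banach, second_countable_topology}"
  assumes "f \<in> borel_measurable borel"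
  shows "(LINT x|lborel. f (x + d)) = (LINT x|lborel. f x)"
    and "integrable lborel (\<lambda>x. f (x + d)) \<longleftrightarrow> integrable lborel f"
  using integral_distr[of "\<lambda>x. x + d" lborel borel f] integrable_distr_eq[of "\<lambda>x. x + d" lborel borel f] assms
  by (simp_all add: lborel_translate)

lemma L2_reflect: "f \<in> L2 \<Longrightarrow> (\<lambda>x. f (d - x)) \<in> L2" "f \<in> L2 \<Longrightarrow> L2_norm (\<lambda>x. f (d - x)) = L2_norm f"
  using lborel_integral_reflect[of "\<lambda>y. (norm (f y))\<^sup>2" d] by (auto simp: L2_def L2_norm_def)

lemma L2_translate: "f \<in> L2 \<Longrightarrow> (\<lambda>x. f (x + d)) \<in> L2" "f \<in> L2 \<Longrightarrow> L2_norm (\<lambda>x. f (x + d)) = L2_norm f"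
  using lborel_integral_translate[of "\<lambda>y. (norm (f y))\<^sup>2" d] by (auto simp: L2_def L2_norm_def)

section \<open>Integration by parts\<close>

lemma smooth_fun_line_derivative:
  assumes "smooth_fun u"
  shows "((\<lambda>t. u (y + t *\<^sub>R axis i 1)) has_vector_derivative partial i u (y + t *\<^sub>R axis i 1)) (at t within S)"
proof -
  let ?x = "y + t *\<^sub>R axis i 1"
  have lin: "linear (frechet_derivative u (at ?x))"
    using smooth_fun_has_derivative[OF assms] has_derivative_linear by blast
  have "((\<lambda>t. y + t *\<^sub>R axis i (1::real)) has_derivative (\<lambda>h. h *\<^sub>R axis i 1)) (at t within S)"
    by (auto intro!: derivative_eq_intros)
  from has_derivative_compose[OF this smooth_fun_has_derivative[OF assms]]
  show ?thesis by (simp add: has_vector_derivative_def partial_def linear_cmul[OF lin])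
qed

text \<open>Translation invariance replaces compact support. The difference
  \<open>u (y + e) - u y\<close>, with \<open>e\<close> the unit vector, has integral zero, and
  along the unit segment it is the integral of the partial derivative; exchanging the two integrals
  gives the claim. It thus covers the resolvent solutions, whose support is unbounded.\<close>

lemma integral_partial_eq_0:
  assumes u: "smooth_fun u" "integrable lborel u" "integrable lborel (partial i u)"
  shows "(LINT y|lborel. partial i u y) = 0"
proof -
  let ?e = "axis i 1 :: plane"
  let ?p = "partial i u"
  have [measurable]: "?p \<in> borel_measurable borel" "u \<in> borel_measurable borel"
    using u by (auto intro: smooth_fun_measurable)
  have cp: "continuous_on S (\<lambda>t. ?p (y + t *\<^sub>R ?e))" for y S
    by (rule continuous_on_compose2[OF smooth_fun_continuous[of ?p UNIV, OF smooth_fun_partial[OF u(1)]]])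
       (auto intro!: continuous_intros)
  have ftc: "(LINT t|lborel. indicator {0..1} t *\<^sub>R ?p (y + t *\<^sub>R ?e)) = u (y + ?e) - u y" for y
    using integral_FTC_atLeastAtMost[of 0 1 "\<lambda>t. u (y + t *\<^sub>R ?e)" "\<lambda>t. ?p (y + t *\<^sub>R ?e)"]
      smooth_fun_line_derivative[OF u(1)] cp by simp
  have int_t: "integrable lborel (\<lambda>y. ?p (y + d))" and int_t': "(LINT y|lborel. ?p (y + d)) = (LINT y|lborel. ?p y)"
    and int_n: "(LINT y|lborel. norm (?p (y + d))) = (LINT y|lborel. norm (?p y))" for d
    using lborel_integral_translate[of ?p d] lborel_integral_translate[of "\<lambda>y. norm (?p y)" d] u(3) by simp_all
  have int: "integrable (lborel \<Otimes>\<^sub>M lborel) (\<lambda>(t::real, y). indicator {0..1} t *\<^sub>R ?p (y + t *\<^sub>R ?e))"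
  proof (rule lborel_pair.Fubini_integrable)
    show "(\<lambda>(t::real, y). indicator {0..1} t *\<^sub>R ?p (y + t *\<^sub>R ?e)) \<in> borel_measurable (lborel \<Otimes>\<^sub>M lborel)"
      by measurable
    have "integrable lborel (\<lambda>t::real. indicator {0..1} t * (LINT y|lborel. norm (?p y)))"
      by (intro integrable_mult_left) simp
    then show "integrable lborel (\<lambda>t::real. LINT y|lborel. norm (case (t, y) of (t, y) \<Rightarrow> indicator {0..1} t *\<^sub>R ?p (y + t *\<^sub>R ?e)))"
      by (simp add: int_n)
    show "AE t::real in lborel. integrable lborel (\<lambda>y. case (t, y) of (t, y) \<Rightarrow> indicator {0..1} t *\<^sub>R ?p (y + t *\<^sub>R ?e))"
      using int_t by simp
  qed
  have "0 = (LINT y|lborel. u (y + ?e) - u y)"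
    using lborel_integral_translate[of u ?e] u(2) by simp
  also have "\<dots> = (LINT y|lborel. LINT t|lborel. indicator {0..1} t *\<^sub>R ?p (y + t *\<^sub>R ?e))"
    by (simp add: ftc)
  also have "\<dots> = (LINT t|lborel. LINT y|lborel. indicator {0..1} t *\<^sub>R ?p (y + t *\<^sub>R ?e))"
    using lborel_pair.Fubini_integral[OF int] .
  also have "\<dots> = (LINT t|lborel. indicator {0..1::real} t *\<^sub>R (LINT y|lborel. ?p y))"
    by (simp add: int_t')
  also have "\<dots> = (LINT y|lborel. ?p y)" by simp
  finally show ?thesis by simp
qed

lemma integration_by_parts:
  assumes "smooth_fun u" "smooth_fun v" "integrable lborel (\<lambda>y. u y * v y)"
    "integrable lborel (\<lambda>y. u y * partial i v y)" "integrable lborel (\<lambda>y. partial i u y * v y)"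
  shows "(LINT y|lborel. u y * partial i v y) = - (LINT y|lborel. partial i u y * v y)"
proof -
  have p: "partial i (\<lambda>y. u y * v y) = (\<lambda>y. u y * partial i v y + partial i u y * v y)"
    using partial_mult smooth_fun_differentiable assms(1,2) by blast
  have "(LINT y|lborel. partial i (\<lambda>y. u y * v y) y) = 0"
    by (rule integral_partial_eq_0) (use assms p in \<open>auto intro!: smooth_intros\<close>)
  then show ?thesis using assms unfolding p by (simp add: add_eq_0_iff2)
qed

lemma integration_by_parts_L2:
  assumes "smooth_fun u" "smooth_fun v" "u \<in> L2" "v \<in> L2" "partial i u \<in> L2" "partial i v \<in> L2"
  shows "(LINT y|lborel. u y * partial i v y) = - (LINT y|lborel. partial i u y * v y)"
  using assms by (intro integration_by_parts L2_mult_integrable)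

lemma integration_by_parts_test:
  assumes "smooth_fun u" "\<phi> \<in> test_functions \<Omega>"
  shows "(LINT y|lborel. u y * partial i \<phi> y) = - (LINT y|lborel. partial i u y * \<phi> y)"
  using assms test_functions_integrable[OF test_functions_mult[OF assms(2,1)]]
    test_functions_integrable[OF test_functions_mult[OF test_functions_partial[OF assms(2), of i] assms(1)]]
    test_functions_integrable[OF test_functions_mult[OF assms(2) smooth_fun_partial[OF assms(1), of i]]]
  by (intro integration_by_parts) (auto intro: test_functions_smooth)

lemma green_test:
  assumes "smooth_fun u" "\<phi> \<in> test_functions \<Omega>"
  shows "(LINT y|lborel. u y * lap \<phi> y) = (LINT y|lborel. lap u y * \<phi> y)"
proof -
  have i1: "integrable lborel (\<lambda>y. u y * partial i (partial i \<phi>) y)"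
       "integrable lborel (\<lambda>y. partial i (partial i u) y * \<phi> y)" for i
    using assms by (auto intro!: test_functions_integrable[OF test_functions_mult] test_functions_partial)
  have "(LINT y|lborel. u y * partial i (partial i \<phi>) y) = (LINT y|lborel. partial i (partial i u) y * \<phi> y)" for i
    using integration_by_parts_test[OF assms(1) test_functions_partial[OF assms(2)], of i i]
       integration_by_parts_test[OF smooth_fun_partial[OF assms(1)] assms(2), of i i] by simp
  then show ?thesis
    using i1 unfolding lap_def by (simp add: sum_distrib_left sum_distrib_right Bochner_Integration.integral_sum)
qed

section \<open>Completeness and density\<close>

text \<open>The geometric rate yields almost-everywhere convergence of the whole sequence and not
  only of a subsequence. This is what allows the L2 limit to be compared later with a pointwise
  limit of the same sequence.\<close>

lemma L2_complete:
  assumes f: "\<And>n. f n \<in> L2"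
    and le: "\<And>n. L2_norm (\<lambda>y. f (Suc n) y - f n y) \<le> C * (1/4) ^ n"
  obtains g where "g \<in> L2" "AE y in lborel. (\<lambda>n. f n y) \<longlonglongrightarrow> g y"
    "(\<lambda>n. L2_norm (\<lambda>y. f n y - g y)) \<longlonglongrightarrow> 0"
proof -
  have [measurable]: "f n \<in> borel_measurable borel" for n using f by (rule L2_measurable)
  have C0: "C \<ge> 0" using order_trans[OF L2_norm_ge_0 le[of 0]] by simp
  \<comment> \<open>The weight \<open>4 ^ n\<close> still leaves integrals of size
    \<open>(1/4) ^ n\<close>, hence a summable series; and where the sum of the \<open>D n y\<close>
    is finite, the increments are bounded by a multiple of \<open>(1/2) ^ n\<close>.\<close>
  define D where "D n y = 4 ^ n * (norm (f (Suc n) y - f n y))\<^sup>2" for n y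
  have D0: "D n y \<ge> 0" for n y by (simp add: D_def)
  have [measurable]: "D n \<in> borel_measurable borel" for n unfolding D_def[abs_def] by measurable
  have Dint: "(\<integral>\<^sup>+ y. ennreal (D n y) \<partial>lborel) \<le> ennreal (C\<^sup>2 * (1/4) ^ n)" for n
  proof -
    have i: "integrable lborel (D n)"
      unfolding D_def[abs_def] by (intro integrable_mult_right L2_integrable L2_diff f)
    have "(\<integral>\<^sup>+ y. ennreal (D n y) \<partial>lborel) = ennreal (LINT y|lborel. D n y)"
      by (intro nn_integral_eq_integral i) (simp add: D0)
    also have "(LINT y|lborel. D n y) = 4 ^ n * (L2_norm (\<lambda>y. f (Suc n) y - f n y))\<^sup>2"
      unfolding D_def[abs_def] by (simp add: L2_norm_sq)
    also have "\<dots> \<le> 4 ^ n * (C * (1/4) ^ n)\<^sup>2"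
      by (intro mult_left_mono power_mono le) auto
    also have "\<dots> = C\<^sup>2 * (1/4) ^ n"
      by (simp add: power_mult_distrib power2_eq_square power_divide)
    finally show ?thesis by (simp add: ennreal_leI)
  qed
  have "(\<integral>\<^sup>+ y. (\<Sum>n. ennreal (D n y)) \<partial>lborel) = (\<Sum>n. \<integral>\<^sup>+ y. ennreal (D n y) \<partial>lborel)"
    by (intro nn_integral_suminf) measurable
  also have "\<dots> \<le> (\<Sum>n. ennreal (C\<^sup>2 * (1/4) ^ n))"
    by (intro suminf_le Dint) auto
  also have "\<dots> = ennreal (\<Sum>n. C\<^sup>2 * (1/4) ^ n)"
    by (intro suminf_ennreal2 summable_mult summable_geometric) auto
  finally have "(\<integral>\<^sup>+ y. (\<Sum>n. ennreal (D n y)) \<partial>lborel) \<noteq> \<infinity>"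
    by (auto simp: top_unique)
  then have "AE y in lborel. (\<Sum>n. ennreal (D n y)) \<noteq> \<infinity>"
    by (intro nn_integral_PInf_AE) measurable
  then have conv: "AE y in lborel. convergent (\<lambda>n. f n y)"
  proof eventually_elim
    fix y assume fin: "(\<Sum>n. ennreal (D n y)) \<noteq> \<infinity>"
    define F where "F = enn2real (\<Sum>n. ennreal (D n y))"
    have "ennreal (D n y) \<le> (\<Sum>n. ennreal (D n y))" for n
      using sum_le_suminf[of "\<lambda>n. ennreal (D n y)" "{n}"] by auto
    then have DF: "D n y \<le> F" for n
      using fin D0[of n y] unfolding F_def by (metis enn2real_ennreal enn2real_mono infinity_ennreal_def less_top)
    have le: "norm (f (Suc n) y - f n y) \<le> sqrt F * (1/2) ^ n" for n
    proof (rule power2_le_imp_le)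
      have "(norm (f (Suc n) y - f n y))\<^sup>2 \<le> F * (1/4) ^ n"
        using DF[of n] by (simp add: D_def field_simps)
      also have "\<dots> = (sqrt F * (1/2) ^ n)\<^sup>2"
      proof -
        have "((1/2::real) ^ n)\<^sup>2 = (1/4) ^ n"
          unfolding power2_eq_square power_mult_distrib[symmetric] by simp
        then show ?thesis using DF[of 0] D0[of 0 y] by (simp add: power_mult_distrib)
      qed
      finally show "(norm (f (Suc n) y - f n y))\<^sup>2 \<le> (sqrt F * (1/2) ^ n)\<^sup>2" .
      show "0 \<le> sqrt F * (1/2) ^ n" using DF[of 0] D0[of 0 y] by simp
    qed
    have "summable (\<lambda>n. sqrt F * (1/2) ^ n)" by (intro summable_mult summable_geometric) simp
    then have "summable (\<lambda>n. f (Suc n) y - f n y)"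
      using le by (rule summable_comparison_test'[of _ 0])
    then have "convergent (\<lambda>n. \<Sum>k<n. f (Suc k) y - f k y)" by (simp add: summable_iff_convergent)
    then have "convergent (\<lambda>n. f n y - f 0 y)" unfolding sum_lessThan_telescope[of "\<lambda>n. f n y"] .
    then have "convergent (\<lambda>n. (f n y - f 0 y) + f 0 y)" by (rule convergent_add[OF _ convergent_const])
    then show "convergent (\<lambda>n. f n y)" by simp
  qed
  define g where "g y = lim (\<lambda>n. f n y)" for y
  have [measurable]: "g \<in> borel_measurable borel"
    unfolding g_def[abs_def] by (rule borel_measurable_lim_metric) simp
  have fg: "AE y in lborel. (\<lambda>n. f n y) \<longlonglongrightarrow> g y"
    using conv by (simp add: g_def convergent_LIMSEQ_iff)
  \<comment> \<open>The factor \<open>1 - (1/4) ^ k\<close> strengthens the claim so that the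
    induction closes: passing to \<open>Suc k\<close> enlarges the right side by more than the new
    increment.\<close>
  have diff: "L2_norm (\<lambda>y. f (n + k) y - f n y) \<le> 2 * C * (1/4) ^ n * (1 - (1/4) ^ k)" for n k
  proof (induction k)
    case 0
    then show ?case by (simp add: L2_norm_def)
  next
    case (Suc k)
    have "L2_norm (\<lambda>y. f (n + Suc k) y - f n y) = L2_norm (\<lambda>y. (f (Suc (n + k)) y - f (n + k) y) + (f (n + k) y - f n y))"
      by simp
    also have "\<dots> \<le> C * (1/4) ^ (n + k) + 2 * C * (1/4) ^ n * (1 - (1/4) ^ k)"
      by (rule order_trans[OF L2_norm_triangle[OF L2_diff[OF f f] L2_diff[OF f f]] add_mono[OF le Suc]])
    also have "\<dots> \<le> 2 * C * (1/4) ^ n * (1 - (1/4) ^ Suc k)"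
    proof -
      have "0 \<le> C * (1/4) ^ n * (1/4) ^ k * (1/2)" using C0 by simp
      then show ?thesis by (simp add: power_add algebra_simps)
    qed
    finally show ?case .
  qed
  \<comment> \<open>Fatou's lemma: the squared distance to the limit is the lower limit of the
    squared distances to \<open>f (n + k)\<close>, which \<open>diff\<close> bounds uniformly in
    \<open>k\<close>.\<close>
  have nn: "(\<integral>\<^sup>+ y. ennreal ((norm (f n y - g y))\<^sup>2) \<partial>lborel) \<le> ennreal ((2 * C * (1/4) ^ n)\<^sup>2)" for n
  proof -
    have "(\<integral>\<^sup>+ y. ennreal ((norm (f n y - g y))\<^sup>2) \<partial>lborel) = (\<integral>\<^sup>+ y. liminf (\<lambda>k. ennreal ((norm (f (n + k) y - f n y))\<^sup>2)) \<partial>lborel)"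
    proof (rule nn_integral_cong_AE, use fg in eventually_elim)
      fix y assume "(\<lambda>n. f n y) \<longlonglongrightarrow> g y"
      then have "(\<lambda>k. f (n + k) y) \<longlonglongrightarrow> g y"
        using LIMSEQ_ignore_initial_segment[of "\<lambda>n. f n y" "g y" n] by (simp add: add.commute)
      then have "(\<lambda>k. ennreal ((norm (f (n + k) y - f n y))\<^sup>2)) \<longlonglongrightarrow> ennreal ((norm (g y - f n y))\<^sup>2)"
        by (intro tendsto_intros tendsto_ennrealI)
      then show "ennreal ((norm (f n y - g y))\<^sup>2) = liminf (\<lambda>k. ennreal ((norm (f (n + k) y - f n y))\<^sup>2))"
        using lim_imp_Liminf[OF sequentially_bot] by (metis norm_minus_commute)
    qed
    also have "\<dots> \<le> liminf (\<lambda>k. \<integral>\<^sup>+ y. ennreal ((norm (f (n + k) y - f n y))\<^sup>2) \<partial>lborel)"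
      by (intro nn_integral_liminf) measurable
    also have "\<dots> \<le> ennreal ((2 * C * (1/4) ^ n)\<^sup>2)"
    proof (rule Liminf_le, simp, rule always_eventually, rule allI)
      fix k
      have "(\<integral>\<^sup>+ y. ennreal ((norm (f (n + k) y - f n y))\<^sup>2) \<partial>lborel) = ennreal ((L2_norm (\<lambda>y. f (n + k) y - f n y))\<^sup>2)"
        unfolding L2_norm_sq by (intro nn_integral_eq_integral L2_integrable L2_diff f) auto
      also have "\<dots> \<le> ennreal ((2 * C * (1/4) ^ n)\<^sup>2)"
      proof (intro ennreal_leI power_mono order_trans[OF diff])
        have "2 * C * (1/4) ^ n * (1 - (1/4) ^ k) \<le> 2 * C * (1/4) ^ n * 1"
          using C0 by (intro mult_left_mono) auto
        then show "2 * C * (1/4) ^ n * (1 - (1/4) ^ k) \<le> 2 * C * (1/4) ^ n" by simp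
      qed auto
      finally show "(\<integral>\<^sup>+ y. ennreal ((norm (f (n + k) y - f n y))\<^sup>2) \<partial>lborel) \<le> ennreal ((2 * C * (1/4) ^ n)\<^sup>2)" .
    qed
    finally show ?thesis .
  qed
  have fgL2: "(\<lambda>y. f n y - g y) \<in> L2" for n
  proof (rule L2I)
    show "(\<lambda>y. f n y - g y) \<in> borel_measurable borel" by measurable
    show "integrable lborel (\<lambda>y. (norm (f n y - g y))\<^sup>2)"
      by (intro integrableI_bounded) (use nn[of n] in \<open>auto simp: less_top[symmetric] top_unique\<close>)
  qed
  have gL2: "g \<in> L2" using L2_diff[OF f fgL2, of 0 0] by simp
  have bnd: "L2_norm (\<lambda>y. f n y - g y) \<le> 2 * C * (1/4) ^ n" for n
  proof (rule power2_le_imp_le)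
    have "ennreal ((L2_norm (\<lambda>y. f n y - g y))\<^sup>2) = (\<integral>\<^sup>+ y. ennreal ((norm (f n y - g y))\<^sup>2) \<partial>lborel)"
      unfolding L2_norm_sq by (intro nn_integral_eq_integral[symmetric] L2_integrable fgL2) auto
    with nn[of n] have "ennreal ((L2_norm (\<lambda>y. f n y - g y))\<^sup>2) \<le> ennreal ((2 * C * (1/4) ^ n)\<^sup>2)" by simp
    then show "(L2_norm (\<lambda>y. f n y - g y))\<^sup>2 \<le> (2 * C * (1/4) ^ n)\<^sup>2"
      by (subst (asm) ennreal_le_iff) auto
    show "0 \<le> 2 * C * (1/4) ^ n" using C0 by simp
  qed
  have "(\<lambda>n. L2_norm (\<lambda>y. f n y - g y)) \<longlonglongrightarrow> 0"
  proof (rule tendsto_sandwich[OF _ _ tendsto_const])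
    show "(\<lambda>n. 2 * C * (1/4) ^ n) \<longlonglongrightarrow> 0"
      using tendsto_mult[OF tendsto_const[of "2 * C"] LIMSEQ_power_zero[of "1/4::real"]] by simp
  qed (use bnd in auto)
  then show ?thesis using that gL2 fg by blast
qed

lemma L2_dominated_convergence:
  assumes "\<And>n. f n \<in> borel_measurable borel" "g \<in> borel_measurable borel"
    and G: "integrable lborel (\<lambda>y. (G y)\<^sup>2)" "\<And>n y. norm (f n y) \<le> G y"
    and lim: "\<And>y. (\<lambda>n. f n y) \<longlonglongrightarrow> g y"
  shows "\<And>n. f n \<in> L2" "g \<in> L2" "(\<lambda>n. L2_norm (\<lambda>y. g y - f n y)) \<longlonglongrightarrow> 0"
proof -
  have gG: "norm (g y) \<le> G y" for y
    by (rule tendsto_upperbound[OF tendsto_norm[OF lim]]) (auto simp: G)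
  show f: "f n \<in> L2" for n
    by (rule L2_bound[OF _ G(1)]) (auto intro!: assms power_mono)
  show g: "g \<in> L2"
    by (rule L2_bound[OF _ G(1)]) (auto intro!: assms power_mono gG)
  have "(\<lambda>n. LINT y|lborel. (norm (g y - f n y))\<^sup>2) \<longlonglongrightarrow> (LINT y|(lborel::plane measure). 0)"
  proof (rule integral_dominated_convergence)
    show "integrable lborel (\<lambda>y. 4 * (G y)\<^sup>2)" using G(1) by simp
    show "AE y in lborel. (\<lambda>n. (norm (g y - f n y))\<^sup>2) \<longlonglongrightarrow> 0"
    proof (rule AE_I2)
      fix y
      have "(\<lambda>n. (norm (g y - f n y))\<^sup>2) \<longlonglongrightarrow> (norm (g y - g y))\<^sup>2"
        by (intro tendsto_intros lim)
      then show "(\<lambda>n. (norm (g y - f n y))\<^sup>2) \<longlonglongrightarrow> 0" by simp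
    qed
    show "AE y in lborel. norm ((norm (g y - f n y))\<^sup>2) \<le> 4 * (G y)\<^sup>2" for n
    proof (rule AE_I2)
      fix y
      have "norm (g y - f n y) \<le> 2 * G y"
        using norm_triangle_ineq4[of "g y" "f n y"] gG[of y] G(2)[of n y] by linarith
      then have "(norm (g y - f n y))\<^sup>2 \<le> (2 * G y)\<^sup>2" by (intro power_mono) auto
      then show "norm ((norm (g y - f n y))\<^sup>2) \<le> 4 * (G y)\<^sup>2" by (simp add: power_mult_distrib)
    qed
  qed (use assms(1,2) in measurable)
  from tendsto_real_sqrt[OF this] show "(\<lambda>n. L2_norm (\<lambda>y. g y - f n y)) \<longlonglongrightarrow> 0"
    by (simp add: L2_norm_def)
qed

text \<open>Membership in \<open>L2\<close> is part of the property so that it passes through sums,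
  multiples and limits without side conditions in the Dynkin-class argument for indicators.\<close>

definition test_approx :: "(plane \<Rightarrow> complex) \<Rightarrow> bool" where
  "test_approx f \<longleftrightarrow> f \<in> L2 \<and> (\<forall>e>0. \<exists>\<psi>\<in>test_functions UNIV. L2_norm (\<lambda>y. f y - \<psi> y) < e)"

lemma test_approx_test: "\<psi> \<in> test_functions UNIV \<Longrightarrow> test_approx \<psi>"
  unfolding test_approx_def by (auto intro!: test_functions_L2 bexI[of _ \<psi>] simp: L2_norm_def)

lemma test_approx_lim:
  assumes "\<And>n. test_approx (g n)" "f \<in> L2" "(\<lambda>n. L2_norm (\<lambda>y. f y - g n y)) \<longlonglongrightarrow> 0"
  shows "test_approx f"
  unfolding test_approx_def
proof (intro conjI allI impI assms(2))
  fix e :: real assume "e > 0"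
  then have "eventually (\<lambda>n. L2_norm (\<lambda>y. f y - g n y) < e / 2) sequentially"
    using order_tendstoD(2)[OF assms(3), of "e/2"] by simp
  then obtain n where n: "L2_norm (\<lambda>y. f y - g n y) < e / 2" unfolding eventually_sequentially by blast
  obtain \<psi> where \<psi>: "\<psi> \<in> test_functions UNIV" "L2_norm (\<lambda>y. g n y - \<psi> y) < e / 2"
    using assms(1)[of n] \<open>e > 0\<close> unfolding test_approx_def by (meson half_gt_zero)
  have "g n \<in> L2" using assms(1) by (simp add: test_approx_def)
  then have "L2_norm (\<lambda>y. f y - \<psi> y) \<le> L2_norm (\<lambda>y. f y - g n y) + L2_norm (\<lambda>y. g n y - \<psi> y)"
    using L2_norm_triangle[OF L2_diff[OF assms(2)] L2_diff[OF _ test_functions_L2[OF \<psi>(1)]], of "g n" "g n"] by simp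
  then show "\<exists>\<psi>\<in>test_functions UNIV. L2_norm (\<lambda>y. f y - \<psi> y) < e" using n \<psi> by (intro bexI[of _ \<psi>]) auto
qed

lemma test_approx_add:
  assumes "test_approx f" "test_approx g" shows "test_approx (\<lambda>y. f y + g y)"
  unfolding test_approx_def
proof (intro conjI allI impI)
  have L: "f \<in> L2" "g \<in> L2" using assms by (auto simp: test_approx_def)
  then show "(\<lambda>y. f y + g y) \<in> L2" by (rule L2_add)
  fix e :: real assume "e > 0"
  then obtain \<phi> \<psi> where *: "\<phi> \<in> test_functions UNIV" "L2_norm (\<lambda>y. f y - \<phi> y) < e / 2"
      "\<psi> \<in> test_functions UNIV" "L2_norm (\<lambda>y. g y - \<psi> y) < e / 2"
    using assms unfolding test_approx_def by (meson half_gt_zero)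
  have "L2_norm (\<lambda>y. (f y + g y) - (\<phi> y + \<psi> y)) \<le> L2_norm (\<lambda>y. f y - \<phi> y) + L2_norm (\<lambda>y. g y - \<psi> y)"
    using L2_norm_triangle[OF L2_diff[OF L(1) test_functions_L2[OF *(1)]] L2_diff[OF L(2) test_functions_L2[OF *(3)]]]
    by (simp add: algebra_simps)
  then show "\<exists>\<psi>\<in>test_functions UNIV. L2_norm (\<lambda>y. (f y + g y) - \<psi> y) < e"
    using * test_functions_add[OF *(1,3)] by (intro bexI[of _ "\<lambda>y. \<phi> y + \<psi> y"]) auto
qed

lemma test_approx_cmult:
  assumes "test_approx f" shows "test_approx (\<lambda>y. c * f y)"
proof (cases "c = 0")
  case True
  then show ?thesis using test_approx_test[OF test_functions_zero] by simp
next
  case False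
  show ?thesis unfolding test_approx_def
  proof (intro conjI allI impI)
    show "(\<lambda>y. c * f y) \<in> L2" using assms by (auto simp: test_approx_def intro: L2_cmult)
    fix e :: real assume "e > 0"
    then obtain \<phi> where *: "\<phi> \<in> test_functions UNIV" "L2_norm (\<lambda>y. f y - \<phi> y) < e / norm c"
      using assms False unfolding test_approx_def by (meson divide_pos_pos zero_less_norm_iff)
    have "L2_norm (\<lambda>y. c * f y - c * \<phi> y) = norm c * L2_norm (\<lambda>y. f y - \<phi> y)"
      by (simp add: L2_norm_cmult flip: right_diff_distrib)
    then show "\<exists>\<psi>\<in>test_functions UNIV. L2_norm (\<lambda>y. c * f y - \<psi> y) < e"
      using * False test_functions_cmult[OF *(1), of c]
      by (intro bexI[of _ "\<lambda>y. c * \<phi> y"]) (auto simp: field_simps)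
  qed
qed

lemma test_approx_sum:
  "(\<And>s. s \<in> S \<Longrightarrow> test_approx (f s)) \<Longrightarrow> test_approx (\<lambda>y. \<Sum>s\<in>S. f s y)"
  by (induction S rule: infinite_finite_induct)
     (auto intro!: test_approx_add test_approx_test[OF test_functions_zero])

lemma test_approx_dominated:
  assumes "\<And>n. test_approx (f n)" "g \<in> borel_measurable borel"
    and "integrable lborel (\<lambda>y. (G y)\<^sup>2)" "\<And>n y. norm (f n y) \<le> G y"
    and "\<And>y. (\<lambda>n. f n y) \<longlonglongrightarrow> g y"
  shows "test_approx g"
proof -
  have m: "f n \<in> borel_measurable borel" for n
    using assms(1) by (auto simp: test_approx_def intro: L2_measurable)
  show ?thesis
    using test_approx_lim[OF assms(1) L2_dominated_convergence(2,3)[OF m assms(2-5)]] by blast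
qed

text \<open>Stretching the argument turns the bump into the indicator of the open half-line, which
  is why the approximation of sets starts from open boxes.\<close>

lemma bump_scaled_tendsto: "(\<lambda>n. bump 1 (real (Suc n) * t)) \<longlonglongrightarrow> indicator {0<..} t"
proof (cases "t > 0")
  case True
  have "(\<lambda>n. exp (- (inverse (real (Suc n)) * (1 / t)))) \<longlonglongrightarrow> exp (- (0 * (1 / t)))"
    by (intro tendsto_intros LIMSEQ_inverse_real_of_nat)
  moreover have "bump 1 (real (Suc n) * t) = exp (- (inverse (real (Suc n)) * (1 / t)))" for n
    using True by (simp add: bump_def field_simps add_pos_nonneg)
  ultimately show ?thesis using True by simp
next
  case False
  then have "real (Suc n) * t \<le> 0" for n by (simp add: mult_nonneg_nonpos)
  then show ?thesis using False by (simp add: not_less)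
qed

lemma mem_box_plane: "y \<in> box a b \<longleftrightarrow> (\<forall>i. a $ i < y $ i \<and> y $ i < b $ i)" for a b y :: plane
  by (rule mem_box_cart(1))

lemma test_approx_box: "test_approx (\<lambda>y. indicator (box a b) y)"
proof (rule test_approx_dominated)
  define \<psi> where "\<psi> n y = (\<Prod>i\<in>UNIV. complex_of_real (bump 1 (real (Suc n) * (y $ i - a $ i))) *
     complex_of_real (bump 1 (real (Suc n) * (b $ i - y $ i))))" for n and y :: plane
  have \<psi>r: "\<psi> n y = complex_of_real (\<Prod>i\<in>UNIV. bump 1 (real (Suc n) * (y $ i - a $ i)) * bump 1 (real (Suc n) * (b $ i - y $ i)))" for n y
    by (simp add: \<psi>_def)
  have zero: "\<psi> n y = 0" if y: "y \<notin> box a b" for n y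
  proof -
    obtain i where "y $ i \<le> a $ i \<or> b $ i \<le> y $ i" using y unfolding mem_box_plane by (meson not_less)
    then have "bump 1 (real (Suc n) * (y $ i - a $ i)) = 0 \<or> bump 1 (real (Suc n) * (b $ i - y $ i)) = 0"
      by (auto simp: mult_nonneg_nonpos)
    then show ?thesis unfolding \<psi>_def by (intro prod_zero) auto
  qed
  have sm: "smooth_fun (\<psi> n)" for n
  proof -
    have "smooth_fun (\<lambda>y. complex_of_real (bump 1 (real (Suc n) * (y $ i - a $ i))))" for i
      by (rule smooth_fun_bump) (simp only: of_real_mult of_real_diff, intro smooth_intros)
    moreover have "smooth_fun (\<lambda>y. complex_of_real (bump 1 (real (Suc n) * (b $ i - y $ i))))" for i
      by (rule smooth_fun_bump) (simp only: of_real_mult of_real_diff, intro smooth_intros)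
    ultimately show ?thesis unfolding \<psi>_def[abs_def] by (intro smooth_intros)
  qed
  have "\<psi> n \<in> test_functions UNIV" for n
    unfolding test_functions_iff using sm zero box_subset_cbox[of a b]
    by (auto intro!: exI[of _ "cbox a b"])
  then show "test_approx (\<psi> n)" for n by (rule test_approx_test)
  show "(\<lambda>y. indicator (box a b) y) \<in> borel_measurable borel" by simp
  have "integrable lborel (\<lambda>y. indicator (cbox a b) y :: real)"
    by (intro integrable_real_indicator emeasure_bounded_finite bounded_cbox) auto
  then show "integrable lborel (\<lambda>y. (indicator (cbox a b) y :: real)\<^sup>2)"
    by (simp add: power2_eq_square flip: indicator_inter_arith)
  show "norm (\<psi> n y) \<le> indicator (cbox a b) y" for n y
  proof (cases "y \<in> box a b")
    case True
    have "norm (\<psi> n y) \<le> 1" unfolding \<psi>r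
      by (simp add: abs_prod abs_mult del: of_real_prod, intro prod_le_1) (auto intro: mult_le_one)
    then show ?thesis using True box_subset_cbox[of a b] by auto
  qed (simp add: zero)
  show "(\<lambda>n. \<psi> n y) \<longlonglongrightarrow> indicator (box a b) y" for y
  proof -
    have "(\<lambda>n. \<psi> n y) \<longlonglongrightarrow> (\<Prod>i\<in>UNIV. complex_of_real (indicator {0<..} (y $ i - a $ i)) *
        complex_of_real (indicator {0<..} (b $ i - y $ i)))"
      unfolding \<psi>_def by (intro tendsto_intros bump_scaled_tendsto)
    moreover have "(\<Prod>i\<in>UNIV. complex_of_real (indicator {0<..} (y $ i - a $ i)) *
        complex_of_real (indicator {0<..} (b $ i - y $ i))) = indicator (box a b) y"
      by (auto simp: indicator_def mem_box_plane prod_zero_iff)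
    ultimately show ?thesis by simp
  qed
qed

text \<open>Open boxes form an intersection-stable generator, so complements and disjoint unions
  suffice. Intersecting with one fixed box throughout keeps every indicator square integrable and
  turns complements into differences.\<close>

lemma test_approx_indicator:
  assumes "A \<in> sets borel"
  shows "test_approx (\<lambda>y. indicator (A \<inter> box a b) y)"
proof -
  let ?G = "range (\<lambda>(a, b). box a b) :: plane set set"
  have "A \<in> sigma_sets UNIV ?G" using assms by (simp add: borel_eq_box)
  have "Int_stable ?G" "?G \<subseteq> Pow UNIV" by (auto simp: Int_stable_def box_Int_box)
  from this \<open>A \<in> sigma_sets UNIV ?G\<close> show ?thesis
  proof (induction rule: sigma_sets_induct_disjoint)
    case (basic A)
    then show ?case using test_approx_box by (auto simp: box_Int_box)
  next
    case empty
    then show ?case using test_approx_test[OF test_functions_zero] by simp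
  next
    case (compl A)
    have "(\<lambda>y. indicator ((UNIV - A) \<inter> box a b) y :: complex) = (\<lambda>y. indicator (box a b) y + -1 * indicator (A \<inter> box a b) y)"
      by (auto simp: indicator_def)
    then show ?case using test_approx_add[OF test_approx_box test_approx_cmult[OF compl(2)]] by metis
  next
    case (union A)
    have A: "A i \<in> sets borel" for i using union by (auto simp: borel_eq_box)
    show ?case
    proof (rule test_approx_dominated)
      show "test_approx (\<lambda>y. \<Sum>k<n. indicator (A k \<inter> box a b) y)" for n
        by (intro test_approx_sum union)
      show "(\<lambda>y. indicator (\<Union> (range A) \<inter> box a b) y) \<in> borel_measurable borel" using A by measurable
      have "integrable lborel (\<lambda>y. indicator (cbox a b) y :: real)"
        by (intro integrable_real_indicator emeasure_bounded_finite bounded_cbox) auto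
      then show "integrable lborel (\<lambda>y. (indicator (cbox a b) y :: real)\<^sup>2)"
        by (simp add: power2_eq_square flip: indicator_inter_arith)
      have disj: "disjoint_family (\<lambda>k. A k \<inter> box a b)" using union(1) by (auto simp: disjoint_family_on_def)
      have eq: "(\<Sum>k<n. indicator (A k \<inter> box a b) y) = (indicator (\<Union>k<n. A k \<inter> box a b) y :: complex)" for n y
        by (rule indicator_UN_disjoint[symmetric]) (use disj in \<open>auto simp: disjoint_family_on_def\<close>)
      show "norm (\<Sum>k<n. indicator (A k \<inter> box a b) y :: complex) \<le> indicator (cbox a b) y" for n y
        unfolding eq using box_subset_cbox[of a b] by (auto simp: indicator_def)
      show "(\<lambda>n. \<Sum>k<n. indicator (A k \<inter> box a b) y :: complex) \<longlonglongrightarrow> indicator (\<Union> (range A) \<inter> box a b) y" for y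
      proof -
        have "(\<lambda>n. indicator (\<Union>k<n. A k \<inter> box a b) y :: complex) \<longlonglongrightarrow> indicator (\<Union>k. A k \<inter> box a b) y"
          by (rule LIMSEQ_indicator_UN)
        then show ?thesis by (simp add: eq)
      qed
    qed
  qed
qed

lemma test_functions_dense:
  assumes h: "h \<in> L2" shows "test_approx h"
proof -
  have hm: "h \<in> borel_measurable borel" using h by (rule L2_measurable)
  obtain F where F: "\<And>i. simple_function borel (F i)" "\<And>y. (\<lambda>i. F i y) \<longlonglongrightarrow> h y"
      "\<And>i y. dist (F i y) 0 \<le> 2 * dist (h y) 0"
    using borel_measurable_implies_sequence_metric[OF hm, of 0] by (auto simp: space_borel)
  \<comment> \<open>Growing boxes: \<open>test_approx_indicator\<close> treats pieces inside a box,
    so the simple functions are truncated while they converge.\<close>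
  let ?B = "\<lambda>n::nat. box (- (real n *\<^sub>R One)) (real n *\<^sub>R One) :: plane set"
  show ?thesis
  proof (rule test_approx_dominated[OF _ hm])
    fix n
    have fin: "finite (range (F n))" using F(1)[of n] by (auto simp: simple_function_def)
    have "F n -` {c} \<in> sets borel" for c
      using simple_functionD(2)[OF F(1)[of n], of "{c}"] by (simp add: space_borel)
    then have "test_approx (\<lambda>y. \<Sum>c\<in>range (F n). c * indicator (F n -` {c} \<inter> ?B n) y)"
      by (intro test_approx_sum test_approx_cmult test_approx_indicator)
    moreover have "(\<Sum>c\<in>range (F n). c * indicator (F n -` {c} \<inter> ?B n) y) = F n y * indicator (?B n) y" for y
    proof -
      have "(\<Sum>c\<in>range (F n). c * indicator (F n -` {c} \<inter> ?B n) y) = (\<Sum>c\<in>range (F n). if c = F n y then F n y * indicator (?B n) y else 0)"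
        by (intro sum.cong) (auto simp: indicator_def)
      also have "\<dots> = F n y * indicator (?B n) y" using fin by (subst sum.delta) auto
      finally show ?thesis .
    qed
    ultimately show "test_approx (\<lambda>y. F n y * indicator (?B n) y)" by simp
  next
    show "integrable lborel (\<lambda>y. (2 * norm (h y))\<^sup>2)" using L2_integrable[OF h] by (simp add: power_mult_distrib)
    show "norm (F n y * indicator (?B n) y) \<le> 2 * norm (h y)" for n y
      using F(3)[of n y] by (auto simp: indicator_def)
    show "(\<lambda>n. F n y * indicator (?B n) y) \<longlonglongrightarrow> h y" for y
    proof -
      obtain N where "y \<in> ?B N" using UN_box_eq_UNIV by blast
      then have "y \<in> ?B n" if "n \<ge> N" for n
        using that by (fastforce simp: box_def)
      then have "eventually (\<lambda>n. F n y = F n y * indicator (?B n) y) sequentially"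
        unfolding eventually_sequentially by (intro exI[of _ N]) simp
      then show ?thesis by (rule Lim_transform_eventually[OF F(2)])
    qed
  qed
qed

text \<open>The pairing is bilinear, so it is the conjugate of \<open>u\<close> that is approximated
  by test functions; the squared norm of \<open>u\<close> then equals the pairing of
  \<open>u\<close> with the approximation error alone.\<close>

lemma L2_eq_0_if_orthogonal:
  assumes u: "u \<in> L2" and orth: "\<And>\<psi>. \<psi> \<in> test_functions UNIV \<Longrightarrow> (LINT y|lborel. u y * \<psi> y) = 0"
  shows "AE y in lborel. u y = 0"
proof -
  have "L2_norm u * L2_norm u \<le> e * L2_norm u" if "e > 0" for e :: real
  proof -
    obtain \<psi> where \<psi>: "\<psi> \<in> test_functions UNIV" "L2_norm (\<lambda>y. cnj (u y) - \<psi> y) < e"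
      using test_functions_dense[OF L2_cnj[OF u]] \<open>e > 0\<close> unfolding test_approx_def by blast
    note L = L2_cnj[OF u] test_functions_L2[OF \<psi>(1)]
    have "complex_of_real ((L2_norm u)\<^sup>2) = (LINT y|lborel. u y * cnj (u y))"
      unfolding L2_norm_sq complex_norm_square[symmetric] by (rule integral_complex_of_real[symmetric])
    also have "\<dots> = (LINT y|lborel. u y * (cnj (u y) - \<psi> y)) + (LINT y|lborel. u y * \<psi> y)"
      using L2_mult_integrable[OF u L2_diff[OF L]] L2_mult_integrable[OF u L(2)]
      by (subst Bochner_Integration.integral_add[symmetric]) (auto simp: algebra_simps)
    also have "\<dots> = (LINT y|lborel. u y * (cnj (u y) - \<psi> y))" using orth[OF \<psi>(1)] by simp
    finally have "(L2_norm u)\<^sup>2 = norm (LINT y|lborel. u y * (cnj (u y) - \<psi> y))"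
      by (metis norm_of_real abs_of_nonneg zero_le_power2)
    also have "\<dots> \<le> L2_norm u * e"
      using L2_Cauchy_Schwarz[OF u L2_diff[OF L]] \<psi>(2) mult_left_mono[OF less_imp_le[OF \<psi>(2)] L2_norm_ge_0[of u]]
      by linarith
    finally show ?thesis by (simp add: power2_eq_square mult.commute)
  qed
  then have "L2_norm u \<le> e" if "e > 0" for e
    using that L2_norm_ge_0[of u] mult_right_le_imp_le[of "L2_norm u" "L2_norm u" e] less_imp_le
    by (cases "L2_norm u = 0") auto
  then have "L2_norm u = 0" using L2_norm_ge_0[of u] by (metis field_le_epsilon add_0 antisym)
  then show ?thesis by (rule L2_norm_eq_0_imp_AE[OF u])
qed

section \<open>Radial integrals\<close>

text \<open>The disc of squared radius \<open>s\<close> has area \<open>pi * s\<close>, so in the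
  squared radius the image of planar Lebesgue measure has constant density. This takes the place of
  polar coordinates and is one reason for writing radial functions in the squared distance.\<close>

lemma distr_norm_sq_plane:
  "distr lborel borel (\<lambda>y::plane. (norm y)\<^sup>2) = density lborel (\<lambda>s. ennreal (pi * indicator {0..} s))"
    (is "?N = ?D")
proof (rule measure_eqI_generator_eq)
  let ?E = "range (atMost :: real \<Rightarrow> real set)"
  show "Int_stable ?E" by (auto simp: Int_stable_def)
  show "?E \<subseteq> Pow UNIV" by simp
  show "sets ?N = sigma_sets UNIV ?E" "sets ?D = sigma_sets UNIV ?E"
    by (simp_all add: borel_eq_atMost)
  show "range (\<lambda>n::nat. {..real n}) \<subseteq> ?E" by auto
  show "(\<Union>n::nat. {..real n}) = UNIV" using real_arch_simple by auto
  have N: "emeasure ?N {..s} = (if s \<ge> 0 then ennreal (pi * s) else 0)" for s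
  proof -
    have "emeasure ?N {..s} = emeasure lborel ((\<lambda>y::plane. (norm y)\<^sup>2) -` {..s})"
      by (subst emeasure_distr) auto
    also have "(\<lambda>y::plane. (norm y)\<^sup>2) -` {..s} = (if s \<ge> 0 then cball 0 (sqrt s) else {})"
      using real_le_rsqrt real_sqrt_le_iff by (auto simp: real_le_rsqrt sqrt_le_D intro: order_trans[OF zero_le_power2])
         (metis norm_ge_zero real_sqrt_le_iff real_sqrt_pow2 real_sqrt_power sqrt_le_D)
    also have "emeasure lborel \<dots> = (if s \<ge> 0 then ennreal (pi * s) else 0)"
      by (auto simp: emeasure_cball unit_ball_vol_2 mult.commute)
    finally show ?thesis .
  qed
  have D: "emeasure ?D {..s} = (if s \<ge> 0 then ennreal (pi * s) else 0)" for s
  proof -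
    have "emeasure ?D {..s} = (\<integral>\<^sup>+ t. ennreal pi * indicator {0..s} t \<partial>lborel)"
      by (subst emeasure_density) (auto intro!: nn_integral_cong simp: indicator_def)
    also have "\<dots> = ennreal pi * emeasure lborel {0..s}" by (simp add: nn_integral_cmult_indicator)
    finally show ?thesis by (auto simp: ennreal_mult')
  qed
  show "emeasure ?N X = emeasure ?D X" if "X \<in> ?E" for X using that N D by auto
  show "emeasure ?N {..real n} \<noteq> \<infinity>" for n by (simp add: N)
qed

lemma radial_integral:
  fixes h :: "real \<Rightarrow> 'b::{banach, second_countable_topology}"
  assumes [measurable]: "h \<in> borel_measurable borel"
  shows "integrable lborel (\<lambda>y::plane. h ((norm y)\<^sup>2)) \<longleftrightarrow> set_integrable lborel {0..} h"
    and "(LINT y|lborel. h ((norm (y::plane))\<^sup>2)) = pi *\<^sub>R (LINT s:{0..}|lborel. h s)"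
proof -
  have "integrable lborel (\<lambda>y::plane. h ((norm y)\<^sup>2)) \<longleftrightarrow> integrable (distr lborel borel (\<lambda>y::plane. (norm y)\<^sup>2)) h"
    by (rule integrable_distr_eq[symmetric]) auto
  also have "\<dots> \<longleftrightarrow> integrable lborel (\<lambda>s. (pi * indicator {0..} s) *\<^sub>R h s)"
    unfolding distr_norm_sq_plane by (rule integrable_density) auto
  also have "(\<lambda>s. (pi * indicator {0..} s) *\<^sub>R h s) = (\<lambda>s. pi *\<^sub>R (indicator {0..} s *\<^sub>R h s))" by simp
  finally show "integrable lborel (\<lambda>y::plane. h ((norm y)\<^sup>2)) \<longleftrightarrow> set_integrable lborel {0..} h"
    using integrable_scaleR_right[of pi lborel "\<lambda>s. indicator {0..} s *\<^sub>R h s"]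
      integrable_scaleR_right[of "1 / pi" lborel "\<lambda>s. pi *\<^sub>R (indicator {0..} s *\<^sub>R h s)"]
    by (auto simp: set_integrable_def)
  have "(LINT y|lborel. h ((norm (y::plane))\<^sup>2)) = (LINT s|distr lborel borel (\<lambda>y::plane. (norm y)\<^sup>2). h s)"
    by (rule integral_distr[symmetric]) auto
  also have "\<dots> = (LINT s|lborel. (pi * indicator {0..} s) *\<^sub>R h s)"
    unfolding distr_norm_sq_plane by (rule integral_density) auto
  finally show "(LINT y|lborel. h ((norm (y::plane))\<^sup>2)) = pi *\<^sub>R (LINT s:{0..}|lborel. h s)"
    by (simp add: set_lebesgue_integral_def flip: scaleR_scaleR)
qed

text \<open>The common majorant for the estimates of the fundamental solution: the singularity at
  zero has order \<open>- 1 / 2\<close>, the decay has order \<open>- 3 / 2\<close>, and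
  \<open>2 * arctan (sqrt s)\<close> is a primitive.\<close>

lemma integrable_inverse_sqrt_mult:
  "set_integrable lborel {0..} (\<lambda>s. 1 / (sqrt s * (1 + s)))"
proof -
  have "set_integrable lborel (einterval (ereal 0) \<infinity>) (\<lambda>s. 1 / (sqrt s * (1 + s)))"
  proof (rule interval_integral_FTC_nonneg(1)[where F = "\<lambda>s. 2 * arctan (sqrt s)" and A = 0 and B = pi])
    fix s :: real assume "ereal 0 < ereal s" "ereal s < \<infinity>"
    then have s: "s > 0" by simp
    show "DERIV (\<lambda>s. 2 * arctan (sqrt s)) s :> 1 / (sqrt s * (1 + s))"
    proof (rule DERIV_cong)
      show "DERIV (\<lambda>s. 2 * arctan (sqrt s)) s :> 2 * (inverse (1 + (sqrt s)\<^sup>2) * (inverse (sqrt s) / 2))"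
        using s by (intro DERIV_cmult DERIV_chain2[OF DERIV_arctan DERIV_real_sqrt])
      show "2 * (inverse (1 + (sqrt s)\<^sup>2) * (inverse (sqrt s) / 2)) = 1 / (sqrt s * (1 + s))"
        using s by (simp add: inverse_eq_divide)
    qed
    show "isCont (\<lambda>s. 1 / (sqrt s * (1 + s))) s" using s by (intro continuous_intros) auto
  next
    show "AE s in lborel. ereal 0 < ereal s \<longrightarrow> ereal s < \<infinity> \<longrightarrow> 0 \<le> 1 / (sqrt s * (1 + s))" by auto
    have "((\<lambda>s. 2 * arctan (sqrt s)) \<longlongrightarrow> 2 * arctan (sqrt 0)) (at_right 0)" by (intro tendsto_intros)
    then show "(((\<lambda>s. 2 * arctan (sqrt s)) \<circ> real_of_ereal) \<longlongrightarrow> 0) (at_right (ereal 0))"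
      by (simp add: ereal_tendsto_simps)
    have "((\<lambda>s. 2 * arctan (sqrt s)) \<longlongrightarrow> 2 * (pi / 2)) at_top"
      by (intro tendsto_intros filterlim_compose[OF tendsto_arctan_at_top sqrt_at_top])
    then show "(((\<lambda>s. 2 * arctan (sqrt s)) \<circ> real_of_ereal) \<longlongrightarrow> pi) (at_left \<infinity>)"
      by (simp add: ereal_tendsto_simps)
  qed simp
  moreover have "einterval (ereal 0) \<infinity> = {0<..}" by (auto simp: einterval_def)
  ultimately have "set_integrable lborel {0<..} (\<lambda>s. 1 / (sqrt s * (1 + s)))" by simp
  then show ?thesis unfolding set_integrable_def
    by (rule integrable_cong_AE_imp) (auto simp: indicator_def intro!: AE_I2)
qed

text \<open>This kernel is the profile of the approximate identity in
  \<open>fundamental_solution\<close>, where its mass fixes the normalisation; it also dominates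
  squares of functions that decay like \<open>1 / (1 + (norm y)\<^sup>2)\<close>.\<close>

lemma plane_integral_inverse_sq:
  "integrable lborel (\<lambda>y::plane. 1 / (1 + (norm y)\<^sup>2)\<^sup>2)"
  "(LINT y|lborel. 1 / (1 + (norm (y::plane))\<^sup>2)\<^sup>2) = pi"
proof -
  let ?f = "\<lambda>s::real. 1 / (1 + s)\<^sup>2"
  have "(\<integral>\<^sup>+x. ennreal (?f x) * indicator {0..} x \<partial>lborel) = ennreal (0 - (- 1 / (1 + 0)))"
  proof (rule nn_integral_FTC_atLeast)
    show "DERIV (\<lambda>s. - 1 / (1 + s)) s :> ?f s" if "0 \<le> s" for s
      using that by (auto intro!: derivative_eq_intros simp: field_simps power2_eq_square)
    have "filterlim (\<lambda>s::real. 1 + s) at_infinity at_top"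
      by (intro filterlim_at_top_imp_at_infinity filterlim_tendsto_add_at_top[OF tendsto_const filterlim_ident])
    then show "((\<lambda>s::real. - 1 / (1 + s)) \<longlongrightarrow> 0) at_top"
      by (intro tendsto_divide_0[OF tendsto_const])
  qed auto
  then have nn: "(\<integral>\<^sup>+x. ennreal (indicator {0..} x * ?f x) \<partial>lborel) = 1"
    by (subst (asm) nn_integral_cong[of _ _ "\<lambda>x. ennreal (indicator {0..} x * ?f x)"]) (auto simp: indicator_def)
  have hb: "has_bochner_integral lborel (\<lambda>x. indicator {0..} x * ?f x) 1"
    by (rule has_bochner_integral_nn_integral) (use nn in \<open>auto simp: indicator_def\<close>)
  then show "integrable lborel (\<lambda>y::plane. 1 / (1 + (norm y)\<^sup>2)\<^sup>2)"
    by (subst radial_integral(1)[of ?f]) (auto simp: set_integrable_def has_bochner_integral_iff)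
  show "(LINT y|lborel. 1 / (1 + (norm (y::plane))\<^sup>2)\<^sup>2) = pi"
    using hb by (subst radial_integral(2)[of ?f]) (auto simp: set_lebesgue_integral_def has_bochner_integral_iff)
qed

section \<open>The logarithmic solution of the modified Bessel equation\<close>

text \<open>At \<open>u = w\<^sup>2 / 4\<close> the first series is the modified Bessel function
  \<open>I\<^sub>0 w\<close> and the second is the harmonic-number series in the classical expansion
  of \<open>K\<^sub>0 w\<close>. In the variable \<open>u\<close> both are entire; the remaining
  four are their first and second derivatives.\<close>

definition serI :: "complex \<Rightarrow> complex" where "serI u = (\<Sum>k. 1 / (fact k)\<^sup>2 * u ^ k)"
definition serT :: "complex \<Rightarrow> complex" where "serT u = (\<Sum>k. harm k / (fact k)\<^sup>2 * u ^ k)"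
definition dserI :: "complex \<Rightarrow> complex" where "dserI u = (\<Sum>k. diffs (\<lambda>k. 1 / (fact k)\<^sup>2) k * u ^ k)"
definition dserT :: "complex \<Rightarrow> complex" where "dserT u = (\<Sum>k. diffs (\<lambda>k. harm k / (fact k)\<^sup>2) k * u ^ k)"
definition ddserI :: "complex \<Rightarrow> complex" where "ddserI u = (\<Sum>k. diffs (diffs (\<lambda>k. 1 / (fact k)\<^sup>2)) k * u ^ k)"
definition ddserT :: "complex \<Rightarrow> complex" where "ddserT u = (\<Sum>k. diffs (diffs (\<lambda>k. harm k / (fact k)\<^sup>2)) k * u ^ k)"

lemma summable_serT: "summable (\<lambda>k. harm k / (fact k)\<^sup>2 * (u::complex) ^ k)"
proof (rule summable_comparison_test')
  show "summable (\<lambda>k. norm u ^ k / fact k)" using summable_exp[of "norm u"] by (simp add: field_simps)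
  fix k :: nat
  have "harm k \<le> real k"
  proof (induction k)
    case (Suc k)
    have "inverse (real (Suc k)) \<le> 1" by (simp add: inverse_le_1_iff)
    with Suc show ?case by (simp add: harm_Suc)
  qed (simp add: harm_def)
  also have "real k \<le> fact k" using fact_ge_self[of k] by (metis of_nat_fact of_nat_le_iff)
  finally have h: "harm k \<le> (fact k :: real)" .
  have "norm (harm k / (fact k)\<^sup>2 * u ^ k) = harm k * (norm u ^ k / (fact k)\<^sup>2)"
    by (simp add: norm_mult norm_divide norm_power norm_harm)
  also have "\<dots> \<le> fact k * (norm u ^ k / (fact k)\<^sup>2)" by (intro mult_right_mono h) auto
  also have "\<dots> = norm u ^ k / fact k" by (simp add: power2_eq_square)
  finally show "norm (harm k / (fact k)\<^sup>2 * u ^ k) \<le> norm u ^ k / fact k" .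
qed

lemma summable_serI: "summable (\<lambda>k. 1 / (fact k)\<^sup>2 * (u::complex) ^ k)"
proof (rule summable_comparison_test')
  show "summable (\<lambda>k. norm u ^ k / fact k)" using summable_exp[of "norm u"] by (simp add: field_simps)
  fix k :: nat
  have "norm (1 / (fact k)\<^sup>2 * u ^ k) = 1 * (norm u ^ k / (fact k)\<^sup>2)"
    by (simp add: norm_mult norm_divide norm_power)
  also have "\<dots> \<le> fact k * (norm u ^ k / (fact k)\<^sup>2)" by (intro mult_right_mono fact_ge_1) auto
  also have "\<dots> = norm u ^ k / fact k" by (simp add: power2_eq_square)
  finally show "norm (1 / (fact k)\<^sup>2 * u ^ k) \<le> norm u ^ k / fact k" .
qed

text \<open>The third claim holds because the Bessel operator \<open>u D\<^sup>2 + D\<close> sends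
  \<open>u ^ Suc k\<close> to \<open>(Suc k)\<^sup>2 * u ^ k\<close>. Differential equations for
  such series thereby become comparisons of coefficients.\<close>

lemma power_series_second_order:
  fixes a :: "nat \<Rightarrow> complex"
  assumes a: "\<And>u. summable (\<lambda>k. a k * u ^ k)"
  shows "((\<lambda>u. \<Sum>k. a k * u ^ k) has_field_derivative (\<Sum>k. diffs a k * u ^ k)) (at u)"
    and "((\<lambda>u. \<Sum>k. diffs a k * u ^ k) has_field_derivative (\<Sum>k. diffs (diffs a) k * u ^ k)) (at u)"
    and "(\<lambda>k. (of_nat (Suc k))\<^sup>2 * a (Suc k) * u ^ k) sums (u * (\<Sum>k. diffs (diffs a) k * u ^ k) + (\<Sum>k. diffs a k * u ^ k))"
proof -
  have d: "summable (\<lambda>k. diffs a k * u ^ k)" for u by (rule termdiff_converges_all[OF a])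
  have dd: "summable (\<lambda>k. diffs (diffs a) k * u ^ k)" for u by (rule termdiff_converges_all[OF d])
  show "((\<lambda>u. \<Sum>k. a k * u ^ k) has_field_derivative (\<Sum>k. diffs a k * u ^ k)) (at u)"
    by (rule termdiffs_strong_converges_everywhere[OF a])
  show "((\<lambda>u. \<Sum>k. diffs a k * u ^ k) has_field_derivative (\<Sum>k. diffs (diffs a) k * u ^ k)) (at u)"
    by (rule termdiffs_strong_converges_everywhere[OF d])
  have "(\<lambda>k. u * (diffs (diffs a) k * u ^ k)) sums (u * (\<Sum>k. diffs (diffs a) k * u ^ k))"
    by (intro sums_mult summable_sums dd)
  then have "(\<lambda>k. of_nat (Suc k) * diffs a (Suc k) * u ^ Suc k) sums (u * (\<Sum>k. diffs (diffs a) k * u ^ k))"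
    by (simp add: diffs_def[of "diffs a"] mult_ac)
  then have "(\<lambda>k. of_nat k * diffs a k * u ^ k) sums (u * (\<Sum>k. diffs (diffs a) k * u ^ k))"
    by (subst (asm) sums_Suc_iff) simp
  from sums_add[OF this summable_sums[OF d[of u]]]
  have "(\<lambda>k. of_nat k * diffs a k * u ^ k + diffs a k * u ^ k) sums (u * (\<Sum>k. diffs (diffs a) k * u ^ k) + (\<Sum>k. diffs a k * u ^ k))" .
  moreover have "of_nat k * diffs a k * u ^ k + diffs a k * u ^ k = (of_nat (Suc k))\<^sup>2 * a (Suc k) * u ^ k" for k
    by (simp add: diffs_def power2_eq_square algebra_simps)
  ultimately show "(\<lambda>k. (of_nat (Suc k))\<^sup>2 * a (Suc k) * u ^ k) sums (u * (\<Sum>k. diffs (diffs a) k * u ^ k) + (\<Sum>k. diffs a k * u ^ k))"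
    by simp
qed

lemma DERIV_serI: "(serI has_field_derivative dserI u) (at u)"
  unfolding serI_def[abs_def] dserI_def by (rule power_series_second_order(1)[OF summable_serI])
lemma DERIV_dserI: "(dserI has_field_derivative ddserI u) (at u)"
  unfolding dserI_def[abs_def] ddserI_def by (rule power_series_second_order(2)[OF summable_serI])
lemma DERIV_serT: "(serT has_field_derivative dserT u) (at u)"
  unfolding serT_def[abs_def] dserT_def by (rule power_series_second_order(1)[OF summable_serT])
lemma DERIV_dserT: "(dserT has_field_derivative ddserT u) (at u)"
  unfolding dserT_def[abs_def] ddserT_def by (rule power_series_second_order(2)[OF summable_serT])

lemma Suc_sq_div_fact_sq: "(of_nat (Suc k))\<^sup>2 / (fact (Suc k))\<^sup>2 = (1 / (fact k)\<^sup>2 :: complex)"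
  by (simp add: power_mult_distrib del: of_nat_Suc)

lemma serI_ode: "u * ddserI u + dserI u = serI u"
proof -
  have "(of_nat (Suc k))\<^sup>2 * (1 / (fact (Suc k))\<^sup>2) * u ^ k = 1 / (fact k)\<^sup>2 * u ^ k" for k
    using Suc_sq_div_fact_sq[of k] by simp
  then have "(\<lambda>k. 1 / (fact k)\<^sup>2 * u ^ k) sums (u * ddserI u + dserI u)"
    using power_series_second_order(3)[OF summable_serI, of u] by (simp only: ddserI_def dserI_def)
  then show ?thesis by (simp add: serI_def sums_iff)
qed

text \<open>The step from \<open>harm k\<close> to \<open>harm (Suc k)\<close> adds
  \<open>1 / Suc k\<close>, and this produces the inhomogeneity \<open>dserI\<close>. In
  \<open>logsol_ode\<close> it cancels exactly the cross term that comes from the product with the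
  logarithm.\<close>

lemma serT_ode: "u * ddserT u + dserT u = serT u + dserI u"
proof -
  have *: "(of_nat (Suc k))\<^sup>2 * (harm (Suc k) / (fact (Suc k))\<^sup>2) * u ^ k
      = harm k / (fact k)\<^sup>2 * u ^ k + diffs (\<lambda>k. 1 / (fact k)\<^sup>2) k * u ^ k" for k
  proof -
    have "(of_nat (Suc k))\<^sup>2 * (harm (Suc k) / (fact (Suc k))\<^sup>2) = ((of_nat (Suc k))\<^sup>2 / (fact (Suc k))\<^sup>2) * (harm (Suc k) :: complex)"
      by simp
    also have "\<dots> = harm k / (fact k)\<^sup>2 + 1 / (of_nat (Suc k) * (fact k)\<^sup>2)"
      unfolding Suc_sq_div_fact_sq by (simp add: harm_Suc field_simps del: of_nat_Suc)
    also have "1 / (of_nat (Suc k) * (fact k)\<^sup>2) = (diffs (\<lambda>k. 1 / (fact k)\<^sup>2) k :: complex)"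
      by (simp add: diffs_def power_mult_distrib power2_eq_square del: of_nat_Suc)
    finally show ?thesis by (simp add: ring_distribs)
  qed
  have "(\<lambda>k. harm k / (fact k)\<^sup>2 * u ^ k + diffs (\<lambda>k. 1 / (fact k)\<^sup>2) k * u ^ k) sums (u * ddserT u + dserT u)"
    using power_series_second_order(3)[OF summable_serT, of u] unfolding ddserT_def dserT_def * .
  moreover have "(\<lambda>k. harm k / (fact k)\<^sup>2 * u ^ k + diffs (\<lambda>k. 1 / (fact k)\<^sup>2) k * u ^ k) sums (serT u + dserI u)"
    unfolding serT_def dserI_def by (intro sums_add summable_sums summable_serT termdiff_converges_all[OF summable_serI])
  ultimately show ?thesis by (rule sums_unique2)
qed

lemma serI_0 [simp]: "serI 0 = 1"
  unfolding serI_def using suminf_finite[of "{0}" "\<lambda>k. 1 / (fact k)\<^sup>2 * (0::complex) ^ k"] by simp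
lemma serT_0 [simp]: "serT 0 = 0"
  unfolding serT_def using suminf_finite[of "{0}" "\<lambda>k. harm k / (fact k)\<^sup>2 * (0::complex) ^ k"] by (simp add: harm_def)

text \<open>In the squared radius \<open>s\<close> the planar Laplacian of a radial function is
  \<open>4 (s F'' + F')\<close>. This is the solution of \<open>s F'' + F' = \<mu> F\<close> that
  behaves like minus the logarithm of the radius; the parameter \<open>c\<close> selects the
  multiple of the regular solution added to it.\<close>

definition logsol :: "complex \<Rightarrow> complex \<Rightarrow> complex \<Rightarrow> complex" where
  "logsol \<mu> c s = - (Ln s / 2 + c) * serI (\<mu> * s) + serT (\<mu> * s)"
definition dlogsol :: "complex \<Rightarrow> complex \<Rightarrow> complex \<Rightarrow> complex" where
  "dlogsol \<mu> c s = - (1 / (2 * s)) * serI (\<mu> * s) - (Ln s / 2 + c) * (\<mu> * dserI (\<mu> * s)) + \<mu> * dserT (\<mu> * s)"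
definition ddlogsol :: "complex \<Rightarrow> complex \<Rightarrow> complex \<Rightarrow> complex" where
  "ddlogsol \<mu> c s = 1 / (2 * s\<^sup>2) * serI (\<mu> * s) - \<mu> / s * dserI (\<mu> * s)
     - (Ln s / 2 + c) * (\<mu>\<^sup>2 * ddserI (\<mu> * s)) + \<mu>\<^sup>2 * ddserT (\<mu> * s)"

lemma DERIV_logsol:
  assumes "s \<notin> \<real>\<^sub>\<le>\<^sub>0"
  shows "(logsol \<mu> c has_field_derivative dlogsol \<mu> c s) (at s)"
proof -
  have "s \<noteq> 0" using assms by auto
  then show ?thesis unfolding logsol_def[abs_def] dlogsol_def
    using assms by (auto intro!: derivative_eq_intros DERIV_chain2[OF DERIV_serI] DERIV_chain2[OF DERIV_serT] simp: field_simps)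
qed

lemma DERIV_dlogsol:
  assumes "s \<notin> \<real>\<^sub>\<le>\<^sub>0"
  shows "(dlogsol \<mu> c has_field_derivative ddlogsol \<mu> c s) (at s)"
proof -
  have "s \<noteq> 0" using assms by auto
  then show ?thesis unfolding dlogsol_def[abs_def] ddlogsol_def
    using assms by (auto intro!: derivative_eq_intros DERIV_chain2[OF DERIV_serI] DERIV_chain2[OF DERIV_dserI]
        DERIV_chain2[OF DERIV_dserT] simp: field_simps power2_eq_square)
qed

lemma logsol_ode:
  assumes "s \<noteq> 0"
  shows "s * ddlogsol \<mu> c s + dlogsol \<mu> c s = \<mu> * logsol \<mu> c s"
proof -
  have "s * ddlogsol \<mu> c s + dlogsol \<mu> c s =
     - \<mu> * dserI (\<mu> * s) - (Ln s / 2 + c) * \<mu> * ((\<mu> * s) * ddserI (\<mu> * s) + dserI (\<mu> * s))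
     + \<mu> * ((\<mu> * s) * ddserT (\<mu> * s) + dserT (\<mu> * s))"
    using assms unfolding ddlogsol_def dlogsol_def by (simp add: field_simps power2_eq_square)
  also have "\<dots> = \<mu> * logsol \<mu> c s"
    unfolding serI_ode serT_ode logsol_def by (simp add: algebra_simps)
  finally show ?thesis .
qed

lemma continuous_series:
  "isCont serI u" "isCont serT u" "isCont dserI u" "isCont dserT u" "isCont ddserI u" "isCont ddserT u"
proof -
  show "isCont serI u" "isCont serT u" "isCont dserI u" "isCont dserT u"
    by (blast intro: DERIV_isCont DERIV_serI DERIV_serT DERIV_dserI DERIV_dserT)+
  have *: "isCont (\<lambda>u. \<Sum>k. diffs (diffs a) k * u ^ k) u" if "\<And>u. summable (\<lambda>k. a k * u ^ k)" for a :: "nat \<Rightarrow> complex"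
    by (rule DERIV_isCont[OF power_series_second_order(2)]) (rule termdiff_converges_all[OF that])
  show "isCont ddserI u" unfolding ddserI_def[abs_def] by (rule *[OF summable_serI])
  show "isCont ddserT u" unfolding ddserT_def[abs_def] by (rule *[OF summable_serT])
qed

lemma tendsto_series_0:
  fixes \<mu> :: complex
  assumes f: "\<And>u. isCont f u"
  shows "((\<lambda>s::real. f (\<mu> * of_real s)) \<longlongrightarrow> f 0) (at_right 0)"
proof -
  have "((\<lambda>s::real. \<mu> * of_real s) \<longlongrightarrow> \<mu> * of_real 0) (at_right 0)" by (intro tendsto_intros)
  then show ?thesis using isCont_tendsto_compose[OF f, of _ 0] by simp
qed

lemma tendsto_mult_ln_0: "((\<lambda>s::real. complex_of_real s * Ln (of_real s)) \<longlongrightarrow> 0) (at_right 0)"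
proof -
  have "((\<lambda>s::real. s * ln s) \<longlongrightarrow> 0) (at_right 0)" by real_asymp
  then have "((\<lambda>s::real. complex_of_real (s * ln s)) \<longlongrightarrow> of_real 0) (at_right 0)" by (rule tendsto_of_real)
  then have "((\<lambda>s::real. complex_of_real (s * ln s)) \<longlongrightarrow> 0) (at_right 0)" by simp
  then show ?thesis
    by (rule Lim_transform_eventually) (auto simp: eventually_at_filter Ln_of_real)
qed

text \<open>The logarithm multiplies \<open>serI - 1\<close>, which is of order \<open>s\<close>, so
  that product vanishes in the limit; \<open>serT\<close> vanishes at zero. What is left of the
  solution is \<open>- Ln s / 2 - c\<close>.\<close>

lemma logsol_tendsto:
  "((\<lambda>s::real. logsol \<mu> c (of_real s) + Ln (of_real s) / 2 + c) \<longlongrightarrow> 0) (at_right 0)"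
proof -
  have I: "((\<lambda>s::real. (serI (\<mu> * of_real s) - 1) / of_real s) \<longlongrightarrow> \<mu> * dserI 0) (at_right 0)"
  proof -
    have "((\<lambda>s. serI (\<mu> * s)) has_field_derivative dserI (\<mu> * 0) * \<mu>) (at 0)"
      by (rule DERIV_chain2[OF DERIV_serI]) (auto intro!: derivative_eq_intros)
    then have "((\<lambda>s. (serI (\<mu> * s) - 1) / s) \<longlongrightarrow> \<mu> * dserI 0) (at 0)" by (simp add: DERIV_def mult.commute)
    moreover have "filterlim (\<lambda>s::real. complex_of_real s) (at 0) (at_right 0)"
    proof -
      have "((\<lambda>s::real. complex_of_real s) \<longlongrightarrow> of_real 0) (at_right 0)" by (intro tendsto_intros)
      then show ?thesis by (auto simp: filterlim_at eventually_at_filter)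
    qed
    ultimately show ?thesis by (rule filterlim_compose)
  qed
  have "((\<lambda>s::real. - ((of_real s * Ln (of_real s)) / 2 + c * of_real s) * ((serI (\<mu> * of_real s) - 1) / of_real s) + serT (\<mu> * of_real s))
      \<longlongrightarrow> - (0 / 2 + c * of_real 0) * (\<mu> * dserI 0) + serT 0) (at_right 0)"
    by (intro tendsto_intros tendsto_mult_ln_0 I tendsto_series_0 continuous_series) simp_all
  then have "((\<lambda>s::real. - ((of_real s * Ln (of_real s)) / 2 + c * of_real s) * ((serI (\<mu> * of_real s) - 1) / of_real s) + serT (\<mu> * of_real s))
      \<longlongrightarrow> 0) (at_right 0)" by simp
  then show ?thesis
    by (rule Lim_transform_eventually) (auto simp: eventually_at_filter logsol_def field_simps)
qed

text \<open>Only the term in which the logarithm is differentiated twice survives the factor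
  \<open>s\<^sup>2\<close>. Its constant becomes the mass of the point source in
  \<open>fundamental_solution\<close>.\<close>

lemma ddlogsol_tendsto:
  "((\<lambda>s::real. (of_real s)\<^sup>2 * ddlogsol \<mu> c (of_real s)) \<longlongrightarrow> 1 / 2) (at_right 0)"
proof -
  have "((\<lambda>s::real. serI (\<mu> * of_real s) / 2 - \<mu> * of_real s * dserI (\<mu> * of_real s)
     - (of_real s * (of_real s * Ln (of_real s)) / 2 + c * (of_real s)\<^sup>2) * (\<mu>\<^sup>2 * ddserI (\<mu> * of_real s)) + (of_real s)\<^sup>2 * \<mu>\<^sup>2 * ddserT (\<mu> * of_real s))
      \<longlongrightarrow> serI 0 / 2 - \<mu> * of_real 0 * dserI 0 - (of_real 0 * 0 / 2 + c * (of_real 0)\<^sup>2) * (\<mu>\<^sup>2 * ddserI 0) + (of_real 0)\<^sup>2 * \<mu>\<^sup>2 * ddserT 0) (at_right 0)"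
    by (intro tendsto_intros tendsto_mult_ln_0 tendsto_series_0 continuous_series) auto
  then have "((\<lambda>s::real. serI (\<mu> * of_real s) / 2 - \<mu> * of_real s * dserI (\<mu> * of_real s)
     - (of_real s * (of_real s * Ln (of_real s)) / 2 + c * (of_real s)\<^sup>2) * (\<mu>\<^sup>2 * ddserI (\<mu> * of_real s)) + (of_real s)\<^sup>2 * \<mu>\<^sup>2 * ddserT (\<mu> * of_real s))
      \<longlongrightarrow> 1 / 2) (at_right 0)" by simp
  then show ?thesis
    by (rule Lim_transform_eventually) (auto simp: eventually_at_filter ddlogsol_def field_simps power2_eq_square)
qed

section \<open>The Macdonald function\<close>

text \<open>Cutting the integral at a natural number gives proper integrals that are entire in
  \<open>w\<close>, so differentiation under the integral is free and the limit can be taken by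
  locally uniform convergence of holomorphic functions.\<close>

definition macK_trunc :: "nat \<Rightarrow> complex \<Rightarrow> complex" where
  "macK_trunc n w = integral {0..real n} (\<lambda>t. exp (- w * of_real (cosh t)))"

definition macK :: "complex \<Rightarrow> complex" where
  "macK w = lim (\<lambda>n. macK_trunc n w)"

text \<open>The quadratic Taylor bound for \<open>exp t\<close> is added to the tangent bound for
  \<open>exp (- t)\<close>. The constant \<open>1 / 4\<close> is not the sharp one, but it suffices
  for \<open>macK_bound\<close>.\<close>

lemma cosh_ge_quadratic: "cosh t \<ge> 1 + t\<^sup>2 / 4" if "t \<ge> 0" for t :: real
  using exp_lower_Taylor_quadratic[OF that] exp_ge_add_one_self[of "-t"]
  by (simp add: cosh_def field_simps)

lemma cosh_ge_self: "cosh t \<ge> t" if "t \<ge> 0" for t :: real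
proof -
  have "0 \<le> (t / 2 - 1)\<^sup>2" by simp
  then have "t \<le> 1 + t\<^sup>2 / 4" by (simp add: power2_eq_square field_simps)
  then show ?thesis using cosh_ge_quadratic[OF that] by simp
qed

lemma cosh_sinh_of_real:
  "cosh (of_real t) = complex_of_real (cosh t)" "sinh (of_real t) = complex_of_real (sinh t)"
  by (simp_all add: cosh_field_def sinh_field_def flip: exp_of_real)

lemma macK_moment_derivative:
  "((\<lambda>w::complex. integral {0..b} (\<lambda>t. of_real (cosh t) ^ k * exp (- w * of_real (cosh t)))) has_field_derivative
     - integral {0..b} (\<lambda>t. of_real (cosh t) ^ Suc k * exp (- w * of_real (cosh t)))) (at w)"
proof -
  have "((\<lambda>w. integral (cbox 0 b) (\<lambda>t. of_real (cosh t) ^ k * exp (- w * of_real (cosh t)))) has_field_derivative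
     integral (cbox 0 b) (\<lambda>t. - (of_real (cosh t) ^ Suc k * exp (- w * of_real (cosh t))))) (at w within UNIV)"
  proof (rule leibniz_rule_field_derivative[where
        f = "\<lambda>(w::complex) (t::real). of_real (cosh t) ^ k * exp (- w * of_real (cosh t))" and
        fx = "\<lambda>(w::complex) (t::real). - (of_real (cosh t) ^ Suc k * exp (- w * of_real (cosh t)))"])
    show "((\<lambda>w. of_real (cosh t) ^ k * exp (- w * of_real (cosh t))) has_field_derivative
        - (of_real (cosh t) ^ Suc k * exp (- w * of_real (cosh t)))) (at w within UNIV)" for w :: complex and t :: real
      by (auto intro!: derivative_eq_intros)
    show "(\<lambda>t. of_real (cosh t) ^ k * exp (- w * of_real (cosh t))) integrable_on cbox 0 b" for w :: complex
      by (intro integrable_continuous continuous_intros)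
    show "continuous_on (UNIV \<times> cbox 0 b) (\<lambda>(w::complex, t::real). - (of_real (cosh t) ^ Suc k * exp (- w * of_real (cosh t))))"
      unfolding split_def by (intro continuous_intros)
  qed auto
  then show ?thesis by simp
qed

lemma macK_trunc_derivs:
  "(macK_trunc n has_field_derivative - integral {0..real n} (\<lambda>t. of_real (cosh t) * exp (- w * of_real (cosh t)))) (at w)"
  "deriv (macK_trunc n) = (\<lambda>w. - integral {0..real n} (\<lambda>t. of_real (cosh t) * exp (- w * of_real (cosh t))))"
  "(deriv ^^ 2) (macK_trunc n) w = integral {0..real n} (\<lambda>t. (of_real (cosh t))\<^sup>2 * exp (- w * of_real (cosh t)))"
proof -
  show d: "(macK_trunc n has_field_derivative - integral {0..real n} (\<lambda>t. of_real (cosh t) * exp (- w * of_real (cosh t)))) (at w)" for w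
    using macK_moment_derivative[of "real n" 0 w] by (simp add: macK_trunc_def[abs_def])
  then show d1: "deriv (macK_trunc n) = (\<lambda>w. - integral {0..real n} (\<lambda>t. of_real (cosh t) * exp (- w * of_real (cosh t))))"
    using DERIV_imp_deriv by blast
  have "((\<lambda>w. - integral {0..real n} (\<lambda>t. of_real (cosh t) * exp (- w * of_real (cosh t)))) has_field_derivative
      integral {0..real n} (\<lambda>t. (of_real (cosh t))\<^sup>2 * exp (- w * of_real (cosh t)))) (at w)"
    using DERIV_minus[OF macK_moment_derivative[of "real n" 1 w]] by (simp add: power2_eq_square)
  then show "(deriv ^^ 2) (macK_trunc n) w = integral {0..real n} (\<lambda>t. (of_real (cosh t))\<^sup>2 * exp (- w * of_real (cosh t)))"
    by (simp add: numeral_2_eq_2 d1 DERIV_imp_deriv)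
qed

text \<open>By \<open>cosh\<^sup>2 - sinh\<^sup>2 = 1\<close> the operator applied to the integrand
  is, up to sign, the derivative in \<open>t\<close> of \<open>sinh t * exp (- w * cosh t)\<close>.
  That primitive vanishes at zero, so only the value at the truncation point remains.\<close>

lemma macK_trunc_ode:
  "w * (deriv ^^ 2) (macK_trunc n) w + deriv (macK_trunc n) w - w * macK_trunc n w
    = - (of_real (sinh (real n)) * exp (- w * of_real (cosh (real n))))"
proof -
  have i: "(\<lambda>t. of_real (cosh t) ^ k * exp (- w * of_real (cosh t))) integrable_on {0..real n}" for k
    by (intro integrable_continuous_interval continuous_intros)
  have "((\<lambda>t. of_real (cosh t) * exp (- w * of_real (cosh t)) - w * (of_real (sinh t))\<^sup>2 * exp (- w * of_real (cosh t)))
      has_integral (of_real (sinh (real n)) * exp (- w * of_real (cosh (real n))) - of_real (sinh 0) * exp (- w * of_real (cosh 0)))) {0..real n}"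
  proof (rule fundamental_theorem_of_calculus)
    fix t :: real
    have "((\<lambda>z. sinh z * exp (- w * cosh z)) has_field_derivative
        cosh (of_real t) * exp (- w * cosh (of_real t)) - w * (sinh (of_real t))\<^sup>2 * exp (- w * cosh (of_real t))) (at (of_real t))"
      by (auto intro!: derivative_eq_intros simp: power2_eq_square algebra_simps)
    from has_vector_derivative_real_field[OF this]
    show "((\<lambda>t. of_real (sinh t) * exp (- w * of_real (cosh t))) has_vector_derivative
        of_real (cosh t) * exp (- w * of_real (cosh t)) - w * (of_real (sinh t))\<^sup>2 * exp (- w * of_real (cosh t))) (at t within {0..real n})"
      by (simp only: cosh_sinh_of_real)
  qed simp
  then have 1: "((\<lambda>t. of_real (cosh t) * exp (- w * of_real (cosh t)) - w * (of_real (sinh t))\<^sup>2 * exp (- w * of_real (cosh t)))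
      has_integral (of_real (sinh (real n)) * exp (- w * of_real (cosh (real n))))) {0..real n}" by simp
  have 2: "of_real (cosh t) * exp (- w * of_real (cosh t)) - w * (of_real (sinh t))\<^sup>2 * exp (- w * of_real (cosh t))
     = of_real (cosh t) * exp (- w * of_real (cosh t)) - w * ((of_real (cosh t))\<^sup>2 * exp (- w * of_real (cosh t))) + w * exp (- w * of_real (cosh t))" for t :: real
  proof -
    have *: "(of_real (sinh t))\<^sup>2 = ((of_real (cosh t))\<^sup>2 - 1 :: complex)"
    proof -
      have "(sinh t)\<^sup>2 = (cosh t)\<^sup>2 - 1" using hyperbolic_pythagoras[of t] by simp
      from arg_cong[OF this, of complex_of_real] show ?thesis by simp
    qed
    show ?thesis unfolding * by (simp add: algebra_simps)
  qed
  define I where "I k = integral {0..real n} (\<lambda>t. of_real (cosh t) ^ k * exp (- w * of_real (cosh t)))" for k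
  have hI: "((\<lambda>t. of_real (cosh t) ^ k * exp (- w * of_real (cosh t))) has_integral I k) {0..real n}" for k
    unfolding I_def using i by (rule integrable_integral)
  have "((\<lambda>t. of_real (cosh t) ^ 1 * exp (- w * of_real (cosh t)) - w * (of_real (cosh t) ^ 2 * exp (- w * of_real (cosh t))) + w * (of_real (cosh t) ^ 0 * exp (- w * of_real (cosh t))))
     has_integral (I 1 - w * I 2 + w * I 0)) {0..real n}"
    by (intro has_integral_add has_integral_diff has_integral_mult_right hI)
  moreover have "I 1 = - deriv (macK_trunc n) w" "I 2 = (deriv ^^ 2) (macK_trunc n) w" "I 0 = macK_trunc n w"
    unfolding macK_trunc_derivs macK_trunc_def I_def by simp_all
  ultimately have "((\<lambda>t. of_real (cosh t) * exp (- w * of_real (cosh t)) - w * ((of_real (cosh t))\<^sup>2 * exp (- w * of_real (cosh t))) + w * exp (- w * of_real (cosh t)))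
     has_integral (- deriv (macK_trunc n) w - w * (deriv ^^ 2) (macK_trunc n) w + w * macK_trunc n w)) {0..real n}"
    by simp
  with 1 2 have "- deriv (macK_trunc n) w - w * (deriv ^^ 2) (macK_trunc n) w + w * macK_trunc n w = of_real (sinh (real n)) * exp (- w * of_real (cosh (real n)))"
    by (simp only: has_integral_unique)
  then show ?thesis by (simp add: algebra_simps)
qed

lemma macK_trunc_diff:
  assumes "Re w \<ge> \<delta>" "\<delta> > 0" "n \<le> m"
  shows "norm (macK_trunc m w - macK_trunc n w) \<le> exp (- \<delta> * real n) / \<delta>"
proof -
  let ?f = "\<lambda>t. exp (- w * of_real (cosh t))"
  have i: "?f integrable_on {a..b}" for a b
    by (intro integrable_continuous_interval continuous_intros)
  have "macK_trunc n w + integral {real n..real m} ?f = macK_trunc m w"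
    unfolding macK_trunc_def by (rule Henstock_Kurzweil_Integration.integral_combine) (use assms i in auto)
  then have "norm (macK_trunc m w - macK_trunc n w) = norm (integral {real n..real m} ?f)" by (metis add_diff_cancel_left')
  also have "\<dots> \<le> integral {real n..real m} (\<lambda>t. exp (- \<delta> * t))"
  proof (rule integral_norm_bound_integral[OF i])
    show "(\<lambda>t. exp (- \<delta> * t)) integrable_on {real n..real m}"
      by (intro integrable_continuous_interval continuous_intros)
    fix t assume "t \<in> {real n..real m}"
    then have "t \<ge> 0" by simp
    then have "\<delta> * t \<le> Re w * cosh t"
      using assms cosh_ge_self by (intro mult_mono) auto
    then show "norm (?f t) \<le> exp (- \<delta> * t)" by (simp add: norm_exp_eq_Re)
  qed
  also have "\<dots> = (- exp (- \<delta> * real m) / \<delta>) - (- exp (- \<delta> * real n) / \<delta>)"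
    by (rule integral_unique, rule fundamental_theorem_of_calculus)
       (use assms in \<open>auto intro!: derivative_eq_intros simp: has_real_derivative_iff_has_vector_derivative[symmetric]\<close>)
  also have "\<dots> \<le> exp (- \<delta> * real n) / \<delta>" using assms by simp
  finally show ?thesis .
qed

lemma tendsto_exp_minus_nat: "(\<lambda>n. exp (- \<delta> * real n) / \<delta>) \<longlonglongrightarrow> 0" if "\<delta> > 0"
  using that by real_asymp

lemma macK_trunc_tendsto:
  assumes "Re w > 0"
  shows "(\<lambda>n. macK_trunc n w) \<longlonglongrightarrow> macK w"
proof -
  have "Cauchy (\<lambda>n. macK_trunc n w)"
  proof (rule metric_CauchyI)
    fix e :: real assume "e > 0"
    then have "eventually (\<lambda>n. exp (- Re w * real n) / Re w < e / 2) sequentially"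
      using order_tendstoD(2)[OF tendsto_exp_minus_nat[OF assms]] half_gt_zero by blast
    then obtain N where N: "exp (- Re w * real N) / Re w < e / 2" unfolding eventually_sequentially by blast
    have *: "dist (macK_trunc m w) (macK_trunc N w) < e / 2" if "m \<ge> N" for m
      unfolding dist_norm by (rule order_le_less_trans[OF macK_trunc_diff[OF order_refl assms that] N])
    show "\<exists>M. \<forall>m\<ge>M. \<forall>n\<ge>M. dist (macK_trunc m w) (macK_trunc n w) < e"
      using * dist_triangle_half_l by blast
  qed
  then show ?thesis unfolding macK_def by (simp add: Cauchy_convergent convergent_LIMSEQ_iff[symmetric])
qed

lemma macK_uniform_limit:
  assumes "\<delta> > 0"
  shows "uniform_limit {w. Re w > \<delta>} macK_trunc macK sequentially"
proof (rule uniform_limitI)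
  fix e :: real assume "e > 0"
  then have "eventually (\<lambda>n. exp (- \<delta> * real n) / \<delta> < e) sequentially"
    using order_tendstoD(2)[OF tendsto_exp_minus_nat[OF assms]] half_gt_zero by blast
  then show "\<forall>\<^sub>F n in sequentially. \<forall>w\<in>{w. Re w > \<delta>}. dist (macK_trunc n w) (macK w) < e"
  proof eventually_elim
    case (elim n)
    show ?case
    proof
      fix w assume "w \<in> {w. Re w > \<delta>}"
      then have w: "Re w \<ge> \<delta>" "Re w > 0" using assms by auto
      have "(\<lambda>m. norm (macK_trunc m w - macK_trunc n w)) \<longlonglongrightarrow> norm (macK w - macK_trunc n w)"
        by (intro tendsto_intros macK_trunc_tendsto w)
      then have "norm (macK w - macK_trunc n w) \<le> exp (- \<delta> * real n) / \<delta>"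
        by (rule tendsto_upperbound[OF _ eventually_sequentiallyI[of n, OF macK_trunc_diff[OF w(1) assms]]]) simp_all
      then show "dist (macK_trunc n w) (macK w) < e" using elim by (simp add: dist_norm norm_minus_commute)
    qed
  qed
qed

lemma macK_trunc_holomorphic: "macK_trunc n holomorphic_on S"
  using macK_trunc_derivs(1) field_differentiable_at_within field_differentiable_def
  unfolding holomorphic_on_def by blast

lemma macK_deriv_tendsto:
  assumes "Re w > 0"
  shows "(\<lambda>n. (deriv ^^ k) (macK_trunc n) w) \<longlonglongrightarrow> (deriv ^^ k) macK w"
proof (rule higher_deriv_complex_uniform_limit)
  show "uniform_limit {u. Re u > Re w / 2} macK_trunc macK sequentially"
    by (rule macK_uniform_limit) (use assms in simp)
  show "open {u. Re u > Re w / 2}" by (rule open_halfspace_Re_gt)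
qed (use assms macK_trunc_holomorphic in auto)

lemma macK_holomorphic: "macK holomorphic_on {w. Re w > 0}"
proof (rule holomorphic_uniform_sequence[of _ macK_trunc])
  show "open {w. Re w > 0}" by (simp add: open_halfspace_Re_gt)
  fix w :: complex assume w: "w \<in> {w. Re w > 0}"
  have sub: "cball w (Re w / 2) \<subseteq> {u. Re u > Re w / 3}"
  proof
    fix u assume "u \<in> cball w (Re w / 2)"
    then have "Re w - Re u \<le> Re w / 2" using complex_Re_le_cmod[of "w - u"] by (simp add: dist_norm)
    moreover have "Re w > 0" using w by simp
    ultimately have "Re u > Re w / 3" by linarith
    then show "u \<in> {u. Re u > Re w / 3}" by simp
  qed
  have "uniform_limit (cball w (Re w / 2)) macK_trunc macK sequentially"
    by (rule uniform_limit_on_subset[OF macK_uniform_limit sub]) (use w in simp)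
  moreover have "cball w (Re w / 2) \<subseteq> {w. Re w > 0}" using sub w by force
  ultimately show "\<exists>d>0. cball w d \<subseteq> {w. Re w > 0} \<and> uniform_limit (cball w d) macK_trunc macK sequentially"
    using w by (intro exI[of _ "Re w / 2"]) auto
qed (rule macK_trunc_holomorphic)

text \<open>Locally uniform convergence carries over to all derivatives, and the boundary term of
  \<open>macK_trunc_ode\<close> disappears because \<open>exp (- Re w * cosh n)\<close> decays
  doubly exponentially.\<close>

lemma macK_ode:
  assumes "Re w > 0"
  shows "w * (deriv ^^ 2) macK w + deriv macK w - w * macK w = 0"
proof -
  have d1: "(\<lambda>n. deriv (macK_trunc n) w) \<longlonglongrightarrow> deriv macK w"
    using macK_deriv_tendsto[OF assms, of 1] by simp
  have "(\<lambda>n. w * (deriv ^^ 2) (macK_trunc n) w + deriv (macK_trunc n) w - w * macK_trunc n w) \<longlonglongrightarrow>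
      w * (deriv ^^ 2) macK w + deriv macK w - w * macK w"
    by (intro tendsto_intros macK_deriv_tendsto macK_trunc_tendsto d1 assms)
  then have 1: "(\<lambda>n. - (of_real (sinh (real n)) * exp (- w * of_real (cosh (real n))))) \<longlonglongrightarrow>
      w * (deriv ^^ 2) macK w + deriv macK w - w * macK w"
    unfolding macK_trunc_ode .
  have "(\<lambda>n. norm (- (of_real (sinh (real n)) * exp (- w * of_real (cosh (real n)))) :: complex)) \<longlonglongrightarrow> 0"
  proof -
    have "(\<lambda>n. sinh (real n) * exp (- Re w * cosh (real n))) \<longlonglongrightarrow> 0"
      unfolding sinh_field_def cosh_field_def using assms by real_asymp
    then show ?thesis by (simp add: norm_mult norm_exp_eq_Re)
  qed
  then have "(\<lambda>n. - (of_real (sinh (real n)) * exp (- w * of_real (cosh (real n))) :: complex)) \<longlonglongrightarrow> 0"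
    by (rule tendsto_norm_zero_cancel)
  then show ?thesis using 1 LIMSEQ_unique by blast
qed

text \<open>After \<open>cosh_ge_quadratic\<close> splits off \<open>exp (- Re w)\<close>, the
  estimate \<open>exp (- q) \<le> 1 / (1 + q)\<close> leaves an integrand with an arctangent as
  primitive. The power \<open>- 1 / 2\<close> overstates the logarithmic singularity at zero but is
  still square integrable in the plane.\<close>

lemma macK_bound:
  assumes "Re w > 0"
  shows "norm (macK w) \<le> pi * exp (- Re w) / sqrt (Re w)"
proof (rule tendsto_upperbound[OF tendsto_norm[OF macK_trunc_tendsto[OF assms]]])
  let ?x = "Re w"
  let ?g = "\<lambda>t. exp (- ?x) * (1 / (1 + (sqrt ?x * t / 2)\<^sup>2))"
  have "norm (macK_trunc n w) \<le> pi * exp (- ?x) / sqrt ?x" for n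
  proof -
    have "norm (macK_trunc n w) \<le> integral {0..real n} ?g"
      unfolding macK_trunc_def
    proof (rule integral_norm_bound_integral)
      show "(\<lambda>t. exp (- w * of_real (cosh t))) integrable_on {0..real n}"
        by (intro integrable_continuous_interval continuous_intros)
      show "?g integrable_on {0..real n}"
        by (intro integrable_continuous_interval continuous_intros) (auto simp: add_nonneg_eq_0_iff)
      fix t assume "t \<in> {0..real n}"
      then have "?x * (1 + t\<^sup>2 / 4) \<le> ?x * cosh t"
        using assms by (intro mult_left_mono cosh_ge_quadratic) auto
      then have "exp (- (?x * cosh t)) \<le> exp (- ?x) * exp (- (?x * t\<^sup>2 / 4))"
        by (simp add: exp_add[symmetric] algebra_simps)
      also have "\<dots> \<le> exp (- ?x) * (1 / (1 + ?x * t\<^sup>2 / 4))"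
      proof (intro mult_left_mono)
        have "1 + ?x * t\<^sup>2 / 4 \<le> exp (?x * t\<^sup>2 / 4)" by (rule exp_ge_add_one_self)
        moreover have "0 \<le> ?x * t\<^sup>2 / 4" using assms by simp
        ultimately show "exp (- (?x * t\<^sup>2 / 4)) \<le> 1 / (1 + ?x * t\<^sup>2 / 4)"
          unfolding exp_minus inverse_eq_divide by (intro divide_left_mono) (auto intro: mult_pos_pos)
      qed simp
      also have "?x * t\<^sup>2 / 4 = (sqrt ?x * t / 2)\<^sup>2" using assms by (simp add: power_mult_distrib power_divide)
      finally show "norm (exp (- w * of_real (cosh t))) \<le> ?g t" by (simp add: norm_exp_eq_Re)
    qed
    also have "\<dots> = exp (- ?x) * (2 / sqrt ?x * arctan (sqrt ?x * real n / 2)) - exp (- ?x) * (2 / sqrt ?x * arctan (sqrt ?x * 0 / 2))"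
    proof (rule integral_unique, rule fundamental_theorem_of_calculus)
      fix t assume "t \<in> {0..real n}"
      have "((\<lambda>t. exp (- ?x) * (2 / sqrt ?x * arctan (sqrt ?x * t / 2))) has_real_derivative
          exp (- ?x) * (2 / sqrt ?x * (inverse (1 + (sqrt ?x * t / 2)\<^sup>2) * (sqrt ?x / 2)))) (at t within {0..real n})"
        by (intro DERIV_cmult DERIV_chain2[OF DERIV_arctan]) (auto intro!: derivative_eq_intros)
      moreover have "exp (- ?x) * (2 / sqrt ?x * (inverse (1 + (sqrt ?x * t / 2)\<^sup>2) * (sqrt ?x / 2))) = ?g t"
      proof -
        have "2 / sqrt ?x * (c * (sqrt ?x / 2)) = c" for c using assms by simp
        then show ?thesis by (simp only: inverse_eq_divide)
      qed
      ultimately show "((\<lambda>t. exp (- ?x) * (2 / sqrt ?x * arctan (sqrt ?x * t / 2))) has_vector_derivative ?g t) (at t within {0..real n})"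
        by (simp only: has_real_derivative_iff_has_vector_derivative)
    qed simp
    also have "\<dots> \<le> exp (- ?x) * (2 / sqrt ?x * (pi / 2))"
      using assms arctan_ubound[of "sqrt ?x * real n / 2"] by (simp add: divide_right_mono)
    finally show ?thesis by (simp add: mult.commute)
  qed
  then show "\<forall>\<^sub>F n in sequentially. norm (macK_trunc n w) \<le> pi * exp (- ?x) / sqrt ?x" by simp
qed simp

section \<open>Small-argument behaviour of the Macdonald function\<close>

text \<open>This is \<open>exp (- t) / t\<close> with the divergent part \<open>1 / t\<close>
  removed on the unit interval, so it stays bounded near zero. At \<open>t = 0\<close> division by
  zero makes the value 0.\<close>

definition exp_cut_kernel :: "real \<Rightarrow> real" where
  "exp_cut_kernel t = (exp (- t) - (if t \<le> 1 then 1 else 0)) / t"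

lemma exp_cut_kernel_bound:
  "t \<ge> 0 \<Longrightarrow> \<bar>exp_cut_kernel t\<bar> \<le> (if t \<in> {0..1} then 1 else 0) + exp (- t)"
  "0 \<le> t \<Longrightarrow> t \<le> 1 \<Longrightarrow> \<bar>exp_cut_kernel t\<bar> \<le> 1"
  "t > 1 \<Longrightarrow> \<bar>exp_cut_kernel t\<bar> \<le> exp (- t)"
proof -
  show 1: "\<bar>exp_cut_kernel t\<bar> \<le> 1" if "0 \<le> t" "t \<le> 1"
  proof (cases "t = 0")
    case False
    have "1 - t \<le> exp (- t)" using exp_ge_add_one_self[of "-t"] by simp
    moreover have "exp (- t) \<le> 1" using that by simp
    ultimately have "\<bar>exp (- t) - 1\<bar> \<le> t" by linarith
    then show ?thesis using that False by (simp add: exp_cut_kernel_def field_simps)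
  qed (simp add: exp_cut_kernel_def)
  show 2: "\<bar>exp_cut_kernel t\<bar> \<le> exp (- t)" if "t > 1"
    using that mult_left_mono[of 1 t "exp (- t)"] by (simp add: exp_cut_kernel_def field_simps)
  show "\<bar>exp_cut_kernel t\<bar> \<le> (if t \<in> {0..1} then 1 else 0) + exp (- t)" if "t \<ge> 0"
  proof (cases "t \<le> 1")
    case True
    have "\<bar>exp_cut_kernel t\<bar> \<le> 1 + exp (- t)" using 1[OF that True] exp_ge_zero[of "-t"] by linarith
    then show ?thesis using True that by simp
  qed (use 2 in simp)
qed

lemma exp_cut_majorant_integrable: "(\<lambda>t::real. (if t \<in> {0..1} then 1 else 0) + exp (- t)) integrable_on {0..}"
proof (rule integrable_add)
  have "((\<lambda>t::real. 1::real) has_integral (1 - 0)) {0..1}"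
    using has_integral_const_real[of "1::real" 0 1] by simp
  then have "((\<lambda>t::real. if t \<in> {0..1} then 1 else 0 :: real) has_integral 1) {0..}"
    by (subst has_integral_restrict) auto
  then show "(\<lambda>t::real. if t \<in> {0..1} then 1 else 0 :: real) integrable_on {0..}" by blast
  show "(\<lambda>t::real. exp (- t)) integrable_on {0..}"
    using has_integral_exp_minus_to_infinity[of 1 0] by auto
qed

text \<open>Both sides of \<open>\<Gamma>(s) - 1 / s = \<integral> t\<^bsup>s\<^esup> exp_cut_kernel t dt\<close> converge as \<open>s \<rightarrow> 0\<close>, the left one to
  \<open>\<Gamma>'(1)\<close>.\<close>

lemma exp_cut_kernel_integral:
  "exp_cut_kernel integrable_on {0..}" "integral {0..} exp_cut_kernel = - euler_mascheroni"
proof -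
  define s where "s n = inverse (real (Suc n))" for n
  have s: "s n > 0" "s n \<le> 1" for n by (auto simp: s_def inverse_le_1_iff)
  define f where "f n t = t powr s n * exp_cut_kernel t" for n t
  have fint: "(f n has_integral (Gamma (s n) - 1 / s n)) {0..}" for n
  proof -
    have "((\<lambda>t. t powr (s n - 1)) has_integral (1 powr (s n - 1 + 1) / (s n - 1 + 1))) {0..1}"
      by (rule has_integral_powr_from_0) (use s[of n] in auto)
    then have "((\<lambda>t. if t \<in> {0..1} then t powr (s n - 1) else 0) has_integral 1 / s n) {0..}"
      by (subst has_integral_restrict) auto
    from has_integral_diff[OF Gamma_integral_real[OF s(1)] this]
    show ?thesis
    proof (rule has_integral_eq[rotated])
      fix t :: real assume "t \<in> {0..}"
      then show "t powr (s n - 1) / exp t - (if t \<in> {0..1} then t powr (s n - 1) else 0) = f n t"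
        by (cases "t = 0") (auto simp: f_def exp_cut_kernel_def powr_diff exp_minus divide_simps algebra_simps)
    qed
  qed
  have conv: "(\<lambda>n. f n t) \<longlonglongrightarrow> exp_cut_kernel t" if "t \<in> {0..}" for t
  proof (cases "t = 0")
    case False
    have "(\<lambda>n. t powr s n) \<longlonglongrightarrow> t powr 0"
      unfolding s_def using False by (intro tendsto_intros LIMSEQ_inverse_real_of_nat) auto
    then have "(\<lambda>n. t powr s n * exp_cut_kernel t) \<longlonglongrightarrow> 1 * exp_cut_kernel t"
      using False by (intro tendsto_intros) auto
    then show ?thesis by (simp add: f_def)
  qed (simp add: f_def exp_cut_kernel_def)
  have bnd: "norm (f n t) \<le> (if t \<in> {0..1} then 1 else 0) + exp (- t)" if "t \<in> {0..}" for n t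
  proof (cases "t \<le> 1")
    case True
    have "t powr s n \<le> 1" using that True s[of n] by (simp add: powr_le1)
    then have "norm (f n t) \<le> 1 * 1"
      unfolding f_def norm_mult using that True exp_cut_kernel_bound(2)[of t] by (intro mult_mono) auto
    then show ?thesis using that True by (simp add: add_increasing2)
  next
    case False
    have "t powr s n \<le> t powr 1" using False s[of n] by (intro powr_mono) auto
    then have "norm (f n t) \<le> t * \<bar>exp_cut_kernel t\<bar>"
      unfolding f_def norm_mult using False by (intro mult_mono) auto
    also have "\<dots> = exp (- t)" using False by (simp add: exp_cut_kernel_def)
    finally show ?thesis using False by simp
  qed
  have fi: "f n integrable_on {0..}" for n using fint by blast
  note dc = dominated_convergence[OF fi exp_cut_majorant_integrable bnd conv]
  show "exp_cut_kernel integrable_on {0..}" by (rule dc(1))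
  have "(\<lambda>n. Gamma (s n) - 1 / s n) \<longlonglongrightarrow> integral {0..} exp_cut_kernel"
    using dc(2) by (simp add: integral_unique[OF fint])
  moreover have "(\<lambda>n. Gamma (s n) - 1 / s n) \<longlonglongrightarrow> - euler_mascheroni"
  proof -
    have "(Gamma has_field_derivative Gamma 1 * Digamma 1) (at (1::real))"
      by (rule has_field_derivative_Gamma) (auto simp: nonpos_Ints_def)
    then have "((\<lambda>h::real. (Gamma (1 + h) - Gamma 1) / h) \<longlongrightarrow> - euler_mascheroni) (at 0)"
      by (simp add: DERIV_def)
    moreover have "filterlim s (at 0) sequentially"
      unfolding filterlim_at using LIMSEQ_inverse_real_of_nat s by (auto simp: s_def[abs_def])
    ultimately have "(\<lambda>n. (Gamma (1 + s n) - Gamma 1) / s n) \<longlonglongrightarrow> - euler_mascheroni"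
      by (rule filterlim_compose)
    \<comment> \<open>The functional equation \<open>Gamma (1 + s) = s * Gamma s\<close> turns the
      difference quotient of \<open>Gamma\<close> at 1 into the moment computed above.\<close>
    moreover have "(Gamma (1 + s n) - Gamma 1) / s n = Gamma (s n) - 1 / s n" for n
      using Gamma_plus1[of "s n"] s(1)[of n] by (auto simp: add.commute field_simps nonpos_Ints_def)
    ultimately show ?thesis by simp
  qed
  ultimately show "integral {0..} exp_cut_kernel = - euler_mascheroni" using LIMSEQ_unique by blast
qed

text \<open>The substitution \<open>u = a * exp t\<close> leads to the integral of
  \<open>exp (- u) / u\<close> from \<open>a\<close> to \<open>b\<close>, where
  \<open>b = a * exp n\<close>. This is \<open>- ln a\<close> plus an integral of
  \<open>exp_cut_kernel\<close>; completing the latter to the half-line costs at most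
  \<open>a\<close> near zero and \<open>exp (- b)\<close> at infinity.\<close>

lemma exp_integral_bound:
  fixes a :: real
  assumes a: "0 < a" "a < 1" and n: "a * exp (real n) > 1"
  shows "\<bar>integral {0..real n} (\<lambda>t. exp (- (a * exp t))) + ln a + euler_mascheroni\<bar> \<le> a + exp (- (a * exp (real n)))"
proof -
  let ?k = exp_cut_kernel
  define b where "b = a * exp (real n)"
  have b: "b > 1" using n by (simp add: b_def)
  then have "a < b" using a by simp
  have abs: "?k absolutely_integrable_on {0..}"
    by (rule absolutely_integrable_integrable_bound[OF _ exp_cut_kernel_integral(1) exp_cut_majorant_integrable])
       (simp add: exp_cut_kernel_bound(1) del: atLeastAtMost_iff)
  have sub: "?k integrable_on S" if "S \<subseteq> {0..}" "S \<in> sets lebesgue" for S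
    using set_integrable_subset[OF abs that(2,1)] set_lebesgue_integral_eq_integral(1) by blast
  have i: "?k integrable_on {0..a}" "?k integrable_on {a..b}" "?k integrable_on {b..}" "?k integrable_on {0..b}"
    using a b \<open>a < b\<close> by (auto intro!: sub)
  have "integral ({0..b} \<union> {b..}) ?k = integral {0..b} ?k + integral {b..} ?k"
    by (rule integral_Un) (use i b in \<open>auto intro!: negligible_subset[of "{b}"]\<close>)
  moreover have "{0..b} \<union> {b..} = {0..}" using b by auto
  moreover have "integral {0..a} ?k + integral {a..b} ?k = integral {0..b} ?k"
    by (rule Henstock_Kurzweil_Integration.integral_combine) (use i a b \<open>a < b\<close> in auto)
  ultimately have split: "integral {a..b} ?k + euler_mascheroni = - integral {0..a} ?k - integral {b..} ?k"
    using exp_cut_kernel_integral(2) by simp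
  have A: "\<bar>integral {0..a} ?k\<bar> \<le> a"
  proof -
    have "norm (integral {0..a} ?k) \<le> integral {0..a} (\<lambda>_. 1)"
      by (rule integral_norm_bound_integral[OF i(1)]) (use a exp_cut_kernel_bound(2) in auto)
    then show ?thesis using a by simp
  qed
  have B: "\<bar>integral {b..} ?k\<bar> \<le> exp (- b)"
  proof -
    have "norm (integral {b..} ?k) \<le> integral {b..} (\<lambda>t. exp (-1 * t))"
      by (rule integral_norm_bound_integral[OF i(3)])
         (use b exp_cut_kernel_bound(3) has_integral_exp_minus_to_infinity[of 1 b] in auto)
    also have "\<dots> = exp (- b)" using integral_unique[OF has_integral_exp_minus_to_infinity[of 1 b]] by simp
    finally show ?thesis by simp
  qed
  have "((\<lambda>t. (a * exp t) *\<^sub>R (exp (- (a * exp t)) / (a * exp t))) has_integral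
      (integral {a * exp 0..a * exp (real n)} (\<lambda>u. exp (- u) / u))) {0..real n}"
    by (rule has_integral_substitution[where c = a and d = b])
       (use a in \<open>auto intro!: derivative_eq_intros continuous_intros simp: b_def\<close>)
  then have "((\<lambda>t. exp (- (a * exp t))) has_integral (integral {a..b} (\<lambda>u. exp (- u) / u))) {0..real n}"
    using a by (simp add: b_def)
  then have 1: "integral {0..real n} (\<lambda>t. exp (- (a * exp t))) = integral {a..b} (\<lambda>u. exp (- u) / u)"
    by (rule integral_unique)
  have "((\<lambda>u. 1 / u) has_integral (ln 1 - ln a)) {a..1}"
    by (rule fundamental_theorem_of_calculus)
       (use a in \<open>auto intro!: derivative_eq_intros simp: has_real_derivative_iff_has_vector_derivative[symmetric]\<close>)
  then have "((\<lambda>u. if u \<in> {a..1} then 1 / u else 0) has_integral (- ln a)) {a..b}"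
    using b by (subst has_integral_restrict) auto
  from has_integral_add[OF integrable_integral[OF i(2)] this]
  have "((\<lambda>u. exp (- u) / u) has_integral (integral {a..b} ?k - ln a)) {a..b}"
    unfolding diff_conv_add_uminus
    by (rule has_integral_eq[rotated]) (use a in \<open>auto simp: exp_cut_kernel_def field_simps\<close>)
  then have "integral {a..b} (\<lambda>u. exp (- u) / u) = integral {a..b} ?k - ln a" by (rule integral_unique)
  then have "integral {0..real n} (\<lambda>t. exp (- (a * exp t))) + ln a + euler_mascheroni = - integral {0..a} ?k - integral {b..} ?k"
    using 1 split by simp
  then show ?thesis using A B unfolding b_def by linarith
qed

text \<open>Replacing \<open>v * cosh t\<close> by \<open>a * exp t\<close> with
  \<open>a = v / 2\<close> changes the integral by at most the integral of
  \<open>a * exp (- t)\<close>, that is by at most \<open>a\<close>. A second \<open>a\<close> comes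
  from \<open>exp_integral_bound\<close>, and the two add up to \<open>v\<close>.\<close>

lemma macK_small:
  assumes v: "0 < v" "v < 1"
  shows "norm (macK (of_real v) + of_real (ln (v / 2) + euler_mascheroni)) \<le> v"
proof -
  define a where "a = v / 2"
  have a: "0 < a" "a < 1" using v by (auto simp: a_def)
  have bound: "norm (macK_trunc n (of_real v) + of_real (ln a + euler_mascheroni)) \<le> v + exp (- (a * exp (real n)))"
    if n: "a * exp (real n) > 1" for n
  proof -
    let ?E = "\<lambda>t. exp (- (a * exp t)) :: real"
    have tr: "macK_trunc n (of_real v) = of_real (integral {0..real n} (\<lambda>t. exp (- v * cosh t)))"
    proof -
      have "((\<lambda>t. exp (- v * cosh t)) has_integral integral {0..real n} (\<lambda>t. exp (- v * cosh t))) {0..real n}"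
        by (intro integrable_integral integrable_continuous_interval continuous_intros)
      from has_integral_of_real[OF this, where 'b=complex] show ?thesis
        unfolding macK_trunc_def by (intro integral_unique) (simp flip: exp_of_real)
    qed
    have "\<bar>integral {0..real n} (\<lambda>t. exp (- v * cosh t) - ?E t)\<bar> \<le> integral {0..real n} (\<lambda>t. a * exp (- t))"
      unfolding real_norm_def[symmetric]
    proof (rule integral_norm_bound_integral)
      fix t :: real assume "t \<in> {0..real n}"
      have eq: "exp (- v * cosh t) = ?E t * exp (- (a * exp (- t)))"
        by (simp add: a_def cosh_def exp_add[symmetric] field_simps)
      have "1 - a * exp (- t) \<le> exp (- (a * exp (- t)))" using exp_ge_add_one_self[of "- (a * exp (- t))"] by simp
      then have "\<bar>exp (- (a * exp (- t))) - 1\<bar> \<le> a * exp (- t)" using a by (auto simp: abs_if)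
      then have "?E t * \<bar>exp (- (a * exp (- t))) - 1\<bar> \<le> 1 * (a * exp (- t))"
        using a by (intro mult_mono) auto
      then show "norm (exp (- v * cosh t) - ?E t) \<le> a * exp (- t)"
      proof -
        have "exp (- v * cosh t) - ?E t = ?E t * (exp (- (a * exp (- t))) - 1)" unfolding eq by (simp add: algebra_simps)
        with \<open>?E t * \<bar>exp (- (a * exp (- t))) - 1\<bar> \<le> 1 * (a * exp (- t))\<close> show ?thesis by (simp add: abs_mult)
      qed
    qed (intro integrable_continuous_interval continuous_intros)+
    also have "integral {0..real n} (\<lambda>t. a * exp (- t)) = (- a * exp (- real n)) - (- a * exp (- 0))"
      by (rule integral_unique, rule fundamental_theorem_of_calculus)
         (auto intro!: derivative_eq_intros simp: has_real_derivative_iff_has_vector_derivative[symmetric])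
    also have "\<dots> \<le> a" using a by simp
    finally have "\<bar>integral {0..real n} (\<lambda>t. exp (- v * cosh t)) - integral {0..real n} ?E\<bar> \<le> a"
      by (subst (asm) Henstock_Kurzweil_Integration.integral_diff) (auto intro!: integrable_continuous_interval continuous_intros)
    then have "\<bar>integral {0..real n} (\<lambda>t. exp (- v * cosh t)) + (ln a + euler_mascheroni)\<bar> \<le> v + exp (- (a * exp (real n)))"
      using exp_integral_bound[OF a n] unfolding a_def by linarith
    then show ?thesis unfolding tr of_real_add[symmetric] norm_of_real .
  qed
  have "(\<lambda>n. norm (macK_trunc n (of_real v) + of_real (ln a + euler_mascheroni))) \<longlonglongrightarrow> norm (macK (of_real v) + of_real (ln a + euler_mascheroni))"
    by (intro tendsto_intros macK_trunc_tendsto) (use v in auto)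
  moreover have "(\<lambda>n. v + exp (- (a * exp (real n)))) \<longlonglongrightarrow> v + 0"
    by (intro tendsto_intros) (use a in real_asymp)
  moreover have "eventually (\<lambda>n. a * exp (real n) > 1) sequentially"
    using a by real_asymp
  then have "eventually (\<lambda>n. norm (macK_trunc n (of_real v) + of_real (ln a + euler_mascheroni)) \<le> v + exp (- (a * exp (real n)))) sequentially"
    by eventually_elim (rule bound)
  ultimately have "norm (macK (of_real v) + of_real (ln a + euler_mascheroni)) \<le> v + 0"
    by (intro tendsto_le[OF sequentially_bot])
  then show ?thesis by (simp add: a_def)
qed

section \<open>Identification of the Macdonald function\<close>

text \<open>The restriction of \<open>serI\<close> to the real axis, on which positivity and
  monotonicity can be stated.\<close>

definition rserI :: "real \<Rightarrow> real" where "rserI u = (\<Sum>k. 1 / (fact k)\<^sup>2 * u ^ k)"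

lemma summable_rserI: "summable (\<lambda>k. 1 / (fact k)\<^sup>2 * (u::real) ^ k)"
proof -
  have "summable (\<lambda>k. Re (1 / (fact k)\<^sup>2 * (of_real u) ^ k))" by (intro summable_Re summable_serI)
  moreover have "Re (1 / (fact k)\<^sup>2 * (of_real u) ^ k) = 1 / (fact k)\<^sup>2 * u ^ k" for k
  proof -
    have "1 / (fact k)\<^sup>2 * (of_real u) ^ k = complex_of_real (1 / (fact k)\<^sup>2 * u ^ k)" by simp
    then show ?thesis by (simp only: Re_complex_of_real)
  qed
  ultimately show ?thesis by simp
qed

lemma serI_of_real: "serI (of_real u) = of_real (rserI u)"
  unfolding serI_def rserI_def by (subst suminf_of_real[OF summable_rserI]) simp

lemma rserI_ge_1: "u \<ge> 0 \<Longrightarrow> rserI u \<ge> 1"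
  unfolding rserI_def using sum_le_suminf[OF summable_rserI, of "{0}" u] by simp

lemma rserI_mono: "0 \<le> u \<Longrightarrow> u \<le> w \<Longrightarrow> rserI u \<le> rserI w"
  unfolding rserI_def by (intro suminf_le summable_rserI mult_left_mono power_mono) auto

text \<open>For positive \<open>A\<close> the function \<open>\<phi> v - A * ln v\<close> would be
  nondecreasing, so \<open>\<phi> v\<close> would lie below \<open>\<phi> 1 + A * ln v\<close> and
  tend to minus infinity at zero.\<close>

lemma logarithmic_growth_contradiction:
  fixes \<phi> :: "real \<Rightarrow> real"
  assumes d: "\<And>v. 0 < v \<Longrightarrow> v \<le> 1 \<Longrightarrow> (\<phi> has_real_derivative \<phi>' v) (at v)"
    and ge: "\<And>v. 0 < v \<Longrightarrow> v \<le> 1 \<Longrightarrow> \<phi>' v \<ge> A / v"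
    and lim: "(\<phi> \<longlongrightarrow> 0) (at_right 0)"
  shows "A \<le> 0"
proof (rule ccontr)
  assume A: "\<not> A \<le> 0"
  have le: "\<phi> v - A * ln v \<le> \<phi> 1" if "0 < v" "v \<le> 1" for v
  proof -
    have "\<phi> v - A * ln v \<le> \<phi> 1 - A * ln 1"
    proof (rule DERIV_nonneg_imp_nondecreasing[OF that(2)])
      fix u assume u: "v \<le> u" "u \<le> 1"
      then have "((\<lambda>v. \<phi> v - A * ln v) has_real_derivative (\<phi>' u - A * (1 / u))) (at u)"
        using that by (auto intro!: derivative_eq_intros d)
      then show "\<exists>y. ((\<lambda>v. \<phi> v - A * ln v) has_real_derivative y) (at u) \<and> y \<ge> 0"
        using ge[of u] u that by (intro exI conjI) auto
    qed
    then show ?thesis by simp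
  qed
  have "((\<lambda>v. (\<phi> v - \<phi> 1) + 0) \<longlongrightarrow> 0 - \<phi> 1 + 0) (at_right 0)" by (intro tendsto_intros lim)
  moreover have "filterlim (\<lambda>v. A * ln v) at_bot (at_right 0)" using A by real_asymp
  moreover have "eventually (\<lambda>v. \<phi> v - \<phi> 1 \<le> A * ln v) (at_right 0)"
    using le by (auto simp: eventually_at_filter eventually_nhds_metric intro!: exI[of _ 1] simp: dist_real_def) force
  ultimately have "filterlim (\<lambda>v. \<phi> v - \<phi> 1) at_bot (at_right 0)"
    by (auto elim: filterlim_at_bot_mono)
  moreover have "((\<lambda>v. \<phi> v - \<phi> 1) \<longlongrightarrow> - \<phi> 1) (at_right 0)" using tendsto_diff[OF lim tendsto_const[of "\<phi> 1"]] by simp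
  ultimately show False using not_tendsto_and_filterlim_at_infinity[of "at_right (0::real)"] filterlim_at_bot_imp_at_infinity
    by (metis trivial_limit_at_right_real)
qed

text \<open>The Wronskian of \<open>macK\<close> minus the series with the regular solution is constant; a nonzero
  constant would make the quotient of the two grow logarithmically at \<open>0\<close>.\<close>

lemma macK_eq_logsol_real:
  assumes "v > 0"
  shows "macK (of_real v) = logsol (1/4) (euler_mascheroni - of_real (ln 2)) ((of_real v)\<^sup>2)"
proof -
  let ?\<mu> = "1/4 :: complex" and ?c = "euler_mascheroni - of_real (ln 2) :: complex"
  \<comment> \<open>The series solution lives in the squared variable, so \<open>D1\<close> and
    \<open>D2\<close> carry the chain-rule factors of \<open>z\<^sup>2\<close>. The constant
    \<open>euler_mascheroni - ln 2\<close> is the one that matches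
    \<open>macK_small\<close>.\<close>
  define D D1 D2 where "D z = macK z - logsol ?\<mu> ?c (z\<^sup>2)"
    and "D1 z = deriv macK z - 2 * z * dlogsol ?\<mu> ?c (z\<^sup>2)"
    and "D2 z = (deriv ^^ 2) macK z - 2 * dlogsol ?\<mu> ?c (z\<^sup>2) - 4 * z\<^sup>2 * ddlogsol ?\<mu> ?c (z\<^sup>2)" for z
  define Y Y1 Y2 where "Y z = serI (z\<^sup>2 / 4)" and "Y1 z = z / 2 * dserI (z\<^sup>2 / 4)"
    and "Y2 z = dserI (z\<^sup>2 / 4) / 2 + z\<^sup>2 / 4 * ddserI (z\<^sup>2 / 4)" for z
  let ?H = "{z. Re z > 0}"
  have opH: "open ?H" by (rule open_halfspace_Re_gt)
  have sq: "z\<^sup>2 \<notin> \<real>\<^sub>\<le>\<^sub>0" "z \<noteq> 0" if "Re z > 0" for z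
  proof -
    show "z\<^sup>2 \<notin> \<real>\<^sub>\<le>\<^sub>0"
    proof
      assume "z\<^sup>2 \<in> \<real>\<^sub>\<le>\<^sub>0"
      then have "Re z * Im z = 0" "(Re z)\<^sup>2 - (Im z)\<^sup>2 \<le> 0"
        by (auto simp: complex_nonpos_Reals_iff power2_eq_square)
      then have "Im z = 0" "(Re z)\<^sup>2 \<le> 0" using that by auto
      then show False using that by simp
    qed
  qed (use that in auto)
  have dK: "(macK has_field_derivative deriv macK z) (at z)"
    "(deriv macK has_field_derivative (deriv ^^ 2) macK z) (at z)" if "Re z > 0" for z
    using holomorphic_derivI[OF macK_holomorphic opH] holomorphic_derivI[OF holomorphic_deriv[OF macK_holomorphic opH] opH] that
    by (simp_all add: numeral_2_eq_2)
  have dD: "(D has_field_derivative D1 z) (at z)" if "Re z > 0" for z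
    unfolding D_def[abs_def] D1_def
  proof (intro DERIV_diff dK(1) that)
    have "((\<lambda>z. logsol ?\<mu> ?c (z\<^sup>2)) has_field_derivative dlogsol ?\<mu> ?c (z\<^sup>2) * (2 * z)) (at z)"
      by (rule DERIV_chain2[where f="logsol ?\<mu> ?c" and g="\<lambda>z. z\<^sup>2", OF DERIV_logsol[OF sq(1)[OF that]]])
         (auto intro!: derivative_eq_intros)
    then show "((\<lambda>z. logsol ?\<mu> ?c (z\<^sup>2)) has_field_derivative 2 * z * dlogsol ?\<mu> ?c (z\<^sup>2)) (at z)"
      by (simp add: mult_ac)
  qed
  have dD1: "(D1 has_field_derivative D2 z) (at z)" if "Re z > 0" for z
  proof -
    have "((\<lambda>z. dlogsol ?\<mu> ?c (z\<^sup>2)) has_field_derivative ddlogsol ?\<mu> ?c (z\<^sup>2) * (2 * z)) (at z)"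
      by (rule DERIV_chain2[where f="dlogsol ?\<mu> ?c" and g="\<lambda>z. z\<^sup>2", OF DERIV_dlogsol[OF sq(1)[OF that]]]) (auto intro!: derivative_eq_intros)
    then have "((\<lambda>z. 2 * z * dlogsol ?\<mu> ?c (z\<^sup>2)) has_field_derivative
        2 * dlogsol ?\<mu> ?c (z\<^sup>2) + ddlogsol ?\<mu> ?c (z\<^sup>2) * (2 * z) * (2 * z)) (at z)"
      by (intro DERIV_mult) (auto intro!: derivative_eq_intros)
    from DERIV_diff[OF dK(2)[OF that] this] show ?thesis
      unfolding D1_def[abs_def] D2_def by (simp add: power2_eq_square algebra_simps)
  qed
  have dY: "(Y has_field_derivative Y1 z) (at z)" "(Y1 has_field_derivative Y2 z) (at z)" for z
  proof -
    have g: "((\<lambda>z. z\<^sup>2 / 4) has_field_derivative z / 2) (at z)"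
      by (auto intro!: derivative_eq_intros)
    have "((\<lambda>z. serI (z\<^sup>2 / 4)) has_field_derivative dserI (z\<^sup>2 / 4) * (z / 2)) (at z)"
      by (rule DERIV_chain2[where f=serI and g="\<lambda>z. z\<^sup>2 / 4", OF DERIV_serI g])
    then show "(Y has_field_derivative Y1 z) (at z)"
      unfolding Y_def[abs_def] Y1_def by (simp add: mult.commute)
    have dI: "((\<lambda>z. dserI (z\<^sup>2 / 4)) has_field_derivative ddserI (z\<^sup>2 / 4) * (z / 2)) (at z)"
      by (rule DERIV_chain2[where f=dserI and g="\<lambda>z. z\<^sup>2 / 4", OF DERIV_dserI g])
    have "((\<lambda>z. z / 2 * dserI (z\<^sup>2 / 4)) has_field_derivative 1 / 2 * dserI (z\<^sup>2 / 4) + ddserI (z\<^sup>2 / 4) * (z / 2) * (z / 2)) (at z)"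
      by (intro DERIV_mult dI) (auto intro!: derivative_eq_intros)
    then show "(Y1 has_field_derivative Y2 z) (at z)"
      unfolding Y1_def[abs_def] Y2_def by (simp add: power2_eq_square mult_ac)
  qed
  have odeD: "z * D2 z + D1 z = z * D z" if "Re z > 0" for z
  proof -
    have "z * D2 z + D1 z - z * D z = (z * (deriv ^^ 2) macK z + deriv macK z - z * macK z)
       - 4 * z * (z\<^sup>2 * ddlogsol ?\<mu> ?c (z\<^sup>2) + dlogsol ?\<mu> ?c (z\<^sup>2) - ?\<mu> * logsol ?\<mu> ?c (z\<^sup>2))"
      unfolding D_def D1_def D2_def by (simp add: algebra_simps power2_eq_square)
    also have "\<dots> = 0" using macK_ode[OF that] logsol_ode[of "z\<^sup>2" ?\<mu> ?c] sq(2)[OF that] by simp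
    finally show ?thesis by simp
  qed
  have odeY: "z * Y2 z + Y1 z = z * Y z" for z
  proof -
    have "z * Y2 z + Y1 z = z * ((z\<^sup>2 / 4) * ddserI (z\<^sup>2 / 4) + dserI (z\<^sup>2 / 4))"
      unfolding Y_def Y1_def Y2_def by (simp add: algebra_simps)
    then show ?thesis unfolding serI_ode Y_def .
  qed
  \<comment> \<open>Abel's identity: for \<open>z y'' + y' = z y\<close> the Wronskian is
    proportional to \<open>1 / z\<close>, whence the factor \<open>z\<close>.\<close>
  have "\<exists>c. \<forall>z\<in>?H. z * (D1 z * Y z - D z * Y1 z) = c"
  proof (rule has_field_derivative_zero_constant)
    show "convex ?H" by (rule convex_halfspace_Re_gt)
    fix z assume "z \<in> ?H"
    then have z: "Re z > 0" by simp
    have "((\<lambda>z. z * (D1 z * Y z - D z * Y1 z)) has_field_derivative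
       1 * (D1 z * Y z - D z * Y1 z) + ((D2 z * Y z + Y1 z * D1 z) - (D1 z * Y1 z + Y2 z * D z)) * z) (at z)"
      by (intro DERIV_mult DERIV_diff dD dD1 dY z DERIV_ident)
    moreover have "1 * (D1 z * Y z - D z * Y1 z) + ((D2 z * Y z + Y1 z * D1 z) - (D1 z * Y1 z + Y2 z * D z)) * z
        = Y z * (z * D2 z + D1 z) - D z * (z * Y2 z + Y1 z)" by (simp add: algebra_simps)
    moreover have "Y z * (z * D2 z + D1 z) - D z * (z * Y2 z + Y1 z) = 0"
      unfolding odeD[OF z] odeY by (simp only: mult_ac diff_self)
    ultimately have "((\<lambda>z. z * (D1 z * Y z - D z * Y1 z)) has_field_derivative 0) (at z)" by (simp only:)
    then show "((\<lambda>z. z * (D1 z * Y z - D z * Y1 z)) has_field_derivative 0) (at z within ?H)"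
      by (rule has_field_derivative_at_within)
  qed
  then obtain c where c: "\<And>z. Re z > 0 \<Longrightarrow> z * (D1 z * Y z - D z * Y1 z) = c" by auto
  define y where "y v = rserI (v\<^sup>2 / 4)" for v
  have Yr: "Y (of_real v) = of_real (y v)" for v
    using serI_of_real[of "v\<^sup>2 / 4"] by (simp add: Y_def y_def)
  have y1: "y v \<ge> 1" for v by (simp add: y_def rserI_ge_1)
  define Q where "Q v = D (of_real v) / Y (of_real v)" for v :: real
  have dQ: "(Q has_vector_derivative c / (of_real v * (Y (of_real v))\<^sup>2)) (at v)" if "v > 0" for v
  proof -
    have Y0: "Y (of_real v) \<noteq> 0" unfolding Yr using y1[of v] by simp
    have "((\<lambda>z. D z / Y z) has_field_derivative (D1 (of_real v) * Y (of_real v) - D (of_real v) * Y1 (of_real v)) / (Y (of_real v) * Y (of_real v))) (at (of_real v))"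
      by (rule DERIV_divide[OF dD dY(1) Y0]) (use that in simp)
    moreover have "(D1 (of_real v) * Y (of_real v) - D (of_real v) * Y1 (of_real v)) / (Y (of_real v) * Y (of_real v)) = c / (of_real v * (Y (of_real v))\<^sup>2)"
    proof -
      have "c / (of_real v * (Y (of_real v))\<^sup>2) = of_real v * (D1 (of_real v) * Y (of_real v) - D (of_real v) * Y1 (of_real v)) / (of_real v * (Y (of_real v))\<^sup>2)"
        using c[of "of_real v"] that by simp
      then show ?thesis using that by (simp add: power2_eq_square)
    qed
    ultimately have "((\<lambda>z. D z / Y z) has_field_derivative c / (of_real v * (Y (of_real v))\<^sup>2)) (at (of_real v))" by simp
    then show ?thesis
      unfolding Q_def[abs_def] by (rule has_vector_derivative_real_field)
  qed
  have limD: "((\<lambda>v::real. D (of_real v)) \<longlongrightarrow> 0) (at_right 0)"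
  proof -
    have 1: "((\<lambda>v. macK (of_real v) + of_real (ln (v / 2) + euler_mascheroni)) \<longlongrightarrow> 0) (at_right 0)"
    proof (rule Lim_null_comparison)
      show "eventually (\<lambda>v. norm (macK (of_real v) + of_real (ln (v / 2) + euler_mascheroni)) \<le> v) (at_right 0)"
        using macK_small by (auto simp: eventually_at_filter eventually_nhds_metric dist_real_def intro!: exI[of _ 1])
    qed (rule tendsto_ident_at)
    have "filterlim (\<lambda>v::real. v\<^sup>2) (at_right 0) (at_right 0)" by real_asymp
    from filterlim_compose[OF logsol_tendsto[of ?\<mu> ?c] this]
    have 2: "((\<lambda>v::real. logsol ?\<mu> ?c (of_real (v\<^sup>2)) + Ln (of_real (v\<^sup>2)) / 2 + ?c) \<longlongrightarrow> 0) (at_right 0)" .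
    from tendsto_diff[OF 1 2] have "((\<lambda>v. (macK (of_real v) + of_real (ln (v / 2) + euler_mascheroni)) -
        (logsol ?\<mu> ?c (of_real (v\<^sup>2)) + Ln (of_real (v\<^sup>2)) / 2 + ?c)) \<longlongrightarrow> 0) (at_right 0)" by simp
    then show ?thesis
      by (rule Lim_transform_eventually)
         (auto simp: eventually_at_filter D_def ln_div ln_realpow Ln_of_real simp flip: of_real_power)
  qed
  have limQ: "(Q \<longlongrightarrow> 0) (at_right 0)"
  proof (rule Lim_null_comparison)
    have "norm (Q v) \<le> norm (D (of_real v))" for v
    proof -
      have "norm (Q v) = norm (D (of_real v)) / y v" unfolding Q_def Yr using y1[of v] by (simp add: norm_divide)
      also have "\<dots> \<le> norm (D (of_real v)) / 1" using y1[of v] by (intro divide_left_mono) auto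
      finally show ?thesis by simp
    qed
    then show "eventually (\<lambda>v. norm (Q v) \<le> norm (D (of_real v))) (at_right 0)" by simp
    show "((\<lambda>v::real. norm (D (of_real v))) \<longlongrightarrow> 0) (at_right 0)" using limD by (rule tendsto_norm_zero)
  qed
  have "c = 0"
  proof -
    define M where "M = y 1"
    have yM: "y v \<le> M" if "0 < v" "v \<le> 1" for v
      unfolding M_def y_def using that by (intro rserI_mono) (auto simp: power_le_one)
    have "(norm c)\<^sup>2 / M\<^sup>2 \<le> 0"
    proof (rule logarithmic_growth_contradiction)
      fix v :: real assume v: "0 < v" "v \<le> 1"
      \<comment> \<open>Multiplication by \<open>cnj c\<close> makes the derivative of the quotient
        real and nonnegative, so that the growth lemma for real functions applies to its real
        part.\<close>
      have "((\<lambda>v. cnj c * Q v) has_vector_derivative cnj c * (c / (of_real v * (Y (of_real v))\<^sup>2))) (at v)"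
        by (intro has_vector_derivative_mult_right dQ v)
      then have "((\<lambda>v. Re (cnj c * Q v)) has_real_derivative Re (cnj c * (c / (of_real v * (Y (of_real v))\<^sup>2)))) (at v)"
        unfolding has_real_derivative_iff_has_vector_derivative
        by (rule bounded_linear.has_vector_derivative[OF bounded_linear_Re])
      moreover have "cnj c * (c / (of_real v * (Y (of_real v))\<^sup>2)) = of_real ((norm c)\<^sup>2 / (v * (y v)\<^sup>2))"
        unfolding Yr using complex_norm_square[of c] by (simp add: mult.commute)
      ultimately show "((\<lambda>v. Re (cnj c * Q v)) has_real_derivative (norm c)\<^sup>2 / (v * (y v)\<^sup>2)) (at v)" by simp
      have "(norm c)\<^sup>2 / (v * M\<^sup>2) \<le> (norm c)\<^sup>2 / (v * (y v)\<^sup>2)"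
        using v yM[OF v] y1[of v] by (intro divide_left_mono mult_left_mono power_mono mult_pos_pos) auto
      then show "(norm c)\<^sup>2 / M\<^sup>2 / v \<le> (norm c)\<^sup>2 / (v * (y v)\<^sup>2)" by (simp add: mult.commute)
    next
      have "((\<lambda>v. Re (cnj c * Q v)) \<longlongrightarrow> Re (cnj c * 0)) (at_right 0)" by (intro tendsto_intros limQ)
      then show "((\<lambda>v. Re (cnj c * Q v)) \<longlongrightarrow> 0) (at_right 0)" by simp
    qed
    moreover have "M > 0" using y1[of 1] by (simp add: M_def)
    ultimately show ?thesis by (simp add: divide_le_0_iff)
  qed
  have "\<exists>q. \<forall>v\<in>{0<..}. Q v = q"
  proof (rule has_derivative_zero_constant)
    fix v :: real assume "v \<in> {0<..}"
    then have "(Q has_vector_derivative 0) (at v within {0<..})"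
      using dQ[of v] \<open>c = 0\<close> by (auto intro: has_vector_derivative_at_within)
    then show "(Q has_derivative (\<lambda>h. 0)) (at v within {0<..})" by (simp add: has_vector_derivative_def)
  qed simp
  then obtain q where q: "\<And>v. v > 0 \<Longrightarrow> Q v = q" by auto
  have "((\<lambda>v. q) \<longlongrightarrow> 0) (at_right (0::real))"
    by (rule Lim_transform_eventually[OF limQ]) (auto simp: eventually_at_filter q)
  then have "q = 0" using tendsto_unique[OF _ tendsto_const] trivial_limit_at_right_real by (metis)
  then have "D (of_real v) = 0" using q[OF assms] y1[of v] by (simp add: Q_def Yr)
  then show ?thesis by (simp add: D_def)
qed

text \<open>On the positive axis \<open>Ln (z\<^sup>2) / 2\<close> is \<open>Ln z\<close>, so the
  real identity takes a form holomorphic in the right half-plane; analytic continuation from the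
  axis finishes the proof.\<close>

lemma macK_eq_series:
  assumes "Re z > 0"
  shows "macK z = - (Ln (z / 2) + euler_mascheroni) * serI (z\<^sup>2 / 4) + serT (z\<^sup>2 / 4)"
proof -
  let ?H = "{z. Re z > 0}"
  have holS: "(\<lambda>z. f (z\<^sup>2 / 4)) holomorphic_on ?H" if "\<And>u. (f has_field_derivative f' u) (at u)" for f f' :: "complex \<Rightarrow> complex"
    unfolding holomorphic_on_open[OF open_halfspace_Re_gt]
    by (auto intro!: exI DERIV_chain2[OF that] derivative_eq_intros)
  let ?f = "\<lambda>z. macK z - (- (Ln (z / 2) + euler_mascheroni) * serI (z\<^sup>2 / 4) + serT (z\<^sup>2 / 4))"
  have "?f z = 0"
  proof (rule analytic_continuation[of ?f ?H "of_real ` {0<..}" 1])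
    show "?f holomorphic_on ?H"
      by (intro holomorphic_intros macK_holomorphic holS[OF DERIV_serI] holS[OF DERIV_serT])
         (auto simp: complex_nonpos_Reals_iff)
    show "open ?H" by (rule open_halfspace_Re_gt)
    show "connected ?H" by (intro convex_connected convex_halfspace_Re_gt)
    show "(1::complex) islimpt of_real ` {0<..}"
    proof -
      have "(\<lambda>n. complex_of_real (1 + inverse (real (Suc n)))) \<longlonglongrightarrow> of_real (1 + 0)"
        by (intro tendsto_intros LIMSEQ_inverse_real_of_nat)
      moreover have "complex_of_real (1 + inverse (real (Suc n))) \<noteq> 1" for n
      proof -
        have "1 + inverse (real (Suc n)) \<noteq> 1" by simp
        then show ?thesis by (metis of_real_1 of_real_eq_iff)
      qed
      moreover have "complex_of_real (1 + inverse (real (Suc n))) \<in> of_real ` {0<..}" for n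
        by (intro imageI) (simp add: add_pos_nonneg)
      ultimately show ?thesis
        unfolding islimpt_sequential by (intro exI[of _ "\<lambda>n. complex_of_real (1 + inverse (real (Suc n)))"]) auto
    qed
    fix w assume "w \<in> complex_of_real ` {0<..}"
    then obtain v where v: "v > 0" "w = of_real v" by auto
    have "Ln (w / 2) = of_real (ln v - ln 2)"
      using Ln_of_real[of "v/2"] v by (simp add: ln_div)
    moreover have "Ln (w\<^sup>2) = of_real (2 * ln v)"
      using Ln_of_real[of "v\<^sup>2"] v by (simp add: ln_realpow)
    ultimately show "?f w = 0"
      using macK_eq_logsol_real[OF v(1)] unfolding v(2)[symmetric] by (simp add: logsol_def)
  qed (use assms in auto)
  then show ?thesis by simp
qed

text \<open>The alternating signs of the Bessel series turn into the argument
  \<open>- w\<^sup>2 / 4\<close> of \<open>serI\<close> and \<open>serT\<close>. For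
  \<open>Im w > 0\<close> the argument of \<open>w / 2\<close> lies strictly between 0 and
  \<open>pi\<close>, so the rotation by \<open>- \<i>\<close> stays on the principal branch and
  shifts the logarithm by \<open>- \<i> * pi / 2\<close>; this shift is the \<open>bessel_J0\<close>
  part of the Hankel function.\<close>

lemma hankel_eq_macK:
  assumes "Im w > 0"
  shows "\<i> / 4 * hankel1_0 w = macK (- \<i> * w) / (2 * of_real pi)"
proof -
  have p: "(- (w\<^sup>2 / 4)) ^ k = (-1) ^ k * (w\<^sup>2 / 4) ^ k" for k by (rule power_minus)
  have J: "bessel_J0 w = serI (- (w\<^sup>2 / 4))"
    unfolding bessel_J0_def serI_def p by simp
  have T: "(\<Sum>k. (-1) ^ k * harm k * (w\<^sup>2 / 4) ^ k / (fact k)\<^sup>2) = serT (- (w\<^sup>2 / 4))"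
    unfolding serT_def p by (simp add: mult_ac)
  have sq: "(- \<i> * w)\<^sup>2 / 4 = - (w\<^sup>2 / 4)" by (simp add: power_mult_distrib)
  have w0: "w / 2 \<noteq> 0" using assms by auto
  have "Ln (- \<i> * (w / 2)) = Ln (- \<i>) + Ln (w / 2)"
  proof (rule Ln_times_simple)
    have "Im (Ln (w / 2)) > 0" "Im (Ln (w / 2)) < pi"
      using Im_Ln_pos_lt[OF w0] assms by (auto simp: Im_divide_numeral)
    then show "- pi < Im (Ln (- \<i>)) + Im (Ln (w / 2))" "Im (Ln (- \<i>)) + Im (Ln (w / 2)) \<le> pi"
      by auto
  qed (use w0 in auto)
  then have L: "Ln (- \<i> * w / 2) = Ln (w / 2) - \<i> * of_real pi / 2" by simp
  have "Re (- \<i> * w) > 0" using assms by simp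
  from macK_eq_series[OF this]
  have M: "macK (- \<i> * w) = - (Ln (w / 2) - \<i> * of_real pi / 2 + euler_mascheroni) * serI (- (w\<^sup>2 / 4)) + serT (- (w\<^sup>2 / 4))"
    unfolding sq L .
  show ?thesis
    unfolding hankel1_0_def bessel_Y0_def J T M by (simp add: field_simps)
qed

section \<open>The fundamental solution\<close>

text \<open>\<open>lam\<close> is \<open>- \<i> \<surd>z\<close>, so that the spectral parameter is \<open>z = - lam\<^sup>2\<close>; \<open>rad\<close> is the fundamental solution
  as a function of the squared distance.\<close>

locale helmholtz =
  fixes lam :: complex
  assumes lam: "Re lam > 0"
begin

definition zz :: complex where "zz = - lam\<^sup>2"
definition rad :: "real \<Rightarrow> complex" where
  "rad s = logsol (lam\<^sup>2 / 4) (Ln (lam / 2) + euler_mascheroni) (of_real s) / (2 * of_real pi)"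
definition drad :: "real \<Rightarrow> complex" where
  "drad s = dlogsol (lam\<^sup>2 / 4) (Ln (lam / 2) + euler_mascheroni) (of_real s) / (2 * of_real pi)"
definition ddrad :: "real \<Rightarrow> complex" where
  "ddrad s = ddlogsol (lam\<^sup>2 / 4) (Ln (lam / 2) + euler_mascheroni) (of_real s) / (2 * of_real pi)"
definition G :: "plane \<Rightarrow> plane \<Rightarrow> complex" where "G c y = rad ((norm (y - c))\<^sup>2)"

text \<open>This is \<open>macK_bound\<close> at \<open>lam * sqrt s\<close>, divided by
  \<open>2 * pi\<close>; the fourth root of \<open>s\<close> is the square root of the
  radius.\<close>

definition rad_bound :: "real \<Rightarrow> real" where
  "rad_bound s = exp (- Re lam * sqrt s) / (2 * sqrt (Re lam) * sqrt (sqrt s))"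

text \<open>Since \<open>sqrt s\<close> is positive, \<open>Ln (lam * sqrt s / 2)\<close> splits
  into \<open>Ln s / 2 + Ln (lam / 2)\<close>. This is where the constant in the definition of
  \<open>rad\<close> comes from.\<close>

lemma rad_eq_macK: "s > 0 \<Longrightarrow> rad s = macK (lam * of_real (sqrt s)) / (2 * of_real pi)"
proof -
  assume s: "s > 0"
  have l0: "lam / 2 \<noteq> 0" using lam by auto
  have r: "Re (lam * of_real (sqrt s)) > 0" using lam s by simp
  have "Ln (of_real (sqrt s) * (lam / 2)) = Ln (of_real (sqrt s)) + Ln (lam / 2)"
    using Ln_times_of_real[of "sqrt s" "lam / 2"] s l0 by (simp add: Ln_of_real)
  then have L: "Ln (lam * of_real (sqrt s) / 2) = Ln (of_real s) / 2 + Ln (lam / 2)"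
    using s by (simp add: Ln_of_real ln_sqrt mult.commute)
  have "(of_real (sqrt s))\<^sup>2 = complex_of_real s" using s by (simp flip: of_real_power)
  then have sq: "(lam * of_real (sqrt s))\<^sup>2 / 4 = lam\<^sup>2 / 4 * of_real s" by (simp add: power_mult_distrib)
  show ?thesis unfolding macK_eq_series[OF r] L sq rad_def logsol_def by (simp add: algebra_simps)
qed

lemma norm_rad_le:
  assumes "s > 0" shows "norm (rad s) \<le> rad_bound s"
proof -
  have "norm (rad s) = norm (macK (lam * of_real (sqrt s))) / (2 * pi)"
    unfolding rad_eq_macK[OF assms] by (simp add: norm_divide norm_mult)
  also have "\<dots> \<le> (pi * exp (- (Re lam * sqrt s)) / sqrt (Re lam * sqrt s)) / (2 * pi)"
    using macK_bound[of "lam * of_real (sqrt s)"] lam assms by (intro divide_right_mono) auto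
  also have "\<dots> = rad_bound s" by (simp add: rad_bound_def real_sqrt_mult)
  finally show ?thesis .
qed

text \<open>Monotonicity lets the bound at the true radius dominate all regularisations, whose
  squared radius is shifted upwards.\<close>

lemma rad_bound_antimono: "0 < s \<Longrightarrow> s \<le> t \<Longrightarrow> rad_bound t \<le> rad_bound s"
  unfolding rad_bound_def using lam by (intro frac_le mult_left_mono) auto

lemma rad_bound_nonneg: "s \<ge> 0 \<Longrightarrow> rad_bound s \<ge> 0"
  unfolding rad_bound_def using lam by simp

text \<open>With \<open>x = sqrt s\<close> both products are at most a constant times
  \<open>(1 + x) ^ 5 * exp (- b * x)\<close>, because \<open>sqrt x \<le> 1 + x\<close> and
  \<open>1 + x\<^sup>2 \<le> (1 + x)\<^sup>2\<close>; the exponential absorbs the fifth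
  power.\<close>

lemma rad_bound_estimates:
  obtains C where "\<And>s. s > 0 \<Longrightarrow> (1 + s) * rad_bound s \<le> C * (1 / (sqrt s * (1 + s)))"
    "\<And>s. s > 0 \<Longrightarrow> (rad_bound s)\<^sup>2 \<le> C * (1 / (sqrt s * (1 + s)))"
proof -
  define b where "b = Re lam"
  define K where "K = 1 / (2 * sqrt b)"
  \<comment> \<open>Chosen so that \<open>1 + x \<le> M * (1 + b * x / 5)\<close>, whose fifth power
    is at most \<open>M ^ 5 * exp (b * x)\<close>.\<close>
  define M where "M = max 1 (5 / b)"
  have b: "b > 0" "K > 0" "M \<ge> 1" "M * (b / 5) \<ge> 1"
    using lam by (auto simp: b_def K_def M_def max_def field_simps)
  have rb: "rad_bound (x\<^sup>2) = K * exp (- b * x) / sqrt x" if "x > 0" for x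
    using that by (simp add: rad_bound_def K_def b_def)
  have p: "(1 + x) ^ 5 * exp (- b * x) \<le> M ^ 5" if "x > 0" for x
  proof -
    have "1 + x \<le> M * (1 + b * x / 5)"
    proof -
      have "1 * x \<le> M * (b / 5) * x" using b that by (intro mult_right_mono) auto
      then show ?thesis using b by (simp add: algebra_simps)
    qed
    also have "\<dots> \<le> M * exp (b * x / 5)" using b by (intro mult_left_mono exp_ge_add_one_self) auto
    finally have "(1 + x) ^ 5 \<le> (M * exp (b * x / 5)) ^ 5" using that by (intro power_mono) auto
    also have "\<dots> = M ^ 5 * exp (b * x)"
      using exp_of_nat_mult[of 5 "b * x / 5"] by (simp add: power_mult_distrib)
    finally have "(1 + x) ^ 5 * exp (- b * x) \<le> M ^ 5 * exp (b * x) * exp (- b * x)" by (intro mult_right_mono) auto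
    then show ?thesis by (simp add: exp_minus field_simps)
  qed
  define C where "C = (K + K\<^sup>2) * M ^ 5"
  have x2: "1 + x\<^sup>2 \<le> (1 + x)\<^sup>2" "sqrt x \<le> 1 + x" if "x > 0" for x :: real
  proof -
    show "1 + x\<^sup>2 \<le> (1 + x)\<^sup>2" using that by (simp add: power2_sum)
    have "sqrt x \<le> sqrt ((1 + x)\<^sup>2)" using that by (intro real_sqrt_le_mono) (simp add: power2_sum)
    then show "sqrt x \<le> 1 + x" using that by simp
  qed
  have 1: "(1 + x\<^sup>2) * rad_bound (x\<^sup>2) * (x * (1 + x\<^sup>2)) \<le> C" if x: "x > 0" for x
  proof -
    have "(1 + x\<^sup>2) * rad_bound (x\<^sup>2) * (x * (1 + x\<^sup>2)) = K * ((1 + x\<^sup>2) * (1 + x\<^sup>2) * sqrt x * exp (- b * x))"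
    proof -
      have "(1 + x\<^sup>2) * rad_bound (x\<^sup>2) * (x * (1 + x\<^sup>2)) = K * ((1 + x\<^sup>2) * (1 + x\<^sup>2) * (x / sqrt x) * exp (- b * x))"
        unfolding rb[OF x] by simp
      then show ?thesis using x by (simp only: real_div_sqrt)
    qed
    also have "\<dots> \<le> K * ((1 + x)\<^sup>2 * (1 + x)\<^sup>2 * (1 + x) * exp (- b * x))"
      using x b x2[OF x] by (intro mult_left_mono mult_right_mono mult_mono) auto
    also have "(1 + x)\<^sup>2 * (1 + x)\<^sup>2 * (1 + x) = (1 + x) ^ 5" by (simp add: eval_nat_numeral)
    also have "K * ((1 + x) ^ 5 * exp (- b * x)) \<le> K * M ^ 5" using p[OF x] b by (intro mult_left_mono) auto
    also have "\<dots> \<le> C" using b by (simp add: C_def algebra_simps)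
    finally show ?thesis .
  qed
  have 2: "(rad_bound (x\<^sup>2))\<^sup>2 * (x * (1 + x\<^sup>2)) \<le> C" if x: "x > 0" for x
  proof -
    have "(rad_bound (x\<^sup>2))\<^sup>2 * (x * (1 + x\<^sup>2)) = K\<^sup>2 * ((1 + x\<^sup>2) * (exp (- b * x) * exp (- b * x)))"
      unfolding rb[OF x] using x by (simp add: power2_eq_square field_simps)
    also have "\<dots> \<le> K\<^sup>2 * ((1 + x) ^ 5 * (1 * exp (- b * x)))"
    proof (intro mult_left_mono mult_mono)
      show "1 + x\<^sup>2 \<le> (1 + x) ^ 5"
        using x2(1)[OF x] power_increasing[of 2 5 "1 + x"] x by linarith
    qed (use x b in auto)
    also have "\<dots> \<le> K\<^sup>2 * M ^ 5" using p[OF x] by (intro mult_left_mono) auto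
    also have "\<dots> \<le> C" using b by (simp add: C_def algebra_simps)
    finally show ?thesis .
  qed
  show ?thesis
  proof (rule that)
    fix s :: real assume s: "s > 0"
    define x where "x = sqrt s"
    have x: "x > 0" "s = x\<^sup>2" using s by (auto simp: x_def)
    have pos: "x * (1 + x\<^sup>2) > 0" using x by (simp add: add_pos_nonneg)
    show "(1 + s) * rad_bound s \<le> C * (1 / (sqrt s * (1 + s)))"
      using 1[OF x(1)] pos x by (simp add: pos_le_divide_eq)
    show "(rad_bound s)\<^sup>2 \<le> C * (1 / (sqrt s * (1 + s)))"
      using 2[OF x(1)] pos x by (simp add: pos_le_divide_eq)
  qed
qed

section \<open>Measurability and integrability of the fundamental solution\<close>

lemma rad_bound_measurable [measurable]: "rad_bound \<in> borel_measurable borel"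
  unfolding rad_bound_def[abs_def] by measurable

text \<open>The weighted integral is for the decay of convolutions in \<open>conv_L2\<close>, the
  squared one for \<open>G_L2\<close>.\<close>

lemma rad_bound_integrable:
  "integrable lborel (\<lambda>y::plane. (1 + (norm y)\<^sup>2) * rad_bound ((norm y)\<^sup>2))"
  "integrable lborel (\<lambda>y::plane. (rad_bound ((norm y)\<^sup>2))\<^sup>2)"
proof -
  obtain C where C: "\<And>s. s > 0 \<Longrightarrow> (1 + s) * rad_bound s \<le> C * (1 / (sqrt s * (1 + s)))"
    "\<And>s. s > 0 \<Longrightarrow> (rad_bound s)\<^sup>2 \<le> C * (1 / (sqrt s * (1 + s)))"
    using rad_bound_estimates by blast
  have i: "set_integrable lborel {0..} (\<lambda>s. C * (1 / (sqrt s * (1 + s))))"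
    by (intro set_integrable_mult_right integrable_inverse_sqrt_mult)
  have ae: "AE s in lborel. s \<noteq> (0::real)" by (rule AE_lborel_singleton)
  have "set_integrable lborel {0..} (\<lambda>s. (1 + s) * rad_bound s)"
  proof (rule set_integrable_bound[OF i])
    show "set_borel_measurable lborel {0..} (\<lambda>s. (1 + s) * rad_bound s)"
      unfolding set_borel_measurable_def by measurable
    show "AE s in lborel. s \<in> {0..} \<longrightarrow> norm ((1 + s) * rad_bound s) \<le> norm (C * (1 / (sqrt s * (1 + s))))"
      using ae
    proof eventually_elim
      fix s :: real assume "s \<noteq> 0"
      show "s \<in> {0..} \<longrightarrow> norm ((1 + s) * rad_bound s) \<le> norm (C * (1 / (sqrt s * (1 + s))))"
      proof
        assume "s \<in> {0..}"
        then have "s > 0" using \<open>s \<noteq> 0\<close> by simp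
        then have "norm ((1 + s) * rad_bound s) = (1 + s) * rad_bound s" using rad_bound_nonneg[of s] by simp
        also have "\<dots> \<le> norm (C * (1 / (sqrt s * (1 + s))))"
          unfolding real_norm_def by (rule order_trans[OF C(1)[OF \<open>s > 0\<close>] abs_ge_self])
        finally show "norm ((1 + s) * rad_bound s) \<le> norm (C * (1 / (sqrt s * (1 + s))))" .
      qed
    qed
  qed
  then show "integrable lborel (\<lambda>y::plane. (1 + (norm y)\<^sup>2) * rad_bound ((norm y)\<^sup>2))"
    by (subst radial_integral(1)[of "\<lambda>s. (1 + s) * rad_bound s"]) auto
  have "set_integrable lborel {0..} (\<lambda>s. (rad_bound s)\<^sup>2)"
  proof (rule set_integrable_bound[OF i])
    show "set_borel_measurable lborel {0..} (\<lambda>s. (rad_bound s)\<^sup>2)"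
      unfolding set_borel_measurable_def by measurable
    show "AE s in lborel. s \<in> {0..} \<longrightarrow> norm ((rad_bound s)\<^sup>2) \<le> norm (C * (1 / (sqrt s * (1 + s))))"
      using ae
    proof eventually_elim
      fix s :: real assume "s \<noteq> 0"
      show "s \<in> {0..} \<longrightarrow> norm ((rad_bound s)\<^sup>2) \<le> norm (C * (1 / (sqrt s * (1 + s))))"
      proof
        assume "s \<in> {0..}"
        then have "s > 0" using \<open>s \<noteq> 0\<close> by simp
        have "norm ((rad_bound s)\<^sup>2) = (rad_bound s)\<^sup>2" by simp
        also have "\<dots> \<le> norm (C * (1 / (sqrt s * (1 + s))))"
          unfolding real_norm_def by (rule order_trans[OF C(2)[OF \<open>s > 0\<close>] abs_ge_self])
        finally show "norm ((rad_bound s)\<^sup>2) \<le> norm (C * (1 / (sqrt s * (1 + s))))" .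
      qed
    qed
  qed
  then show "integrable lborel (\<lambda>y::plane. (rad_bound ((norm y)\<^sup>2))\<^sup>2)"
    by (subst radial_integral(1)[of "\<lambda>s. (rad_bound s)\<^sup>2"]) auto
qed

lemma rad_measurable [measurable]: "rad \<in> borel_measurable borel"
proof -
  have [measurable]: "serI \<in> borel_measurable borel" "serT \<in> borel_measurable borel"
    by (auto intro!: borel_measurable_continuous_onI continuous_at_imp_continuous_on continuous_series)
  show ?thesis unfolding rad_def[abs_def] logsol_def by measurable
qed

lemma G_measurable [measurable]: "G c \<in> borel_measurable borel"
  unfolding G_def[abs_def] by measurable

lemma norm_G_le: "y \<noteq> c \<Longrightarrow> norm (G c y) \<le> rad_bound ((norm (y - c))\<^sup>2)"
  unfolding G_def by (rule norm_rad_le) simp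

lemma G_L2: "G c \<in> L2"
proof -
  have "G 0 \<in> L2"
  proof (rule L2I[OF G_measurable], rule Bochner_Integration.integrable_bound[OF rad_bound_integrable(2)])
    show "AE y in lborel. norm ((norm (G 0 y))\<^sup>2) \<le> norm ((rad_bound ((norm y)\<^sup>2))\<^sup>2)"
      using AE_lborel_singleton[of "0::plane"]
    proof eventually_elim
      fix y :: plane assume "y \<noteq> 0"
      then have "(norm (G 0 y))\<^sup>2 \<le> (rad_bound ((norm y)\<^sup>2))\<^sup>2"
        using norm_G_le[of y 0] by (intro power_mono) auto
      then show "norm ((norm (G 0 y))\<^sup>2) \<le> norm ((rad_bound ((norm y)\<^sup>2))\<^sup>2)" by simp
    qed
  qed measurable
  from L2_translate(1)[OF this, of "-c"] show ?thesis by (simp add: G_def[abs_def])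
qed

lemma G_weighted_integrable: "integrable lborel (\<lambda>y. (1 + (norm y)\<^sup>2) * norm (G 0 y))"
proof (rule Bochner_Integration.integrable_bound[OF rad_bound_integrable(1)])
  show "AE y in lborel. norm ((1 + (norm y)\<^sup>2) * norm (G 0 y)) \<le> norm ((1 + (norm y)\<^sup>2) * rad_bound ((norm y)\<^sup>2))"
    using AE_lborel_singleton[of "0::plane"]
  proof eventually_elim
    fix y :: plane assume "y \<noteq> 0"
    then show "norm ((1 + (norm y)\<^sup>2) * norm (G 0 y)) \<le> norm ((1 + (norm y)\<^sup>2) * rad_bound ((norm y)\<^sup>2))"
      using norm_G_le[of y 0] rad_bound_nonneg[of "(norm y)\<^sup>2"] by (auto simp: abs_mult intro!: mult_left_mono)
  qed
qed measurable

lemma G_integrable: "integrable lborel (G 0)"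
proof (rule Bochner_Integration.integrable_bound[OF G_weighted_integrable])
  show "AE y in lborel. norm (G 0 y) \<le> norm ((1 + (norm y)\<^sup>2) * norm (G 0 y))"
    by (rule AE_I2) (simp add: abs_mult mult_le_cancel_right1)
qed measurable

section \<open>Radial derivatives and the radial differential equation\<close>

lemma of_real_not_nonpos: "s > 0 \<Longrightarrow> complex_of_real s \<notin> \<real>\<^sub>\<le>\<^sub>0"
  by (auto simp: complex_nonpos_Reals_iff)

lemma rad_derivs:
  assumes "s > 0"
  shows "(rad has_vector_derivative drad s) (at s)" "(drad has_vector_derivative ddrad s) (at s)"
proof -
  have "((\<lambda>s. logsol m c s / (2 * of_real pi)) has_field_derivative dlogsol m c (of_real s) / (2 * of_real pi)) (at (of_real s))"
     "((\<lambda>s. dlogsol m c s / (2 * of_real pi)) has_field_derivative ddlogsol m c (of_real s) / (2 * of_real pi)) (at (of_real s))" for m c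
    by (intro DERIV_cdivide DERIV_logsol DERIV_dlogsol of_real_not_nonpos assms)+
  from this[THEN has_vector_derivative_real_field]
  show "(rad has_vector_derivative drad s) (at s)" "(drad has_vector_derivative ddrad s) (at s)"
    unfolding rad_def[abs_def] drad_def[abs_def] ddrad_def by blast+
qed

lemma rad_ode:
  assumes "s > 0" shows "s * ddrad s + drad s = lam\<^sup>2 / 4 * rad s"
proof -
  let ?c = "Ln (lam / 2) + euler_mascheroni" and ?m = "lam\<^sup>2 / 4"
  have "s * ddrad s + drad s = (of_real s * ddlogsol ?m ?c (of_real s) + dlogsol ?m ?c (of_real s)) / (2 * of_real pi)"
    unfolding drad_def ddrad_def by (simp add: add_divide_distrib)
  also have "\<dots> = ?m * logsol ?m ?c (of_real s) / (2 * of_real pi)"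
    by (subst logsol_ode) (use assms in auto)
  finally show ?thesis by (simp add: rad_def)
qed

lemma isCont_rads:
  assumes "s > 0" shows "isCont rad s" "isCont drad s" "isCont ddrad s"
proof -
  show "isCont rad s" "isCont drad s"
    using rad_derivs[OF assms] by (auto intro: has_vector_derivative_continuous)
  have s: "complex_of_real s \<notin> \<real>\<^sub>\<le>\<^sub>0" by (rule of_real_not_nonpos[OF assms])
  have ser: "isCont (\<lambda>s. f (lam\<^sup>2 / 4 * complex_of_real s)) s" if "\<And>u. isCont f u" for f :: "complex \<Rightarrow> complex"
    by (rule isCont_o2[OF _ that]) (intro continuous_intros)
  show "isCont ddrad s"
    unfolding ddrad_def[abs_def] ddlogsol_def
    using assms s by (intro continuous_intros ser continuous_series) auto
qed

text \<open>Adding \<open>\<epsilon>\<^sup>2\<close> keeps the argument of \<open>rad\<close> away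
  from its singularity, so the regularised function is smooth across \<open>c\<close> as
  well.\<close>

definition Ge :: "plane \<Rightarrow> real \<Rightarrow> plane \<Rightarrow> complex" where
  "Ge c \<epsilon> y = rad ((norm (y - c))\<^sup>2 + \<epsilon>\<^sup>2)"

lemma smooth_q: "smooth_fun (\<lambda>y. complex_of_real ((norm (y - c))\<^sup>2 + \<epsilon>\<^sup>2))"
  unfolding of_real_add by (intro smooth_intros)

lemma partial_q: "partial i (\<lambda>y. complex_of_real ((norm (y - c))\<^sup>2 + \<epsilon>\<^sup>2)) y = of_real (2 * (y $ i - c $ i))"
proof -
  have "partial i (\<lambda>y. complex_of_real ((norm (y - c))\<^sup>2) + of_real (\<epsilon>\<^sup>2)) y =
      partial i (\<lambda>y. complex_of_real ((norm (y - c))\<^sup>2)) y + partial i (\<lambda>y. of_real (\<epsilon>\<^sup>2)) y"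
    by (intro partial_add smooth_fun_differentiable smooth_intros)
  then show ?thesis unfolding of_real_add partial_norm_sq by simp
qed

lemma q_pos: "\<epsilon> > 0 \<Longrightarrow> (norm (y - c))\<^sup>2 + \<epsilon>\<^sup>2 > 0" for \<epsilon> :: real
  by (simp add: add_nonneg_pos)

text \<open>Holomorphy on the slit plane supplies derivatives of every order at once; the sequence
  required by \<open>smooth_fun_compose\<close> consists of their restrictions to the positive
  axis.\<close>

lemma smooth_fun_Ge:
  assumes "\<epsilon> > 0" shows "smooth_fun (Ge c \<epsilon>)"
proof -
  let ?L = "\<lambda>s. logsol (lam\<^sup>2 / 4) (Ln (lam / 2) + euler_mascheroni) s / (2 * of_real pi)"
  have op: "open (- \<real>\<^sub>\<le>\<^sub>0 :: complex set)" by (simp add: open_Compl)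
  have hol: "?L holomorphic_on - \<real>\<^sub>\<le>\<^sub>0"
    unfolding holomorphic_on_open[OF op] by (auto intro!: exI DERIV_cdivide DERIV_logsol)
  define \<eta> where "\<eta> n s = (deriv ^^ n) ?L (of_real s)" for n and s :: real
  have "(\<eta> n has_vector_derivative \<eta> (Suc n) s) (at s)" if "s > 0" for n s
  proof -
    have "((deriv ^^ n) ?L has_field_derivative (deriv ^^ Suc n) ?L (of_real s)) (at (of_real s))"
      using holomorphic_derivI[OF holomorphic_higher_deriv[OF hol op] op] of_real_not_nonpos[OF that] by simp
    then show ?thesis unfolding \<eta>_def[abs_def] by (rule has_vector_derivative_real_field)
  qed
  then have "smooth_fun (\<lambda>y. \<eta> 0 ((norm (y - c))\<^sup>2 + \<epsilon>\<^sup>2))"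
    using smooth_fun_compose[of "\<lambda>y. (norm (y - c))\<^sup>2 + \<epsilon>\<^sup>2" \<eta> 0] smooth_q q_pos[OF assms] by blast
  then show ?thesis by (simp add: \<eta>_def Ge_def[abs_def] rad_def)
qed

lemma partial_Ge:
  assumes "\<epsilon> > 0"
  shows "partial i (Ge c \<epsilon>) = (\<lambda>y. drad ((norm (y - c))\<^sup>2 + \<epsilon>\<^sup>2) * of_real (2 * (y $ i - c $ i)))"
    and "partial j (partial i (Ge c \<epsilon>)) y = ddrad ((norm (y - c))\<^sup>2 + \<epsilon>\<^sup>2) * of_real (4 * (y $ i - c $ i) * (y $ j - c $ j))
       + drad ((norm (y - c))\<^sup>2 + \<epsilon>\<^sup>2) * (if i = j then 2 else 0)"
proof -
  let ?q = "\<lambda>y. (norm (y - c))\<^sup>2 + \<epsilon>\<^sup>2"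
  show 1: "partial i (Ge c \<epsilon>) = (\<lambda>y. drad (?q y) * of_real (2 * (y $ i - c $ i)))"
    unfolding Ge_def[abs_def]
    using partial_compose(2)[OF smooth_fun_differentiable[OF smooth_q] rad_derivs(1)[OF q_pos[OF assms]]]
    unfolding partial_q by blast
  have d: "(\<lambda>y. drad (?q y)) differentiable (at y)"
    by (rule partial_compose(1)[OF smooth_fun_differentiable[OF smooth_q] rad_derivs(2)[OF q_pos[OF assms]]])
  have pd: "partial j (\<lambda>y. drad (?q y)) y = ddrad (?q y) * of_real (2 * (y $ j - c $ j))"
    using partial_compose(2)[OF smooth_fun_differentiable[OF smooth_q] rad_derivs(2)[OF q_pos[OF assms]]]
    unfolding partial_q by blast
  have sm: "smooth_fun (\<lambda>y. 2 * (complex_of_real (y $ i) - of_real (c $ i)))"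
    by (intro smooth_intros)
  have pl: "partial j (\<lambda>y. 2 * (complex_of_real (y $ i) - of_real (c $ i))) y = (if i = j then 2 else 0)"
  proof -
    have "partial j (\<lambda>y. 2 * (complex_of_real (y $ i) - of_real (c $ i))) y
        = 2 * partial j (\<lambda>y. complex_of_real (y $ i) - of_real (c $ i)) y"
      by (intro partial_cmult smooth_fun_differentiable smooth_intros)
    also have "partial j (\<lambda>y. complex_of_real (y $ i) - of_real (c $ i)) y
        = partial j (\<lambda>y. complex_of_real (y $ i)) y - partial j (\<lambda>y. of_real (c $ i)) y"
      by (intro partial_diff smooth_fun_differentiable smooth_intros)
    finally show ?thesis by (simp add: partial_coord)
  qed
  have "partial j (partial i (Ge c \<epsilon>)) y = partial j (\<lambda>y. drad (?q y) * (2 * (complex_of_real (y $ i) - of_real (c $ i)))) y"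
    unfolding 1 by simp
  also have "\<dots> = drad (?q y) * (if i = j then 2 else 0) + ddrad (?q y) * of_real (2 * (y $ j - c $ j)) * (2 * (complex_of_real (y $ i) - of_real (c $ i)))"
    by (subst partial_mult[OF d smooth_fun_differentiable[OF sm]]) (simp only: pl pd)
  finally show "partial j (partial i (Ge c \<epsilon>)) y = ddrad (?q y) * of_real (4 * (y $ i - c $ i) * (y $ j - c $ j))
       + drad (?q y) * (if i = j then 2 else 0)" by (simp add: algebra_simps)
qed

text \<open>The Laplacian is \<open>4 (r\<^sup>2 F'' + F')\<close> with
  \<open>r\<^sup>2 = s - \<epsilon>\<^sup>2\<close>, where \<open>s\<close> is the shifted argument.
  The radial equation at \<open>s\<close> cancels everything but the term with
  \<open>\<epsilon>\<^sup>2\<close>, which concentrates at \<open>c\<close> as \<epsilon> tends to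
  zero.\<close>

lemma lap_Ge:
  assumes "\<epsilon> > 0"
  shows "lap (Ge c \<epsilon>) y + zz * Ge c \<epsilon> y = - 4 * of_real (\<epsilon>\<^sup>2) * ddrad ((norm (y - c))\<^sup>2 + \<epsilon>\<^sup>2)"
proof -
  let ?s = "(norm (y - c))\<^sup>2 + \<epsilon>\<^sup>2"
  have "lap (Ge c \<epsilon>) y = (\<Sum>i\<in>UNIV. ddrad ?s * of_real (4 * (y $ i - c $ i) * (y $ i - c $ i)) + drad ?s * 2)"
    unfolding lap_def partial_Ge(2)[OF assms] by simp
  also have "\<dots> = 4 * ddrad ?s * (\<Sum>i\<in>UNIV. (of_real (y $ i) - of_real (c $ i))\<^sup>2) + 4 * drad ?s"
    by (simp add: sum_2 power2_eq_square algebra_simps)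
  also have "\<dots> = 4 * ddrad ?s * of_real ((norm (y - c))\<^sup>2) + 4 * drad ?s"
    unfolding norm_sq_plane ..
  also have "\<dots> = 4 * (of_real ?s * ddrad ?s + drad ?s) - 4 * of_real (\<epsilon>\<^sup>2) * ddrad ?s"
    by (simp add: algebra_simps)
  also have "\<dots> = lam\<^sup>2 * rad ?s - 4 * of_real (\<epsilon>\<^sup>2) * ddrad ?s"
    unfolding rad_ode[OF q_pos[OF assms]] by simp
  finally show ?thesis by (simp add: Ge_def zz_def)
qed

end

lemma lborel_integral_scale:
  fixes f :: "plane \<Rightarrow> complex"
  assumes [measurable]: "f \<in> borel_measurable borel" and "\<epsilon> > 0"
  shows "(LINT y|lborel. f y) = \<epsilon>\<^sup>2 *\<^sub>R (LINT u|lborel. f (c + \<epsilon> *\<^sub>R u))"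
proof -
  have "(LINT y|lborel. f y) = (LINT y|density (distr lborel borel (\<lambda>u. c + \<epsilon> *\<^sub>R u)) (\<lambda>_. ennreal (\<bar>\<epsilon>\<bar> ^ DIM(plane))). f y)"
    using lborel_affine[of \<epsilon> c] assms by simp
  also have "\<dots> = (LINT y|distr lborel borel (\<lambda>u. c + \<epsilon> *\<^sub>R u). \<bar>\<epsilon>\<bar> ^ DIM(plane) *\<^sub>R f y)"
    by (rule integral_density) auto
  also have "\<dots> = (LINT u|lborel. \<bar>\<epsilon>\<bar> ^ DIM(plane) *\<^sub>R f (c + \<epsilon> *\<^sub>R u))"
    by (rule integral_distr) auto
  finally show ?thesis using assms by simp
qed

section \<open>The point source as a limit of the regularisations\<close>

context helmholtz begin

lemma sq_ddrad_tendsto: "((\<lambda>s. of_real (s\<^sup>2) * ddrad s) \<longlongrightarrow> 1 / (4 * of_real pi)) (at_right 0)"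
proof -
  have "((\<lambda>s::real. (of_real s)\<^sup>2 * ddlogsol (lam\<^sup>2 / 4) (Ln (lam / 2) + euler_mascheroni) (of_real s) / (2 * of_real pi)) \<longlongrightarrow> 1 / 2 / (2 * of_real pi)) (at_right 0)"
    by (intro tendsto_divide ddlogsol_tendsto tendsto_const) simp
  then show ?thesis by (simp add: ddrad_def)
qed

lemma sq_ddrad_bounded:
  obtains C where "\<And>s. 0 < s \<Longrightarrow> s \<le> R \<Longrightarrow> norm (of_real (s\<^sup>2) * ddrad s) \<le> C"
proof -
  let ?f = "\<lambda>s. of_real (s\<^sup>2) * ddrad s"
  have "eventually (\<lambda>s. dist (?f s) (1 / (4 * of_real pi)) < 1) (at_right 0)"
    using tendstoD[OF sq_ddrad_tendsto, of 1] by simp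
  then obtain d where d: "d > 0" "\<And>s. 0 < s \<Longrightarrow> s < d \<Longrightarrow> dist (?f s) (1 / (4 * of_real pi)) < 1"
    unfolding eventually_at_right_field by auto
  have "compact (?f ` {d / 2..R})"
    using d by (intro compact_continuous_image compact_Icc continuous_at_imp_continuous_on ballI continuous_intros isCont_rads) auto
  then obtain C where C0: "\<forall>x\<in>?f ` {d / 2..R}. norm x \<le> C"
    using compact_imp_bounded[of "?f ` {d / 2..R}"] unfolding bounded_iff by metis
  have C: "norm (?f s) \<le> C" if "s \<in> {d / 2..R}" for s using C0 imageI[OF that, of ?f] by (rule bspec)
  show ?thesis
  proof (rule that)
    fix s :: real assume s: "0 < s" "s \<le> R"
    show "norm (?f s) \<le> max C (1 + norm (1 / (4 * complex_of_real pi)))"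
    proof (cases "s < d")
      case True
      from d(2)[OF s(1) True] have "norm (?f s - 1 / (4 * of_real pi)) < 1" by (simp add: dist_norm)
      then have "norm (?f s) \<le> 1 + norm (1 / (4 * complex_of_real pi))"
        using norm_triangle_sub[of "?f s" "1 / (4 * of_real pi)"] by simp
      then show ?thesis by simp
    next
      case False
      then show ?thesis using C[of s] s d(1) by (simp add: max.coboundedI1)
    qed
  qed
qed

lemma inverse_Suc_pos: "inverse (real (Suc n)) > 0" "inverse (real (Suc n)) \<le> 1"
  by (auto simp: inverse_le_1_iff)

lemma tendsto_shift_sq: "(\<lambda>n. s + (inverse (real (Suc n)))\<^sup>2) \<longlonglongrightarrow> s"
  using tendsto_add[OF tendsto_const[of s] tendsto_power[OF LIMSEQ_inverse_real_of_nat, of 2]] by simp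

text \<open>Green's formula for the smooth \<open>Ge\<close> moves the operator off
  \<open>\<phi>\<close>, leaving the remainder of \<open>lap_Ge\<close>. After the substitution
  \<open>y = c + \<epsilon> u\<close> its limit is \<open>- 1 / pi\<close> times the kernel
  \<open>1 / (1 + (norm u)\<^sup>2)\<^sup>2\<close> times \<open>\<phi> c\<close>, and the kernel
  has mass \<open>pi\<close>.\<close>

lemma fundamental_solution:
  assumes \<phi>: "\<phi> \<in> test_functions UNIV"
  shows "(LINT y|lborel. G c y * (lap \<phi> y + zz * \<phi> y)) = - \<phi> c"
proof -
  define e where "e n = inverse (real (Suc n))" for n
  have e: "e n > 0" "e n \<le> 1" for n unfolding e_def by (rule inverse_Suc_pos)+
  have e0: "e \<longlonglongrightarrow> 0" unfolding e_def[abs_def] by (rule LIMSEQ_inverse_real_of_nat)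
  let ?\<psi> = "\<lambda>y. lap \<phi> y + zz * \<phi> y"
  note sm = test_functions_smooth[OF \<phi>]
  have [measurable]: "\<phi> \<in> borel_measurable borel" "lap \<phi> \<in> borel_measurable borel"
    "Ge c (e n) \<in> borel_measurable borel" for n
    using sm smooth_fun_Ge e by (auto intro!: smooth_fun_measurable)
  have \<psi>t: "?\<psi> \<in> test_functions UNIV"
    by (intro test_functions_add test_functions_lap test_functions_cmult \<phi>)
  obtain M where M: "M \<ge> 0" "\<And>y. norm (?\<psi> y) \<le> M" using test_functions_bounded[OF \<psi>t] by metis
  have 1: "(\<lambda>n. LINT y|lborel. Ge c (e n) y * ?\<psi> y) \<longlonglongrightarrow> (LINT y|lborel. G c y * ?\<psi> y)"
  proof (rule integral_dominated_convergence)
    have "integrable lborel (\<lambda>y::plane. rad_bound ((norm y)\<^sup>2))"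
      by (rule Bochner_Integration.integrable_bound[OF rad_bound_integrable(1)])
         (auto simp: abs_mult mult_le_cancel_right1 intro!: AE_I2)
    then have "integrable lborel (\<lambda>y::plane. rad_bound ((norm (y + - c))\<^sup>2))"
      by (subst lborel_integral_translate(2)[of "\<lambda>y. rad_bound ((norm y)\<^sup>2)" "- c"]) auto
    then show "integrable lborel (\<lambda>y. rad_bound ((norm (y - c))\<^sup>2) * M)" by simp
    show "AE y in lborel. (\<lambda>n. Ge c (e n) y * ?\<psi> y) \<longlonglongrightarrow> G c y * ?\<psi> y"
      using AE_lborel_singleton[of c]
    proof eventually_elim
      fix y assume y: "y \<noteq> c"
      have "(\<lambda>n. rad ((norm (y - c))\<^sup>2 + (e n)\<^sup>2)) \<longlonglongrightarrow> rad ((norm (y - c))\<^sup>2)"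
        unfolding e_def by (rule isCont_tendsto_compose[OF isCont_rads(1) tendsto_shift_sq]) (use y in simp)
      then show "(\<lambda>n. Ge c (e n) y * ?\<psi> y) \<longlonglongrightarrow> G c y * ?\<psi> y"
        unfolding Ge_def G_def by (rule tendsto_mult_right)
    qed
    show "AE y in lborel. norm (Ge c (e n) y * ?\<psi> y) \<le> rad_bound ((norm (y - c))\<^sup>2) * M" for n
      using AE_lborel_singleton[of c]
    proof eventually_elim
      fix y assume y: "y \<noteq> c"
      have *: "rad_bound ((norm (y - c))\<^sup>2) \<ge> 0" by (rule rad_bound_nonneg) simp
      have "norm (Ge c (e n) y) \<le> rad_bound ((norm (y - c))\<^sup>2 + (e n)\<^sup>2)"
        unfolding Ge_def by (intro norm_rad_le q_pos e)
      also have "\<dots> \<le> rad_bound ((norm (y - c))\<^sup>2)" using y by (intro rad_bound_antimono) auto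
      finally show "norm (Ge c (e n) y * ?\<psi> y) \<le> rad_bound ((norm (y - c))\<^sup>2) * M"
        unfolding norm_mult by (rule mult_mono[OF _ M(2) * norm_ge_zero])
    qed
  qed measurable
  \<comment> \<open>One \<open>\<epsilon>\<^sup>2\<close> comes from the Jacobian and one from
    \<open>lap_Ge\<close>. With \<open>s = \<epsilon>\<^sup>2 (1 + (norm u)\<^sup>2)\<close> their
    product is \<open>s\<^sup>2 / (1 + (norm u)\<^sup>2)\<^sup>2\<close>, so that
    \<open>s\<^sup>2 * ddrad s\<close> appears, which has a limit.\<close>
  have 2: "(LINT y|lborel. Ge c (e n) y * ?\<psi> y) =
      (LINT u|lborel. - 4 * (of_real (((e n)\<^sup>2 * (1 + (norm u)\<^sup>2))\<^sup>2) * ddrad ((e n)\<^sup>2 * (1 + (norm u)\<^sup>2)) * of_real (1 / (1 + (norm u)\<^sup>2)\<^sup>2) * \<phi> (c + e n *\<^sub>R u)))" for n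
  proof -
    note smG = smooth_fun_Ge[OF e(1)[of n], of c]
    have i: "integrable lborel (\<lambda>y. Ge c (e n) y * lap \<phi> y)" "integrable lborel (\<lambda>y. Ge c (e n) y * \<phi> y)"
      "integrable lborel (\<lambda>y. lap (Ge c (e n)) y * \<phi> y)"
      using smG by (auto intro!: test_functions_integrable[OF test_functions_mult] test_functions_lap \<phi>)
    have "(LINT y|lborel. Ge c (e n) y * ?\<psi> y) = (LINT y|lborel. Ge c (e n) y * lap \<phi> y) + zz * (LINT y|lborel. Ge c (e n) y * \<phi> y)"
      using i by (simp add: distrib_left mult.left_commute)
    also have "\<dots> = (LINT y|lborel. lap (Ge c (e n)) y * \<phi> y) + zz * (LINT y|lborel. Ge c (e n) y * \<phi> y)"
      unfolding green_test[OF smG \<phi>] ..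
    also have "\<dots> = (LINT y|lborel. (lap (Ge c (e n)) y + zz * Ge c (e n) y) * \<phi> y)"
      using i by (simp add: distrib_right mult.assoc)
    also have "\<dots> = (LINT y|lborel. - 4 * of_real ((e n)\<^sup>2) * ddrad ((norm (y - c))\<^sup>2 + (e n)\<^sup>2) * \<phi> y)"
      unfolding lap_Ge[OF e(1)] ..
    also have "\<dots> = (e n)\<^sup>2 *\<^sub>R (LINT u|lborel. - 4 * of_real ((e n)\<^sup>2) * ddrad ((norm ((c + e n *\<^sub>R u) - c))\<^sup>2 + (e n)\<^sup>2) * \<phi> (c + e n *\<^sub>R u))"
    proof (rule lborel_integral_scale[OF _ e(1)])
      have "smooth_fun (\<lambda>y. (lap (Ge c (e n)) y + zz * Ge c (e n) y) * \<phi> y)"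
        using smG sm by (intro smooth_intros) auto
      then show "(\<lambda>y. - 4 * of_real ((e n)\<^sup>2) * ddrad ((norm (y - c))\<^sup>2 + (e n)\<^sup>2) * \<phi> y) \<in> borel_measurable borel"
        unfolding lap_Ge[OF e(1)] by (rule smooth_fun_measurable)
    qed
    also have "\<dots> = (LINT u|lborel. of_real ((e n)\<^sup>2) * (- 4 * of_real ((e n)\<^sup>2) * ddrad ((norm ((c + e n *\<^sub>R u) - c))\<^sup>2 + (e n)\<^sup>2) * \<phi> (c + e n *\<^sub>R u)))"
      by (simp add: scaleR_conv_of_real)
    also have "\<dots> = (LINT u|lborel. - 4 * (of_real (((e n)\<^sup>2 * (1 + (norm u)\<^sup>2))\<^sup>2) * ddrad ((e n)\<^sup>2 * (1 + (norm u)\<^sup>2)) * of_real (1 / (1 + (norm u)\<^sup>2)\<^sup>2) * \<phi> (c + e n *\<^sub>R u)))"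
    proof (rule Bochner_Integration.integral_cong[OF refl])
      fix u :: plane
      have "(1 + (norm u)\<^sup>2)\<^sup>2 \<noteq> 0" by (simp add: add_nonneg_eq_0_iff)
      then have a: "((e n)\<^sup>2 * (1 + (norm u)\<^sup>2))\<^sup>2 * (1 / (1 + (norm u)\<^sup>2)\<^sup>2) = (e n)\<^sup>2 * (e n)\<^sup>2"
        by (simp add: power_mult_distrib power2_eq_square)
      have b: "(norm ((c + e n *\<^sub>R u) - c))\<^sup>2 + (e n)\<^sup>2 = (e n)\<^sup>2 * (1 + (norm u)\<^sup>2)"
        using e(1)[of n] by (simp add: power_mult_distrib algebra_simps)
      have "of_real ((e n)\<^sup>2) * (- 4 * of_real ((e n)\<^sup>2) * ddrad ((e n)\<^sup>2 * (1 + (norm u)\<^sup>2)) * \<phi> (c + e n *\<^sub>R u))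
         = - 4 * (of_real ((e n)\<^sup>2 * (e n)\<^sup>2) * ddrad ((e n)\<^sup>2 * (1 + (norm u)\<^sup>2)) * \<phi> (c + e n *\<^sub>R u))"
        unfolding of_real_mult by (simp only: mult_ac mult_minus_left mult_minus_right)
      also have "\<dots> = - 4 * (of_real (((e n)\<^sup>2 * (1 + (norm u)\<^sup>2))\<^sup>2) * ddrad ((e n)\<^sup>2 * (1 + (norm u)\<^sup>2)) * of_real (1 / (1 + (norm u)\<^sup>2)\<^sup>2) * \<phi> (c + e n *\<^sub>R u))"
        unfolding a[symmetric] of_real_mult by (simp only: mult_ac)
      finally show "of_real ((e n)\<^sup>2) * (- 4 * of_real ((e n)\<^sup>2) * ddrad ((norm ((c + e n *\<^sub>R u) - c))\<^sup>2 + (e n)\<^sup>2) * \<phi> (c + e n *\<^sub>R u))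
        = - 4 * (of_real (((e n)\<^sup>2 * (1 + (norm u)\<^sup>2))\<^sup>2) * ddrad ((e n)\<^sup>2 * (1 + (norm u)\<^sup>2)) * of_real (1 / (1 + (norm u)\<^sup>2)\<^sup>2) * \<phi> (c + e n *\<^sub>R u))"
        unfolding b .
    qed
    finally show ?thesis .
  qed
  obtain N where N: "N \<ge> 0" "\<And>y. norm (\<phi> y) \<le> N" using test_functions_bounded[OF \<phi>] by metis
  obtain K where K: "compact K" "\<And>y. y \<notin> K \<Longrightarrow> \<phi> y = 0" using \<phi> unfolding test_functions_iff by blast
  obtain R where R: "\<And>y. y \<in> K \<Longrightarrow> norm (y - c) \<le> R"
    using compact_imp_bounded[OF K(1)] bounded_any_center[of K c] by (auto simp: dist_norm norm_minus_commute)
  \<comment> \<open>On the support of \<open>\<phi>\<close> the argument \<open>s\<close> stays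
    below \<open>R\<^sup>2 + 1\<close> because \<open>e n \<le> 1\<close>; off the support the
    integrand is zero.\<close>
  obtain C where C: "\<And>s. 0 < s \<Longrightarrow> s \<le> R\<^sup>2 + 1 \<Longrightarrow> norm (of_real (s\<^sup>2) * ddrad s) \<le> C"
    using sq_ddrad_bounded[of "R\<^sup>2 + 1"] by blast
  let ?s = "\<lambda>n u. (e n)\<^sup>2 * (1 + (norm u)\<^sup>2) :: real"
  have spos: "?s n u > 0" for n and u :: plane using e[of n] by (simp add: add_pos_nonneg)
  have lim: "(\<lambda>n. LINT u|lborel. - 4 * (of_real ((?s n u)\<^sup>2) * ddrad (?s n u) * of_real (1 / (1 + (norm u)\<^sup>2)\<^sup>2) * \<phi> (c + e n *\<^sub>R u)))
     \<longlonglongrightarrow> (LINT u|lborel. - 4 * (1 / (4 * of_real pi) * of_real (1 / (1 + (norm (u::plane))\<^sup>2)\<^sup>2) * \<phi> c))"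
  proof (rule integral_dominated_convergence)
    show "integrable lborel (\<lambda>u::plane. 4 * (\<bar>C\<bar> * N) * (1 / (1 + (norm u)\<^sup>2)\<^sup>2))"
      by (intro integrable_mult_right plane_integral_inverse_sq)
    show "(\<lambda>u. - 4 * (of_real ((?s n u)\<^sup>2) * ddrad (?s n u) * of_real (1 / (1 + (norm u)\<^sup>2)\<^sup>2) * \<phi> (c + e n *\<^sub>R u))) \<in> borel_measurable lborel" for n
    proof -
      have "continuous_on UNIV (\<lambda>u::plane. ddrad (?s n u))"
        using spos[of n] by (intro continuous_at_imp_continuous_on ballI isCont_o2[OF _ isCont_rads(3)] continuous_intros)
      then have [measurable]: "(\<lambda>u::plane. ddrad (?s n u)) \<in> borel_measurable borel"
        by (rule borel_measurable_continuous_onI)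
      show ?thesis by measurable
    qed
    show "AE u in lborel. (\<lambda>n. - 4 * (of_real ((?s n u)\<^sup>2) * ddrad (?s n u) * of_real (1 / (1 + (norm u)\<^sup>2)\<^sup>2) * \<phi> (c + e n *\<^sub>R u)))
       \<longlonglongrightarrow> - 4 * (1 / (4 * of_real pi) * of_real (1 / (1 + (norm u)\<^sup>2)\<^sup>2) * \<phi> c)"
    proof (rule AE_I2)
      fix u :: plane
      have "(\<lambda>n. ?s n u) \<longlonglongrightarrow> 0\<^sup>2 * (1 + (norm u)\<^sup>2)" by (intro tendsto_intros e0)
      then have "filterlim (\<lambda>n. ?s n u) (at_right 0) sequentially"
        unfolding filterlim_at
      proof (intro conjI always_eventually allI)
        show "?s n u \<in> {0<..}" "?s n u \<noteq> 0" for n using spos[of n u] by (simp_all only: greaterThan_iff less_imp_neq[symmetric] not_False_eq_True)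
      qed simp
      from filterlim_compose[OF sq_ddrad_tendsto this]
      have a: "(\<lambda>n. of_real ((?s n u)\<^sup>2) * ddrad (?s n u)) \<longlonglongrightarrow> 1 / (4 * of_real pi)" .
      have "(\<lambda>n. c + e n *\<^sub>R u) \<longlonglongrightarrow> c + 0 *\<^sub>R u" by (intro tendsto_intros e0)
      then have b: "(\<lambda>n. \<phi> (c + e n *\<^sub>R u)) \<longlonglongrightarrow> \<phi> c"
        using isCont_tendsto_compose[OF smooth_fun_isCont[OF sm]] by force
      show "(\<lambda>n. - 4 * (of_real ((?s n u)\<^sup>2) * ddrad (?s n u) * of_real (1 / (1 + (norm u)\<^sup>2)\<^sup>2) * \<phi> (c + e n *\<^sub>R u)))
       \<longlonglongrightarrow> - 4 * (1 / (4 * of_real pi) * of_real (1 / (1 + (norm u)\<^sup>2)\<^sup>2) * \<phi> c)"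
        by (intro tendsto_mult a b tendsto_const)
    qed
    show "AE u in lborel. norm (- 4 * (of_real ((?s n u)\<^sup>2) * ddrad (?s n u) * of_real (1 / (1 + (norm u)\<^sup>2)\<^sup>2) * \<phi> (c + e n *\<^sub>R u)))
       \<le> 4 * (\<bar>C\<bar> * N) * (1 / (1 + (norm u)\<^sup>2)\<^sup>2)" for n
    proof (rule AE_I2)
      fix u :: plane
      have "norm (of_real ((?s n u)\<^sup>2) * ddrad (?s n u)) * norm (\<phi> (c + e n *\<^sub>R u)) \<le> \<bar>C\<bar> * N"
      proof (cases "c + e n *\<^sub>R u \<in> K")
        case True
        from R[OF True] have "\<bar>e n\<bar> * norm u \<le> R" by simp
        then have "(\<bar>e n\<bar> * norm u)\<^sup>2 \<le> R\<^sup>2" by (intro power_mono) auto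
        moreover have "(e n)\<^sup>2 \<le> 1" using e[of n] by (simp add: power_le_one)
        ultimately have "?s n u \<le> R\<^sup>2 + 1" by (simp add: power_mult_distrib algebra_simps)
        then show ?thesis by (intro mult_mono order_trans[OF C[OF spos] abs_ge_self] N) auto
      next
        case False
        then show ?thesis using K(2) N by simp
      qed
      then have "4 * (norm (of_real ((?s n u)\<^sup>2) * ddrad (?s n u)) * norm (\<phi> (c + e n *\<^sub>R u))) * (1 / (1 + (norm u)\<^sup>2)\<^sup>2) \<le> 4 * (\<bar>C\<bar> * N) * (1 / (1 + (norm u)\<^sup>2)\<^sup>2)"
        by (intro mult_right_mono mult_left_mono) auto
      then show "norm (- 4 * (of_real ((?s n u)\<^sup>2) * ddrad (?s n u) * of_real (1 / (1 + (norm u)\<^sup>2)\<^sup>2) * \<phi> (c + e n *\<^sub>R u)))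
       \<le> 4 * (\<bar>C\<bar> * N) * (1 / (1 + (norm u)\<^sup>2)\<^sup>2)"
        by (simp only: norm_mult norm_minus_cancel norm_numeral norm_of_real abs_of_nonneg[OF divide_nonneg_nonneg[OF zero_le_one zero_le_power2]] mult_ac)
    qed
  qed measurable
  have "(LINT u|lborel. - 4 * (1 / (4 * of_real pi) * of_real (1 / (1 + (norm (u::plane))\<^sup>2)\<^sup>2) * \<phi> c))
      = (- \<phi> c / of_real pi) * (LINT u|lborel. complex_of_real (1 / (1 + (norm (u::plane))\<^sup>2)\<^sup>2))"
    by (subst Bochner_Integration.integral_mult_right_zero[symmetric]) (simp add: field_simps)
  also have "\<dots> = - \<phi> c"
    unfolding integral_complex_of_real plane_integral_inverse_sq(2) by simp
  finally have "(\<lambda>n. LINT y|lborel. Ge c (e n) y * ?\<psi> y) \<longlonglongrightarrow> - \<phi> c"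
    using lim unfolding 2 by simp
  then show ?thesis using 1 LIMSEQ_unique by blast
qed

end

section \<open>Local spaces and weak derivatives\<close>

lemma continuous_AE_eq_open:
  fixes f g :: "plane \<Rightarrow> complex"
  assumes "open S" "continuous_on S f" "continuous_on S g" "AE y in lborel. f y = g y" "y \<in> S"
  shows "f y = g y"
proof (rule ccontr)
  assume ne: "f y \<noteq> g y"
  let ?U = "S \<inter> (\<lambda>y. f y - g y) -` (- {0})"
  have "open ?U"
    by (rule continuous_open_preimage[OF continuous_on_diff[OF assms(2,3)] assms(1)]) auto
  moreover have "negligible ?U"
  proof -
    have "AE y in lborel. y \<notin> ?U" using assms(4) by eventually_elim auto
    moreover have "?U \<in> sets borel" using \<open>open ?U\<close> by auto
    ultimately have "?U \<in> null_sets lborel" by (subst (asm) AE_iff_null_sets[symmetric]) auto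
    then show ?thesis by (simp add: negligible_iff_null_sets null_sets_completionI)
  qed
  moreover have "y \<in> ?U" using assms(5) ne by auto
  ultimately show False using open_not_negligible by blast
qed

lemma continuous_on_L2_loc:
  assumes "continuous_on \<Omega> u" shows "u \<in> L2_loc \<Omega>"
  unfolding L2_loc_def
proof (intro CollectI allI impI, elim conjE, intro conjI)
  fix K assume K: "compact K" "K \<subseteq> \<Omega>"
  have c: "continuous_on K u" using continuous_on_subset[OF assms K(2)] .
  show "set_borel_measurable lborel K u"
    unfolding set_borel_measurable_def
    using borel_measurable_continuous_on_indicator[OF _ c] K(1) by (simp add: compact_imp_closed borel_closed)
  show "set_integrable lborel K (\<lambda>y. (norm (u y))\<^sup>2)"
    unfolding set_integrable_def by (intro borel_integrable_compact K continuous_intros c)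
qed

lemma L2_imp_L2_loc:
  assumes u: "u \<in> L2" shows "u \<in> L2_loc \<Omega>"
  unfolding L2_loc_def
proof (intro CollectI allI impI, elim conjE, intro conjI)
  fix K :: "plane set" assume K: "compact K" "K \<subseteq> \<Omega>"
  have Kb: "K \<in> sets borel" using K(1) by (simp add: compact_imp_closed borel_closed)
  note [measurable] = L2_measurable[OF u]
  show "set_borel_measurable lborel K u"
    unfolding set_borel_measurable_def using Kb by measurable
  show "set_integrable lborel K (\<lambda>y. (norm (u y))\<^sup>2)"
    unfolding set_integrable_def using Kb by (intro integrable_mult_indicator L2_integrable u) auto
qed

lemma L2_loc_test_integrable:
  assumes u: "u \<in> L2_loc \<Omega>" and \<phi>: "\<phi> \<in> test_functions \<Omega>"
  shows "integrable lborel (\<lambda>y. u y * \<phi> y)"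
proof -
  obtain K where K: "compact K" "K \<subseteq> \<Omega>" "\<And>y. y \<notin> K \<Longrightarrow> \<phi> y = 0"
    using \<phi> unfolding test_functions_iff by blast
  have "(\<lambda>y. indicator K y *\<^sub>R u y) \<in> L2"
  proof (rule L2I)
    show "(\<lambda>y. indicator K y *\<^sub>R u y) \<in> borel_measurable borel"
      using u K unfolding L2_loc_def set_borel_measurable_def by auto
    have "(\<lambda>y. (norm (indicator K y *\<^sub>R u y))\<^sup>2) = (\<lambda>y. indicator K y *\<^sub>R (norm (u y))\<^sup>2)"
      by (auto simp: indicator_def)
    then show "integrable lborel (\<lambda>y. (norm (indicator K y *\<^sub>R u y))\<^sup>2)"
      using u K unfolding L2_loc_def set_integrable_def by auto
  qed
  then have "integrable lborel (\<lambda>y. indicator K y *\<^sub>R u y * \<phi> y)"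
    by (rule L2_mult_integrable[OF _ test_functions_L2[OF \<phi>]])
  moreover have "(\<lambda>y. indicator K y *\<^sub>R u y * \<phi> y) = (\<lambda>y. u y * \<phi> y)"
    using K(3) by (auto simp: indicator_def)
  ultimately show ?thesis by simp
qed

text \<open>The single form \<open>a * u + v\<close> covers sums and multiples, so each closure
  property is proved once.\<close>

lemma L2_loc_combination:
  assumes u: "u \<in> L2_loc \<Omega>" and v: "v \<in> L2_loc \<Omega>"
  shows "(\<lambda>y. a * u y + v y) \<in> L2_loc \<Omega>"
  unfolding L2_loc_def
proof (intro CollectI allI impI, elim conjE)
  fix K :: "plane set" assume K: "compact K" "K \<subseteq> \<Omega>"
  have L: "(\<lambda>y. indicator K y *\<^sub>R w y) \<in> L2" if "w \<in> L2_loc \<Omega>" for w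
  proof (rule L2I)
    show "(\<lambda>y. indicator K y *\<^sub>R w y) \<in> borel_measurable borel"
      using that K unfolding L2_loc_def set_borel_measurable_def by auto
    have "(\<lambda>y. (norm (indicator K y *\<^sub>R w y))\<^sup>2) = (\<lambda>y. indicator K y *\<^sub>R (norm (w y))\<^sup>2)"
      by (auto simp: indicator_def)
    then show "integrable lborel (\<lambda>y. (norm (indicator K y *\<^sub>R w y))\<^sup>2)"
      using that K unfolding L2_loc_def set_integrable_def by auto
  qed
  have s: "(\<lambda>y. a * (indicator K y *\<^sub>R u y) + indicator K y *\<^sub>R v y) \<in> L2"
    by (intro L2_add L2_cmult L u v)
  have e1: "(\<lambda>y. a * (indicator K y *\<^sub>R u y) + indicator K y *\<^sub>R v y) = (\<lambda>y. indicator K y *\<^sub>R (a * u y + v y))"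
    by (auto simp: indicator_def)
  have e2: "(\<lambda>y. (norm (indicator K y *\<^sub>R (a * u y + v y)))\<^sup>2) = (\<lambda>y. indicator K y *\<^sub>R (norm (a * u y + v y))\<^sup>2)"
    by (auto simp: indicator_def)
  show "set_borel_measurable lborel K (\<lambda>y. a * u y + v y) \<and> set_integrable lborel K (\<lambda>y. (norm (a * u y + v y))\<^sup>2)"
    unfolding set_borel_measurable_def set_integrable_def
    using L2_measurable[OF s[unfolded e1]] L2_integrable[OF s[unfolded e1], unfolded e2] by (intro conjI) (simp, assumption)
qed

lemma weak_partial_combination:
  assumes "weak_partial \<Omega> i u u'" "weak_partial \<Omega> i v v'"
    "u \<in> L2_loc \<Omega>" "u' \<in> L2_loc \<Omega>" "v \<in> L2_loc \<Omega>" "v' \<in> L2_loc \<Omega>"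
  shows "weak_partial \<Omega> i (\<lambda>y. a * u y + v y) (\<lambda>y. a * u' y + v' y)"
  unfolding weak_partial_def
proof
  fix \<phi> assume \<phi>: "\<phi> \<in> test_functions \<Omega>"
  note i = L2_loc_test_integrable[OF _ \<phi>] L2_loc_test_integrable[OF _ test_functions_partial[OF \<phi>, of i]]
  show "(LINT y|lborel. (a * u y + v y) * partial i \<phi> y) = - (LINT y|lborel. (a * u' y + v' y) * \<phi> y)"
    using assms(1,2) \<phi> i(2)[OF assms(3)] i(1)[OF assms(4)] i(2)[OF assms(5)] i(1)[OF assms(6)]
    unfolding weak_partial_def by (simp add: distrib_right mult.assoc)
qed

lemma W22_loc_combination:
  assumes "u \<in> W22_loc \<Omega>" "v \<in> W22_loc \<Omega>"
  shows "(\<lambda>y. a * u y + v y) \<in> W22_loc \<Omega>"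
proof -
  have uv: "u \<in> L2_loc \<Omega>" "v \<in> L2_loc \<Omega>" using assms by (auto simp: W22_loc_def)
  have "\<exists>d\<in>L2_loc \<Omega>. weak_partial \<Omega> i (\<lambda>y. a * u y + v y) d \<and> (\<forall>j. \<exists>w\<in>L2_loc \<Omega>. weak_partial \<Omega> j d w)" for i
  proof -
    obtain u' where u': "u' \<in> L2_loc \<Omega>" "weak_partial \<Omega> i u u'" "\<forall>j. \<exists>w\<in>L2_loc \<Omega>. weak_partial \<Omega> j u' w"
      using assms(1) unfolding W22_loc_def by blast
    obtain v' where v': "v' \<in> L2_loc \<Omega>" "weak_partial \<Omega> i v v'" "\<forall>j. \<exists>w\<in>L2_loc \<Omega>. weak_partial \<Omega> j v' w"
      using assms(2) unfolding W22_loc_def by blast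
    have "\<exists>w\<in>L2_loc \<Omega>. weak_partial \<Omega> j (\<lambda>y. a * u' y + v' y) w" for j
    proof -
      obtain u'' v'' where "u'' \<in> L2_loc \<Omega>" "weak_partial \<Omega> j u' u''" "v'' \<in> L2_loc \<Omega>" "weak_partial \<Omega> j v' v''"
        using u'(3) v'(3) by blast
      then show ?thesis using u'(1) v'(1) weak_partial_combination L2_loc_combination by blast
    qed
    then show ?thesis
      using weak_partial_combination[OF u'(2) v'(2) uv(1) u'(1) uv(2) v'(1)] L2_loc_combination[OF u'(1) v'(1)] by blast
  qed
  then show ?thesis using L2_loc_combination[OF uv] by (auto simp: W22_loc_def)
qed

lemma smooth_fun_W22_loc:
  assumes "smooth_fun u" shows "u \<in> W22_loc \<Omega>"
proof -
  have L: "v \<in> L2_loc \<Omega>" if "smooth_fun v" for v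
    using that by (intro continuous_on_L2_loc smooth_fun_continuous)
  have W: "weak_partial \<Omega> i v (partial i v)" if "smooth_fun v" for v i
    unfolding weak_partial_def using integration_by_parts_test[OF that] by blast
  show ?thesis
    unfolding W22_loc_def
  proof (intro CollectI conjI allI)
    show "u \<in> L2_loc \<Omega>" by (rule L[OF assms])
    fix i
    show "\<exists>v\<in>L2_loc \<Omega>. weak_partial \<Omega> i u v \<and> (\<forall>j. \<exists>w\<in>L2_loc \<Omega>. weak_partial \<Omega> j v w)"
    proof (rule bexI[of _ "partial i u"], intro conjI allI)
      fix j
      show "\<exists>w\<in>L2_loc \<Omega>. weak_partial \<Omega> j (partial i u) w"
        by (intro bexI[of _ "partial j (partial i u)"] W L smooth_fun_partial assms)
    qed (intro W L smooth_fun_partial assms)+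
  qed
qed

section \<open>Linear structure of the adjoint operator\<close>

lemma H_star_combination:
  assumes "(f, h) \<in> H_star X" "(g, k) \<in> H_star X"
  shows "(\<lambda>y. a * f y + g y, \<lambda>y. a * h y + k y) \<in> H_star X"
proof -
  have L: "f \<in> L2" "h \<in> L2" "g \<in> L2" "k \<in> L2" using assms by (auto simp: H_star_def)
  have wl: "weak_laplacian (- X) f (\<lambda>y. - h y)" "weak_laplacian (- X) g (\<lambda>y. - k y)"
    using assms by (auto simp: H_star_def)
  have "weak_laplacian (- X) (\<lambda>y. a * f y + g y) (\<lambda>y. - (a * h y + k y))"
    unfolding weak_laplacian_def lap_def[symmetric]
  proof
    fix \<phi> assume \<phi>: "\<phi> \<in> test_functions (- X)"
    have i: "integrable lborel (\<lambda>y. u y * \<phi> y)" "integrable lborel (\<lambda>y. u y * lap \<phi> y)" if "u \<in> L2" for u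
      using that test_functions_L2[OF \<phi>] test_functions_L2[OF test_functions_lap[OF \<phi>]] by (auto intro: L2_mult_integrable)
    have "(LINT y|lborel. f y * lap \<phi> y) = - (LINT y|lborel. h y * \<phi> y)" "(LINT y|lborel. g y * lap \<phi> y) = - (LINT y|lborel. k y * \<phi> y)"
      using bspec[OF wl(1)[unfolded weak_laplacian_def lap_def[symmetric]] \<phi>]
        bspec[OF wl(2)[unfolded weak_laplacian_def lap_def[symmetric]] \<phi>] by simp_all
    moreover have "(LINT y|lborel. (a * f y + g y) * lap \<phi> y) = a * (LINT y|lborel. f y * lap \<phi> y) + (LINT y|lborel. g y * lap \<phi> y)"
      using i[OF L(1)] i[OF L(3)] by (simp add: distrib_right mult.assoc)
    moreover have "(LINT y|lborel. - (a * h y + k y) * \<phi> y) = - (LINT y|lborel. a * (h y * \<phi> y) + k y * \<phi> y)"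
    proof -
      have "- (a * h y + k y) * \<phi> y = - (a * (h y * \<phi> y) + k y * \<phi> y)" for y by (simp add: algebra_simps)
      then show ?thesis by (simp only: Bochner_Integration.integral_minus)
    qed
    moreover have "(LINT y|lborel. a * (h y * \<phi> y) + k y * \<phi> y) = a * (LINT y|lborel. h y * \<phi> y) + (LINT y|lborel. k y * \<phi> y)"
      using i[OF L(2)] i[OF L(4)] by simp
    ultimately show "(LINT y|lborel. (a * f y + g y) * lap \<phi> y) = (LINT y|lborel. - (a * h y + k y) * \<phi> y)"
      by (simp only: mult_minus_right minus_add_distrib)
  qed
  then show ?thesis using assms by (auto simp: H_star_def intro!: L2_add L2_cmult W22_loc_combination)
qed

lemma smooth_fun_H_star:
  assumes "smooth_fun f" "f \<in> L2" "lap f \<in> L2"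
  shows "(f, \<lambda>y. - lap f y) \<in> H_star X"
proof -
  have "(\<lambda>y. - lap f y) \<in> L2" using L2_cmult[OF assms(3), of "-1"] by simp
  moreover have "weak_laplacian (- X) f (\<lambda>y. - (- lap f y))"
    unfolding weak_laplacian_def lap_def[symmetric] using green_test[OF assms(1)] by simp
  ultimately show ?thesis unfolding H_star_def using assms smooth_fun_W22_loc by auto
qed

lemma H_star_zero: "(\<lambda>y. 0, \<lambda>y. 0) \<in> H_star X"
proof -
  have "lap (\<lambda>y. 0) = (\<lambda>y. 0)" by (simp add: lap_def fun_eq_iff)
  then show ?thesis using smooth_fun_H_star[of "\<lambda>y. 0" X] by (simp add: smooth_fun_const L2_zero)
qed

lemma H_star_sum:
  "finite S \<Longrightarrow> (\<And>s. s \<in> S \<Longrightarrow> (f s, h s) \<in> H_star X) \<Longrightarrow> (\<lambda>y. \<Sum>s\<in>S. a s * f s y, \<lambda>y. \<Sum>s\<in>S. a s * h s y) \<in> H_star X"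
  by (induction S rule: finite_induct) (auto simp: H_star_zero intro!: H_star_combination)

text \<open>The differential conditions are integrals against test functions and do not see null
  sets; with this the defect space consists of full classes.\<close>

lemma H_star_cong_AE:
  assumes "(g, k) \<in> H_star X" "f \<in> L2" "h \<in> L2" "AE y in lborel. f y = g y" "AE y in lborel. h y = k y"
  shows "(f, h) \<in> H_star X"
proof -
  have gk: "g \<in> L2" "k \<in> L2" using assms by (auto simp: H_star_def)
  have eq: "(LINT y|lborel. f y * \<phi> y) = (LINT y|lborel. g y * \<phi> y)" if "\<phi> \<in> test_functions \<Omega>" for \<phi> \<Omega>
    by (rule integral_cong_AE)
       (use assms gk that smooth_fun_measurable[OF test_functions_smooth[OF that]] in \<open>auto dest: L2_measurable\<close>)
  have eq': "(LINT y|lborel. - h y * \<phi> y) = (LINT y|lborel. - k y * \<phi> y)" if "\<phi> \<in> test_functions \<Omega>" for \<phi> \<Omega>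
    by (rule integral_cong_AE)
       (use assms gk that smooth_fun_measurable[OF test_functions_smooth[OF that]] in \<open>auto dest: L2_measurable\<close>)
  have "weak_laplacian (- X) f (\<lambda>y. - h y)"
    using assms(1) eq[OF test_functions_lap] eq' unfolding H_star_def weak_laplacian_def lap_def[symmetric] by auto
  moreover have "weak_partial \<Omega> i f v \<longleftrightarrow> weak_partial \<Omega> i g v" for \<Omega> i v
    unfolding weak_partial_def using eq[OF test_functions_partial] by auto
  then have "f \<in> W22_loc (- X)"
    using assms(1) L2_imp_L2_loc[OF assms(2)] by (auto simp: H_star_def W22_loc_def)
  ultimately show ?thesis using assms by (simp add: H_star_def)
qed

section \<open>Fundamental solutions in the domain of the adjoint\<close>

context helmholtz begin

text \<open>On the support of \<open>\<phi>\<close> the distance to \<open>c\<close> is bounded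
  below, so the shifted squared distances stay in a compact subset of the positive axis and
  \<open>f\<close> is bounded there. Identities for the smooth \<open>Ge\<close> thus pass to
  \<open>G\<close> away from its pole.\<close>

lemma shifted_radial_limit:
  assumes f: "\<And>s. s > 0 \<Longrightarrow> isCont f s" and p: "continuous_on UNIV p"
    and \<phi>: "\<phi> \<in> test_functions \<Omega>" "c \<notin> \<Omega>"
  shows "(\<lambda>n. LINT y|lborel. f ((norm (y - c))\<^sup>2 + (inverse (real (Suc n)))\<^sup>2) * p y * \<phi> y)
     \<longlonglongrightarrow> (LINT y|lborel. f ((norm (y - c))\<^sup>2) * p y * (\<phi> y :: complex) :: complex)"
proof -
  define e where "e n = inverse (real (Suc n))" for n
  have e: "e n > 0" "e n \<le> 1" for n unfolding e_def by (rule inverse_Suc_pos)+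
  obtain K where K: "compact K" "K \<subseteq> \<Omega>" "\<And>y. y \<notin> K \<Longrightarrow> \<phi> y = 0" "smooth_fun \<phi>"
    using \<phi> unfolding test_functions_iff by blast
  have "c \<notin> K" using K(2) \<phi>(2) by auto
  then obtain d where d: "d > 0" "\<And>y. y \<in> K \<Longrightarrow> d \<le> norm (y - c)"
    using separate_point_closed[OF compact_imp_closed[OF K(1)], of c] by (auto simp: dist_norm norm_minus_commute)
  obtain R where R: "\<And>y. y \<in> K \<Longrightarrow> norm (y - c) \<le> R"
    using compact_imp_bounded[OF K(1)] bounded_any_center[of K c] by (auto simp: dist_norm norm_minus_commute)
  have "compact (f ` {d\<^sup>2..R\<^sup>2 + 1})"
    using d(1) f by (intro compact_continuous_image compact_Icc continuous_at_imp_continuous_on ballI) (auto intro: less_le_trans[OF zero_less_power])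
  then obtain M where M0: "\<forall>x\<in>f ` {d\<^sup>2..R\<^sup>2 + 1}. norm x \<le> M"
    using compact_imp_bounded[of "f ` {d\<^sup>2..R\<^sup>2 + 1}"] unfolding bounded_iff by metis
  have M: "norm (f s) \<le> M" if "s \<in> {d\<^sup>2..R\<^sup>2 + 1}" for s using M0 imageI[OF that, of f] by (rule bspec)
  have [measurable]: "p \<in> borel_measurable borel" "\<phi> \<in> borel_measurable borel"
    using p K(4) by (auto intro: borel_measurable_continuous_onI smooth_fun_measurable)
  have fm: "(\<lambda>y. f ((norm (y - c))\<^sup>2 + (e n)\<^sup>2) * p y * \<phi> y) \<in> borel_measurable borel" for n
  proof -
    have "continuous_on UNIV (\<lambda>y. f ((norm (y - c))\<^sup>2 + (e n)\<^sup>2))"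
      by (intro continuous_at_imp_continuous_on ballI isCont_o2[OF _ f] continuous_intros q_pos e)
    then have [measurable]: "(\<lambda>y. f ((norm (y - c))\<^sup>2 + (e n)\<^sup>2)) \<in> borel_measurable borel"
      by (rule borel_measurable_continuous_onI)
    show ?thesis by measurable
  qed
  have lim: "(\<lambda>n. f ((norm (y - c))\<^sup>2 + (e n)\<^sup>2) * p y * \<phi> y) \<longlonglongrightarrow> f ((norm (y - c))\<^sup>2) * p y * \<phi> y" for y
  proof (cases "y = c")
    case True
    then show ?thesis using K(3) \<open>c \<notin> K\<close> by simp
  next
    case False
    have "(\<lambda>n. f ((norm (y - c))\<^sup>2 + (e n)\<^sup>2)) \<longlonglongrightarrow> f ((norm (y - c))\<^sup>2)"
      unfolding e_def by (rule isCont_tendsto_compose[OF f tendsto_shift_sq]) (use False in simp)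
    then show ?thesis by (intro tendsto_mult tendsto_const)
  qed
  have "(\<lambda>n. LINT y|lborel. f ((norm (y - c))\<^sup>2 + (e n)\<^sup>2) * p y * \<phi> y) \<longlonglongrightarrow> (LINT y|lborel. f ((norm (y - c))\<^sup>2) * p y * \<phi> y)"
  proof (rule integral_dominated_convergence)
    show "integrable lborel (\<lambda>y. \<bar>M\<bar> * norm (p y * \<phi> y))"
      by (rule continuous_compact_support_integrable[OF _ K(1)])
         (use K(3) in \<open>auto intro!: continuous_intros p smooth_fun_continuous[OF K(4)]\<close>)
    show "AE y in lborel. (\<lambda>n. f ((norm (y - c))\<^sup>2 + (e n)\<^sup>2) * p y * \<phi> y) \<longlonglongrightarrow> f ((norm (y - c))\<^sup>2) * p y * \<phi> y"
      using lim by simp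
    show "(\<lambda>y. f ((norm (y - c))\<^sup>2) * p y * \<phi> y) \<in> borel_measurable lborel"
      using borel_measurable_LIMSEQ_metric[OF fm lim] by simp
    show "(\<lambda>y. f ((norm (y - c))\<^sup>2 + (e n)\<^sup>2) * p y * \<phi> y) \<in> borel_measurable lborel" for n using fm by simp
    show "AE y in lborel. norm (f ((norm (y - c))\<^sup>2 + (e n)\<^sup>2) * p y * \<phi> y) \<le> \<bar>M\<bar> * norm (p y * \<phi> y)" for n
    proof (rule AE_I2)
      fix y
      show "norm (f ((norm (y - c))\<^sup>2 + (e n)\<^sup>2) * p y * \<phi> y) \<le> \<bar>M\<bar> * norm (p y * \<phi> y)"
      proof (cases "y \<in> K")
        case True
        have "d\<^sup>2 \<le> (norm (y - c))\<^sup>2" "(norm (y - c))\<^sup>2 \<le> R\<^sup>2"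
          using d R True by (auto intro!: power_mono)
        moreover have "(e n)\<^sup>2 \<le> 1" "0 \<le> (e n)\<^sup>2" using e[of n] by (auto simp: power_le_one)
        ultimately have "(norm (y - c))\<^sup>2 + (e n)\<^sup>2 \<in> {d\<^sup>2..R\<^sup>2 + 1}" by (simp only: atLeastAtMost_iff) linarith
        from M[OF this] show ?thesis
          unfolding mult.assoc norm_mult[of "f _"] by (intro mult_right_mono) auto
      qed (simp add: K(3))
    qed
  qed
  then show ?thesis by (simp add: e_def)
qed

lemma G_weak_partials:
  assumes c: "c \<notin> \<Omega>"
  shows "weak_partial \<Omega> i (G c) (\<lambda>y. drad ((norm (y - c))\<^sup>2) * of_real (2 * (y $ i - c $ i)))"
    and "weak_partial \<Omega> j (\<lambda>y. drad ((norm (y - c))\<^sup>2) * of_real (2 * (y $ i - c $ i)))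
      (\<lambda>y. ddrad ((norm (y - c))\<^sup>2) * of_real (4 * (y $ i - c $ i) * (y $ j - c $ j))
         + drad ((norm (y - c))\<^sup>2) * (if i = j then 2 else 0))"
proof -
  let ?e = "\<lambda>n. inverse (real (Suc n))"
  note ep = inverse_Suc_pos(1)
  have pc: "continuous_on UNIV (\<lambda>y::plane. complex_of_real (2 * (y $ i - c $ i)))"
      "continuous_on UNIV (\<lambda>y::plane. complex_of_real (4 * (y $ i - c $ i) * (y $ j - c $ j)))"
      "continuous_on UNIV (\<lambda>y::plane. if i = j then 2 else 0 :: complex)"
      "continuous_on UNIV (\<lambda>y::plane. 1 :: complex)" for i j
    by (intro continuous_intros)+
  show "weak_partial \<Omega> i (G c) (\<lambda>y. drad ((norm (y - c))\<^sup>2) * of_real (2 * (y $ i - c $ i)))"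
    unfolding weak_partial_def
  proof
    fix \<phi> assume \<phi>: "\<phi> \<in> test_functions \<Omega>"
    have "(\<lambda>n. LINT y|lborel. rad ((norm (y - c))\<^sup>2 + (?e n)\<^sup>2) * 1 * partial i \<phi> y) \<longlonglongrightarrow> (LINT y|lborel. rad ((norm (y - c))\<^sup>2) * 1 * partial i \<phi> y)"
      by (rule shifted_radial_limit[OF isCont_rads(1) pc(4) test_functions_partial[OF \<phi>] c])
    moreover have "(\<lambda>n. - (LINT y|lborel. drad ((norm (y - c))\<^sup>2 + (?e n)\<^sup>2) * of_real (2 * (y $ i - c $ i)) * \<phi> y))
       \<longlonglongrightarrow> - (LINT y|lborel. drad ((norm (y - c))\<^sup>2) * of_real (2 * (y $ i - c $ i)) * \<phi> y)"
      by (intro tendsto_minus shifted_radial_limit[OF isCont_rads(2) pc(1) \<phi> c])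
    moreover have "(LINT y|lborel. rad ((norm (y - c))\<^sup>2 + (?e n)\<^sup>2) * 1 * partial i \<phi> y)
        = - (LINT y|lborel. drad ((norm (y - c))\<^sup>2 + (?e n)\<^sup>2) * of_real (2 * (y $ i - c $ i)) * \<phi> y)" for n
      using integration_by_parts_test[OF smooth_fun_Ge[OF ep] \<phi>, of c n i]
      unfolding partial_Ge(1)[OF ep] Ge_def by simp
    ultimately have "(LINT y|lborel. rad ((norm (y - c))\<^sup>2) * 1 * partial i \<phi> y)
        = - (LINT y|lborel. drad ((norm (y - c))\<^sup>2) * of_real (2 * (y $ i - c $ i)) * \<phi> y)"
      using LIMSEQ_unique by simp
    then show "(LINT y|lborel. G c y * partial i \<phi> y) = - (LINT y|lborel. drad ((norm (y - c))\<^sup>2) * of_real (2 * (y $ i - c $ i)) * \<phi> y)"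
      by (simp add: G_def)
  qed
  show "weak_partial \<Omega> j (\<lambda>y. drad ((norm (y - c))\<^sup>2) * of_real (2 * (y $ i - c $ i)))
      (\<lambda>y. ddrad ((norm (y - c))\<^sup>2) * of_real (4 * (y $ i - c $ i) * (y $ j - c $ j))
         + drad ((norm (y - c))\<^sup>2) * (if i = j then 2 else 0))"
    unfolding weak_partial_def
  proof
    fix \<phi> assume \<phi>: "\<phi> \<in> test_functions \<Omega>"
    let ?A = "\<lambda>s y. ddrad s * of_real (4 * (y $ i - c $ i) * (y $ j - c $ j)) * \<phi> y"
    let ?B = "\<lambda>s y. drad s * (if i = j then 2 else 0) * \<phi> y"
    have q0: "y \<in> \<Omega> \<Longrightarrow> (norm (y - c))\<^sup>2 > 0" for y using c by auto
    have cont: "continuous_on \<Omega> (\<lambda>y. f ((norm (y - c))\<^sup>2) * p y)"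
      if "\<And>s. s > 0 \<Longrightarrow> isCont f s" "continuous_on UNIV p" for f p :: "_ \<Rightarrow> complex"
      by (intro continuous_on_mult continuous_on_subset[OF that(2)] continuous_at_imp_continuous_on ballI isCont_o2[OF _ that(1)] continuous_intros q0) auto
    have iA: "integrable lborel (\<lambda>y. ?A ((norm (y - c))\<^sup>2) y)"
      using L2_loc_test_integrable[OF continuous_on_L2_loc[OF cont[OF isCont_rads(3) pc(2)]] \<phi>] .
    have iB: "integrable lborel (\<lambda>y. ?B ((norm (y - c))\<^sup>2) y)"
      using L2_loc_test_integrable[OF continuous_on_L2_loc[OF cont[OF isCont_rads(2) pc(3)]] \<phi>] .
    have ce: "continuous_on UNIV (\<lambda>y. f ((norm (y - c))\<^sup>2 + (?e n)\<^sup>2) * p y)"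
      if "\<And>s. s > 0 \<Longrightarrow> isCont f s" "continuous_on UNIV p" for f p :: "_ \<Rightarrow> complex" and n
      by (intro continuous_on_mult that(2) continuous_at_imp_continuous_on ballI isCont_o2[OF _ that(1)] continuous_intros q_pos ep)
    have iAe: "integrable lborel (\<lambda>y. ?A ((norm (y - c))\<^sup>2 + (?e n)\<^sup>2) y)" for n
      using L2_loc_test_integrable[OF continuous_on_L2_loc[OF continuous_on_subset[OF ce[OF isCont_rads(3) pc(2)] subset_UNIV]] \<phi>] .
    have iBe: "integrable lborel (\<lambda>y. ?B ((norm (y - c))\<^sup>2 + (?e n)\<^sup>2) y)" for n
      using L2_loc_test_integrable[OF continuous_on_L2_loc[OF continuous_on_subset[OF ce[OF isCont_rads(2) pc(3)] subset_UNIV]] \<phi>] .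
    have l1: "(\<lambda>n. LINT y|lborel. drad ((norm (y - c))\<^sup>2 + (?e n)\<^sup>2) * of_real (2 * (y $ i - c $ i)) * partial j \<phi> y)
      \<longlonglongrightarrow> (LINT y|lborel. drad ((norm (y - c))\<^sup>2) * of_real (2 * (y $ i - c $ i)) * partial j \<phi> y)"
      by (rule shifted_radial_limit[OF isCont_rads(2) pc(1) test_functions_partial[OF \<phi>] c])
    have l2: "(\<lambda>n. - ((LINT y|lborel. ?A ((norm (y - c))\<^sup>2 + (?e n)\<^sup>2) y) + (LINT y|lborel. ?B ((norm (y - c))\<^sup>2 + (?e n)\<^sup>2) y)))
       \<longlonglongrightarrow> - ((LINT y|lborel. ?A ((norm (y - c))\<^sup>2) y) + (LINT y|lborel. ?B ((norm (y - c))\<^sup>2) y))"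
      by (intro tendsto_minus tendsto_add shifted_radial_limit[OF isCont_rads(3) pc(2) \<phi> c] shifted_radial_limit[OF isCont_rads(2) pc(3) \<phi> c])
    have l3: "(LINT y|lborel. drad ((norm (y - c))\<^sup>2 + (?e n)\<^sup>2) * of_real (2 * (y $ i - c $ i)) * partial j \<phi> y)
       = - ((LINT y|lborel. ?A ((norm (y - c))\<^sup>2 + (?e n)\<^sup>2) y) + (LINT y|lborel. ?B ((norm (y - c))\<^sup>2 + (?e n)\<^sup>2) y))" for n
      using integration_by_parts_test[OF smooth_fun_partial[OF smooth_fun_Ge[OF ep]] \<phi>, of i c n j,
          unfolded partial_Ge(2)[OF ep], unfolded partial_Ge(1)[OF ep]] Bochner_Integration.integral_add[OF iAe[of n] iBe[of n]]
      by (simp only: distrib_right)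
    have "(LINT y|lborel. drad ((norm (y - c))\<^sup>2) * of_real (2 * (y $ i - c $ i)) * partial j \<phi> y)
       = - ((LINT y|lborel. ?A ((norm (y - c))\<^sup>2) y) + (LINT y|lborel. ?B ((norm (y - c))\<^sup>2) y))"
      by (rule LIMSEQ_unique[OF l1[unfolded l3] l2])
    then show "(LINT y|lborel. drad ((norm (y - c))\<^sup>2) * of_real (2 * (y $ i - c $ i)) * partial j \<phi> y)
       = - (LINT y|lborel. (ddrad ((norm (y - c))\<^sup>2) * of_real (4 * (y $ i - c $ i) * (y $ j - c $ j))
         + drad ((norm (y - c))\<^sup>2) * (if i = j then 2 else 0)) * \<phi> y)"
      by (simp only: distrib_right Bochner_Integration.integral_add[OF iA iB])
  qed
qed

lemma G_continuous: "c \<notin> \<Omega> \<Longrightarrow> continuous_on \<Omega> (G c)"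
  unfolding G_def[abs_def]
  by (intro continuous_at_imp_continuous_on ballI isCont_o2[OF _ isCont_rads(1)] continuous_intros) auto

text \<open>Test functions supported off \<open>X\<close> vanish at \<open>c\<close>, so the point
  source in \<open>fundamental_solution\<close> does not contribute.\<close>

lemma G_H_star:
  assumes "c \<in> X" shows "(G c, \<lambda>y. zz * G c y) \<in> H_star X"
proof -
  have c: "c \<notin> - X" using assms by simp
  have q0: "y \<in> - X \<Longrightarrow> (norm (y - c))\<^sup>2 > 0" for y using c by auto
  have L: "(\<lambda>y. f ((norm (y - c))\<^sup>2) * p y) \<in> L2_loc (- X)"
    if "\<And>s. s > 0 \<Longrightarrow> isCont f s" "continuous_on UNIV p" for f p :: "_ \<Rightarrow> complex"
    by (intro continuous_on_L2_loc continuous_on_mult continuous_on_subset[OF that(2)] continuous_at_imp_continuous_on ballI isCont_o2[OF _ that(1)] continuous_intros q0) auto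
  have "G c \<in> W22_loc (- X)"
    unfolding W22_loc_def
  proof (intro CollectI conjI allI)
    show "G c \<in> L2_loc (- X)" by (intro continuous_on_L2_loc G_continuous c)
    fix i
    show "\<exists>v\<in>L2_loc (- X). weak_partial (- X) i (G c) v \<and> (\<forall>j. \<exists>w\<in>L2_loc (- X). weak_partial (- X) j v w)"
    proof (rule bexI, intro conjI allI)
      show "weak_partial (- X) i (G c) (\<lambda>y. drad ((norm (y - c))\<^sup>2) * of_real (2 * (y $ i - c $ i)))"
        by (rule G_weak_partials(1)[OF c])
      show "(\<lambda>y. drad ((norm (y - c))\<^sup>2) * of_real (2 * (y $ i - c $ i))) \<in> L2_loc (- X)"
        by (intro L isCont_rads continuous_intros)
      fix j
      have W: "weak_partial (- X) j (\<lambda>y. drad ((norm (y - c))\<^sup>2) * of_real (2 * (y $ i - c $ i)))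
        (\<lambda>y. ddrad ((norm (y - c))\<^sup>2) * of_real (4 * (y $ i - c $ i) * (y $ j - c $ j))
           + drad ((norm (y - c))\<^sup>2) * (if i = j then 2 else 0))"
        by (rule G_weak_partials(2)[OF c])
      have "(\<lambda>y. 1 * (ddrad ((norm (y - c))\<^sup>2) * of_real (4 * (y $ i - c $ i) * (y $ j - c $ j)))
           + drad ((norm (y - c))\<^sup>2) * (if i = j then 2 else 0)) \<in> L2_loc (- X)"
        by (intro L2_loc_combination L isCont_rads continuous_intros)
      then have "(\<lambda>y. ddrad ((norm (y - c))\<^sup>2) * of_real (4 * (y $ i - c $ i) * (y $ j - c $ j))
           + drad ((norm (y - c))\<^sup>2) * (if i = j then 2 else 0)) \<in> L2_loc (- X)" by simp
      with W show "\<exists>w\<in>L2_loc (- X). weak_partial (- X) j (\<lambda>y. drad ((norm (y - c))\<^sup>2) * of_real (2 * (y $ i - c $ i))) w"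
        by (rule bexI)
    qed
  qed
  moreover have "weak_laplacian (- X) (G c) (\<lambda>y. - (zz * G c y))"
    unfolding weak_laplacian_def lap_def[symmetric]
  proof
    fix \<phi> assume \<phi>: "\<phi> \<in> test_functions (- X)"
    have \<phi>U: "\<phi> \<in> test_functions UNIV" using test_functions_mono[OF \<phi>] by simp
    have "\<phi> c = 0" using \<phi> c unfolding test_functions_iff by auto
    then have "(LINT y|lborel. G c y * lap \<phi> y + zz * (G c y * \<phi> y)) = 0"
      using fundamental_solution[OF \<phi>U, of c] by (simp add: algebra_simps)
    then show "(LINT y|lborel. G c y * lap \<phi> y) = (LINT y|lborel. - (zz * G c y) * \<phi> y)"
      using L2_mult_integrable[OF G_L2 test_functions_L2[OF \<phi>], of c] L2_mult_integrable[OF G_L2 test_functions_L2[OF test_functions_lap[OF \<phi>]], of c]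
      by (simp add: mult.assoc add_eq_0_iff2)
  qed
  ultimately show ?thesis by (simp add: H_star_def G_L2 L2_cmult)
qed

end

section \<open>Second-order estimates for test functions\<close>

lemma frechet_partial_expansion:
  assumes "smooth_fun f"
  shows "frechet_derivative f (at y) h = (\<Sum>i\<in>UNIV. (h $ i) *\<^sub>R partial i f y)"
proof -
  have lin: "linear (frechet_derivative f (at y))"
    using smooth_fun_has_derivative[OF assms] has_derivative_linear by blast
  have "h = (\<Sum>i\<in>UNIV. (h $ i) *\<^sub>R axis i 1)"
    using basis_expansion[of h] by (simp add: scalar_mult_eq_scaleR)
  then have "frechet_derivative f (at y) h = frechet_derivative f (at y) (\<Sum>i\<in>UNIV. (h $ i) *\<^sub>R axis i 1)" by simp
  also have "\<dots> = (\<Sum>i\<in>UNIV. (h $ i) *\<^sub>R frechet_derivative f (at y) (axis i 1))"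
    by (simp add: linear_sum[OF lin] linear_cmul[OF lin])
  finally show ?thesis by (simp add: partial_def)
qed

lemma norm_frechet_le:
  fixes a :: "2 \<Rightarrow> complex" and h :: plane
  assumes "\<And>i. norm (a i) \<le> M"
  shows "norm (\<Sum>i\<in>UNIV. (h $ i) *\<^sub>R a i) \<le> 2 * M * norm h"
proof -
  have "norm (\<Sum>i\<in>UNIV. (h $ i) *\<^sub>R a i) \<le> (\<Sum>i\<in>(UNIV::2 set). norm h * M)"
  proof (rule sum_norm_le)
    fix i :: 2
    have "norm ((h $ i) *\<^sub>R a i) = \<bar>h $ i\<bar> * norm (a i)" by simp
    also have "\<dots> \<le> norm h * M" using component_le_norm_cart[of h i] assms[of i] by (intro mult_mono) auto
    finally show "norm ((h $ i) *\<^sub>R a i) \<le> norm h * M" .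
  qed
  also have "\<dots> = 2 * M * norm h" by simp
  finally show ?thesis .
qed

lemma test_function_lipschitz:
  assumes "\<phi> \<in> test_functions UNIV"
  obtains C where "C \<ge> 0" "\<And>y h. norm (\<phi> (y + h) - \<phi> y) \<le> C * norm h"
proof -
  note sm = test_functions_smooth[OF assms]
  have "\<forall>i. \<exists>A\<ge>0. \<forall>y. norm (partial i \<phi> y) \<le> A"
    using test_functions_bounded[OF test_functions_partial[OF assms]] by metis
  then obtain A where A: "\<And>i. A i \<ge> 0" "\<And>i y. norm (partial i \<phi> y) \<le> A i" by metis
  define M where "M = (\<Sum>i\<in>UNIV. A i)"
  have M: "norm (partial i \<phi> y) \<le> M" for i y
    unfolding M_def using A(2)[of i y] member_le_sum[of i UNIV A] A(1) by (meson UNIV_I finite_class.finite_UNIV order_trans)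
  have "norm (\<phi> (y + h) - \<phi> y) \<le> 2 * M * norm ((y + h) - y)" for y h
  proof (rule differentiable_bound[of UNIV \<phi> "\<lambda>y. frechet_derivative \<phi> (at y)"])
    show "onorm (frechet_derivative \<phi> (at x)) \<le> 2 * M" for x
      by (rule onorm_le) (simp add: frechet_partial_expansion[OF sm] norm_frechet_le[OF M])
  qed (use smooth_fun_has_derivative[OF sm] in auto)
  then show ?thesis using that[of "2 * M"] A(1) by (auto simp: M_def sum_nonneg)
qed

text \<open>The remainder is uniform in \<open>y\<close>, so it can be integrated against
  \<open>G 0\<close> when a convolution is differentiated.\<close>

lemma test_function_taylor:
  assumes "\<phi> \<in> test_functions UNIV"
  obtains C where "C \<ge> 0" "\<And>y h. norm (\<phi> (y + h) - \<phi> y - (\<Sum>i\<in>UNIV. (h $ i) *\<^sub>R partial i \<phi> y)) \<le> C * (norm h)\<^sup>2"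
proof -
  note sm = test_functions_smooth[OF assms]
  have "\<forall>i. \<exists>A\<ge>0. \<forall>y h. norm (partial i \<phi> (y + h) - partial i \<phi> y) \<le> A * norm h"
    using test_function_lipschitz[OF test_functions_partial[OF assms]] by metis
  then obtain A where A: "\<And>i. A i \<ge> 0" "\<And>i y h. norm (partial i \<phi> (y + h) - partial i \<phi> y) \<le> A i * norm h" by metis
  define M where "M = (\<Sum>i\<in>UNIV. A i)"
  have AM: "A i \<le> M" for i unfolding M_def using member_le_sum[of i UNIV A] A(1) by simp
  have M: "norm (partial i \<phi> (y + h) - partial i \<phi> y) \<le> M * norm h" for i y h
    by (rule order_trans[OF A(2) mult_right_mono[OF AM norm_ge_zero]])
  have "norm (\<phi> (y + h) - \<phi> y - (\<Sum>i\<in>UNIV. (h $ i) *\<^sub>R partial i \<phi> y)) \<le> 2 * M * (norm h)\<^sup>2" for y h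
  proof -
    have M0: "M \<ge> 0" using A(1) by (simp add: M_def sum_nonneg)
    have "norm (\<phi> (y + h) - \<phi> y - frechet_derivative \<phi> (at y) ((y + h) - y)) \<le> norm ((y + h) - y) * (2 * (M * norm h))"
    proof (rule differentiable_bound_linearization[of _ _ "cball y (norm h)" _ "\<lambda>y. frechet_derivative \<phi> (at y)"])
      fix t :: real assume "t \<in> {0..1}"
      then show "y + t *\<^sub>R ((y + h) - y) \<in> cball y (norm h)"
        using mult_right_mono[of "\<bar>t\<bar>" 1 "norm h"] by (simp add: dist_norm)
    next
      fix x assume "x \<in> cball y (norm h)"
      then have x: "norm (x - y) \<le> norm h" by (simp add: dist_norm norm_minus_commute)
      show "onorm (frechet_derivative \<phi> (at x) - frechet_derivative \<phi> (at y)) \<le> 2 * (M * norm h)"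
      proof (rule onorm_le)
        fix v
        have a: "norm (partial i \<phi> x - partial i \<phi> y) \<le> M * norm h" for i
          using M[of i y "x - y"] mult_left_mono[OF x M0] by simp
        have "(frechet_derivative \<phi> (at x) - frechet_derivative \<phi> (at y)) v = (\<Sum>i\<in>UNIV. (v $ i) *\<^sub>R (partial i \<phi> x - partial i \<phi> y))"
          by (simp add: frechet_partial_expansion[OF sm] scaleR_diff_right sum_subtractf)
        then show "norm ((frechet_derivative \<phi> (at x) - frechet_derivative \<phi> (at y)) v) \<le> 2 * (M * norm h) * norm v"
          using norm_frechet_le[OF a] by simp
      qed
      show "(\<phi> has_derivative frechet_derivative \<phi> (at x)) (at x within cball y (norm h))"
        by (rule has_derivative_at_withinI[OF smooth_fun_has_derivative[OF sm]])
    qed simp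
    then show ?thesis by (simp add: frechet_partial_expansion[OF sm] power2_eq_square mult_ac)
  qed
  then show ?thesis using that[of "2 * M"] A(1) by (auto simp: M_def sum_nonneg)
qed

lemma has_derivative_quadraticI:
  fixes f :: "plane \<Rightarrow> complex"
  assumes "bounded_linear L" "\<And>h. norm (f (y + h) - f y - L h) \<le> C * (norm h)\<^sup>2"
  shows "(f has_derivative L) (at y)"
  unfolding has_derivative_at
proof (intro conjI assms(1))
  show "(\<lambda>h. norm (f (y + h) - f y - L h) / norm h) \<midarrow>0\<rightarrow> 0"
  proof (rule tendsto_sandwich[OF _ _ tendsto_const])
    show "\<forall>\<^sub>F h in at 0. norm (f (y + h) - f y - L h) / norm h \<le> C * norm h"
    proof (rule always_eventually, rule allI)
      fix h :: plane
      show "norm (f (y + h) - f y - L h) / norm h \<le> C * norm h"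
        using assms(2)[of h] by (cases "h = 0") (simp_all add: divide_le_eq power2_eq_square mult.assoc)
    qed
    have "((\<lambda>h. C * norm h) \<longlongrightarrow> C * norm (0::plane)) (at (0::plane))" by (rule tendsto_mult[OF tendsto_const tendsto_norm[OF tendsto_ident_at]])
    then show "((\<lambda>h. C * norm h) \<longlongrightarrow> 0) (at (0::plane))" by simp
  qed auto
qed

text \<open>The argument is weak. For step \<open>t\<close> in direction \<open>j\<close>, the
  first-order Taylor remainder of \<open>\<phi>\<close> has as its partial derivative in direction
  \<open>i\<close> the remainder of \<open>partial i \<phi>\<close> minus \<open>t\<close> times the
  commutator. Both remainders are of order \<open>t\<^sup>2\<close>, so after integration by parts
  against any test function the commutator pairs to a quantity of order \<open>t\<close>, hence to
  zero; continuity makes it vanish everywhere.\<close>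

lemma test_function_partial_commute:
  assumes \<phi>: "\<phi> \<in> test_functions UNIV"
  shows "partial i (partial j \<phi>) y = partial j (partial i \<phi>) y"
proof -
  note sm = test_functions_smooth[OF \<phi>]
  let ?w = "\<lambda>y. partial i (partial j \<phi>) y - partial j (partial i \<phi>) y"
  have wt: "?w \<in> test_functions UNIV" by (intro test_functions_diff test_functions_partial \<phi>)
  obtain A where A: "A \<ge> 0" "\<And>y h. norm (\<phi> (y + h) - \<phi> y - (\<Sum>i\<in>UNIV. (h $ i) *\<^sub>R partial i \<phi> y)) \<le> A * (norm h)\<^sup>2"
    by (rule test_function_taylor[OF \<phi>]) iprover
  obtain B where B: "B \<ge> 0" "\<And>y h. norm (partial i \<phi> (y + h) - partial i \<phi> y - (\<Sum>k\<in>UNIV. (h $ k) *\<^sub>R partial k (partial i \<phi>) y)) \<le> B * (norm h)\<^sup>2"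
    by (rule test_function_taylor[OF test_functions_partial[OF \<phi>]]) iprover
  let ?e = "axis j 1 :: plane"
  have ex: "(\<Sum>k\<in>UNIV. ((t *\<^sub>R ?e) $ k) *\<^sub>R a k) = t *\<^sub>R a j" for t :: real and a :: "2 \<Rightarrow> complex"
  proof -
    have "(\<Sum>k\<in>UNIV. ((t *\<^sub>R ?e) $ k) *\<^sub>R a k) = (\<Sum>k\<in>UNIV. if k = j then t *\<^sub>R a j else 0)"
      by (intro sum.cong) (auto simp: axis_def)
    then show ?thesis by simp
  qed
  have A': "norm (\<phi> (y + t *\<^sub>R ?e) - \<phi> y - t *\<^sub>R partial j \<phi> y) \<le> A * t\<^sup>2" for y t
    using A(2)[of y "t *\<^sub>R ?e"] unfolding ex by (simp add: norm_axis_1)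
  have B': "norm (partial i \<phi> (y + t *\<^sub>R ?e) - partial i \<phi> y - t *\<^sub>R partial j (partial i \<phi>) y) \<le> B * t\<^sup>2" for y t
    using B(2)[of y "t *\<^sub>R ?e"] unfolding ex by (simp add: norm_axis_1)
  have "AE y in lborel. ?w y = 0"
  proof (rule L2_eq_0_if_orthogonal[OF test_functions_L2[OF wt]])
    fix \<psi> :: "plane \<Rightarrow> complex" assume \<psi>: "\<psi> \<in> test_functions UNIV"
    note s\<psi> = test_functions_smooth[OF \<psi>]
    let ?I = "LINT y|lborel. ?w y * \<psi> y"
    define S where "S = A * (LINT y|lborel. norm (partial i \<psi> y)) + B * (LINT y|lborel. norm (\<psi> y))"
    have S0: "S \<ge> 0" using A(1) B(1) by (simp add: S_def)
    have int: "integrable lborel (\<lambda>y. f y * \<theta> y)" if "smooth_fun f" "\<theta> \<in> test_functions UNIV" for f \<theta>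
      using test_functions_integrable[OF test_functions_mult[OF that(2,1)]] .
    have bound: "norm (LINT y|lborel. f y * \<theta> y) \<le> D * t\<^sup>2 * (LINT y|lborel. norm (\<theta> y))"
      if "smooth_fun f" "\<theta> \<in> test_functions UNIV" "\<And>y. norm (f y) \<le> D * t\<^sup>2" for f \<theta> and D t :: real
    proof -
      have "norm (LINT y|lborel. f y * \<theta> y) \<le> (LINT y|lborel. norm (f y * \<theta> y))" by (rule integral_norm_bound)
      also have "\<dots> \<le> (LINT y|lborel. D * t\<^sup>2 * norm (\<theta> y))"
      proof (rule integral_mono)
        show "integrable lborel (\<lambda>y. norm (f y * \<theta> y))" by (intro integrable_norm int that)
        show "integrable lborel (\<lambda>y. D * t\<^sup>2 * norm (\<theta> y))"
          using test_functions_integrable[OF that(2)] by simp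
        show "norm (f y * \<theta> y) \<le> D * t\<^sup>2 * norm (\<theta> y)" for y
          unfolding norm_mult by (intro mult_right_mono that) simp
      qed
      finally show ?thesis by simp
    qed
    have "norm ?I \<le> t * S" if t: "t > 0" for t
    proof -
      have sh: "smooth_fun (\<lambda>y. f (y + t *\<^sub>R ?e))" if "smooth_fun f" for f
        using smooth_fun_affine[OF that, of 1 "t *\<^sub>R ?e"] by simp
      have psh: "partial i (\<lambda>y. \<phi> (y + t *\<^sub>R ?e)) y = partial i \<phi> (y + t *\<^sub>R ?e)" for y
        using partial_affine(2)[of \<phi> 1 y "t *\<^sub>R ?e" i, OF smooth_fun_differentiable[OF sm]] by simp
      define R1 where "R1 y = \<phi> (y + t *\<^sub>R ?e) - \<phi> y - of_real t * partial j \<phi> y" for y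
      define R2 where "R2 y = partial i \<phi> (y + t *\<^sub>R ?e) - partial i \<phi> y - of_real t * partial j (partial i \<phi>) y" for y
      have smR: "smooth_fun R1" "smooth_fun R2"
        unfolding R1_def[abs_def] R2_def[abs_def] using sm by (auto intro!: smooth_intros sh)
      have nR: "norm (R1 y) \<le> A * t\<^sup>2" "norm (R2 y) \<le> B * t\<^sup>2" for y
        using A'[of y t] B'[of y t] by (simp_all add: R1_def R2_def scaleR_conv_of_real)
      have pR: "partial i R1 y = R2 y - of_real t * ?w y" for y
      proof -
        have "partial i R1 y = partial i (\<lambda>y. \<phi> (y + t *\<^sub>R ?e) - \<phi> y) y - partial i (\<lambda>y. of_real t * partial j \<phi> y) y"
          unfolding R1_def[abs_def] using sm by (intro partial_diff smooth_fun_differentiable smooth_intros sh) auto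
        also have "partial i (\<lambda>y. \<phi> (y + t *\<^sub>R ?e) - \<phi> y) y = partial i \<phi> (y + t *\<^sub>R ?e) - partial i \<phi> y"
          unfolding psh[symmetric] using sm by (intro partial_diff smooth_fun_differentiable sh)
        also have "partial i (\<lambda>y. of_real t * partial j \<phi> y) y = of_real t * partial i (partial j \<phi>) y"
          using sm by (intro partial_cmult smooth_fun_differentiable) auto
        finally show ?thesis by (simp add: R2_def algebra_simps)
      qed
      have sw: "smooth_fun ?w" by (rule test_functions_smooth[OF wt])
      have "(LINT y|lborel. R1 y * partial i \<psi> y) = - (LINT y|lborel. (R2 y - of_real t * ?w y) * \<psi> y)"
        unfolding integration_by_parts_test[OF smR(1) \<psi>] pR ..
      also have "(LINT y|lborel. (R2 y - of_real t * ?w y) * \<psi> y) = (LINT y|lborel. R2 y * \<psi> y - of_real t * (?w y * \<psi> y))"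
        by (simp add: left_diff_distrib mult.assoc)
      also have "\<dots> = (LINT y|lborel. R2 y * \<psi> y) - of_real t * ?I"
        by (subst Bochner_Integration.integral_diff) (use int[OF smR(2) \<psi>] int[OF sw \<psi>] in auto)
      finally have "of_real t * ?I = (LINT y|lborel. R1 y * partial i \<psi> y) + (LINT y|lborel. R2 y * \<psi> y)"
        by (simp add: algebra_simps)
      then have "norm (of_real t * ?I) = norm ((LINT y|lborel. R1 y * partial i \<psi> y) + (LINT y|lborel. R2 y * \<psi> y))"
        by (rule arg_cong)
      then have "t * norm ?I = norm ((LINT y|lborel. R1 y * partial i \<psi> y) + (LINT y|lborel. R2 y * \<psi> y))"
        unfolding norm_mult norm_of_real abs_of_pos[OF t] .
      also have "\<dots> \<le> A * t\<^sup>2 * (LINT y|lborel. norm (partial i \<psi> y)) + B * t\<^sup>2 * (LINT y|lborel. norm (\<psi> y))"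
        by (intro order_trans[OF norm_triangle_ineq] add_mono bound smR \<psi> test_functions_partial nR)
      also have "\<dots> = t * (t * S)" by (simp add: S_def algebra_simps power2_eq_square)
      finally show ?thesis using t by simp
    qed
    note le = this
    have "norm ?I \<le> 0 + e" if "e > 0" for e
    proof -
      have "norm ?I \<le> e / (S + 1) * S" using le[of "e / (S + 1)"] S0 that by simp
      also have "\<dots> \<le> e" using S0 that by (simp add: field_simps)
      finally show ?thesis by simp
    qed
    then have "norm ?I \<le> 0" by (rule field_le_epsilon)
    then show "?I = 0" by simp
  qed
  then show ?thesis
    using continuous_AE_eq_open[of UNIV ?w "\<lambda>_. 0" y] smooth_fun_continuous[OF test_functions_smooth[OF wt]] by simp
qed

section \<open>The free resolvent on test functions\<close>

context helmholtz begin

text \<open>The difference \<open>y - u\<close> sits in the test function, so derivatives fall on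
  \<open>\<psi>\<close> and the singular kernel is never differentiated.\<close>

definition conv :: "(plane \<Rightarrow> complex) \<Rightarrow> plane \<Rightarrow> complex" where
  "conv \<psi> y = (LINT u|lborel. G 0 u * \<psi> (y - u))"

lemma reflect_test: "\<psi> \<in> test_functions UNIV \<Longrightarrow> (\<lambda>u. \<psi> (y - u)) \<in> test_functions UNIV"
  using test_functions_affine[of \<psi> "-1" y] by simp

lemma conv_integrable: "\<psi> \<in> test_functions UNIV \<Longrightarrow> integrable lborel (\<lambda>u. G 0 u * \<psi> (y - u))"
  by (intro L2_mult_integrable G_L2 test_functions_L2[OF reflect_test])

lemma conv_diff:
  "\<phi> \<in> test_functions UNIV \<Longrightarrow> \<psi> \<in> test_functions UNIV \<Longrightarrow> conv (\<lambda>y. \<phi> y - \<psi> y) y = conv \<phi> y - conv \<psi> y"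
  unfolding conv_def using conv_integrable by (simp add: right_diff_distrib)

lemma conv_combination:
  "\<phi> \<in> test_functions UNIV \<Longrightarrow> \<psi> \<in> test_functions UNIV \<Longrightarrow> conv (\<lambda>y. \<phi> y + c * \<psi> y) y = conv \<phi> y + c * conv \<psi> y"
  unfolding conv_def using conv_integrable by (simp add: distrib_left mult.left_commute[of _ c])

lemma norm_conv_le: "\<psi> \<in> test_functions UNIV \<Longrightarrow> norm (conv \<psi> y) \<le> L2_norm (G 0) * L2_norm \<psi>"
  using L2_Cauchy_Schwarz[OF G_L2 test_functions_L2[OF reflect_test], of \<psi> 0 y] L2_reflect(2)[OF test_functions_L2, of \<psi> UNIV y]
  unfolding conv_def by simp

lemma conv_has_derivative:
  assumes \<psi>: "\<psi> \<in> test_functions UNIV"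
  shows "(conv \<psi> has_derivative (\<lambda>h. \<Sum>i\<in>UNIV. (h $ i) *\<^sub>R conv (partial i \<psi>) y)) (at y)"
proof -
  obtain A where A: "A \<ge> 0" "\<And>y h. norm (\<psi> (y + h) - \<psi> y - (\<Sum>i\<in>UNIV. (h $ i) *\<^sub>R partial i \<psi> y)) \<le> A * (norm h)\<^sup>2"
    by (rule test_function_taylor[OF \<psi>]) iprover
  show ?thesis
  proof (rule has_derivative_quadraticI)
    show "bounded_linear (\<lambda>h. \<Sum>i\<in>UNIV. (h $ i) *\<^sub>R conv (partial i \<psi>) y)"
      by (intro bounded_linear_sum bounded_linear_scaleR_const bounded_linear_vec_nth)
    fix h :: plane
    note i1 = conv_integrable[OF \<psi>] and i2 = conv_integrable[OF test_functions_partial[OF \<psi>]]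
    have "conv \<psi> (y + h) - conv \<psi> y - (\<Sum>i\<in>UNIV. (h $ i) *\<^sub>R conv (partial i \<psi>) y)
       = (LINT u|lborel. G 0 u * (\<psi> ((y - u) + h) - \<psi> (y - u) - (\<Sum>i\<in>UNIV. (h $ i) *\<^sub>R partial i \<psi> (y - u))))"
    proof -
      have iS: "integrable lborel (\<lambda>u. \<Sum>i\<in>UNIV. (h $ i) *\<^sub>R (G 0 u * partial i \<psi> (y - u)))"
        by (intro Bochner_Integration.integrable_sum Bochner_Integration.integrable_scaleR_right i2)
      have "(\<Sum>i\<in>UNIV. (h $ i) *\<^sub>R conv (partial i \<psi>) y) = (LINT u|lborel. (\<Sum>i\<in>UNIV. (h $ i) *\<^sub>R (G 0 u * partial i \<psi> (y - u))))"
        unfolding conv_def using i2 by (subst Bochner_Integration.integral_sum) auto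
      then have "conv \<psi> (y + h) - conv \<psi> y - (\<Sum>i\<in>UNIV. (h $ i) *\<^sub>R conv (partial i \<psi>) y)
        = (LINT u|lborel. G 0 u * \<psi> (y + h - u) - G 0 u * \<psi> (y - u) - (\<Sum>i\<in>UNIV. (h $ i) *\<^sub>R (G 0 u * partial i \<psi> (y - u))))"
        unfolding Bochner_Integration.integral_diff[OF Bochner_Integration.integrable_diff[OF i1 i1] iS]
          Bochner_Integration.integral_diff[OF i1 i1] by (simp add: conv_def)
      also have "\<dots> = (LINT u|lborel. G 0 u * (\<psi> ((y - u) + h) - \<psi> (y - u) - (\<Sum>i\<in>UNIV. (h $ i) *\<^sub>R partial i \<psi> (y - u))))"
        by (intro Bochner_Integration.integral_cong refl) (simp add: right_diff_distrib sum_distrib_left algebra_simps)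
      finally show ?thesis .
    qed
    also have "norm \<dots> \<le> (LINT u|lborel. norm (G 0 u) * (A * (norm h)\<^sup>2))"
    proof (rule order_trans[OF integral_norm_bound], rule integral_mono')
      show "integrable lborel (\<lambda>u. norm (G 0 u) * (A * (norm h)\<^sup>2))" using G_integrable by simp
      show "norm (G 0 u * (\<psi> ((y - u) + h) - \<psi> (y - u) - (\<Sum>i\<in>UNIV. (h $ i) *\<^sub>R partial i \<psi> (y - u)))) \<le> norm (G 0 u) * (A * (norm h)\<^sup>2)" for u
        unfolding norm_mult by (intro mult_left_mono A(2)) simp
    qed (use A(1) in simp)
    also have "\<dots> = (LINT u|lborel. norm (G 0 u)) * A * (norm h)\<^sup>2" by simp
    finally show "norm (conv \<psi> (y + h) - conv \<psi> y - (\<Sum>i\<in>UNIV. (h $ i) *\<^sub>R conv (partial i \<psi>) y)) \<le> (LINT u|lborel. norm (G 0 u)) * A * (norm h)\<^sup>2" .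
  qed
qed

lemma partial_conv:
  assumes \<psi>: "\<psi> \<in> test_functions UNIV" shows "partial i (conv \<psi>) = conv (partial i \<psi>)"
proof
  fix y
  have "(\<Sum>k\<in>UNIV. (axis i 1 $ k) *\<^sub>R conv (partial k \<psi>) y) = (\<Sum>k\<in>UNIV. if k = i then conv (partial i \<psi>) y else 0)"
    by (intro sum.cong) (auto simp: axis_def)
  then show "partial i (conv \<psi>) y = conv (partial i \<psi>) y"
    using partial_eqI[OF conv_has_derivative[OF \<psi>], of i y] by simp
qed

lemma smooth_fun_conv:
  assumes "\<psi> \<in> test_functions UNIV" shows "smooth_fun (conv \<psi>)"
proof -
  have d: "conv \<psi> differentiable (at y)" if "\<psi> \<in> test_functions UNIV" for \<psi> y
    using conv_has_derivative[OF that] unfolding differentiable_def by blast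
  have "C_k k (conv \<psi>)" if "\<psi> \<in> test_functions UNIV" for k \<psi>
    using that
  proof (induction k arbitrary: \<psi>)
    case 0
    then show ?case using d by (auto simp: continuous_on_eq_continuous_at intro!: differentiable_imp_continuous_within)
  next
    case (Suc k)
    then show ?case using d by (simp add: differentiable_on_def partial_conv test_functions_partial)
  qed
  then show ?thesis using assms by (simp add: smooth_fun_def)
qed

text \<open>Peetre's inequality distributes the weight \<open>1 + (norm y)\<^sup>2\<close> over the
  kernel, where it is integrable by \<open>G_weighted_integrable\<close>, and over the test
  function, where it is bounded. The convolution therefore decays like the inverse weight, which is
  square integrable in the plane.\<close>

lemma conv_L2:
  assumes \<psi>: "\<psi> \<in> test_functions UNIV" shows "conv \<psi> \<in> L2"
proof -
  note sm = test_functions_smooth[OF \<psi>]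
  have "smooth_fun (\<lambda>v. 1 + complex_of_real ((norm (v - 0))\<^sup>2))" by (intro smooth_intros)
  then have t: "(\<lambda>v. (1 + complex_of_real ((norm (v - 0))\<^sup>2)) * \<psi> v) \<in> test_functions UNIV"
    by (rule test_functions_mult[OF \<psi>])
  obtain N where N: "N \<ge> 0" "\<And>v. norm ((1 + complex_of_real ((norm (v - 0))\<^sup>2)) * \<psi> v) \<le> N"
    by (rule test_functions_bounded[OF t]) iprover
  have N': "(1 + (norm v)\<^sup>2) * norm (\<psi> v) \<le> N" for v
  proof -
    have "norm (1 + complex_of_real ((norm (v - 0))\<^sup>2)) = 1 + (norm v)\<^sup>2"
    proof -
      have "1 + complex_of_real ((norm (v - 0))\<^sup>2) = complex_of_real (1 + (norm v)\<^sup>2)" by simp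
      then show ?thesis by (simp only: norm_of_real) simp
    qed
    then show ?thesis using N(2)[of v] by (simp add: norm_mult)
  qed
  define D where "D = (LINT u|lborel. 2 * N * ((1 + (norm u)\<^sup>2) * norm (G 0 u)))"
  have peetre: "1 + (norm y)\<^sup>2 \<le> 2 * (1 + (norm u)\<^sup>2) * (1 + (norm (y - u))\<^sup>2)" for u y :: plane
  proof -
    have "(norm y)\<^sup>2 \<le> (norm u + norm (y - u))\<^sup>2"
      using norm_triangle_ineq[of u "y - u"] by (intro power_mono) auto
    also have "\<dots> \<le> 2 * (norm u)\<^sup>2 + 2 * (norm (y - u))\<^sup>2"
      using sum_squares_bound[of "norm u" "norm (y - u)"] by (simp add: power2_sum)
    finally have "1 + (norm y)\<^sup>2 \<le> 2 + 2 * (norm u)\<^sup>2 + 2 * (norm (y - u))\<^sup>2 + 2 * ((norm u)\<^sup>2 * (norm (y - u))\<^sup>2)"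
      using mult_nonneg_nonneg[OF zero_le_power2[of "norm u"] zero_le_power2[of "norm (y - u)"]] by linarith
    then show ?thesis by (simp add: algebra_simps)
  qed
  have bnd: "(1 + (norm y)\<^sup>2) * norm (conv \<psi> y) \<le> D" for y
  proof -
    have "(1 + (norm y)\<^sup>2) * norm (conv \<psi> y) \<le> (1 + (norm y)\<^sup>2) * (LINT u|lborel. norm (G 0 u * \<psi> (y - u)))"
      unfolding conv_def by (intro mult_left_mono integral_norm_bound) simp
    also have "\<dots> = (LINT u|lborel. (1 + (norm y)\<^sup>2) * norm (G 0 u * \<psi> (y - u)))" by simp
    also have "\<dots> \<le> D" unfolding D_def
    proof (rule integral_mono)
      show "integrable lborel (\<lambda>u. (1 + (norm y)\<^sup>2) * norm (G 0 u * \<psi> (y - u)))"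
        using conv_integrable[OF \<psi>] by simp
      show "integrable lborel (\<lambda>u. 2 * N * ((1 + (norm u)\<^sup>2) * norm (G 0 u)))"
        using G_weighted_integrable by simp
      fix u
      have "(1 + (norm y)\<^sup>2) * norm (\<psi> (y - u)) \<le> 2 * (1 + (norm u)\<^sup>2) * (1 + (norm (y - u))\<^sup>2) * norm (\<psi> (y - u))"
        by (intro mult_right_mono peetre) simp
      also have "\<dots> = 2 * (1 + (norm u)\<^sup>2) * ((1 + (norm (y - u))\<^sup>2) * norm (\<psi> (y - u)))" by simp
      also have "\<dots> \<le> 2 * (1 + (norm u)\<^sup>2) * N" by (intro mult_left_mono N') auto
      finally have "norm (G 0 u) * ((1 + (norm y)\<^sup>2) * norm (\<psi> (y - u))) \<le> norm (G 0 u) * (2 * (1 + (norm u)\<^sup>2) * N)"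
        by (intro mult_left_mono) auto
      then show "(1 + (norm y)\<^sup>2) * norm (G 0 u * \<psi> (y - u)) \<le> 2 * N * ((1 + (norm u)\<^sup>2) * norm (G 0 u))"
        by (simp only: norm_mult mult_ac)
    qed
    finally show ?thesis .
  qed
  show ?thesis
  proof (rule L2_bound)
    show "conv \<psi> \<in> borel_measurable borel" by (rule smooth_fun_measurable[OF smooth_fun_conv[OF \<psi>]])
    show "integrable lborel (\<lambda>y::plane. D\<^sup>2 * (1 / (1 + (norm y)\<^sup>2)\<^sup>2))"
      by (intro integrable_mult_right plane_integral_inverse_sq)
    fix y :: plane
    have "1 + (norm y)\<^sup>2 > 0" by (simp add: add_pos_nonneg)
    then have "norm (conv \<psi> y) \<le> D / (1 + (norm y)\<^sup>2)" using bnd[of y] by (simp add: pos_le_divide_eq mult.commute)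
    then have "(norm (conv \<psi> y))\<^sup>2 \<le> (D / (1 + (norm y)\<^sup>2))\<^sup>2" by (intro power_mono) auto
    then show "(norm (conv \<psi> y))\<^sup>2 \<le> D\<^sup>2 * (1 / (1 + (norm y)\<^sup>2)\<^sup>2)" by (simp add: power_divide)
  qed
qed

lemma lap_conv:
  assumes \<psi>: "\<psi> \<in> test_functions UNIV"
  shows "lap (conv \<psi>) y = - \<psi> y - zz * conv \<psi> y"
proof -
  note sm = test_functions_smooth[OF \<psi>]
  have "lap (conv \<psi>) y = (\<Sum>i\<in>UNIV. conv (partial i (partial i \<psi>)) y)"
    unfolding lap_def by (simp add: partial_conv \<psi> test_functions_partial)
  also have "\<dots> = conv (lap \<psi>) y"
    unfolding conv_def lap_def sum_distrib_left
    by (rule Bochner_Integration.integral_sum[symmetric]) (intro conv_integrable test_functions_partial \<psi>)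
  finally have "lap (conv \<psi>) y + zz * conv \<psi> y = conv (\<lambda>y. lap \<psi> y + zz * \<psi> y) y"
    by (simp add: conv_combination \<psi> test_functions_lap)
  also have "\<dots> = (LINT u|lborel. G 0 u * (lap (\<lambda>u. \<psi> (y - u)) u + zz * \<psi> (y - u)))"
  proof -
    have "lap (\<lambda>u. \<psi> (y - u)) u = lap \<psi> (y - u)" for u
      using lap_affine[OF sm, of "-1" y u] by simp
    then show ?thesis by (simp add: conv_def)
  qed
  also have "\<dots> = - \<psi> y" using fundamental_solution[OF reflect_test[OF \<psi>], of 0 y] by simp
  finally show ?thesis by (simp add: algebra_simps)
qed

text \<open>The distance of the spectral parameter to the half-line; its reciprocal becomes the
  bound of the free resolvent.\<close>

definition gap :: real where "gap = infdist zz (complex_of_real ` {0..})"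

lemma gap_pos: "gap > 0"
proof -
  have "zz \<notin> complex_of_real ` {0..}"
  proof
    assume "zz \<in> complex_of_real ` {0..}"
    then obtain t where t: "t \<ge> 0" "zz = of_real t" by auto
    then have "Im (lam\<^sup>2) = 0" "Re (lam\<^sup>2) = - t" by (auto simp: zz_def minus_equation_iff[of "lam\<^sup>2"] complex_eq_iff)
    then have "Im lam = 0" "(Re lam)\<^sup>2 - (Im lam)\<^sup>2 = - t" using lam by (auto simp: power2_eq_square)
    moreover have "(Re lam)\<^sup>2 > 0" using lam by simp
    ultimately show False using t by simp
  qed
  moreover have "closed (complex_of_real ` {0..})"
    by (rule closed_injective_linear_image) (auto simp: inj_on_def intro: bounded_linear.linear bounded_linear_of_real)
  ultimately show ?thesis unfolding gap_def using infdist_pos_not_in_closed by fastforce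
qed

text \<open>Homogeneous form of the distance: for positive \<open>N\<close> the point
  \<open>T / N\<close> lies on the half-line, and multiplying by \<open>N\<close> avoids the
  division in the energy estimate.\<close>

lemma gap_le: "T \<ge> 0 \<Longrightarrow> N \<ge> 0 \<Longrightarrow> gap * N \<le> norm (of_real T - zz * of_real N)"
proof (cases "N = 0")
  case False
  assume "T \<ge> 0" "N \<ge> 0"
  then have N: "N > 0" using False by simp
  have "gap \<le> dist zz (of_real (T / N))"
    unfolding gap_def by (rule infdist_le) (rule imageI, use \<open>T \<ge> 0\<close> N in simp)
  then have "gap * N \<le> norm (of_real (T / N) - zz) * norm (complex_of_real N)"
    using N by (simp add: dist_norm norm_minus_commute)
  also have "\<dots> = norm (of_real T - zz * of_real N)"
  proof -
    have "(of_real (T / N) - zz) * complex_of_real N = of_real T - zz * of_real N"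
      using N by (simp add: left_diff_distrib)
    then show ?thesis by (metis norm_mult)
  qed
  finally show ?thesis .
qed simp

lemma L2_norm_sq_cnj: "f \<in> L2 \<Longrightarrow> (LINT y|lborel. f y * cnj (f y)) = of_real ((L2_norm f)\<^sup>2)"
  unfolding L2_norm_sq complex_norm_square[symmetric] by (rule integral_complex_of_real)

lemma partial_cnj_smooth: "smooth_fun f \<Longrightarrow> partial i (\<lambda>y. cnj (f y)) = (\<lambda>y. cnj (partial i f y))"
  using partial_cnj smooth_fun_differentiable by blast

text \<open>Pairing \<open>- lap f - zz * f = \<psi>\<close> with the conjugate of \<open>f\<close>
  gives \<open>T - zz * N\<close>, with \<open>T\<close> and \<open>N\<close> the squared norms of
  the gradient and of \<open>f\<close>; \<open>gap_le\<close> bounds \<open>N\<close>, and then the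
  equation bounds \<open>T\<close>. Two integrations by parts identify the sum of the squared norms
  of all second derivatives with the squared norm of \<open>lap f\<close>, which the equation
  controls.\<close>

lemma conv_energy:
  obtains C where "C \<ge> 0" "\<And>\<psi>. \<psi> \<in> test_functions UNIV \<Longrightarrow> gap * L2_norm (conv \<psi>) \<le> L2_norm \<psi>"
    "\<And>\<psi> i. \<psi> \<in> test_functions UNIV \<Longrightarrow> L2_norm (partial i (conv \<psi>)) \<le> C * L2_norm \<psi>"
    "\<And>\<psi> i j. \<psi> \<in> test_functions UNIV \<Longrightarrow> L2_norm (partial j (partial i (conv \<psi>))) \<le> C * L2_norm \<psi>"
proof -
  \<comment> \<open>The square root bounds the gradient through \<open>T\<close>, and
    \<open>1 + norm zz / gap\<close> bounds \<open>lap f\<close>; the sum serves both.\<close>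
  define C where "C = 1 + norm zz / gap + sqrt (1 / gap + norm zz / gap\<^sup>2)"
  have gp: "gap > 0" by (rule gap_pos)
  have C0: "C \<ge> 0" "1 + norm zz / gap \<le> C" "sqrt (1 / gap + norm zz / gap\<^sup>2) \<le> C"
    using gp by (auto simp: C_def)
  have main: "gap * L2_norm (conv \<psi>) \<le> L2_norm \<psi> \<and> L2_norm (partial i (conv \<psi>)) \<le> C * L2_norm \<psi> \<and>
      L2_norm (partial j (partial i (conv \<psi>))) \<le> C * L2_norm \<psi>" if \<psi>: "\<psi> \<in> test_functions UNIV" for \<psi> i j
  proof -
    define f where "f = conv \<psi>"
    note tp = test_functions_partial
    have L: "f \<in> L2" "partial i f \<in> L2" "partial j (partial i f) \<in> L2" "partial k (partial j (partial i f)) \<in> L2" for i j k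
      unfolding f_def by (simp_all add: partial_conv \<psi> tp conv_L2)
    have sm: "smooth_fun f" by (simp add: f_def smooth_fun_conv \<psi>)
    have lapf: "lap f = (\<lambda>y. - \<psi> y - zz * f y)" unfolding f_def using lap_conv[OF \<psi>] by blast
    note \<psi>L = test_functions_L2[OF \<psi>]
    have ibp: "(LINT y|lborel. u y * cnj (partial i v y)) = - (LINT y|lborel. partial i u y * cnj (v y))"
      if "smooth_fun u" "smooth_fun v" "u \<in> L2" "v \<in> L2" "partial i u \<in> L2" "partial i v \<in> L2" for u v i
    proof -
      have "(LINT y|lborel. u y * partial i (\<lambda>y. cnj (v y)) y) = - (LINT y|lborel. partial i u y * cnj (v y))"
        by (rule integration_by_parts_L2) (simp_all add: that smooth_fun_cnj L2_cnj partial_cnj_smooth)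
      then show ?thesis by (simp add: partial_cnj_smooth that)
    qed
    define T where "T = (\<Sum>i\<in>UNIV. (L2_norm (partial i f))\<^sup>2)"
    define N where "N = (L2_norm f)\<^sup>2"
    have T0: "T \<ge> 0" by (simp add: T_def sum_nonneg)
    have "of_real T = (\<Sum>i\<in>UNIV. LINT y|lborel. partial i f y * cnj (partial i f y))"
      by (simp add: T_def L2_norm_sq_cnj L)
    also have "\<dots> = (\<Sum>i\<in>UNIV. - (LINT y|lborel. partial i (partial i f) y * cnj (f y)))"
      by (intro sum.cong refl ibp) (use sm L in auto)
    also have "\<dots> = - (LINT y|lborel. lap f y * cnj (f y))"
      unfolding lap_def sum_distrib_right sum_negf
      by (subst Bochner_Integration.integral_sum) (auto intro!: L2_mult_integrable L2_cnj L)
    also have "(LINT y|lborel. lap f y * cnj (f y)) = (LINT y|lborel. - (\<psi> y * cnj (f y)) - zz * (f y * cnj (f y)))"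
      unfolding lapf by (simp add: algebra_simps)
    also have "\<dots> = - (LINT y|lborel. \<psi> y * cnj (f y)) - zz * of_real N"
      unfolding N_def L2_norm_sq_cnj[OF L(1), symmetric]
      using L2_mult_integrable[OF \<psi>L L2_cnj[OF L(1)]] L2_mult_integrable[OF L(1) L2_cnj[OF L(1)]]
      by (subst Bochner_Integration.integral_diff) auto
    finally have TN: "of_real T - zz * of_real N = (LINT y|lborel. \<psi> y * cnj (f y))" by simp
    have cs: "norm (LINT y|lborel. \<psi> y * cnj (f y)) \<le> L2_norm \<psi> * L2_norm f"
      using L2_Cauchy_Schwarz[OF \<psi>L L2_cnj[OF L(1)]] by simp
    have "gap * N \<le> norm (of_real T - zz * of_real N)" by (rule gap_le) (simp_all add: T0 N_def)
    then have "gap * N \<le> L2_norm \<psi> * L2_norm f" unfolding TN using cs by (rule order_trans)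
    then have "gap * (L2_norm f)\<^sup>2 \<le> L2_norm \<psi> * L2_norm f" by (simp only: N_def)
    then have 1: "gap * L2_norm f \<le> L2_norm \<psi>"
      using L2_norm_ge_0[of f] L2_norm_ge_0[of \<psi>] by (cases "L2_norm f = 0") (auto simp: power2_eq_square)
    then have fle: "L2_norm f \<le> L2_norm \<psi> / gap" using gp by (simp add: pos_le_divide_eq mult.commute)
    have "T = norm (zz * of_real N + (LINT y|lborel. \<psi> y * cnj (f y)))"
      using TN T0 by (metis abs_of_nonneg diff_add_cancel add.commute norm_of_real)
    also have "\<dots> \<le> norm zz * N + L2_norm \<psi> * L2_norm f"
    proof -
      have "norm (zz * of_real N) = norm zz * N" by (simp add: norm_mult N_def norm_power)
      then show ?thesis using norm_triangle_ineq[of "zz * of_real N" "LINT y|lborel. \<psi> y * cnj (f y)"] cs by linarith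
    qed
    also have "\<dots> \<le> norm zz * (L2_norm \<psi> / gap)\<^sup>2 + L2_norm \<psi> * (L2_norm \<psi> / gap)"
      unfolding N_def by (intro add_mono mult_left_mono power_mono fle) auto
    also have "\<dots> = (1 / gap + norm zz / gap\<^sup>2) * (L2_norm \<psi>)\<^sup>2"
      by (simp add: power_divide power2_eq_square algebra_simps)
    finally have Tle: "T \<le> (1 / gap + norm zz / gap\<^sup>2) * (L2_norm \<psi>)\<^sup>2" .
    have 2: "L2_norm (partial i f) \<le> C * L2_norm \<psi>"
    proof -
      have "(L2_norm (partial i f))\<^sup>2 \<le> T" unfolding T_def by (rule member_le_sum) auto
      then have "L2_norm (partial i f) \<le> sqrt ((1 / gap + norm zz / gap\<^sup>2) * (L2_norm \<psi>)\<^sup>2)"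
        using Tle by (intro real_le_rsqrt) simp
      also have "\<dots> = sqrt (1 / gap + norm zz / gap\<^sup>2) * L2_norm \<psi>" by (simp add: real_sqrt_mult)
      also have "\<dots> \<le> C * L2_norm \<psi>" by (intro mult_right_mono C0) simp
      finally show ?thesis .
    qed
    have second: "(\<Sum>i\<in>UNIV. \<Sum>j\<in>UNIV. (L2_norm (partial j (partial i f)))\<^sup>2) = (L2_norm (lap f))\<^sup>2"
    proof -
      have lapL: "lap f \<in> L2" unfolding lapf using L2_diff[OF L2_cmult[OF \<psi>L, of "-1"] L2_cmult[OF L(1)]] by simp
      have eq: "(LINT y|lborel. partial j (partial i f) y * cnj (partial j (partial i f) y)) = (LINT y|lborel. partial i (partial i f) y * cnj (partial j (partial j f) y))" for i j
      proof -
        have "(LINT y|lborel. partial j (partial i f) y * cnj (partial j (partial i f) y)) = - (LINT y|lborel. partial i f y * cnj (partial j (partial j (partial i f)) y))"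
          using ibp[of "partial i f" "partial j (partial i f)" j] sm L by simp
        also have "partial j (partial j (partial i f)) = partial i (partial j (partial j f))"
        proof -
          have "partial j (partial i f) = conv (partial j (partial i \<psi>))" "partial j f = conv (partial j \<psi>)"
            unfolding f_def by (simp_all add: partial_conv \<psi> tp)
          moreover have "partial j (partial i \<psi>) = partial i (partial j \<psi>)"
            using test_function_partial_commute[OF \<psi>] by blast
          moreover have "partial j (partial i (partial j \<psi>)) = partial i (partial j (partial j \<psi>))"
            using test_function_partial_commute[OF tp[OF \<psi>]] by blast
          ultimately show ?thesis by (simp add: partial_conv \<psi> tp)
        qed
        also have "- (LINT y|lborel. partial i f y * cnj (partial i (partial j (partial j f)) y)) = (LINT y|lborel. partial i (partial i f) y * cnj (partial j (partial j f) y))"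
          using ibp[of "partial i f" "partial j (partial j f)" i] sm L by simp
        finally show ?thesis .
      qed
      have "complex_of_real (\<Sum>i\<in>UNIV. \<Sum>j\<in>UNIV. (L2_norm (partial j (partial i f)))\<^sup>2)
         = (\<Sum>i\<in>UNIV. \<Sum>j\<in>UNIV. (LINT y|lborel. partial j (partial i f) y * cnj (partial j (partial i f) y)))"
        by (simp add: L2_norm_sq_cnj L)
      also have "\<dots> = (\<Sum>i\<in>UNIV. \<Sum>j\<in>UNIV. (LINT y|lborel. partial i (partial i f) y * cnj (partial j (partial j f) y)))"
        unfolding eq ..
      also have "\<dots> = (LINT y|lborel. (\<Sum>i\<in>UNIV. \<Sum>j\<in>UNIV. partial i (partial i f) y * cnj (partial j (partial j f) y)))"
        by (subst Bochner_Integration.integral_sum, auto intro!: L2_mult_integrable L2_cnj L integrable_sum)+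
      also have "\<dots> = (LINT y|lborel. lap f y * cnj (lap f y))"
        by (simp add: lap_def sum_product)
      also have "\<dots> = of_real ((L2_norm (lap f))\<^sup>2)" by (rule L2_norm_sq_cnj[OF lapL])
      finally show ?thesis by (simp only: of_real_eq_iff)
    qed
    have 3: "L2_norm (partial j (partial i f)) \<le> C * L2_norm \<psi>"
    proof -
      have "(L2_norm (partial j (partial i f)))\<^sup>2 \<le> (\<Sum>j\<in>UNIV. (L2_norm (partial j (partial i f)))\<^sup>2)"
        by (rule member_le_sum) auto
      also have "\<dots> \<le> (\<Sum>i\<in>UNIV. \<Sum>j\<in>UNIV. (L2_norm (partial j (partial i f)))\<^sup>2)"
        by (rule member_le_sum[of i UNIV "\<lambda>i. \<Sum>j\<in>UNIV. (L2_norm (partial j (partial i f)))\<^sup>2"]) (auto simp: sum_nonneg)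
      finally have "L2_norm (partial j (partial i f)) \<le> L2_norm (lap f)"
        unfolding second by (rule power2_le_imp_le) simp
      also have "\<dots> \<le> L2_norm \<psi> + norm zz * L2_norm f"
        unfolding lapf using L2_norm_triangle_diff[OF L2_cmult[OF \<psi>L, of "-1"] L2_cmult[OF L(1), of zz]] L2_norm_cmult[of "-1" \<psi>]
        by (simp add: L2_norm_cmult)
      also have "\<dots> \<le> L2_norm \<psi> + norm zz * (L2_norm \<psi> / gap)" by (intro add_left_mono mult_left_mono fle) simp
      also have "\<dots> = (1 + norm zz / gap) * L2_norm \<psi>" by (simp add: algebra_simps)
      also have "\<dots> \<le> C * L2_norm \<psi>" by (intro mult_right_mono C0) simp
      finally show ?thesis .
    qed
    show ?thesis using 1 2 3 unfolding f_def by blast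
  qed
  show ?thesis by (rule that[OF C0(1)]) (use main in blast)+
qed

end

section \<open>Solvability and uniqueness\<close>

context helmholtz begin

text \<open>The solution is the limit of \<open>conv (\<psi> n)\<close> for test functions \<open>\<psi> n\<close> converging to \<open>h\<close>; the energy
  estimates carry the second derivatives to the limit, the bound by \<open>L2_norm (G 0)\<close> the continuity.\<close>

lemma resolvent_exists:
  assumes h: "h \<in> L2"
  obtains f g where "\<And>X. (f, \<lambda>y. h y + zz * f y) \<in> H_star X" "continuous_on UNIV g"
    "AE y in lborel. f y = g y" "gap * L2_norm f \<le> L2_norm h"
proof -
  obtain C where C: "C \<ge> 0" "\<And>\<psi>. \<psi> \<in> test_functions UNIV \<Longrightarrow> gap * L2_norm (conv \<psi>) \<le> L2_norm \<psi>"
    "\<And>\<psi> i. \<psi> \<in> test_functions UNIV \<Longrightarrow> L2_norm (partial i (conv \<psi>)) \<le> C * L2_norm \<psi>"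
    "\<And>\<psi> i j. \<psi> \<in> test_functions UNIV \<Longrightarrow> L2_norm (partial j (partial i (conv \<psi>))) \<le> C * L2_norm \<psi>"
    by (rule conv_energy) iprover
  have gp: "gap > 0" by (rule gap_pos)
  \<comment> \<open>The rate is halved so that consecutive differences are below
    \<open>(1/4) ^ n\<close>, the form that \<open>L2_complete\<close> expects.\<close>
  have "\<exists>\<psi>\<in>test_functions UNIV. L2_norm (\<lambda>y. h y - \<psi> y) < (1/4) ^ n / 2" for n :: nat
  proof -
    have "(1/4) ^ n / 2 > (0::real)" by simp
    then show ?thesis using test_functions_dense[OF h] unfolding test_approx_def by blast
  qed
  then obtain \<psi> where \<psi>: "\<And>n. \<psi> n \<in> test_functions UNIV" "\<And>n. L2_norm (\<lambda>y. h y - \<psi> n y) < (1/4) ^ n / 2" by metis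
  note \<psi>L = test_functions_L2[OF \<psi>(1)]
  define d where "d n = (\<lambda>y. \<psi> (Suc n) y - \<psi> n y)" for n
  have dt: "d n \<in> test_functions UNIV" for n unfolding d_def by (intro test_functions_diff \<psi>)
  have dn: "L2_norm (d n) \<le> (1/4) ^ n" for n
  proof -
    have "L2_norm (d n) = L2_norm (\<lambda>y. (h y - \<psi> n y) - (h y - \<psi> (Suc n) y))" by (simp add: d_def)
    also have "\<dots> \<le> L2_norm (\<lambda>y. h y - \<psi> n y) + L2_norm (\<lambda>y. h y - \<psi> (Suc n) y)"
      by (intro L2_norm_triangle_diff L2_diff h \<psi>L)
    also have "\<dots> \<le> (1/4) ^ n / 2 + (1/4) ^ Suc n / 2" using \<psi>(2)[of n] \<psi>(2)[of "Suc n"] by linarith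
    also have "\<dots> \<le> (1/4) ^ n" by simp
    finally show ?thesis .
  qed
  have \<psi>lim: "(\<lambda>n. L2_norm (\<lambda>y. \<psi> n y - h y)) \<longlonglongrightarrow> 0"
  proof (rule tendsto_sandwich[OF _ _ tendsto_const])
    have "(\<lambda>n. (1/4::real) ^ n) \<longlonglongrightarrow> 0" by (rule LIMSEQ_power_zero) simp
    then show "(\<lambda>n. (1/4::real) ^ n) \<longlonglongrightarrow> 0" .
    show "\<forall>\<^sub>F n in sequentially. L2_norm (\<lambda>y. \<psi> n y - h y) \<le> (1/4) ^ n"
    proof (rule always_eventually, rule allI)
      fix n
      have "(1/4::real) ^ n \<ge> 0" by simp
      then show "L2_norm (\<lambda>y. \<psi> n y - h y) \<le> (1/4) ^ n"
        using \<psi>(2)[of n] L2_norm_diff_commute[of h "\<psi> n"] by linarith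
    qed
  qed simp
  define F where "F n = conv (\<psi> n)" for n
  have smF: "smooth_fun (F n)" for n unfolding F_def by (rule smooth_fun_conv[OF \<psi>(1)])
  note tp = test_functions_partial
  have FL: "F n \<in> L2" "partial i (F n) \<in> L2" "partial j (partial i (F n)) \<in> L2" for n i j
    unfolding F_def by (simp_all add: partial_conv \<psi> tp conv_L2)
  have Fd: "F (Suc n) y - F n y = conv (d n) y" "partial i (F (Suc n)) y - partial i (F n) y = partial i (conv (d n)) y"
     "partial j (partial i (F (Suc n))) y - partial j (partial i (F n)) y = partial j (partial i (conv (d n))) y" for n i j y
  proof -
    have 1: "F (Suc n) y - F n y = conv (d n) y" for y unfolding F_def d_def by (simp add: conv_diff \<psi>)
    then have "conv (d n) = (\<lambda>y. F (Suc n) y - F n y)" by auto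
    moreover have 2: "partial i (\<lambda>y. u y - v y) = (\<lambda>y. partial i u y - partial i v y)" if "smooth_fun u" "smooth_fun v" for u v i
      using partial_diff smooth_fun_differentiable that by blast
    ultimately show "partial i (F (Suc n)) y - partial i (F n) y = partial i (conv (d n)) y"
     "partial j (partial i (F (Suc n))) y - partial j (partial i (F n)) y = partial j (partial i (conv (d n))) y"
      using smF by simp_all
    show "F (Suc n) y - F n y = conv (d n) y" by (rule 1)
  qed
  have cb: "C * L2_norm (d n) \<le> C * (1/4) ^ n" for n by (intro mult_left_mono dn C)
  have b0: "L2_norm (\<lambda>y. F (Suc n) y - F n y) \<le> (1 / gap) * (1/4) ^ n" for n
  proof -
    have "gap * L2_norm (conv (d n)) \<le> (1/4) ^ n" by (rule order_trans[OF C(2)[OF dt] dn])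
    then have "L2_norm (conv (d n)) \<le> (1/4) ^ n / gap" using gp by (simp only: pos_le_divide_eq mult.commute)
    then show ?thesis unfolding Fd by simp
  qed
  have b1: "L2_norm (\<lambda>y. partial i (F (Suc n)) y - partial i (F n) y) \<le> C * (1/4) ^ n" for n i
    unfolding Fd by (rule order_trans[OF C(3)[OF dt] cb])
  have b2: "L2_norm (\<lambda>y. partial j (partial i (F (Suc n))) y - partial j (partial i (F n)) y) \<le> C * (1/4) ^ n" for n i j
    unfolding Fd by (rule order_trans[OF C(4)[OF dt] cb])
  obtain f where f: "f \<in> L2" "AE y in lborel. (\<lambda>n. F n y) \<longlonglongrightarrow> f y" "(\<lambda>n. L2_norm (\<lambda>y. F n y - f y)) \<longlonglongrightarrow> 0"
    by (rule L2_complete[of F, OF FL(1) b0]) iprover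
  have "\<forall>i. \<exists>v. v \<in> L2 \<and> (\<lambda>n. L2_norm (\<lambda>y. partial i (F n) y - v y)) \<longlonglongrightarrow> 0"
  proof
    fix i
    show "\<exists>v. v \<in> L2 \<and> (\<lambda>n. L2_norm (\<lambda>y. partial i (F n) y - v y)) \<longlonglongrightarrow> 0"
    by (rule L2_complete[of "\<lambda>n. partial i (F n)", OF FL(2) b1]) iprover
  qed
  from choice[OF this] obtain v where "\<forall>i. v i \<in> L2 \<and> (\<lambda>n. L2_norm (\<lambda>y. partial i (F n) y - v i y)) \<longlonglongrightarrow> 0" ..
  then have v: "\<And>i. v i \<in> L2" "\<And>i. (\<lambda>n. L2_norm (\<lambda>y. partial i (F n) y - v i y)) \<longlonglongrightarrow> 0" by simp_all
  have "\<forall>i. \<forall>j. \<exists>w. w \<in> L2 \<and> (\<lambda>n. L2_norm (\<lambda>y. partial j (partial i (F n)) y - w y)) \<longlonglongrightarrow> 0"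
  proof (intro allI)
    fix i j
    show "\<exists>w. w \<in> L2 \<and> (\<lambda>n. L2_norm (\<lambda>y. partial j (partial i (F n)) y - w y)) \<longlonglongrightarrow> 0"
    by (rule L2_complete[of "\<lambda>n. partial j (partial i (F n))", OF FL(3) b2]) iprover
  qed
  from choice[OF allI[OF choice[OF spec[OF this]]]]
  obtain w where "\<forall>i j. w i j \<in> L2 \<and> (\<lambda>n. L2_norm (\<lambda>y. partial j (partial i (F n)) y - w i j y)) \<longlonglongrightarrow> 0" ..
  then have w: "\<And>i j. w i j \<in> L2" "\<And>i j. (\<lambda>n. L2_norm (\<lambda>y. partial j (partial i (F n)) y - w i j y)) \<longlonglongrightarrow> 0" by simp_all
  have wp1: "weak_partial \<Omega> i f (v i)" for \<Omega> i
    unfolding weak_partial_def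
  proof
    fix \<phi> assume \<phi>: "\<phi> \<in> test_functions \<Omega>"
    have "(\<lambda>n. LINT y|lborel. F n y * partial i \<phi> y) \<longlonglongrightarrow> (LINT y|lborel. f y * partial i \<phi> y)"
      by (rule L2_tendsto_integral[OF FL(1) f(1) test_functions_L2[OF tp[OF \<phi>]] f(3)])
    moreover have "(\<lambda>n. - (LINT y|lborel. partial i (F n) y * \<phi> y)) \<longlonglongrightarrow> - (LINT y|lborel. v i y * \<phi> y)"
      by (intro tendsto_minus L2_tendsto_integral[OF FL(2) v(1) test_functions_L2[OF \<phi>] v(2)])
    moreover have "(LINT y|lborel. F n y * partial i \<phi> y) = - (LINT y|lborel. partial i (F n) y * \<phi> y)" for n
      by (rule integration_by_parts_test[OF smF \<phi>])
    ultimately show "(LINT y|lborel. f y * partial i \<phi> y) = - (LINT y|lborel. v i y * \<phi> y)"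
      using LIMSEQ_unique by simp
  qed
  have wp2: "weak_partial \<Omega> j (v i) (w i j)" for \<Omega> i j
    unfolding weak_partial_def
  proof
    fix \<phi> assume \<phi>: "\<phi> \<in> test_functions \<Omega>"
    have "(\<lambda>n. LINT y|lborel. partial i (F n) y * partial j \<phi> y) \<longlonglongrightarrow> (LINT y|lborel. v i y * partial j \<phi> y)"
      by (rule L2_tendsto_integral[OF FL(2) v(1) test_functions_L2[OF tp[OF \<phi>]] v(2)])
    moreover have "(\<lambda>n. - (LINT y|lborel. partial j (partial i (F n)) y * \<phi> y)) \<longlonglongrightarrow> - (LINT y|lborel. w i j y * \<phi> y)"
      by (intro tendsto_minus L2_tendsto_integral[OF FL(3) w(1) test_functions_L2[OF \<phi>] w(2)])
    moreover have "(LINT y|lborel. partial i (F n) y * partial j \<phi> y) = - (LINT y|lborel. partial j (partial i (F n)) y * \<phi> y)" for n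
      by (rule integration_by_parts_test[OF smooth_fun_partial[OF smF] \<phi>])
    ultimately show "(LINT y|lborel. v i y * partial j \<phi> y) = - (LINT y|lborel. w i j y * \<phi> y)"
      using LIMSEQ_unique by simp
  qed
  have W22: "f \<in> W22_loc \<Omega>" for \<Omega>
    unfolding W22_loc_def using L2_imp_L2_loc[OF f(1)] L2_imp_L2_loc[OF v(1)] L2_imp_L2_loc[OF w(1)] wp1 wp2 by blast
  have wl: "weak_laplacian \<Omega> f (\<lambda>y. - (h y + zz * f y))" for \<Omega>
    unfolding weak_laplacian_def lap_def[symmetric]
  proof
    fix \<phi> assume \<phi>: "\<phi> \<in> test_functions \<Omega>"
    note \<phi>L = test_functions_L2[OF \<phi>]
    have l1: "(\<lambda>n. LINT y|lborel. F n y * lap \<phi> y) \<longlonglongrightarrow> (LINT y|lborel. f y * lap \<phi> y)"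
      by (rule L2_tendsto_integral[OF FL(1) f(1) test_functions_L2[OF test_functions_lap[OF \<phi>]] f(3)])
    have l2: "(\<lambda>n. - (LINT y|lborel. \<psi> n y * \<phi> y) - zz * (LINT y|lborel. F n y * \<phi> y))
       \<longlonglongrightarrow> - (LINT y|lborel. h y * \<phi> y) - zz * (LINT y|lborel. f y * \<phi> y)"
      by (intro tendsto_intros L2_tendsto_integral[OF \<psi>L h \<phi>L \<psi>lim] L2_tendsto_integral[OF FL(1) f(1) \<phi>L f(3)])
    have l3: "(LINT y|lborel. F n y * lap \<phi> y) = - (LINT y|lborel. \<psi> n y * \<phi> y) - zz * (LINT y|lborel. F n y * \<phi> y)" for n
    proof -
      have "(LINT y|lborel. F n y * lap \<phi> y) = (LINT y|lborel. lap (F n) y * \<phi> y)" by (rule green_test[OF smF \<phi>])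
      also have "\<dots> = (LINT y|lborel. - (\<psi> n y * \<phi> y) - zz * (F n y * \<phi> y))"
        unfolding F_def by (simp add: lap_conv \<psi> algebra_simps)
      also have "\<dots> = - (LINT y|lborel. \<psi> n y * \<phi> y) - zz * (LINT y|lborel. F n y * \<phi> y)"
        using L2_mult_integrable[OF \<psi>L \<phi>L] L2_mult_integrable[OF FL(1) \<phi>L]
        by (subst Bochner_Integration.integral_diff) auto
      finally show ?thesis .
    qed
    have "(LINT y|lborel. f y * lap \<phi> y) = - (LINT y|lborel. h y * \<phi> y) - zz * (LINT y|lborel. f y * \<phi> y)"
      by (rule LIMSEQ_unique[OF l1[unfolded l3] l2])
    also have "\<dots> = (LINT y|lborel. - (h y * \<phi> y) - zz * (f y * \<phi> y))"
      using L2_mult_integrable[OF h \<phi>L] L2_mult_integrable[OF f(1) \<phi>L]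
      by (subst Bochner_Integration.integral_diff) auto
    also have "\<dots> = (LINT y|lborel. - (h y + zz * f y) * \<phi> y)"
      by (intro Bochner_Integration.integral_cong refl) (simp add: algebra_simps)
    finally show "(LINT y|lborel. f y * lap \<phi> y) = (LINT y|lborel. - (h y + zz * f y) * \<phi> y)" .
  qed
  have Hs: "(f, \<lambda>y. h y + zz * f y) \<in> H_star X" for X
    unfolding H_star_def using f(1) W22 wl L2_add[OF h L2_cmult[OF f(1)]] by auto
  have bound: "gap * L2_norm f \<le> L2_norm h"
  proof (rule tendsto_le[OF sequentially_bot])
    show "(\<lambda>n. gap * L2_norm (F n)) \<longlonglongrightarrow> gap * L2_norm f"
      by (intro tendsto_intros L2_tendsto_norm[OF FL(1) f(1) f(3)])
    show "(\<lambda>n. L2_norm (\<psi> n)) \<longlonglongrightarrow> L2_norm h" by (rule L2_tendsto_norm[OF \<psi>L h \<psi>lim])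
    show "\<forall>\<^sub>F n in sequentially. gap * L2_norm (F n) \<le> L2_norm (\<psi> n)" using C(2)[OF \<psi>(1)] by (simp add: F_def)
  qed
  define g where "g y = F 0 y + (\<Sum>n. conv (d n) y)" for y
  have ul: "uniform_limit UNIV (\<lambda>n y. \<Sum>i<n. conv (d i) y) (\<lambda>y. \<Sum>n. conv (d n) y) sequentially"
  proof (rule Weierstrass_m_test)
    show "norm (conv (d n) y) \<le> L2_norm (G 0) * (1/4) ^ n" for n y
      by (rule order_trans[OF norm_conv_le[OF dt] mult_left_mono[OF dn]]) simp
    show "summable (\<lambda>n. L2_norm (G 0) * (1/4) ^ n)" by (intro summable_mult summable_geometric) simp
  qed
  have "continuous_on UNIV (\<lambda>y. \<Sum>n. conv (d n) y)"
    by (rule uniform_limit_theorem[OF _ ul])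
       (intro always_eventually allI continuous_on_sum smooth_fun_continuous smooth_fun_conv[OF dt], simp)
  then have gc: "continuous_on UNIV g"
    unfolding g_def[abs_def] by (rule continuous_on_add[OF smooth_fun_continuous[OF smF]])
  have gl: "(\<lambda>n. F n y) \<longlonglongrightarrow> g y" for y
  proof -
    have "(\<lambda>n. F 0 y + (\<Sum>i<n. conv (d i) y)) \<longlonglongrightarrow> g y"
      unfolding g_def by (intro tendsto_intros tendsto_uniform_limitI[OF ul]) simp
    moreover have "F 0 y + (\<Sum>i<n. conv (d i) y) = F n y" for n
      using sum_lessThan_telescope[of "\<lambda>n. F n y" n] by (simp add: Fd)
    ultimately show ?thesis by simp
  qed
  have "AE y in lborel. f y = g y"
    using f(2) by eventually_elim (rule LIMSEQ_unique[OF _ gl])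
  then show ?thesis using that[OF Hs gc _ bound] by blast
qed

text \<open>Test with \<open>cutoff 0 R \<cdot> conv \<psi>\<close> and let \<open>R \<rightarrow> \<infinity>\<close>.\<close>

lemma helmholtz_unique:
  assumes u: "u \<in> L2" and orth: "\<And>\<phi>. \<phi> \<in> test_functions UNIV \<Longrightarrow> (LINT y|lborel. u y * (lap \<phi> y + zz * \<phi> y)) = 0"
  shows "AE y in lborel. u y = 0"
proof (rule L2_eq_0_if_orthogonal[OF u])
  fix \<psi> :: "plane \<Rightarrow> complex" assume \<psi>: "\<psi> \<in> test_functions UNIV"
  note \<psi>L = test_functions_L2[OF \<psi>]
  define f where "f = conv \<psi>"
  have sm: "smooth_fun f" unfolding f_def by (rule smooth_fun_conv[OF \<psi>])
  have L: "f \<in> L2" "partial i f \<in> L2" for i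
    unfolding f_def by (simp_all add: partial_conv \<psi> test_functions_partial conv_L2)
  obtain C where C: "C \<ge> 0" "\<And>c R i y. R > 0 \<Longrightarrow> norm (partial i (cutoff c R) y) \<le> C / R"
    "\<And>c R y. R > 0 \<Longrightarrow> norm (lap (cutoff c R) y) \<le> C / R\<^sup>2"
    by (rule cutoff_derivative_bounds) iprover
  define S where "S = 2 * C * (\<Sum>i\<in>UNIV. L2_norm (partial i f)) + C * L2_norm f"
  have bd: "norm (LINT y|lborel. u y * (a y * b y)) \<le> L2_norm u * (D * L2_norm b)"
    if "b \<in> L2" "a \<in> borel_measurable borel" "\<And>y. norm (a y) \<le> D" for a b and D :: real
  proof -
    have D0: "D \<ge> 0" using that(3)[of 0] norm_ge_zero order_trans by blast
    have le: "(norm (a y * b y))\<^sup>2 \<le> D\<^sup>2 * (norm (b y))\<^sup>2" for y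
      unfolding norm_mult power_mult_distrib by (intro mult_right_mono power_mono that) auto
    have ab: "(\<lambda>y. a y * b y) \<in> L2"
      by (rule L2_bound[of _ "\<lambda>y. D\<^sup>2 * (norm (b y))\<^sup>2"])
         (use that le L2_integrable[OF that(1)] L2_measurable[OF that(1)] in auto)
    have "(L2_norm (\<lambda>y. a y * b y))\<^sup>2 \<le> (LINT y|lborel. D\<^sup>2 * (norm (b y))\<^sup>2)"
      unfolding L2_norm_sq using L2_integrable[OF ab] L2_integrable[OF that(1)] le by (intro integral_mono) auto
    also have "\<dots> = (D * L2_norm b)\<^sup>2" by (simp add: power_mult_distrib L2_norm_sq)
    finally have "L2_norm (\<lambda>y. a y * b y) \<le> D * L2_norm b" by (rule power2_le_imp_le) (simp add: D0)
    then show ?thesis using L2_Cauchy_Schwarz[OF u ab] mult_left_mono[OF _ L2_norm_ge_0[of u]] order_trans by blast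
  qed
  have bound: "norm (LINT y|lborel. u y * (cutoff 0 R y * \<psi> y)) \<le> L2_norm u * S / R" if R: "R \<ge> 1" for R
  proof -
    let ?\<chi> = "cutoff 0 R"
    have R0: "R > 0" using R by simp
    note s\<chi> = smooth_fun_cutoff[of 0 R]
    have \<chi>t: "?\<chi> \<in> test_functions UNIV" by (rule cutoff_test[OF R0]) simp
    have ft: "(\<lambda>y. ?\<chi> y * f y) \<in> test_functions UNIV" by (rule test_functions_mult'[OF \<chi>t sm])
    \<comment> \<open>By \<open>lap_conv\<close> the cutoff passes through exactly to
      \<open>\<psi>\<close>; every remaining term carries a derivative of the cutoff and so a factor
      of order \<open>1 / R\<close>.\<close>
    have eq: "lap (\<lambda>y. ?\<chi> y * f y) y + zz * (?\<chi> y * f y) = - (?\<chi> y * \<psi> y) + (2 * (\<Sum>i\<in>UNIV. partial i ?\<chi> y * partial i f y) + lap ?\<chi> y * f y)" for y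
      unfolding lap_mult[OF s\<chi> sm] unfolding f_def lap_conv[OF \<psi>] by (simp add: algebra_simps)
    have i1: "integrable lborel (\<lambda>y. u y * (?\<chi> y * \<psi> y))"
      using test_functions_mult[OF \<psi> s\<chi>] by (intro L2_mult_integrable u test_functions_L2)
    have i2: "integrable lborel (\<lambda>y. u y * (partial i ?\<chi> y * partial i f y))" for i
      using test_functions_mult'[OF test_functions_partial[OF \<chi>t, of i] smooth_fun_partial[OF sm, of i]]
      by (intro L2_mult_integrable u test_functions_L2)
    have i3: "integrable lborel (\<lambda>y. u y * (lap ?\<chi> y * f y))"
      using test_functions_mult'[OF test_functions_lap[OF \<chi>t] sm] by (intro L2_mult_integrable u test_functions_L2)
    have "0 = (LINT y|lborel. u y * (- (?\<chi> y * \<psi> y) + (2 * (\<Sum>i\<in>UNIV. partial i ?\<chi> y * partial i f y) + lap ?\<chi> y * f y)))"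
      using orth[OF ft] unfolding eq by simp
    also have "\<dots> = (LINT y|lborel. - (u y * (?\<chi> y * \<psi> y)) + (2 * (\<Sum>i\<in>UNIV. u y * (partial i ?\<chi> y * partial i f y)) + u y * (lap ?\<chi> y * f y)))"
      by (intro Bochner_Integration.integral_cong refl) (simp add: distrib_left sum_distrib_left mult.left_commute right_diff_distrib)
    also have "\<dots> = - (LINT y|lborel. u y * (?\<chi> y * \<psi> y)) + (2 * (\<Sum>i\<in>UNIV. (LINT y|lborel. u y * (partial i ?\<chi> y * partial i f y))) + (LINT y|lborel. u y * (lap ?\<chi> y * f y)))"
      using i1 i2 i3 by (simp add: Bochner_Integration.integral_sum)
    finally have "(LINT y|lborel. u y * (?\<chi> y * \<psi> y)) = 2 * (\<Sum>i\<in>UNIV. (LINT y|lborel. u y * (partial i ?\<chi> y * partial i f y))) + (LINT y|lborel. u y * (lap ?\<chi> y * f y))"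
      by (simp add: algebra_simps)
    also have "norm \<dots> \<le> 2 * (\<Sum>i\<in>UNIV. L2_norm u * (C / R * L2_norm (partial i f))) + L2_norm u * (C / R * L2_norm f)"
    proof (rule order_trans[OF norm_triangle_ineq], rule add_mono)
      have "norm (\<Sum>i\<in>UNIV. (LINT y|lborel. u y * (partial i ?\<chi> y * partial i f y))) \<le> (\<Sum>i\<in>UNIV. L2_norm u * (C / R * L2_norm (partial i f)))"
        by (intro sum_norm_le bd L C R0 smooth_fun_measurable smooth_fun_partial s\<chi>)
      then show "norm (2 * (\<Sum>i\<in>UNIV. (LINT y|lborel. u y * (partial i ?\<chi> y * partial i f y)))) \<le> 2 * (\<Sum>i\<in>UNIV. L2_norm u * (C / R * L2_norm (partial i f)))"
        by (simp add: norm_mult)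
      have "C / R\<^sup>2 \<le> C / R" using R C(1) by (intro divide_left_mono) (auto simp: power2_eq_square)
      then have "norm (lap ?\<chi> y) \<le> C / R" for y using C(3)[OF R0, of 0 y] by linarith
      then show "norm (LINT y|lborel. u y * (lap ?\<chi> y * f y)) \<le> L2_norm u * (C / R * L2_norm f)"
        by (intro bd L smooth_fun_measurable smooth_fun_lap s\<chi>)
    qed
    also have "(\<Sum>i\<in>UNIV. L2_norm u * (C / R * L2_norm (partial i f))) = L2_norm u * (C / R) * (\<Sum>i\<in>UNIV. L2_norm (partial i f))"
      by (simp add: sum_distrib_left mult.assoc)
    also have "2 * (L2_norm u * (C / R) * (\<Sum>i\<in>UNIV. L2_norm (partial i f))) + L2_norm u * (C / R * L2_norm f) = L2_norm u * S / R"
      by (simp add: S_def add_divide_distrib algebra_simps)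
    finally show ?thesis .
  qed
  have l1: "(\<lambda>n. LINT y|lborel. u y * (cutoff 0 (real (Suc n)) y * \<psi> y)) \<longlonglongrightarrow> (LINT y|lborel. u y * \<psi> y)"
  proof (rule integral_dominated_convergence)
    show "integrable lborel (\<lambda>y. norm (u y * \<psi> y))" by (intro integrable_norm L2_mult_integrable u \<psi>L)
    note [measurable] = L2_measurable[OF u] L2_measurable[OF \<psi>L] smooth_fun_measurable[OF smooth_fun_cutoff]
    show "(\<lambda>y. u y * \<psi> y) \<in> borel_measurable lborel" by measurable
    show "(\<lambda>y. u y * (cutoff 0 (real (Suc n)) y * \<psi> y)) \<in> borel_measurable lborel" for n by measurable
    show "AE y in lborel. (\<lambda>n. u y * (cutoff 0 (real (Suc n)) y * \<psi> y)) \<longlonglongrightarrow> u y * \<psi> y"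
    proof (rule AE_I2, rule tendsto_eventually)
      fix y :: plane
      obtain N :: nat where N: "norm y \<le> real N" using real_arch_simple by blast
      show "\<forall>\<^sub>F n in sequentially. u y * (cutoff 0 (real (Suc n)) y * \<psi> y) = u y * \<psi> y"
        unfolding eventually_sequentially
      proof (intro exI[of _ N] allI impI)
        fix n assume "N \<le> n"
        then have "dist y 0 \<le> real (Suc n)" using N by simp
        then have "cutoff 0 (real (Suc n)) y = 1" by (intro cutoff_eq_1) auto
        then show "u y * (cutoff 0 (real (Suc n)) y * \<psi> y) = u y * \<psi> y" by simp
      qed
    qed
    show "AE y in lborel. norm (u y * (cutoff 0 (real (Suc n)) y * \<psi> y)) \<le> norm (u y * \<psi> y)" for n
      using norm_cutoff_le[of 0 "real (Suc n)"] by (intro AE_I2) (simp add: norm_mult mult_left_mono mult_left_le_one_le)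
  qed
  have l2: "(\<lambda>n. LINT y|lborel. u y * (cutoff 0 (real (Suc n)) y * \<psi> y)) \<longlonglongrightarrow> 0"
  proof (rule Lim_null_comparison)
    show "\<forall>\<^sub>F n in sequentially. norm (LINT y|lborel. u y * (cutoff 0 (real (Suc n)) y * \<psi> y)) \<le> L2_norm u * S * inverse (real (Suc n))"
      using bound by (intro always_eventually allI) (simp add: divide_inverse)
    have "(\<lambda>n. L2_norm u * S * inverse (real (Suc n))) \<longlonglongrightarrow> L2_norm u * S * 0"
      by (intro tendsto_intros LIMSEQ_inverse_real_of_nat)
    then show "(\<lambda>n. L2_norm u * S * inverse (real (Suc n))) \<longlonglongrightarrow> 0" by simp
  qed
  show "(LINT y|lborel. u y * \<psi> y) = 0" by (rule LIMSEQ_unique[OF l1 l2])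
qed

text \<open>Near \<open>c\<close> the cutoff has derivatives of size \<open>1 / \<epsilon>\<close> and \<open>1 / \<epsilon>\<^sup>2\<close> while \<open>\<phi> = O(\<epsilon>)\<close>, so the integrand is
  bounded by \<open>\<bar>u\<bar> O(1 / \<epsilon>)\<close> on a ball of area \<open>O(\<epsilon>\<^sup>2)\<close>; absolute continuity of \<open>\<integral> \<bar>u\<bar>\<^sup>2\<close> does the rest.\<close>

lemma cutoff_point_limit:
  assumes u: "u \<in> L2" and \<phi>: "\<phi> \<in> test_functions UNIV" "\<phi> c = 0"
  shows "(\<lambda>n. LINT y|lborel. u y * (lap (\<lambda>y. cutoff c (inverse (real (Suc n))) y * \<phi> y) y
      + zz * (cutoff c (inverse (real (Suc n))) y * \<phi> y))) \<longlonglongrightarrow> 0"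
proof -
  define e where "e n = inverse (real (Suc n))" for n
  have e: "e n > 0" "e n \<le> 1" for n unfolding e_def by (rule inverse_Suc_pos)+
  note sm = test_functions_smooth[OF \<phi>(1)]
  obtain C where C: "C \<ge> 0" "\<And>c R i y. R > 0 \<Longrightarrow> norm (partial i (cutoff c R) y) \<le> C / R"
    "\<And>c R y. R > 0 \<Longrightarrow> norm (lap (cutoff c R) y) \<le> C / R\<^sup>2"
    by (rule cutoff_derivative_bounds) iprover
  obtain A where A: "A \<ge> 0" "\<And>y h. norm (\<phi> (y + h) - \<phi> y) \<le> A * norm h" by (rule test_function_lipschitz[OF \<phi>(1)]) iprover
  obtain B where B: "B \<ge> 0" "\<And>y. norm (lap \<phi> y + zz * \<phi> y) \<le> B"
    by (rule test_functions_bounded[OF test_functions_add[OF test_functions_lap[OF \<phi>(1)] test_functions_cmult[OF \<phi>(1), of zz]]]) iprover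
  have "\<forall>i. \<exists>D\<ge>0. \<forall>y. norm (partial i \<phi> y) \<le> D" using test_functions_bounded[OF test_functions_partial[OF \<phi>(1)]] by metis
  then obtain D where D: "\<And>i. D i \<ge> 0" "\<And>i y. norm (partial i \<phi> y) \<le> D i" by metis
  \<comment> \<open>The summands come from the operator applied to \<open>\<phi>\<close>, from the
    products of gradients, and from the Laplacian of the cutoff, where
    \<open>C / \<epsilon>\<^sup>2\<close> meets
    \<open>norm (\<phi> y) \<le> 2 * A * \<epsilon>\<close>.\<close>
  define M where "M = B + 2 * (\<Sum>i\<in>UNIV. C * D i) + 2 * A * C"
  have M0: "M \<ge> 0" using B(1) C(1) D(1) A(1) by (simp add: M_def sum_nonneg)
  let ?g = "\<lambda>n y. lap (\<lambda>y. cutoff c (e n) y * \<phi> y) y + zz * (cutoff c (e n) y * \<phi> y)"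
  let ?b = "\<lambda>n. cball c (2 * e n)"
  have gt: "?g n \<in> test_functions UNIV" for n
    by (intro test_functions_add test_functions_lap test_functions_cmult test_functions_mult \<phi> smooth_fun_cutoff)
  have gb: "norm (?g n y) \<le> M / e n * indicator (?b n) y" for n y
  proof -
    let ?\<chi> = "cutoff c (e n)"
    have g: "?g n y = ?\<chi> y * (lap \<phi> y + zz * \<phi> y) + 2 * (\<Sum>i\<in>UNIV. partial i ?\<chi> y * partial i \<phi> y) + lap ?\<chi> y * \<phi> y"
      unfolding lap_mult[OF smooth_fun_cutoff sm] by (simp add: algebra_simps)
    show ?thesis
    proof (cases "y \<in> ?b n")
      case True
      have "norm (\<phi> y) \<le> A * (2 * e n)"
      proof -
        have "norm (\<phi> (c + (y - c)) - \<phi> c) \<le> A * norm (y - c)" by (rule A(2))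
        also have "\<dots> \<le> A * (2 * e n)" using True A(1) by (intro mult_left_mono) (auto simp: dist_norm norm_minus_commute)
        finally show ?thesis using \<phi>(2) by simp
      qed
      then have t3: "norm (lap ?\<chi> y * \<phi> y) \<le> C / (e n)\<^sup>2 * (A * (2 * e n))"
        unfolding norm_mult using C(1) C(3)[OF e(1)] e(1)[of n] by (intro mult_mono) auto
      have t2: "norm (\<Sum>i\<in>UNIV. partial i ?\<chi> y * partial i \<phi> y) \<le> (\<Sum>i\<in>UNIV. C / e n * D i)"
      proof (rule sum_norm_le)
        fix i
        show "norm (partial i ?\<chi> y * partial i \<phi> y) \<le> C / e n * D i"
          unfolding norm_mult using C(1) less_imp_le[OF e(1)[of n]] by (intro mult_mono C(2)[OF e(1)] D(2)) auto
      qed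
      have t1: "norm (?\<chi> y * (lap \<phi> y + zz * \<phi> y)) \<le> 1 * B"
        unfolding norm_mult by (intro mult_mono norm_cutoff_le B) auto
      have "norm (?g n y) \<le> norm (?\<chi> y * (lap \<phi> y + zz * \<phi> y)) + norm (2 * (\<Sum>i\<in>UNIV. partial i ?\<chi> y * partial i \<phi> y)) + norm (lap ?\<chi> y * \<phi> y)"
        unfolding g by (intro order_trans[OF norm_triangle_ineq] add_right_mono norm_triangle_ineq)
      also have "\<dots> \<le> 1 * B + 2 * (\<Sum>i\<in>UNIV. C / e n * D i) + C / (e n)\<^sup>2 * (A * (2 * e n))"
        using t1 t2 t3 by (simp add: norm_mult)
      also have "\<dots> \<le> B / e n + 2 * (\<Sum>i\<in>UNIV. C * D i) / e n + 2 * A * C / e n"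
      proof -
        have "1 * B \<le> B / e n" using B(1) e[of n] by (simp add: pos_le_divide_eq mult_left_le)
        moreover have "(\<Sum>i\<in>UNIV. C / e n * D i) = (\<Sum>i\<in>UNIV. C * D i) / e n" by (simp add: sum_divide_distrib)
        moreover have "C / (e n)\<^sup>2 * (A * (2 * e n)) = 2 * A * C / e n" using e(1)[of n] by (simp add: power2_eq_square)
        ultimately show ?thesis by simp
      qed
      also have "\<dots> = M / e n" by (simp add: M_def add_divide_distrib)
      finally show ?thesis using True by simp
    next
      case False
      then have far: "dist y c > 2 * e n" by (simp add: dist_commute)
      then have "?g n y = 0"
        unfolding g using cutoff_eq_0[OF e(1), of n y c] cutoff_partial_eq_0[OF e(1) far] cutoff_lap_eq_0[OF e(1) far] by simp
      then show ?thesis using False by simp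
    qed
  qed
  define v where "v n y = indicator (?b n) y * u y" for n y
  have [measurable]: "u \<in> borel_measurable borel" by (rule L2_measurable[OF u])
  have vL: "v n \<in> L2" for n
    by (rule L2_bound[OF _ L2_integrable[OF u]]) (auto simp: v_def[abs_def] indicator_def)
  have vlim: "(\<lambda>n. L2_norm (v n)) \<longlonglongrightarrow> 0"
  proof -
    have "(\<lambda>n. LINT y|lborel. (norm (v n y))\<^sup>2) \<longlonglongrightarrow> (LINT y|(lborel::plane measure). 0)"
    proof (rule integral_dominated_convergence)
      show "integrable lborel (\<lambda>y. (norm (u y))\<^sup>2)" by (rule L2_integrable[OF u])
      show "AE y in lborel. (\<lambda>n. (norm (v n y))\<^sup>2) \<longlonglongrightarrow> 0"
        using AE_lborel_singleton[of c]
      proof eventually_elim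
        fix y assume "y \<noteq> c"
        have "(\<lambda>n. 2 * e n) \<longlonglongrightarrow> 2 * 0" unfolding e_def by (intro tendsto_intros LIMSEQ_inverse_real_of_nat)
        then have "eventually (\<lambda>n. 2 * e n < dist c y) sequentially"
          using \<open>y \<noteq> c\<close> by (intro order_tendstoD(2)[of _ 0]) auto
        then have "eventually (\<lambda>n. (norm (v n y))\<^sup>2 = 0) sequentially"
          by eventually_elim (simp add: v_def)
        then show "(\<lambda>n. (norm (v n y))\<^sup>2) \<longlonglongrightarrow> 0" by (rule tendsto_eventually)
      qed
      show "AE y in lborel. norm ((norm (v n y))\<^sup>2) \<le> (norm (u y))\<^sup>2" for n
        by (intro AE_I2) (auto simp: v_def indicator_def)
    qed (use L2_measurable[OF vL] in measurable)
    from tendsto_real_sqrt[OF this] show ?thesis by (simp add: L2_norm_def)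
  qed
  have est: "norm (LINT y|lborel. u y * ?g n y) \<le> L2_norm (v n) * (M * sqrt (4 * pi))" for n
  proof -
    have gL: "?g n \<in> L2" by (rule test_functions_L2[OF gt])
    have eq: "u y * ?g n y = v n y * ?g n y" for y
      using gb[of n y] by (cases "y \<in> ?b n") (auto simp: v_def)
    have "norm (LINT y|lborel. u y * ?g n y) \<le> L2_norm (v n) * L2_norm (?g n)"
      unfolding eq by (rule L2_Cauchy_Schwarz[OF vL gL])
    also have "L2_norm (?g n) \<le> M * sqrt (4 * pi)"
    proof (rule power2_le_imp_le)
      have "(L2_norm (?g n))\<^sup>2 \<le> (LINT y|lborel. (M / e n)\<^sup>2 * indicator (?b n) y)"
        unfolding L2_norm_sq
      proof (rule integral_mono[OF L2_integrable[OF gL]])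
        show "integrable lborel (\<lambda>y. (M / e n)\<^sup>2 * indicator (?b n) y)"
          by (intro integrable_mult_right integrable_real_indicator emeasure_bounded_finite) auto
        fix y
        have "(norm (?g n y))\<^sup>2 \<le> (M / e n * indicator (?b n) y)\<^sup>2" by (intro power_mono gb) simp
        also have "\<dots> = (M / e n)\<^sup>2 * indicator (?b n) y" by (simp add: indicator_def)
        finally show "(norm (?g n y))\<^sup>2 \<le> (M / e n)\<^sup>2 * indicator (?b n) y" .
      qed
      also have "\<dots> = (M / e n)\<^sup>2 * (pi * (2 * e n)\<^sup>2)"
        using content_cball[of "2 * e n" c] e(1)[of n] by (simp add: unit_ball_vol_2)
      also have "\<dots> = (M * sqrt (4 * pi))\<^sup>2" using e(1)[of n] by (simp add: power_mult_distrib power_divide)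
      finally show "(L2_norm (?g n))\<^sup>2 \<le> (M * sqrt (4 * pi))\<^sup>2" .
    qed (simp add: M0)
    finally show ?thesis by (simp add: mult_left_mono)
  qed
  have "(\<lambda>n. LINT y|lborel. u y * ?g n y) \<longlonglongrightarrow> 0"
  proof (rule Lim_null_comparison)
    show "\<forall>\<^sub>F n in sequentially. norm (LINT y|lborel. u y * ?g n y) \<le> L2_norm (v n) * (M * sqrt (4 * pi))" using est by simp
    show "(\<lambda>n. L2_norm (v n) * (M * sqrt (4 * pi))) \<longlonglongrightarrow> 0" using tendsto_mult_left_zero[OF vlim] .
  qed
  then show ?thesis by (simp add: e_def)
qed

section \<open>Classification of the defect space\<close>

definition Gsum :: "('m::finite \<Rightarrow> plane) \<Rightarrow> complex ^ 'm \<Rightarrow> plane \<Rightarrow> complex" where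
  "Gsum x a y = (\<Sum>j\<in>UNIV. a $ j * G (x j) y)"

lemma Gsum_H_star: "(Gsum x a, \<lambda>y. zz * Gsum x a y) \<in> H_star (range x)"
proof -
  have "(\<lambda>y. \<Sum>j\<in>UNIV. a $ j * G (x j) y, \<lambda>y. \<Sum>j\<in>UNIV. a $ j * (zz * G (x j) y)) \<in> H_star (range x)"
    by (intro H_star_sum G_H_star) auto
  then show ?thesis by (simp add: Gsum_def[abs_def] sum_distrib_left mult.left_commute)
qed

lemma Gsum_L2: "Gsum x a \<in> L2"
  using Gsum_H_star[of x a] by (simp add: H_star_def)

text \<open>As a distribution, the equation applied to \<open>f\<close> is carried by the finitely
  many points. Square integrability of \<open>f\<close> excludes derivatives of point masses, which
  is the content of \<open>vanish\<close>, so only the point masses produced by fundamental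
  solutions are left.\<close>

theorem defect_classification:
  fixes x :: "'m::finite \<Rightarrow> plane"
  assumes inj: "inj x" and f: "f \<in> L2"
    and wl: "\<And>\<phi>. \<phi> \<in> test_functions (- range x) \<Longrightarrow> (LINT y|lborel. f y * (lap \<phi> y + zz * \<phi> y)) = 0"
  obtains a where "AE y in lborel. f y = Gsum x a y"
proof -
  define l where "l \<phi> = (LINT y|lborel. f y * (lap \<phi> y + zz * \<phi> y))" for \<phi>
  have int: "integrable lborel (\<lambda>y. f y * (lap \<phi> y + zz * \<phi> y))" if "\<phi> \<in> test_functions UNIV" for \<phi>
    by (intro L2_mult_integrable f test_functions_L2[OF test_functions_add[OF test_functions_lap[OF that] test_functions_cmult[OF that]]])
  have l_diff: "l (\<lambda>y. \<phi> y - \<psi> y) = l \<phi> - l \<psi>" if "\<phi> \<in> test_functions UNIV" "\<psi> \<in> test_functions UNIV" for \<phi> \<psi>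
  proof -
    have "l (\<lambda>y. \<phi> y - \<psi> y) = (LINT y|lborel. f y * (lap \<phi> y + zz * \<phi> y) - f y * (lap \<psi> y + zz * \<psi> y))"
      unfolding l_def using that[THEN test_functions_smooth] by (simp add: lap_diff algebra_simps)
    then show ?thesis using int[OF that(1)] int[OF that(2)] by (simp add: l_def)
  qed
  have l_sum: "l (\<lambda>y. \<Sum>j\<in>UNIV. b j * \<phi> j y) = (\<Sum>j\<in>UNIV. b j * l (\<phi> j))"
    if "\<And>j::'m. \<phi> j \<in> test_functions UNIV" for b :: "'m \<Rightarrow> complex" and \<phi>
  proof -
    have s: "smooth_fun (\<lambda>y. b j * \<phi> j y)" "smooth_fun (\<phi> j)" for j
      using that test_functions_smooth test_functions_cmult by blast+
    have "l (\<lambda>y. \<Sum>j\<in>UNIV. b j * \<phi> j y) = (LINT y|lborel. (\<Sum>j\<in>UNIV. b j * (f y * (lap (\<phi> j) y + zz * \<phi> j y))))"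
      unfolding l_def using s by (simp add: lap_sum lap_cmult sum_distrib_left distrib_left sum.distrib mult_ac)
    also have "\<dots> = (\<Sum>j\<in>UNIV. b j * l (\<phi> j))"
      unfolding l_def using int[OF that] by (subst Bochner_Integration.integral_sum) auto
    finally show ?thesis .
  qed
  \<comment> \<open>A cutoff of radius \<open>r\<close> has support of radius \<open>2 * r\<close>;
    separation by \<open>4 * \<delta>\<close> keeps it off the ball of radius \<open>r\<close> about
    every other point whenever \<open>r \<le> \<delta>\<close>.\<close>
  obtain \<delta> where \<delta>: "\<delta> > 0" "\<And>j k. j \<noteq> k \<Longrightarrow> 4 * \<delta> \<le> dist (x j) (x k)"
  proof -
    \<comment> \<open>The inserted 1 keeps the set nonempty when there is only one point.\<close>
    let ?S = "insert 1 ((\<lambda>(j, k). dist (x j) (x k)) ` {(j, k). j \<noteq> k})"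
    have fin: "finite ?S" by simp
    have pos: "Min ?S > 0"
      using fin inj by (subst Min_gr_iff) (auto simp: inj_eq)
    have "Min ?S \<le> dist (x j) (x k)" if "j \<noteq> k" for j k
      using fin that by (intro Min_le) auto
    then show ?thesis using that[of "Min ?S / 4"] pos by simp
  qed
  have sep: "cutoff (x j) r (x k) = (if j = k then 1 else 0)" if "0 < r" "r \<le> \<delta>" for r j k
    using that \<delta>(2)[of k j] by (auto intro!: cutoff_eq_1 cutoff_eq_0)
  have sepn: "cutoff (x j) r y = (if j = k then 1 else 0)" if "0 < r" "r \<le> \<delta>" "dist y (x k) \<le> r" for r j k y
  proof (cases "j = k")
    case False
    have "4 * r \<le> dist (x j) (x k)" using \<delta>(2)[OF False] that(2) by simp
    then have "2 * r \<le> dist y (x j)" using that dist_triangle[of "x j" "x k" y] by (simp add: dist_commute)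
    then show ?thesis using False that by (simp add: cutoff_eq_0)
  qed (use that in \<open>simp add: cutoff_eq_1\<close>)
  have vanish: "l \<phi> = 0" if \<phi>: "\<phi> \<in> test_functions UNIV" "\<And>j. \<phi> (x j) = 0" for \<phi>
  proof -
    let ?r = "\<lambda>n. inverse (real (Suc n))"
    have eq: "l \<phi> = (\<Sum>j\<in>UNIV. l (\<lambda>y. cutoff (x j) (?r n) y * \<phi> y))" if n: "?r n \<le> \<delta>" for n
    proof -
      have r0: "?r n > 0" by (rule inverse_Suc_pos)
      let ?\<phi> = "\<lambda>j y. cutoff (x j) (?r n) y * \<phi> y"
      have t: "?\<phi> j \<in> test_functions UNIV" for j by (rule test_functions_mult[OF \<phi>(1) smooth_fun_cutoff])
      have tS: "(\<lambda>y. \<Sum>j\<in>UNIV. ?\<phi> j y) \<in> test_functions UNIV" by (intro test_functions_sum t)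
      \<comment> \<open>Near each point exactly one cutoff equals 1 and the others vanish, so
        subtracting the localised copies leaves a function that is zero around all the points and
        hence an admissible test function.\<close>
      have "(\<lambda>y. \<phi> y - (\<Sum>j\<in>UNIV. ?\<phi> j y)) \<in> test_functions (- range x)"
      proof -
        obtain K where K: "compact K" "\<And>y. y \<notin> K \<Longrightarrow> \<phi> y = 0" using \<phi>(1) unfolding test_functions_iff by blast
        let ?K = "K - (\<Union>j. ball (x j) (?r n))"
        have "compact ?K" by (intro compact_diff K open_UN ballI) simp
        moreover have "?K \<subseteq> - range x"
        proof
          fix y assume "y \<in> ?K"
          moreover have "x j \<in> ball (x j) (?r n)" for j using r0 by (simp only: centre_in_ball)
          ultimately show "y \<in> - range x" by blast
        qed
        moreover have "\<phi> y - (\<Sum>j\<in>UNIV. ?\<phi> j y) = 0" if yK: "y \<notin> ?K" for y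
        proof (cases "y \<in> K")
          case True
          then obtain k where "y \<in> ball (x k) (?r n)" using yK by blast
          then have "dist y (x k) \<le> ?r n" by (simp add: dist_commute)
          then have "(\<Sum>j\<in>UNIV. ?\<phi> j y) = (\<Sum>j\<in>UNIV. if j = k then \<phi> y else 0)"
            using sepn[OF r0 n, of y k] by (intro sum.cong) auto
          then show ?thesis by simp
        qed (simp add: K)
        ultimately show ?thesis
          unfolding test_functions_iff using test_functions_smooth[OF test_functions_diff[OF \<phi>(1) tS]] by blast
      qed
      then have "l (\<lambda>y. \<phi> y - (\<Sum>j\<in>UNIV. ?\<phi> j y)) = 0" unfolding l_def by (rule wl)
      then have "l \<phi> = l (\<lambda>y. \<Sum>j\<in>UNIV. ?\<phi> j y)" using l_diff[OF \<phi>(1) tS] by simp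
      then show ?thesis using l_sum[OF t, of "\<lambda>_. 1"] by simp
    qed
    have "(\<lambda>n. \<Sum>j\<in>UNIV. l (\<lambda>y. cutoff (x j) (?r n) y * \<phi> y)) \<longlonglongrightarrow> (\<Sum>j\<in>(UNIV::'m set). 0)"
      unfolding l_def by (intro tendsto_sum cutoff_point_limit[OF f \<phi>])
    moreover have "eventually (\<lambda>n. (\<Sum>j\<in>UNIV. l (\<lambda>y. cutoff (x j) (?r n) y * \<phi> y)) = l \<phi>) sequentially"
      using order_tendstoD(2)[OF LIMSEQ_inverse_real_of_nat \<delta>(1)]
      by (rule eventually_mono) (rule eq[symmetric], rule less_imp_le)
    ultimately have "(\<lambda>n. l \<phi>) \<longlonglongrightarrow> 0" using Lim_transform_eventually by fastforce
    then show ?thesis using LIMSEQ_unique tendsto_const by blast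
  qed
  define b where "b j = l (cutoff (x j) \<delta>)" for j
  have lb: "l \<phi> = (\<Sum>j\<in>UNIV. \<phi> (x j) * b j)" if \<phi>: "\<phi> \<in> test_functions UNIV" for \<phi>
  proof -
    have t: "cutoff (x j) \<delta> \<in> test_functions UNIV" for j by (rule cutoff_test[OF \<delta>(1)]) simp
    have tS: "(\<lambda>y. \<Sum>j\<in>UNIV. \<phi> (x j) * cutoff (x j) \<delta> y) \<in> test_functions UNIV"
      by (intro test_functions_sum test_functions_cmult t)
    have "l (\<lambda>y. \<phi> y - (\<Sum>j\<in>UNIV. \<phi> (x j) * cutoff (x j) \<delta> y)) = 0"
    proof (rule vanish[OF test_functions_diff[OF \<phi> tS]])
      fix k
      have "(\<Sum>j\<in>UNIV. \<phi> (x j) * cutoff (x j) \<delta> (x k)) = (\<Sum>j\<in>UNIV. if j = k then \<phi> (x k) else 0)"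
        using sep[OF \<delta>(1) order_refl] by (intro sum.cong) auto
      then show "\<phi> (x k) - (\<Sum>j\<in>UNIV. \<phi> (x j) * cutoff (x j) \<delta> (x k)) = 0" by simp
    qed
    then have "l \<phi> = l (\<lambda>y. \<Sum>j\<in>UNIV. \<phi> (x j) * cutoff (x j) \<delta> y)" using l_diff[OF \<phi> tS] by simp
    then show ?thesis using l_sum[OF t] by (simp add: b_def)
  qed
  \<comment> \<open>The sign compensates the \<open>- \<phi> c\<close> of
    \<open>fundamental_solution\<close>.\<close>
  define a where "a = (\<chi> j. - b j)"
  have "AE y in lborel. f y - Gsum x a y = 0"
  proof (rule helmholtz_unique[OF L2_diff[OF f Gsum_L2]])
    fix \<phi> :: "plane \<Rightarrow> complex" assume \<phi>: "\<phi> \<in> test_functions UNIV"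
    let ?\<psi> = "\<lambda>y. lap \<phi> y + zz * \<phi> y"
    have \<psi>L: "?\<psi> \<in> L2" by (intro test_functions_L2[of _ UNIV] test_functions_add test_functions_lap test_functions_cmult \<phi>)
    have iG: "integrable lborel (\<lambda>y. G (x j) y * ?\<psi> y)" for j by (intro L2_mult_integrable G_L2 \<psi>L)
    have "(LINT y|lborel. Gsum x a y * ?\<psi> y) = (LINT y|lborel. (\<Sum>j\<in>UNIV. a $ j * (G (x j) y * ?\<psi> y)))"
      by (simp add: Gsum_def sum_distrib_right mult.assoc)
    also have "\<dots> = (\<Sum>j\<in>UNIV. a $ j * (LINT y|lborel. G (x j) y * ?\<psi> y))"
      using iG by (subst Bochner_Integration.integral_sum) auto
    also have "\<dots> = l \<phi>" unfolding fundamental_solution[OF \<phi>] lb[OF \<phi>] by (simp add: a_def mult.commute)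
    finally have "(LINT y|lborel. Gsum x a y * ?\<psi> y) = l \<phi>" .
    then show "(LINT y|lborel. (f y - Gsum x a y) * ?\<psi> y) = 0"
      using int[OF \<phi>] L2_mult_integrable[OF Gsum_L2 \<psi>L, of x a] by (simp add: left_diff_distrib l_def)
  qed
  then show ?thesis using that[of a] by simp
qed

end

section \<open>Boundary values\<close>

text \<open>The choice in \<open>cont_rep\<close> is harmless off \<open>X\<close>: two continuous
  representatives could differ only on an open null set, which is empty.\<close>

lemma cont_rep_eq:
  assumes "finite X" "continuous_on (- X) g" "AE y in lborel. g y = f y" "y \<notin> X"
  shows "cont_rep X f y = g y"
proof -
  have *: "continuous_on (- X) (cont_rep X f) \<and> (AE y in lborel. cont_rep X f y = f y)"
    unfolding cont_rep_def by (rule someI[of _ g]) (use assms in auto)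
  show ?thesis
  proof (rule continuous_AE_eq_open[of "- X"])
    show "open (- X)" using assms(1) by (simp add: open_Compl finite_imp_closed)
    show "AE y in lborel. cont_rep X f y = g y"
      using * assms(3) by (auto elim: eventually_elim2)
  qed (use * assms in auto)
qed

lemma filterlim_norm_diff: "filterlim (\<lambda>y. norm (y - c)) (at_right 0) (at (c::plane))"
proof -
  have "((\<lambda>y. norm (y - c)) \<longlongrightarrow> norm (c - c)) (at c)"
    by (intro tendsto_norm tendsto_diff tendsto_const tendsto_ident_at)
  then show ?thesis by (auto simp: filterlim_at eventually_at_filter)
qed

lemma tendsto_inverse_ln_norm: "((\<lambda>y. 1 / complex_of_real (ln (norm (y - c)))) \<longlongrightarrow> 0) (at (c::plane))"
proof -
  have "((\<lambda>r::real. 1 / ln r) \<longlongrightarrow> 0) (at_right 0)" by real_asymp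
  from tendsto_of_real[OF filterlim_compose[OF this filterlim_norm_diff], where 'a=complex]
  show ?thesis by simp
qed

context helmholtz begin

text \<open>The constant term of the fundamental solution at its pole, once the logarithm divided by
  \<open>- 2 * pi\<close> is removed; it becomes the diagonal of the Weyl matrix.\<close>

definition green_const :: complex where "green_const = - (Ln (lam / 2) + euler_mascheroni) / (2 * of_real pi)"

lemma G_asymptotics:
  "((\<lambda>y. G c y + of_real (ln (norm (y - c))) / (2 * of_real pi)) \<longlongrightarrow> green_const) (at c)"
proof -
  have "filterlim (\<lambda>r::real. r\<^sup>2) (at_right 0) (at_right 0)" by real_asymp
  from filterlim_compose[OF logsol_tendsto filterlim_compose[OF this filterlim_norm_diff], of "lam\<^sup>2 / 4" "Ln (lam / 2) + euler_mascheroni" c]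
  have "((\<lambda>y. (logsol (lam\<^sup>2 / 4) (Ln (lam / 2) + euler_mascheroni) (of_real ((norm (y - c))\<^sup>2))
      + Ln (of_real ((norm (y - c))\<^sup>2)) / 2 + (Ln (lam / 2) + euler_mascheroni)) / (2 * of_real pi) + green_const) \<longlongrightarrow> 0 / (2 * of_real pi) + green_const) (at c)"
    by (intro tendsto_intros) simp_all
  then have "((\<lambda>y. (logsol (lam\<^sup>2 / 4) (Ln (lam / 2) + euler_mascheroni) (of_real ((norm (y - c))\<^sup>2))
      + Ln (of_real ((norm (y - c))\<^sup>2)) / 2 + (Ln (lam / 2) + euler_mascheroni)) / (2 * of_real pi) + green_const) \<longlongrightarrow> green_const) (at c)"
    by simp
  then show ?thesis
  proof (rule Lim_transform_eventually)
    show "\<forall>\<^sub>F y in at c. (logsol (lam\<^sup>2 / 4) (Ln (lam / 2) + euler_mascheroni) (of_real ((norm (y - c))\<^sup>2))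
      + Ln (of_real ((norm (y - c))\<^sup>2)) / 2 + (Ln (lam / 2) + euler_mascheroni)) / (2 * of_real pi) + green_const
      = G c y + of_real (ln (norm (y - c))) / (2 * of_real pi)"
      unfolding eventually_at_filter
    proof (rule always_eventually, intro allI impI)
      fix y assume y: "y \<noteq> c"
      have "Ln (of_real ((norm (y - c))\<^sup>2)) = of_real (ln ((norm (y - c))\<^sup>2))" by (rule Ln_of_real) (use y in simp)
      also have "\<dots> = 2 * of_real (ln (norm (y - c)))" using y by (simp add: ln_realpow)
      finally have L: "Ln (of_real ((norm (y - c))\<^sup>2)) / 2 = of_real (ln (norm (y - c)))" by simp
      show "(logsol (lam\<^sup>2 / 4) (Ln (lam / 2) + euler_mascheroni) (of_real ((norm (y - c))\<^sup>2))
        + Ln (of_real ((norm (y - c))\<^sup>2)) / 2 + (Ln (lam / 2) + euler_mascheroni)) / (2 * of_real pi) + green_const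
        = G c y + of_real (ln (norm (y - c))) / (2 * of_real pi)"
        unfolding L by (simp add: G_def rad_def green_const_def add_divide_distrib diff_divide_distrib minus_divide_left[symmetric])
    qed
  qed
qed

lemma Gsum_continuous: "continuous_on (- range x) (Gsum x a)"
  unfolding Gsum_def[abs_def] by (intro continuous_intros G_continuous) auto

text \<open>Near \<open>x j\<close> only the \<open>j\<close>-th fundamental solution is singular;
  the others, together with \<open>g\<close>, are continuous there. Dividing by the logarithm
  isolates its coefficient, and subtracting the logarithm leaves constant terms. The summand
  \<open>g\<close> is what makes the lemma applicable to resolvent solutions, where all coefficients
  turn out to be zero.\<close>

lemma boundary_limits:
  fixes x :: "'m::finite \<Rightarrow> plane"
  assumes inj: "inj x" and g: "continuous_on UNIV g" and ae: "AE y in lborel. f y = g y + Gsum x a y"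
  shows "log_coeff x f j = - (a $ j) / (2 * of_real pi)"
    and "((\<lambda>y. cont_rep (range x) f y - log_coeff x f j * of_real (ln (norm (y - x j)))) \<longlongrightarrow>
      a $ j * green_const + (g (x j) + (\<Sum>k\<in>UNIV - {j}. a $ k * G (x k) (x j)))) (at (x j))"
proof -
  let ?F = "cont_rep (range x) f" and ?c = "x j"
  define R where "R y = g y + (\<Sum>k\<in>UNIV - {j}. a $ k * G (x k) y)" for y
  have rep: "?F y = a $ j * G ?c y + R y" if "y \<notin> range x" for y
  proof -
    have "?F y = g y + Gsum x a y"
    proof (rule cont_rep_eq[OF _ _ _ that])
      show "continuous_on (- range x) (\<lambda>y. g y + Gsum x a y)"
        by (intro continuous_on_add Gsum_continuous continuous_on_subset[OF g]) simp
      show "AE y in lborel. g y + Gsum x a y = f y" using ae by eventually_elim simp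
    qed simp
    also have "Gsum x a y = a $ j * G ?c y + (\<Sum>k\<in>UNIV - {j}. a $ k * G (x k) y)"
      unfolding Gsum_def by (rule sum.remove) auto
    finally show ?thesis by (simp add: R_def)
  qed
  have ev: "eventually (\<lambda>y. y \<notin> range x) (at ?c)"
    using islimpt_finite[of "range x" ?c] by (simp add: islimpt_iff_eventually)
  have evF: "eventually (\<lambda>y. ?F y = a $ j * G ?c y + R y) (at ?c)"
    using ev by eventually_elim (rule rep)
  have Rc: "(R \<longlongrightarrow> R ?c) (at ?c)"
  proof -
    have "isCont (G (x k)) ?c" if "k \<in> UNIV - {j}" for k
    proof -
      have "?c \<in> - {x k}" using that inj by (auto simp: inj_eq)
      moreover have "continuous_on (- {x k}) (G (x k))" by (rule G_continuous) simp
      ultimately show ?thesis by (simp add: continuous_on_eq_continuous_at open_Compl)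
    qed
    moreover have "isCont g ?c" using g by (simp add: continuous_on_eq_continuous_at)
    ultimately have "isCont R ?c" unfolding R_def[abs_def] by (intro continuous_intros) auto
    then show ?thesis by (simp add: isCont_def)
  qed
  let ?L = "\<lambda>y. complex_of_real (ln (norm (y - ?c)))"
  have "((\<lambda>y. (a $ j * (G ?c y + ?L y / (2 * of_real pi)) + R y) * (1 / ?L y) - a $ j / (2 * of_real pi)) \<longlongrightarrow>
      (a $ j * green_const + R ?c) * 0 - a $ j / (2 * of_real pi)) (at ?c)"
    by (intro tendsto_intros G_asymptotics Rc tendsto_inverse_ln_norm)
  then have "((\<lambda>y. (a $ j * (G ?c y + ?L y / (2 * of_real pi)) + R y) * (1 / ?L y) - a $ j / (2 * of_real pi)) \<longlongrightarrow>
      - (a $ j) / (2 * of_real pi)) (at ?c)" by simp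
  then have "((\<lambda>y. ?F y / ?L y) \<longlongrightarrow> - (a $ j) / (2 * of_real pi)) (at ?c)"
  proof (rule Lim_transform_eventually)
    have "eventually (\<lambda>r::real. ln r < 0) (at_right 0)" by real_asymp
    then have "eventually (\<lambda>r::real. ln r \<noteq> 0) (at_right 0)" by eventually_elim simp
    then have "eventually (\<lambda>y. ln (norm (y - ?c)) \<noteq> 0) (at ?c)"
      by (rule filterlim_norm_diff[unfolded filterlim_iff, rule_format])
    then show "\<forall>\<^sub>F y in at ?c. (a $ j * (G ?c y + ?L y / (2 * of_real pi)) + R y) * (1 / ?L y) - a $ j / (2 * of_real pi) = ?F y / ?L y"
      using evF
    proof eventually_elim
      case (elim y)
      then have "?L y \<noteq> 0" by simp
      then show ?case unfolding elim(2) by (simp add: field_simps)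
    qed
  qed
  then show lc: "log_coeff x f j = - (a $ j) / (2 * of_real pi)"
    unfolding log_coeff_def by (intro tendsto_Lim) auto
  have "((\<lambda>y. a $ j * (G ?c y + ?L y / (2 * of_real pi)) + R y) \<longlongrightarrow> a $ j * green_const + R ?c) (at ?c)"
    by (intro tendsto_intros G_asymptotics Rc)
  then have "((\<lambda>y. ?F y - log_coeff x f j * ?L y) \<longlongrightarrow> a $ j * green_const + R ?c) (at ?c)"
  proof (rule Lim_transform_eventually)
    show "\<forall>\<^sub>F y in at ?c. a $ j * (G ?c y + ?L y / (2 * of_real pi)) + R y = ?F y - log_coeff x f j * ?L y"
      using evF by eventually_elim (simp add: lc field_simps)
  qed
  then show "((\<lambda>y. ?F y - log_coeff x f j * ?L y) \<longlongrightarrow>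
      a $ j * green_const + (g ?c + (\<Sum>k\<in>UNIV - {j}. a $ k * G (x k) ?c))) (at ?c)"
    by (simp add: R_def)
qed

lemma Gamma0_eq:
  fixes x :: "'m::finite \<Rightarrow> plane"
  assumes "inj x" "continuous_on UNIV g" "AE y in lborel. f y = g y + Gsum x a y"
  shows "Gamma0 x f = a"
  unfolding Gamma0_def vec_eq_iff by (simp add: boundary_limits(1)[OF assms])

definition weyl_matrix :: "('m::finite \<Rightarrow> plane) \<Rightarrow> complex ^ 'm ^ 'm" where
  "weyl_matrix x = (\<chi> j k. if j = k then green_const else G (x k) (x j))"

lemma Gamma1_eq:
  fixes x :: "'m::finite \<Rightarrow> plane"
  assumes "inj x" "AE y in lborel. f y = Gsum x a y"
  shows "Gamma1 x f = weyl_matrix x *v a"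
proof -
  have ae: "AE y in lborel. f y = 0 + Gsum x a y" using assms(2) by simp
  have "Gamma1 x f $ j = (weyl_matrix x *v a) $ j" for j
  proof -
    have "Gamma1 x f $ j = a $ j * green_const + (0 + (\<Sum>k\<in>UNIV - {j}. a $ k * G (x k) (x j)))"
      unfolding Gamma1_def vec_lambda_beta
      by (intro tendsto_Lim boundary_limits(2)[OF assms(1) continuous_on_const ae]) simp
    also have "\<dots> = (\<Sum>k\<in>UNIV. (if j = k then green_const else G (x k) (x j)) * a $ k)"
      by (subst sum.remove[of UNIV j]) (auto simp: mult.commute intro!: sum.cong)
    finally show ?thesis by (simp add: weyl_matrix_def matrix_vector_mult_def)
  qed
  then show ?thesis by (simp add: vec_eq_iff)
qed

section \<open>Defect space, Weyl function, gamma-field and resolvent at \<open>zz\<close>\<close>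

lemma defect_space_iff:
  fixes x :: "'m::finite \<Rightarrow> plane"
  assumes "inj x"
  shows "f \<in> defect_space (H_star (range x)) zz \<longleftrightarrow> f \<in> L2 \<and> (\<exists>a. AE y in lborel. f y = Gsum x a y)"
proof
  assume f: "f \<in> defect_space (H_star (range x)) zz"
  then have fL: "f \<in> L2" and wl: "weak_laplacian (- range x) f (\<lambda>y. - (zz * f y))"
    by (auto simp: defect_space_def H_star_def)
  obtain a where "AE y in lborel. f y = Gsum x a y"
  proof (rule defect_classification[OF assms fL])
    fix \<phi> assume \<phi>: "\<phi> \<in> test_functions (- range x)"
    have "(LINT y|lborel. f y * lap \<phi> y) = (LINT y|lborel. - (zz * f y) * \<phi> y)"
      using bspec[OF wl[unfolded weak_laplacian_def lap_def[symmetric]] \<phi>] .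
    moreover have "(LINT y|lborel. - (zz * f y) * \<phi> y) = - (LINT y|lborel. zz * (f y * \<phi> y))"
      unfolding Bochner_Integration.integral_minus[symmetric] by (simp add: mult.assoc)
    moreover have "(LINT y|lborel. f y * (lap \<phi> y + zz * \<phi> y)) = (LINT y|lborel. f y * lap \<phi> y + zz * (f y * \<phi> y))"
      by (simp add: algebra_simps)
    ultimately show "(LINT y|lborel. f y * (lap \<phi> y + zz * \<phi> y)) = 0"
      using L2_mult_integrable[OF fL test_functions_L2[OF \<phi>]] L2_mult_integrable[OF fL test_functions_L2[OF test_functions_lap[OF \<phi>]]]
      by simp
  qed
  then show "f \<in> L2 \<and> (\<exists>a. AE y in lborel. f y = Gsum x a y)" using fL by blast
next
  assume "f \<in> L2 \<and> (\<exists>a. AE y in lborel. f y = Gsum x a y)"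
  then obtain a where f: "f \<in> L2" "AE y in lborel. f y = Gsum x a y" by blast
  have "AE y in lborel. zz * f y = zz * Gsum x a y" using f(2) by eventually_elim simp
  then have "(f, \<lambda>y. zz * f y) \<in> H_star (range x)"
    by (intro H_star_cong_AE[OF Gsum_H_star f(1) L2_cmult[OF f(1)] f(2)])
  then show "f \<in> defect_space (H_star (range x)) zz" by (simp add: defect_space_def)
qed

lemma Gamma0_Gsum:
  fixes x :: "'m::finite \<Rightarrow> plane"
  assumes "inj x" "AE y in lborel. f y = Gsum x a y"
  shows "Gamma0 x f = a"
  by (rule Gamma0_eq[OF assms(1) continuous_on_const[of _ 0]]) (use assms(2) in simp)

text \<open>The definite description is justified by surjectivity: \<open>Gamma0\<close> takes every
  vector as a value on the defect space, so the relation determines the matrix.\<close>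

lemma weyl_function_eq:
  fixes x :: "'m::finite \<Rightarrow> plane"
  assumes "inj x"
  shows "weyl_function (H_star (range x)) (Gamma0 x) (Gamma1 x) zz = weyl_matrix x"
  unfolding weyl_function_def
proof (rule the_equality)
  show "\<forall>f\<in>defect_space (H_star (range x)) zz. weyl_matrix x *v Gamma0 x f = Gamma1 x f"
    using Gamma0_Gsum[OF assms] Gamma1_eq[OF assms] by (auto simp: defect_space_iff[OF assms])
  fix M :: "complex ^ 'm ^ 'm"
  assume M: "\<forall>f\<in>defect_space (H_star (range x)) zz. M *v Gamma0 x f = Gamma1 x f"
  have "M *v a = weyl_matrix x *v a" for a
  proof -
    have "Gsum x a \<in> defect_space (H_star (range x)) zz"
      unfolding defect_space_iff[OF assms] using Gsum_L2 by auto
    then have "M *v Gamma0 x (Gsum x a) = Gamma1 x (Gsum x a)" using M by blast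
    then show ?thesis using Gamma0_Gsum[OF assms, of "Gsum x a" a] Gamma1_eq[OF assms, of "Gsum x a" a] by simp
  qed
  then show "M = weyl_matrix x" by (simp add: matrix_eq)
qed

lemma gamma_field_eq:
  fixes x :: "'m::finite \<Rightarrow> plane"
  assumes "inj x"
  shows "gamma_field (H_star (range x)) (Gamma0 x) zz a = L2_class (Gsum x a)"
  unfolding gamma_field_def L2_class_def
proof (intro set_eqI iffI)
  fix f assume "f \<in> {f \<in> defect_space (H_star (range x)) zz. Gamma0 x f = a}"
  then have f: "f \<in> defect_space (H_star (range x)) zz" "Gamma0 x f = a" by auto
  then obtain b where b: "f \<in> L2" "AE y in lborel. f y = Gsum x b y"
    unfolding defect_space_iff[OF assms] by blast
  then have "b = a" using Gamma0_Gsum[OF assms b(2)] f(2) by simp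
  with b show "f \<in> {f \<in> L2. AE y in lborel. f y = Gsum x a y}" by blast
next
  fix f assume "f \<in> {f \<in> L2. AE y in lborel. f y = Gsum x a y}"
  then have f: "f \<in> L2" "AE y in lborel. f y = Gsum x a y" by blast+
  then have "f \<in> defect_space (H_star (range x)) zz" unfolding defect_space_iff[OF assms] by blast
  then show "f \<in> {f \<in> defect_space (H_star (range x)) zz. Gamma0 x f = a}"
    using Gamma0_Gsum[OF assms f(2)] by blast
qed

text \<open>Solutions from \<open>resolvent_exists\<close> have a continuous representative, hence
  no logarithms and \<open>Gamma0\<close> zero. Conversely, an element of \<open>H_0\<close> differs
  from the solution for the same right-hand side by a combination of fundamental solutions; its
  boundary value is zero, so the combination vanishes and the bound for the constructed solution
  carries over.\<close>

lemma zz_in_resolvent_set: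
  fixes x :: "'m::finite \<Rightarrow> plane"
  assumes inj: "inj x"
  shows "zz \<in> resolvent_set (H_0 x)"
  unfolding resolvent_set_def
proof (intro CollectI conjI ballI)
  fix h assume h: "h \<in> L2"
  obtain f g where f: "\<And>X. (f, \<lambda>y. h y + zz * f y) \<in> H_star X" "continuous_on UNIV g" "AE y in lborel. f y = g y" "gap * L2_norm f \<le> L2_norm h"
    by (rule resolvent_exists[OF h]) iprover
  have "Gamma0 x f = 0"
    by (rule Gamma0_eq[OF inj f(2)]) (use f(3) in \<open>simp add: Gsum_def\<close>)
  then show "\<exists>f. (f, \<lambda>y. h y + zz * f y) \<in> H_0 x" using f(1) by (auto simp: H_0_def)
next
  have "L2_norm f \<le> (1 / gap) * L2_norm (\<lambda>y. k y - zz * f y)" if fk: "(f, k) \<in> H_0 x" for f k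
  proof -
    have fH: "(f, k) \<in> H_star (range x)" "Gamma0 x f = 0" and L: "f \<in> L2" "k \<in> L2"
      using fk by (auto simp: H_0_def H_star_def)
    define h where "h y = k y - zz * f y" for y
    have h: "h \<in> L2" unfolding h_def[abs_def] by (intro L2_diff L2_cmult L)
    obtain u g where u: "\<And>X. (u, \<lambda>y. h y + zz * u y) \<in> H_star X" "continuous_on UNIV g" "AE y in lborel. u y = g y" "gap * L2_norm u \<le> L2_norm h"
      by (rule resolvent_exists[OF h]) iprover
    have uL: "u \<in> L2" using u(1)[of "{}"] by (simp add: H_star_def)
    have "(\<lambda>y. -1 * u y + f y, \<lambda>y. -1 * (h y + zz * u y) + k y) \<in> H_star (range x)"
      by (rule H_star_combination[OF u(1) fH(1)])
    moreover have "(\<lambda>y. -1 * (h y + zz * u y) + k y) = (\<lambda>y. zz * (-1 * u y + f y))"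
      by (auto simp: h_def algebra_simps)
    ultimately have "(\<lambda>y. -1 * u y + f y) \<in> defect_space (H_star (range x)) zz"
      by (simp add: defect_space_def)
    then obtain a where a: "AE y in lborel. -1 * u y + f y = Gsum x a y"
      unfolding defect_space_iff[OF inj] by blast
    have "AE y in lborel. f y = g y + Gsum x a y"
      using a u(3) by eventually_elim (simp add: algebra_simps)
    from Gamma0_eq[OF inj u(2) this] fH(2) have "a = 0" by simp
    then have "AE y in lborel. f y = u y"
      using a by (auto simp: Gsum_def elim: eventually_mono)
    then have "L2_norm f = L2_norm u" by (intro L2_norm_cong_AE L2_measurable L uL)
    then show ?thesis using u(4) gap_pos by (simp add: h_def[abs_def] field_simps)
  qed
  then show "\<exists>C. \<forall>(f, g)\<in>H_0 x. L2_norm f \<le> C * L2_norm (\<lambda>y. g y - zz * f y)" by blast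
qed

end

section \<open>The spectrum of the free Hamiltonian\<close>

definition plane_wave :: "real \<Rightarrow> plane \<Rightarrow> complex" where
  "plane_wave k y = exp (\<i> * of_real (k * y $ 1))"

lemma norm_plane_wave [simp]: "norm (plane_wave k y) = 1"
  by (simp add: plane_wave_def norm_exp_eq_Re)

lemma plane_wave_smooth: "smooth_fun (plane_wave k)"
  and partial_plane_wave: "partial i (plane_wave k) = (\<lambda>y. (if i = 1 then \<i> * of_real k else 0) * plane_wave k y)"
proof -
  define \<eta> where "\<eta> n t = (\<i> * of_real k) ^ n * exp (\<i> * of_real (k * t))" for n t
  have d: "(\<eta> n has_vector_derivative \<eta> (Suc n) t) (at t)" for n t
  proof -
    have "((\<lambda>z. (\<i> * of_real k) ^ n * exp (\<i> * (of_real k * z))) has_field_derivative (\<i> * of_real k) ^ n * (exp (\<i> * (of_real k * of_real t)) * (\<i> * of_real k))) (at (of_real t))"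
      by (auto intro!: derivative_eq_intros)
    from has_vector_derivative_real_field[OF this] show ?thesis
      unfolding \<eta>_def[abs_def] by (simp add: mult_ac)
  qed
  have c: "smooth_fun (\<lambda>y::plane. complex_of_real (y $ 1))" by (intro smooth_intros)
  have "smooth_fun (\<lambda>y. \<eta> 0 (y $ 1))"
    using smooth_fun_compose[of "\<lambda>y::plane. y $ 1" \<eta> 0] c d by blast
  then show "smooth_fun (plane_wave k)" by (simp add: \<eta>_def plane_wave_def[abs_def])
  have "partial i (\<lambda>y. \<eta> 0 (y $ 1)) y = \<eta> 1 (y $ 1) * partial i (\<lambda>y. complex_of_real (y $ 1)) y" for y
    using partial_compose(2)[OF smooth_fun_differentiable[OF c] d[of 0 "y $ 1"]] by simp
  then show "partial i (plane_wave k) = (\<lambda>y. (if i = 1 then \<i> * of_real k else 0) * plane_wave k y)"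
    by (auto simp: \<eta>_def plane_wave_def[abs_def] partial_coord)
qed

lemma lap_plane_wave: "lap (plane_wave k) y = - (of_real k)\<^sup>2 * plane_wave k y"
proof -
  have "partial i (partial i (plane_wave k)) y = (if i = 1 then - (of_real k)\<^sup>2 * plane_wave k y else 0)" for i
    unfolding partial_plane_wave
    by (subst partial_cmult[OF smooth_fun_differentiable[OF plane_wave_smooth]])
      (simp add: partial_plane_wave power2_eq_square mult.assoc mult.left_commute[of "of_real k" \<i>])
  then show ?thesis by (simp add: lap_def)
qed

text \<open>Cut-off plane waves are approximate eigenfunctions: the norm of \<open>f\<close> grows like \<open>R\<close>, that of
  \<open>(- \<Delta> - k\<^sup>2) f\<close> stays bounded.\<close>

lemma nonneg_not_in_resolvent_set:
  fixes x :: "'m::finite \<Rightarrow> plane"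
  assumes inj: "inj x"
  shows "(of_real k)\<^sup>2 \<notin> resolvent_set (H_0 x)"
proof
  assume "(of_real k)\<^sup>2 \<in> resolvent_set (H_0 x)"
  then obtain C where C: "\<And>f g. (f, g) \<in> H_0 x \<Longrightarrow> L2_norm f \<le> C * L2_norm (\<lambda>y. g y - (of_real k)\<^sup>2 * f y)"
    unfolding resolvent_set_def by blast
  \<comment> \<open>The locale is entered at an arbitrary parameter: it provides
    \<open>Gamma0_eq\<close>, applied below with all coefficients zero, to see that continuous
    functions have vanishing \<open>Gamma0\<close>.\<close>
  interpret helmholtz 1 by unfold_locales simp
  obtain B where B: "B \<ge> 0" "\<And>c R i y. R > 0 \<Longrightarrow> norm (partial i (cutoff c R) y) \<le> B / R"
    "\<And>c R y. R > 0 \<Longrightarrow> norm (lap (cutoff c R) y) \<le> B / R\<^sup>2"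
    by (rule cutoff_derivative_bounds) iprover
  \<comment> \<open>The gradient of the wave brings the factor \<open>\<bar>k\<bar>\<close>; for
    \<open>R \<ge> 1\<close> the second-order term \<open>B / R\<^sup>2\<close> is absorbed into
    \<open>B / R\<close>.\<close>
  define M where "M = 2 * \<bar>k\<bar> * B + B"
  have M0: "M \<ge> 0" using B(1) by (simp add: M_def)
  have main: "sqrt pi * R \<le> \<bar>C\<bar> * (M * sqrt (4 * pi))" if R: "R \<ge> 1" for R
  proof -
    have R0: "R > 0" using R by simp
    let ?\<chi> = "cutoff 0 R"
    define f where "f y = ?\<chi> y * plane_wave k y" for y
    have ft: "f \<in> test_functions UNIV"
      unfolding f_def[abs_def] by (intro test_functions_mult' cutoff_test[OF R0] plane_wave_smooth) simp
    note fs = test_functions_smooth[OF ft] and fL = test_functions_L2[OF ft]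
    have "(f, \<lambda>y. - lap f y) \<in> H_star (range x)"
      by (rule smooth_fun_H_star[OF fs fL test_functions_L2[OF test_functions_lap[OF ft]]])
    moreover have "Gamma0 x f = 0"
      by (rule Gamma0_eq[OF inj smooth_fun_continuous[OF fs]]) (simp add: Gsum_def)
    ultimately have "(f, \<lambda>y. - lap f y) \<in> H_0 x" by (simp add: H_0_def)
    from C[OF this] have le: "L2_norm f \<le> C * L2_norm (\<lambda>y. - lap f y - (of_real k)\<^sup>2 * f y)" .
    define r where "r y = - lap f y - (of_real k)\<^sup>2 * f y" for y
    have req: "r y = - (2 * (partial 1 ?\<chi> y * (\<i> * of_real k * plane_wave k y)) + lap ?\<chi> y * plane_wave k y)" for y
      unfolding r_def f_def[abs_def] lap_mult[OF smooth_fun_cutoff plane_wave_smooth] lap_plane_wave partial_plane_wave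
      by (simp add: sum_2 algebra_simps if_distrib cong: if_cong)
    have rb: "norm (r y) \<le> M / R * indicator (cball 0 (2 * R)) y" for y
    proof (cases "y \<in> cball 0 (2 * R)")
      case True
      have "norm (r y) \<le> 2 * (norm (partial 1 ?\<chi> y) * \<bar>k\<bar>) + norm (lap ?\<chi> y)"
        unfolding req norm_minus_cancel by (rule order_trans[OF norm_triangle_ineq]) (simp add: norm_mult)
      also have "\<dots> \<le> 2 * (B / R * \<bar>k\<bar>) + B / R\<^sup>2"
        by (intro add_mono mult_left_mono mult_right_mono B R0) auto
      also have "\<dots> \<le> 2 * (B / R * \<bar>k\<bar>) + B / R"
        using R B(1) by (intro add_left_mono divide_left_mono) (auto simp: power2_eq_square)
      also have "\<dots> = M / R" by (simp add: M_def add_divide_distrib)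
      finally show ?thesis using True by simp
    next
      case False
      then have far: "dist y 0 > 2 * R" by simp
      show ?thesis using False by (simp add: req cutoff_partial_eq_0[OF R0 far] cutoff_lap_eq_0[OF R0 far])
    qed
    have rt: "r \<in> L2"
    proof -
      have "(\<lambda>y. -1 * lap f y - (of_real k)\<^sup>2 * f y) \<in> L2"
        by (intro L2_diff L2_cmult fL test_functions_L2[OF test_functions_lap[OF ft]])
      then show ?thesis by (simp add: r_def[abs_def])
    qed
    have up: "L2_norm r \<le> M * sqrt (4 * pi)"
    proof (rule power2_le_imp_le)
      have "(L2_norm r)\<^sup>2 \<le> (LINT y|lborel. (M / R)\<^sup>2 * indicator (cball (0::plane) (2 * R)) y)"
        unfolding L2_norm_sq
      proof (rule integral_mono[OF L2_integrable[OF rt]])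
        show "integrable lborel (\<lambda>y. (M / R)\<^sup>2 * indicator (cball (0::plane) (2 * R)) y)"
          by (intro integrable_mult_right integrable_real_indicator emeasure_bounded_finite) auto
        fix y
        have "(norm (r y))\<^sup>2 \<le> (M / R * indicator (cball 0 (2 * R)) y)\<^sup>2" by (intro power_mono rb) simp
        also have "\<dots> = (M / R)\<^sup>2 * indicator (cball 0 (2 * R)) y" by (simp add: indicator_def)
        finally show "(norm (r y))\<^sup>2 \<le> (M / R)\<^sup>2 * indicator (cball 0 (2 * R)) y" .
      qed
      also have "\<dots> = (M / R)\<^sup>2 * (pi * (2 * R)\<^sup>2)"
        using content_cball[of "2 * R" "0::plane"] R0 by (simp add: unit_ball_vol_2)
      also have "\<dots> = (M * sqrt (4 * pi))\<^sup>2" using R0 by (simp add: power_mult_distrib power_divide)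
      finally show "(L2_norm r)\<^sup>2 \<le> (M * sqrt (4 * pi))\<^sup>2" .
    qed (simp add: M0)
    have "(sqrt pi * R)\<^sup>2 = (LINT y|lborel. indicator (cball (0::plane) R) y)"
      using content_cball[of R "0::plane"] R0 by (simp add: unit_ball_vol_2 power_mult_distrib)
    also have "\<dots> \<le> (L2_norm f)\<^sup>2"
      unfolding L2_norm_sq
    proof (rule integral_mono[OF _ L2_integrable[OF fL]])
      show "integrable lborel (\<lambda>y. indicator (cball (0::plane) R) y :: real)"
        by (intro integrable_real_indicator emeasure_bounded_finite) auto
      show "indicator (cball 0 R) y \<le> (norm (f y))\<^sup>2" for y
        by (cases "y \<in> cball 0 R") (auto simp: f_def norm_mult cutoff_eq_1[OF R0])
    qed
    finally have "sqrt pi * R \<le> L2_norm f" by (rule power2_le_imp_le) simp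
    also have "\<dots> \<le> C * L2_norm r" using le by (simp add: r_def[abs_def])
    also have "\<dots> \<le> \<bar>C\<bar> * (M * sqrt (4 * pi))" using up by (intro mult_mono) auto
    finally show ?thesis .
  qed
  define D where "D = \<bar>C\<bar> * (M * sqrt (4 * pi))"
  have D0: "D \<ge> 0" using M0 by (simp add: D_def)
  have "1 \<le> sqrt pi" using pi_ge_two by simp
  \<comment> \<open>The radius \<open>D + 1\<close> already violates the bound, since
    \<open>sqrt pi\<close> is at least 1.\<close>
  have "D + 1 \<le> sqrt pi * (D + 1)" using mult_right_mono[OF \<open>1 \<le> sqrt pi\<close>, of "D + 1"] D0 by simp
  also have "\<dots> \<le> D" unfolding D_def by (rule main) (use D0 in \<open>simp add: D_def\<close>)
  finally show False by simp
qed

section \<open>The Weyl function and the gamma-field\<close>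

text \<open>A real root would make \<open>z\<close> a nonnegative real. Below the real axis the
  principal root has nonnegative real part, so \<open>Im z = 2 * Re * Im\<close> forces its
  imaginary part to be negative, and the sign change in \<open>sqrt_up\<close> repairs this.\<close>

lemma sqrt_up_props:
  assumes "z \<notin> \<real>\<^sub>\<ge>\<^sub>0"
  shows "(sqrt_up z)\<^sup>2 = z" "Im (sqrt_up z) > 0"
proof -
  show "(sqrt_up z)\<^sup>2 = z" by (simp add: sqrt_up_def)
  show "Im (sqrt_up z) > 0"
  proof (cases "Im z \<ge> 0")
    case True
    then have "Im (csqrt z) \<ge> 0" by (simp add: sgn_if complex_Re_le_cmod)
    moreover have "Im (csqrt z) \<noteq> 0"
    proof
      assume "Im (csqrt z) = 0"
      then have "csqrt z = of_real (Re (csqrt z))" by (simp add: complex_eq_iff del: csqrt.simps)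
      then have "z = of_real ((Re (csqrt z))\<^sup>2)" by (metis of_real_power power2_csqrt)
      then show False using assms by (metis nonneg_Reals_of_real_iff zero_le_power2)
    qed
    ultimately show ?thesis using True by (simp add: sqrt_up_def del: csqrt.simps)
  next
    case False
    have "Im z = 2 * Re (csqrt z) * Im (csqrt z)"
      by (subst power2_csqrt[of z, symmetric]) (simp only: power2_eq_square times_complex.sel, simp)
    then have "\<not> 0 \<le> Im (csqrt z)" using False Re_csqrt[of z] by (metis mult_nonneg_nonneg zero_le_numeral)
    then show ?thesis using False by (simp add: sqrt_up_def del: csqrt.simps)
  qed
qed

lemma psi_1: "psi 1 = - euler_mascheroni"
proof -
  have "(Gamma has_field_derivative Gamma 1 * Digamma 1) (at (1::complex))"
    by (rule has_field_derivative_Gamma) (auto simp: nonpos_Ints_def complex_eq_iff)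
  then show ?thesis by (simp add: psi_def DERIV_imp_deriv)
qed

text \<open>Since \<open>lam / 2\<close> equals \<open>sqrt_up z / (2 * \<i>)\<close> and
  \<open>psi 1\<close> is \<open>- euler_mascheroni\<close>, the constant \<open>green_const\<close>
  is literally the diagonal entry; off the diagonal the Hankel form of \<open>G\<close> applies
  because distinct indices give distinct points.\<close>

lemma weyl_function_formula:
  fixes x :: "'m::finite \<Rightarrow> plane"
  assumes "inj x" "z \<notin> \<real>\<^sub>\<ge>\<^sub>0"
  shows "weyl_function (H_star (range x)) (Gamma0 x) (Gamma1 x) z =
          (\<chi> j k. 1 / (2 * complex_of_real pi) * (psi 1 - ln (sqrt_up z / (2 * \<i>)))
                    * (if j = k then 1 else 0)
                  + G_tilde (sqrt_up z) (x j - x k))" (is ?weyl)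
    and "z \<in> resolvent_set (H_0 x)"
    and "let f = (\<lambda>y. \<Sum>j\<in>UNIV. a $ j * (\<i> / 4 * hankel1_0 (sqrt_up z * complex_of_real (norm (y - x j)))))
        in f \<in> L2 \<and> gamma_field (H_star (range x)) (Gamma0 x) z a = L2_class f"
proof -
  note sq = sqrt_up_props[OF assms(2)]
  let ?k = "sqrt_up z"
  define lam where "lam = - \<i> * ?k"
  interpret helmholtz lam by unfold_locales (simp add: sq lam_def)
  have zz: "zz = z" unfolding zz_def by (simp add: lam_def power_mult_distrib sq)
  have Gh: "G c y = \<i> / 4 * hankel1_0 (?k * complex_of_real (norm (y - c)))" if "y \<noteq> c" for c y
  proof -
    have "G c y = macK (lam * of_real (norm (y - c))) / (2 * of_real pi)"
      unfolding G_def by (subst rad_eq_macK) (use that in auto)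
    also have "\<dots> = \<i> / 4 * hankel1_0 (?k * complex_of_real (norm (y - c)))"
      using hankel_eq_macK[of "?k * of_real (norm (y - c))"] that sq by (simp add: mult.assoc lam_def)
    finally show ?thesis .
  qed
  have l2: "lam / 2 = ?k / (2 * \<i>)" by (simp add: lam_def field_simps)
  have gc: "green_const = 1 / (2 * complex_of_real pi) * (psi 1 - ln (?k / (2 * \<i>)))"
    unfolding green_const_def psi_1 l2 by (simp add: field_simps)
  have "weyl_matrix x = (\<chi> j k. 1 / (2 * complex_of_real pi) * (psi 1 - ln (?k / (2 * \<i>)))
                    * (if j = k then 1 else 0) + G_tilde ?k (x j - x k))"
    unfolding weyl_matrix_def vec_eq_iff vec_lambda_beta gc[symmetric]
    using Gh inj_eq[OF assms(1)] by (auto simp: G_tilde_def)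
  then show ?weyl using weyl_function_eq[OF assms(1)] by (simp add: zz)
  show "z \<in> resolvent_set (H_0 x)" using zz_in_resolvent_set[OF assms(1)] by (simp add: zz)
  define f where "f y = (\<Sum>j\<in>UNIV. a $ j * (\<i> / 4 * hankel1_0 (?k * complex_of_real (norm (y - x j)))))" for y
  have fG: "f y = Gsum x a y" if "y \<notin> range x" for y
    unfolding f_def Gsum_def
  proof (intro sum.cong refl)
    fix j
    have "y \<noteq> x j" using that by auto
    then show "a $ j * (\<i> / 4 * hankel1_0 (?k * complex_of_real (norm (y - x j)))) = a $ j * G (x j) y"
      using Gh by metis
  qed
  have ae: "AE y in lborel. f y = Gsum x a y"
  proof (rule AE_I')
    show "range x \<in> null_sets lborel" by (rule finite_imp_null_set_lborel) simp
    show "{y \<in> space lborel. f y \<noteq> Gsum x a y} \<subseteq> range x" using fG by auto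
  qed
  have GL: "Gsum x a \<in> L2" by (rule Gsum_L2)
  \<comment> \<open>The Hankel sum and \<open>Gsum\<close> may disagree at the points
    \<open>x j\<close>, where the logarithm is evaluated at zero; measurability is transferred by
    adding a finite combination of point indicators.\<close>
  have fm: "f \<in> borel_measurable borel"
  proof -
    have "f = (\<lambda>y. Gsum x a y + (\<Sum>c\<in>range x. (f c - Gsum x a c) * indicator {c} y))"
    proof
      fix y
      have "(\<Sum>c\<in>range x. (f c - Gsum x a c) * indicator {c} y) = (\<Sum>c\<in>range x. if c = y then f y - Gsum x a y else 0)"
        by (intro sum.cong) auto
      also have "\<dots> = f y - Gsum x a y" using fG[of y] by (cases "y \<in> range x") (auto simp: sum.delta)
      finally show "f y = Gsum x a y + (\<Sum>c\<in>range x. (f c - Gsum x a c) * indicator {c} y)" by simp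
    qed
    moreover have "(\<lambda>y. Gsum x a y + (\<Sum>c\<in>range x. (f c - Gsum x a c) * indicator {c} y)) \<in> borel_measurable borel"
      using L2_measurable[OF GL] by measurable
    ultimately show ?thesis by simp
  qed
  have fL: "f \<in> L2"
  proof (rule L2I[OF fm])
    have "AE y in lborel. (norm (Gsum x a y))\<^sup>2 = (norm (f y))\<^sup>2" using ae by eventually_elim simp
    then show "integrable lborel (\<lambda>y. (norm (f y))\<^sup>2)"
      using integrable_cong_AE_imp[OF L2_integrable[OF GL], of "\<lambda>y. (norm (f y))\<^sup>2"] fm by simp
  qed
  have "L2_class (Gsum x a) = L2_class f"
    unfolding L2_class_def using ae by (auto elim: eventually_elim2)
  then have "gamma_field (H_star (range x)) (Gamma0 x) z a = L2_class f"
    using gamma_field_eq[OF assms(1), of a] by (simp add: zz)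
  with fL have "f \<in> L2 \<and> gamma_field (H_star (range x)) (Gamma0 x) z a = L2_class f" ..
  then show "let f = (\<lambda>y. \<Sum>j\<in>UNIV. a $ j * (\<i> / 4 * hankel1_0 (?k * complex_of_real (norm (y - x j)))))
        in f \<in> L2 \<and> gamma_field (H_star (range x)) (Gamma0 x) z a = L2_class f"
    by (simp add: f_def[abs_def])
qed

lemma resolvent_set_H_0:
  fixes x :: "'m::finite \<Rightarrow> plane"
  assumes "inj x"
  shows "resolvent_set (H_0 x) = - \<real>\<^sub>\<ge>\<^sub>0"
proof (intro set_eqI iffI)
  fix z assume z: "z \<in> resolvent_set (H_0 x)"
  show "z \<in> - \<real>\<^sub>\<ge>\<^sub>0"
  proof
    assume "z \<in> \<real>\<^sub>\<ge>\<^sub>0"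
    then obtain t where t: "t \<ge> 0" "z = of_real t" by (auto elim: nonneg_Reals_cases)
    then have "z = (of_real (sqrt t))\<^sup>2" by (simp flip: of_real_power)
    then show False using z nonneg_not_in_resolvent_set[OF assms] by metis
  qed
next
  fix z :: complex assume "z \<in> - \<real>\<^sub>\<ge>\<^sub>0"
  then show "z \<in> resolvent_set (H_0 x)" using weyl_function_formula(2)[OF assms] by simp
qed

theorem proposition5p4:
  fixes x :: "'m::finite \<Rightarrow> real ^ 2"
  assumes "inj x"
  shows
    "(\<forall>z. Im z > 0 \<longrightarrow>
        weyl_function (H_star (range x)) (Gamma0 x) (Gamma1 x) z =
          (\<chi> j k. 1 / (2 * complex_of_real pi) * (psi 1 - ln (sqrt_up z / (2 * \<i>)))
                    * (if j = k then 1 else 0)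
                  + G_tilde (sqrt_up z) (x j - x k))) \<and>
     resolvent_set (H_0 x) = - \<real>\<^sub>\<ge>\<^sub>0 \<and>
     (\<forall>z \<in> resolvent_set (H_0 x). \<forall>a :: complex ^ 'm.
        let f = (\<lambda>y. \<Sum>j\<in>UNIV. a $ j *
                   (\<i> / 4 * hankel1_0 (sqrt_up z * complex_of_real (norm (y - x j)))))
        in f \<in> L2 \<and> gamma_field (H_star (range x)) (Gamma0 x) z a = L2_class f)"
proof (intro conjI allI impI ballI)
  fix z :: complex assume "Im z > 0"
  then have "z \<notin> \<real>\<^sub>\<ge>\<^sub>0" by (auto simp: complex_nonneg_Reals_iff)
  then show "weyl_function (H_star (range x)) (Gamma0 x) (Gamma1 x) z =
          (\<chi> j k. 1 / (2 * complex_of_real pi) * (psi 1 - ln (sqrt_up z / (2 * \<i>)))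
                    * (if j = k then 1 else 0)
                  + G_tilde (sqrt_up z) (x j - x k))"
    by (rule weyl_function_formula(1)[OF assms])
next
  show "resolvent_set (H_0 x) = - \<real>\<^sub>\<ge>\<^sub>0" by (rule resolvent_set_H_0[OF assms])
next
  fix z and a :: "complex ^ 'm" assume "z \<in> resolvent_set (H_0 x)"
  then have "z \<notin> \<real>\<^sub>\<ge>\<^sub>0" using resolvent_set_H_0[OF assms] by simp
  then show "let f = (\<lambda>y. \<Sum>j\<in>UNIV. a $ j *
                   (\<i> / 4 * hankel1_0 (sqrt_up z * complex_of_real (norm (y - x j)))))
        in f \<in> L2 \<and> gamma_field (H_star (range x)) (Gamma0 x) z a = L2_class f"
    by (rule weyl_function_formula(3)[OF assms])
qed

end
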